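(* Let $p=p_n$ be a sequence of positive integers and suppose the following hold. (T1) $c_n := p/n \to c \in (0,\infty)$. (T2) For each $n$, $Z_1=Z_1^{(n)}$ and $Z_2=Z_2^{(n)}$ are independent random matrices in $\mathbb{C}^{p\times n}$ with independent entries having zero mean, unit variance ($\mathbb{E}|z_{ij}^{(k)}|^2=1$), and moments of order $4+\eta_0$ bounded uniformly (over all entries, $k\in\{1,2\}$ and all $n$) for some $\eta_0>0$. (T3) $\Sigma_n\in\mathbb{C}^{p\times p}$ is a sequence of (possibly random) positive semi-definite matrices, independent of $Z_1^{(n)},Z_2^{(n)}$, whose empirical spectral distributions $F^{\Sigma_n}$ converge weakly, almost surely, to a (non-random) probability distribution $H\neq\delta_0$ on $[0,\infty)$. (T4) There exists $C>0$ such that $\limsup_{n\to\infty}\frac1p\operatorname{trace}(\Sigma_n)<C$ (almost surely). Let $X_k=\Sigma_n^{1/2}Z_k$ for $k=1,2$ and $S_n^+=\frac1n(X_1X_2^*+X_2X_1^* )$. Then, almost surely, $F^{S_n^+}$ converges weakly to $F^+$, where $F^+$ is a non-random probability distribution on $\mathbb{R}$ whose Stieltjes transform at $z\in\mathbb{C}^+$ is $$s(z)=\frac1z\Big(\frac2c-1\Big)+\frac{1}{cz}\Big(\frac{1}{-1+ch(z)}-\frac{1}{1+ch(z)}\Big),$$ where $h(z)\in\mathbb{C}^+$ is the unique number in $\mathbb{C}^+$ such that $$h(z)=\int\frac{\lambda\,dH(\lambda)}{-z+\lambda\Big(\dfrac{1}{1+ch(z)}+\dfrac{1}{-1+ch(z)}\Big)}.$$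 Further, $h$ is analytic on $\mathbb{C}^+$, and has a continuous dependence on $H$ (for fixed $c$ and $z$, with respect to the Lévy metric on distribution functions).
   Context: $\mathbb{C}^+=\{z\in\mathbb{C}:\Im z>0\}$. $A^*$ is the conjugate transpose of $A$. For a Hermitian $p\times p$ matrix $A$ with eigenvalues $\lambda_1,\dots,\lambda_p$, the empirical spectral distribution is $F^A(x)=\frac1p\sum_j 1_{\{\lambda_j\le x\}}$, $x\in\mathbb{R}$. The Stieltjes transform of a probability measure $\mu$ on $\mathbb{R}$ is $s_\mu(z)=\int\frac{\mu(dt)}{t-z}$, $z\in\mathbb{C}^+$. *)

theory Defs
  imports
    "HOL-Probability.Probability"
    "Jordan_Normal_Form.Schur_Decomposition"
    "HOL-Computational_Algebra.Fundamental_Theorem_Algebra"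
begin

abbreviation upper_half_plane :: "complex set" where
  "upper_half_plane \<equiv> {z. 0 < Im z}"

definition mat_trace :: "complex mat \<Rightarrow> complex" where
  "mat_trace A = (\<Sum>i<dim_row A. A $$ (i, i))"

definition psd :: "nat \<Rightarrow> complex mat \<Rightarrow> bool" where
  "psd d A \<longleftrightarrow> A \<in> carrier_mat d d \<and> mat_adjoint A = A \<and>
     (\<forall>v \<in> carrier_vec d. 0 \<le> Re ((A *\<^sub>v v) \<bullet>c v))"

definition psd_sqrt :: "complex mat \<Rightarrow> complex mat" where
  "psd_sqrt A = (THE B. psd (dim_row A) B \<and> B * B = A)"

text \<open>Eigenvalues are counted with algebraic multiplicity, as roots of the characteristic
  polynomial. The definition is meant for Hermitian matrices, whose eigenvalues are real, so that
  taking real parts is harmless.\<close>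

definition esd :: "complex mat \<Rightarrow> real \<Rightarrow> real" where
  "esd A x = real (size {#l \<in># proots (char_poly A). Re l \<le> x#}) / real (dim_row A)"

text \<open>The \<open>\<sigma>\<close>-algebra on the complex \<open>nr \<times> nc\<close> matrices that is generated by the entries. A random
  matrix is a random variable with values in this measurable space.\<close>

definition mat_borel :: "nat \<Rightarrow> nat \<Rightarrow> complex mat measure" where
  "mat_borel nr nc = vimage_algebra (carrier_mat nr nc)
     (\<lambda>A. \<lambda>ij \<in> {..<nr} \<times> {..<nc}. A $$ ij)
     (\<Pi>\<^sub>M ij \<in> {..<nr} \<times> {..<nc}. (borel :: complex measure))"

text \<open>The constant \<open>indep_var\<close> of the library requires both random variables to have the same value type.
  This is its version for value spaces of different types; compare \<open>prob_space.indep_vars_def2\<close>.\<close>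

definition indep_pair ::
  "'a measure \<Rightarrow> 'b measure \<Rightarrow> ('a \<Rightarrow> 'b) \<Rightarrow> 'c measure \<Rightarrow> ('a \<Rightarrow> 'c) \<Rightarrow> bool" where
  "indep_pair M S X T Y \<longleftrightarrow> X \<in> measurable M S \<and> Y \<in> measurable M T \<and>
     prob_space.indep_set M
       {X -` A \<inter> space M | A. A \<in> sets S} {Y -` B \<inter> space M | B. B \<in> sets T}"

definition stieltjes :: "real measure \<Rightarrow> complex \<Rightarrow> complex" where
  "stieltjes \<mu> z = (LINT t|\<mu>. 1 / (of_real t - z))"

definition nonneg_distr :: "real measure \<Rightarrow> bool" where
  "nonneg_distr H \<longleftrightarrow> real_distribution H \<and> (AE x in H. 0 \<le> x)"

definition levy_dist :: "(real \<Rightarrow> real) \<Rightarrow> (real \<Rightarrow> real) \<Rightarrow> real" where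
  "levy_dist F G = Inf {e. 0 < e \<and> (\<forall>x. F (x - e) - e \<le> G x \<and> G x \<le> F (x + e) + e)}"

text \<open>For \<open>z\<close> and \<open>h\<close> in the upper half plane and \<open>H\<close> on \<open>[0, \<infinity>)\<close>, the integrand is bounded and
  continuous on the support of \<open>H\<close>, since the coefficient of \<open>\<lambda>\<close> in the denominator has negative
  imaginary part. So the Bochner integral never takes its default value 0 here.\<close>

definition solves_h_eq :: "real \<Rightarrow> real measure \<Rightarrow> complex \<Rightarrow> complex \<Rightarrow> bool" where
  "solves_h_eq c H z h \<longleftrightarrow> h \<in> upper_half_plane \<and>
     h = (LINT l|H. of_real l /
            (- z + of_real l * (1 / (1 + of_real c * h) + 1 / (- 1 + of_real c * h))))"

definition h_fun :: "real \<Rightarrow> real measure \<Rightarrow> complex \<Rightarrow> complex" where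
  "h_fun c H z = (THE h. solves_h_eq c H z h)"

definition anticommutator :: "nat \<Rightarrow> complex mat \<Rightarrow> complex mat \<Rightarrow> complex mat" where
  "anticommutator n X1 X2 =
     (1 / of_nat n) \<cdot>\<^sub>m (X1 * mat_adjoint X2 + X2 * mat_adjoint X1)"

end

theory Submission
  imports Defs "HOL-Real_Asymp.Real_Asymp"
begin

text \<open>Let \<open>Q = (S - z)\<^sup>-\<^sup>1\<close> be the resolvent of \<open>S = S\<^sub>n\<^sup>+\<close>, let \<open>A = \<Sigma>\<^sub>n\<close> and \<open>\<theta> = E tr(A Q) / n\<close>.
  Conditioning on \<open>\<Sigma>\<^sub>n\<close>, we may treat \<open>A\<close> as deterministic.

  The \<open>j\<close>-th columns of \<open>X\<^sub>1\<close> and \<open>X\<^sub>2\<close> enter \<open>S\<close> through a perturbation of rank two. Eliminating it leads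
  to a linear system of size two, whose coefficients are quadratic forms in these columns with a matrix that is
  independent of them. The quadratic forms are close to traces, the traces are close to their means by bounded
  differences, and one gets \<open>(1 - \<theta>\<^sup>2) E tr(N Q S) / n + 2 \<theta> E tr(A N Q) / n = O(1 / sqrt n)\<close> for every
  deterministic \<open>N\<close> of bounded norm. The choice \<open>N = 1\<close> keeps \<open>1 - \<theta>\<^sup>2\<close> away from 0 and expresses the mean of
  \<open>tr Q\<close> by \<open>\<theta>\<close>; the choice \<open>N = A (\<sigma> A - z)\<^sup>-\<^sup>1\<close> with \<open>\<sigma> = 1 / (1 + \<theta>) + 1 / (- 1 + \<theta>)\<close> shows that
  \<open>\<theta> / c\<^sub>n\<close> solves the equation for \<open>h\<close> up to a small error. Taking imaginary parts shows that the equation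
  is a strict contraction at its solutions, so solutions are unique, and a compactness argument makes
  approximate solutions converge. Spectra of \<open>\<Sigma>\<^sub>n\<close> that are not bounded are capped at \<open>\<tau>\<close>, which changes \<open>S\<close> by
  a matrix whose rank is controlled by the number of capped eigenvalues. The fourth central
  moments of \<open>tr Q / p\<close> are summable in \<open>n\<close>, again by bounded differences, so convergence of the mean
  implies almost sure convergence.\<close>

section \<open>The fixed point equation\<close>

text \<open>The determinant of the system for one column is close to 1 - \<theta>^2, and nothing
  excludes \<theta>^2 = 1 a priori. The instance N = 1 excludes it: there E tr(Q S) / n is bounded,
  so a small 1 - \<theta>^2 could not balance the term 2 \<theta>^2, which would be close to 2. For
  this reason the estimate is kept multiplied by 1 - \<theta>^2, which also cancels the poles of
  \<sigma>, since (1 - \<theta>^2) \<sigma> = - 2 \<theta>.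

  The cap \<tau> is forced by N = A (\<sigma> A - z)^-1: uniformly in \<sigma>, its norm is
  controlled only by \<tau> / Im z.

  The fixed point map contracts at solutions and not everywhere. Existence therefore comes from
  Brouwer's theorem, and convergence of approximate solutions from excluding every way in which they
  could leave the domain: to infinity, to the poles of \<sigma>, or to the real axis.

  A second obstacle is measurability of the square root of \<Sigma>. With B the root and W the
  anticommutator of the raw matrices, B W B and W B^2 have the same resolvent trace, and the latter
  contains only \<Sigma>.\<close>

definition sig :: "complex => complex" where
 "sig \<theta> = 1 / (1 + \<theta>) + 1 / (- 1 + \<theta>)"

text \<open>This is the ratio - Im (\<open>sig \<theta>\<close>) / Im \<theta>, the factor with
  which Im \<theta> reappears in the imaginary part of the fixed point equation.\<close>

definition sig2 :: "complex => real" where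
 "sig2 \<theta> = 1 / (cmod (1 + \<theta>))\<^sup>2 + 1 / (cmod (- 1 + \<theta>))\<^sup>2"

text \<open>With s = \<open>sig (of_real c * h)\<close>, \<open>hker\<close> is the integrand of the
  equation for h and \<open>rker\<close> that of the limiting Stieltjes transform. Both share one
  denominator.\<close>

definition hker :: "complex => complex => real => complex" where
 "hker z s l = of_real l / (- z + of_real l * s)"

definition rker :: "complex => complex => real => complex" where
 "rker z s l = 1 / (- z + of_real l * s)"

lemma solves_h_eq_alt:
 "solves_h_eq c H z h \<longleftrightarrow> 0 < Im h \<and> h = (LINT l|H. hker z (sig (of_real c * h)) l)"
 by (simp add: solves_h_eq_def sig_def hker_def)

lemma hker_measurable [measurable]: "hker z s \<in> borel_measurable borel"
 unfolding hker_def[abs_def] by measurable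

lemma rker_measurable [measurable]: "rker z s \<in> borel_measurable borel"
 unfolding rker_def[abs_def] by measurable

lemma Im_inverse_complex: "Im (1 / w) = - Im w / (cmod w)\<^sup>2"
 by (simp add: Im_divide cmod_power2)

lemma nonreal_not_pm1:
 assumes "0 < Im \<theta>" shows "1 + \<theta> \<noteq> 0" "- 1 + \<theta> \<noteq> 0"
 using assms by (auto simp: complex_eq_iff)

lemma Im_sig: "Im (sig \<theta>) = - Im \<theta> * sig2 \<theta>"
 by (simp add: sig_def sig2_def Im_inverse_complex algebra_simps)

lemma sig2_pos: assumes "0 < Im \<theta>" shows "0 < sig2 \<theta>"
 using nonreal_not_pm1[OF assms] by (simp add: sig2_def add_pos_pos)

lemma Im_sig_neg: assumes "0 < Im \<theta>" shows "Im (sig \<theta>) < 0"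
 using assms sig2_pos[OF assms] by (simp add: Im_sig)

lemma sig_eq:
 assumes "1 + \<theta> \<noteq> 0" "- 1 + \<theta> \<noteq> 0" shows "sig \<theta> = 2 * \<theta> / (\<theta>\<^sup>2 - 1)"
proof -
 have "\<theta>\<^sup>2 - 1 = (1 + \<theta>) * (- 1 + \<theta>)" by (simp add: algebra_simps power2_eq_square)
 with assms show ?thesis unfolding sig_def by (simp add: field_simps)
qed

text \<open>The negated imaginary part Im z + l (- Im s) is at most the modulus. The first bound
  discards its nonnegative second summand, the second keeps both.\<close>

lemma den_lower:
 assumes "0 \<le> l" "Im s \<le> 0"
 shows "Im z \<le> cmod (- z + of_real l * s)" "l * (- Im s) \<le> cmod (- z + of_real l * s) + (- Im z)"
proof -
 have "\<bar>Im (- z + of_real l * s)\<bar> \<le> cmod (- z + of_real l * s)" by (rule abs_Im_le_cmod)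
 moreover have "Im (- z + of_real l * s) = - Im z + l * Im s" by simp
 moreover have "l * Im s \<le> 0" using assms by (simp add: mult_nonneg_nonpos)
 ultimately show "Im z \<le> cmod (- z + of_real l * s)"
  "l * (- Im s) \<le> cmod (- z + of_real l * s) + (- Im z)" by linarith+
qed

lemma den_nonzero:
 assumes "0 \<le> l" "Im s \<le> 0" "0 < Im z"
 shows "- z + of_real l * s \<noteq> 0"
 using den_lower(1)[OF assms(1,2), of z] assms(3) by auto

lemma hker_bound:
 assumes "0 \<le> l" "Im s < 0" "0 < Im z"
 shows "cmod (hker z s l) \<le> 1 / (- Im s)"
proof -
 have pos: "0 < cmod (- z + of_real l * s)" using den_nonzero[of l s z] assms by auto
 have "l * (- Im s) \<le> cmod (- z + of_real l * s)" using den_lower(2)[of l s z] assms by linarith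
 with pos assms show ?thesis by (simp add: hker_def norm_divide field_simps)
qed

lemma rker_bound:
 assumes "0 \<le> l" "Im s \<le> 0" "0 < Im z"
 shows "cmod (rker z s l) \<le> 1 / Im z"
proof -
 have pos: "0 < cmod (- z + of_real l * s)" using den_nonzero[of l s z] assms by auto
 with den_lower(1)[of l s z] assms show ?thesis by (simp add: rker_def norm_divide field_simps)
qed

text \<open>The product l s is the denominator plus z. Integrated, this identity trades the equation
  for h against a Stieltjes transform, and it keeps h s bounded even where h or s is not.\<close>

lemma hker_rker:
 assumes "0 \<le> l" "Im s \<le> 0" "0 < Im z"
 shows "hker z s l * s = 1 + z * rker z s l"
 using den_nonzero[OF assms] by (simp add: hker_def rker_def field_simps)

text \<open>Im z and - Im s contribute separately, each with a nonnegative weight for l \<ge> 0.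
  After integration the first summand supplies a strict gap and the second reproduces a multiple of
  Im h.\<close>

lemma Im_hker:
 "Im (hker z s l) = Im z * (l / (cmod (- z + of_real l * s))\<^sup>2) - Im s * (l / cmod (- z + of_real l * s))\<^sup>2"
proof -
 have "hker z s l = of_real l * (1 / (- z + of_real l * s))" by (simp add: hker_def)
 then have "Im (hker z s l) = l * Im (1 / (- z + of_real l * s))"
  by (simp only: times_complex.sel Re_complex_of_real Im_complex_of_real mult_zero_left add_0_right)
 also have "... = l * (- (- Im z + l * Im s) / (cmod (- z + of_real l * s))\<^sup>2)"
  by (subst Im_inverse_complex) simp
 also have "... = (Im z * l - Im s * l\<^sup>2) / (cmod (- z + of_real l * s))\<^sup>2"
  by (simp add: algebra_simps power2_eq_square)
 finally show ?thesis by (simp only: power_divide diff_divide_distrib times_divide_eq_right)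
qed

lemma nonneg_distrD:
 assumes "nonneg_distr H" shows "real_distribution H" "prob_space H" "sets H = sets borel" "space H = UNIV"
  "AE x in H. 0 \<le> x"
proof -
 show "real_distribution H" "AE x in H. 0 \<le> x" using assms by (auto simp: nonneg_distr_def)
 then interpret real_distribution H by simp
 show "prob_space H" by (rule prob_space_axioms)
 show "sets H = sets borel" "space H = UNIV" by simp_all
qed

lemma nonneg_distr_measurable:
 assumes "nonneg_distr H" "f \<in> borel_measurable borel" shows "f \<in> borel_measurable H"
 using assms(2) measurable_cong_sets[OF nonneg_distrD(3)[OF assms(1)] refl, of borel] by blast

lemma integrable_bounded_nonneg:
 fixes f :: "real => 'b::{banach, second_countable_topology}"
 assumes H: "nonneg_distr H" and f: "f \<in> borel_measurable borel" and B: "\<And>l. 0 \<le> l ==> norm (f l) \<le> B"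
 shows "integrable H f"
proof -
 interpret prob_space H using nonneg_distrD(2)[OF H] .
 show ?thesis
 proof (rule integrable_const_bound[of _ B])
  show "AE l in H. norm (f l) \<le> B" using nonneg_distrD(5)[OF H] by eventually_elim (rule B)
 qed (rule nonneg_distr_measurable[OF H f])
qed

text \<open>Weak convergence by itself handles one fixed bounded continuous integrand. In Skorohod's
  representation the measures become laws of pointwise convergent variables, so dominated
  convergence also covers integrands that vary with k, provided they converge along convergent
  sequences of nonnegative arguments.\<close>

lemma weak_conv_integral_varying:
 fixes f :: "nat => real => 'b::{banach, second_countable_topology}"
 assumes Hs: "\<And>k. nonneg_distr (Hs k)" and H: "nonneg_distr H" and wc: "weak_conv_m Hs H"
  and meas: "\<And>k. f k \<in> borel_measurable borel" "g \<in> borel_measurable borel"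
  and bound: "\<And>k l. 0 \<le> l ==> norm (f k l) \<le> B"
  and lim: "\<And>y l. (\<And>k. 0 \<le> y k) ==> 0 \<le> l ==> y \<longlonglongrightarrow> l ==> (\<lambda>k. f k (y k)) \<longlonglongrightarrow> g l"
 shows "(\<lambda>k. integral\<^sup>L (Hs k) (f k)) \<longlonglongrightarrow> integral\<^sup>L H g"
proof -
 from Skorohod[OF nonneg_distrD(1)[OF Hs] nonneg_distrD(1)[OF H] wc]
 obtain \<Omega> :: "real measure" and Y :: "nat => real => real" and Y0 where
  \<Omega>: "prob_space \<Omega>" "\<And>n. Y n \<in> borel_measurable \<Omega>" "\<And>n. distr \<Omega> borel (Y n) = Hs n"
   "Y0 \<in> borel_measurable \<Omega>" "distr \<Omega> borel Y0 = H" "\<And>x. x \<in> space \<Omega> ==> (\<lambda>n. Y n x) \<longlonglongrightarrow> Y0 x"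
  unfolding measurable_lborel1 by blast
 note [measurable] = \<Omega>(2) \<Omega>(4) meas(1) meas(2)
 interpret prob_space \<Omega> by fact
 have eq: "integral\<^sup>L (Hs k) (f k) = (LINT x|\<Omega>. f k (Y k x))" for k
  by (subst \<Omega>(3)[symmetric], subst integral_distr) auto
 have eq0: "integral\<^sup>L H g = (LINT x|\<Omega>. g (Y0 x))"
  by (subst \<Omega>(5)[symmetric], subst integral_distr) auto
 have "AE x in distr \<Omega> borel (Y k). 0 \<le> x" for k using nonneg_distrD(5)[OF Hs[of k]] by (simp only: \<Omega>(3))
 then have Yk: "AE x in \<Omega>. 0 \<le> Y k x" for k by (subst (asm) AE_distr_iff) auto
 have all: "AE x in \<Omega>. \<forall>k. 0 \<le> Y k x" using Yk by (simp add: AE_all_countable)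
 have conv: "AE x in \<Omega>. (\<lambda>k. f k (Y k x)) \<longlonglongrightarrow> g (Y0 x)"
  using all AE_space
 proof eventually_elim
  case (elim x)
  have "0 \<le> Y0 x" by (rule LIMSEQ_le_const[OF \<Omega>(6)]) (use elim in auto)
  then show ?case using elim by (intro lim) (auto intro: \<Omega>(6))
 qed
 show ?thesis unfolding eq eq0
  by (rule integral_dominated_convergence[where w="\<lambda>_. B"])
    (use conv in \<open>auto intro: eventually_mono[OF Yk] bound\<close>)
qed

lemma weak_conv_const: "weak_conv_m (\<lambda>_. H) H"
 by (simp add: weak_conv_m_def weak_conv_def)

lemma solves_Im_eq:
 assumes H: "nonneg_distr H" and z: "0 < Im z" and \<theta>: "0 < Im \<theta>"
 defines "D \<equiv> \<lambda>l. cmod (- z + of_real l * sig \<theta>)"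
 shows "integrable H (\<lambda>l. l / (D l)\<^sup>2)" "integrable H (\<lambda>l. (l / D l)\<^sup>2)"
  "Im (LINT l|H. hker z (sig \<theta>) l) = Im z * (LINT l|H. l / (D l)\<^sup>2) + Im \<theta> * sig2 \<theta> * (LINT l|H. (l / D l)\<^sup>2)"
proof -
 note s = Im_sig_neg[OF \<theta>]
 have Dpos: "0 < D l" "Im z \<le> D l" if "0 \<le> l" for l
  using den_nonzero[of l "sig \<theta>" z] den_lower(1)[of l "sig \<theta>" z] that s z by (auto simp: D_def)
 have b1: "l / D l \<le> 1 / (- Im (sig \<theta>))" if "0 \<le> l" for l
  using hker_bound[OF that s z] that by (simp add: hker_def norm_divide D_def)
 show i1: "integrable H (\<lambda>l. l / (D l)\<^sup>2)"
 proof (rule integrable_bounded_nonneg[OF H, where B="1 / (- Im (sig \<theta>)) * (1 / Im z)"])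
  fix l :: real assume l: "0 \<le> l"
  have "l / (D l)\<^sup>2 = l / D l * (1 / D l)" by (simp add: power2_eq_square)
  also have "... \<le> 1 / (- Im (sig \<theta>)) * (1 / Im z)"
   using b1[OF l] Dpos[OF l] l z s by (intro mult_mono) (auto simp: field_simps)
  finally show "norm (l / (D l)\<^sup>2) \<le> 1 / (- Im (sig \<theta>)) * (1 / Im z)" using l by simp
 qed (simp add: D_def)
 show i2: "integrable H (\<lambda>l. (l / D l)\<^sup>2)"
 proof (rule integrable_bounded_nonneg[OF H, where B="(1 / (- Im (sig \<theta>)))\<^sup>2"])
  fix l :: real assume l: "0 \<le> l"
  show "norm ((l / D l)\<^sup>2) \<le> (1 / (- Im (sig \<theta>)))\<^sup>2"
   using power_mono[OF b1[OF l], of 2] l Dpos[OF l] by simp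
 qed (simp add: D_def)
 have i: "integrable H (hker z (sig \<theta>))"
  by (rule integrable_bounded_nonneg[OF H _ hker_bound[OF _ s z]]) auto
 have "Im (LINT l|H. hker z (sig \<theta>) l) = (LINT l|H. Im (hker z (sig \<theta>) l))"
  using i by simp
 also have "... = (LINT l|H. Im z * (l / (D l)\<^sup>2) + Im \<theta> * sig2 \<theta> * (l / D l)\<^sup>2)"
  by (simp only: Im_hker Im_sig D_def) (simp add: algebra_simps)
 also have "... = Im z * (LINT l|H. l / (D l)\<^sup>2) + Im \<theta> * sig2 \<theta> * (LINT l|H. (l / D l)\<^sup>2)"
  using i1 i2 by (subst Bochner_Integration.integral_add) (simp_all del: times_divide_eq_right)
 finally show "Im (LINT l|H. hker z (sig \<theta>) l) = Im z * (LINT l|H. l / (D l)\<^sup>2) + Im \<theta> * sig2 \<theta> * (LINT l|H. (l / D l)\<^sup>2)" .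
qed

lemma nonneg_distr_eq_return_0:
 assumes H: "nonneg_distr H" and "AE x in H. x = 0" shows "H = return borel 0"
proof (rule measure_eqI)
 show "sets H = sets (return borel 0)" using nonneg_distrD(3)[OF H] by simp
 fix A assume "A \<in> sets H"
 then have A: "A \<in> sets borel" using nonneg_distrD(3)[OF H] by simp
 interpret prob_space H using nonneg_distrD(2)[OF H] .
 show "emeasure H A = emeasure (return borel 0) A"
 proof (cases "0 \<in> A")
  case True
  have "AE x in H. x \<in> A" using assms(2) by eventually_elim (use True in auto)
  then show ?thesis using True A \<open>A \<in> sets H\<close> emeasure_eq_1_AE[of A] by simp
 next
  case False
  have "AE x in H. x \<notin> A" using assms(2) by eventually_elim (use False in auto)
  then have "emeasure H A = 0" using \<open>A \<in> sets H\<close> nonneg_distrD(4)[OF H]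
   by (subst (asm) AE_iff_measurable[of A]) (auto)
  then show ?thesis using False A by simp
 qed
qed

text \<open>The exclusion of the point mass at 0 is turned into strict positivity here: on the half
  line, a nonnegative function that vanishes only at 0 has zero integral only against that
  mass.\<close>

lemma integral_pos_nondegenerate:
 assumes H: "nonneg_distr H" "H \<noteq> return borel 0" and f: "integrable H f"
  and pos: "\<And>l. 0 < l ==> 0 < f l" "f 0 = (0::real)"
 shows "0 < (LINT l|H. f l)"
proof -
 have nn: "AE l in H. 0 \<le> f l" using nonneg_distrD(5)[OF H(1)]
  by eventually_elim (metis pos less_eq_real_def)
 have "(LINT l|H. f l) \<noteq> 0"
 proof
  assume "(LINT l|H. f l) = 0"
  then have "AE l in H. f l = 0" using integral_nonneg_eq_0_iff_AE[OF f nn] by simp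
  with nonneg_distrD(5)[OF H(1)] have "AE l in H. l = 0"
   by eventually_elim (metis pos(1) less_eq_real_def less_irrefl)
  then show False using nonneg_distr_eq_return_0[OF H(1)] H(2) by simp
 qed
 moreover have "0 \<le> (LINT l|H. f l)" by (rule integral_nonneg_AE[OF nn])
 ultimately show ?thesis by simp
qed

text \<open>The imaginary part of the equation reads Im h = Im z I + Im h J with I > 0, where J is
  the left side of the claim. Dividing by Im h leaves J < 1.\<close>

lemma solves_contraction:
 assumes H: "nonneg_distr H" "H \<noteq> return borel 0" and c: "0 < c" and z: "0 < Im z" and sol: "solves_h_eq c H z h"
 shows "c * sig2 (of_real c * h) * (LINT l|H. (l / cmod (- z + of_real l * sig (of_real c * h)))\<^sup>2) < 1"
proof -
 let ?\<theta> = "of_real c * h" and ?D = "\<lambda>l. cmod (- z + of_real l * sig (of_real c * h))"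
 from sol have h: "0 < Im h" and eq: "h = (LINT l|H. hker z (sig ?\<theta>) l)" by (auto simp: solves_h_eq_alt)
 have \<theta>: "0 < Im ?\<theta>" using h c by simp
 note I = solves_Im_eq[OF H(1) z \<theta>]
 have "0 < (LINT l|H. l / (?D l)\<^sup>2)"
  by (rule integral_pos_nondegenerate[OF H I(1)])
   (use den_nonzero[of _ "sig ?\<theta>" z] Im_sig_neg[OF \<theta>] z in \<open>auto intro!: divide_pos_pos\<close>)
 then have "Im ?\<theta> * sig2 ?\<theta> * (LINT l|H. (l / ?D l)\<^sup>2) < Im h"
  using I(3)[folded eq] mult_pos_pos[OF z, of "LINT l|H. l / (?D l)\<^sup>2"] by linarith
 then have "Im h * (c * sig2 ?\<theta> * (LINT l|H. (l / ?D l)\<^sup>2)) < Im h * 1"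
  by (simp add: mult_ac)
 then show ?thesis using h mult_less_cancel_left_pos by blast
qed

section \<open>Differences of solutions and uniqueness\<close>

definition hker2 :: "complex => complex => complex => complex => real => complex" where
 "hker2 z1 s1 z2 s2 l = of_real l / ((- z1 + of_real l * s1) * (- z2 + of_real l * s2))"

definition hker3 :: "complex => complex => complex => complex => real => complex" where
 "hker3 z1 s1 z2 s2 l = hker z1 s1 l * hker z2 s2 l"

text \<open>Minus the divided difference of \<open>sig\<close>. In the same way \<open>hker2\<close>
  and minus \<open>hker3\<close> are the divided differences of \<open>hker\<close> in z and in s.
  Exact divided differences, rather than derivatives, serve uniqueness and differentiability of h
  alike.\<close>

definition sigd :: "complex => complex => complex" where
 "sigd \<theta>1 \<theta>2 = 1 / ((1 + \<theta>1) * (1 + \<theta>2)) + 1 / ((- 1 + \<theta>1) * (- 1 + \<theta>2))"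

lemma sig_diff:
 assumes "0 < Im \<theta>1" "0 < Im \<theta>2" shows "sig \<theta>1 - sig \<theta>2 = - (\<theta>1 - \<theta>2) * sigd \<theta>1 \<theta>2"
proof -
 have *: "1 / (e + \<theta>1) - 1 / (e + \<theta>2) = - (\<theta>1 - \<theta>2) * (1 / ((e + \<theta>1) * (e + \<theta>2)))"
  if "e + \<theta>1 \<noteq> 0" "e + \<theta>2 \<noteq> 0" for e
  using that by (simp add: divide_simps)
 have "sig \<theta>1 - sig \<theta>2 = (1 / (1 + \<theta>1) - 1 / (1 + \<theta>2)) + (1 / (- 1 + \<theta>1) - 1 / (- 1 + \<theta>2))"
  unfolding sig_def by simp
 also have "... = - (\<theta>1 - \<theta>2) * sigd \<theta>1 \<theta>2"
  unfolding sigd_def using nonreal_not_pm1[OF assms(1)] nonreal_not_pm1[OF assms(2)]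
  by (subst (1 2) *) (simp_all only: distrib_left not_False_eq_True)
 finally show ?thesis .
qed

lemma hker_diff:
 assumes "0 \<le> l" "Im s1 \<le> 0" "Im s2 \<le> 0" "0 < Im z1" "0 < Im z2"
 shows "hker z1 s1 l - hker z2 s2 l = (z1 - z2) * hker2 z1 s1 z2 s2 l - (s1 - s2) * hker3 z1 s1 z2 s2 l"
proof -
 have "- z1 + of_real l * s1 \<noteq> 0" "- z2 + of_real l * s2 \<noteq> 0"
  using den_nonzero[OF assms(1,2,4)] den_nonzero[OF assms(1,3,5)] by auto
 then show ?thesis unfolding hker_def hker2_def hker3_def
  by (simp add: divide_simps) (simp add: algebra_simps)
qed

lemma hker2_bound:
 assumes "0 \<le> l" "Im s1 < 0" "Im s2 < 0" "0 < Im z1" "0 < Im z2"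
 shows "cmod (hker2 z1 s1 z2 s2 l) \<le> 1 / (- Im s1) * (1 / Im z2)"
proof -
 have "hker2 z1 s1 z2 s2 l = hker z1 s1 l * rker z2 s2 l" by (simp add: hker2_def hker_def rker_def)
 then show ?thesis using hker_bound[of l s1 z1] rker_bound[of l s2 z2] assms
  by (simp add: norm_mult) (intro mult_mono[of _ "1 / (- Im s1)" _ "1 / Im z2", simplified], auto)
qed

lemma hker3_bound:
 assumes "0 \<le> l" "Im s1 < 0" "Im s2 < 0" "0 < Im z1" "0 < Im z2"
 shows "cmod (hker3 z1 s1 z2 s2 l) \<le> 1 / (- Im s1) * (1 / (- Im s2))"
 unfolding hker3_def norm_mult
 by (rule mult_mono) (use hker_bound[of l s1 z1] hker_bound[of l s2 z2] assms in auto)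

lemma hker2_measurable [measurable]: "hker2 z1 s1 z2 s2 \<in> borel_measurable borel"
 unfolding hker2_def[abs_def] by measurable

lemma hker3_measurable [measurable]: "hker3 z1 s1 z2 s2 \<in> borel_measurable borel"
 unfolding hker3_def[abs_def] by measurable

text \<open>Subtracting the two equations and inserting divided differences leaves h1 - h2 on both
  sides; collecting it produces the factor on the left. For z1 = z2 this decides uniqueness, for z1
  close to z2 it yields the difference quotient of h.\<close>

lemma solution_diff:
 assumes H: "nonneg_distr H" and c: "0 < c" and z: "0 < Im z1" "0 < Im z2"
  and sol: "solves_h_eq c H z1 h1" "solves_h_eq c H z2 h2"
 defines "s1 \<equiv> sig (of_real c * h1)" and "s2 \<equiv> sig (of_real c * h2)"
 shows "(h1 - h2) * (1 - of_real c * sigd (of_real c * h1) (of_real c * h2) * (LINT l|H. hker3 z1 s1 z2 s2 l))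
    = (z1 - z2) * (LINT l|H. hker2 z1 s1 z2 s2 l)"
proof -
 have h: "0 < Im h1" "0 < Im h2" and eq: "h1 = (LINT l|H. hker z1 s1 l)" "h2 = (LINT l|H. hker z2 s2 l)"
  using sol by (auto simp: solves_h_eq_alt s1_def s2_def)
 have s: "Im s1 < 0" "Im s2 < 0" unfolding s1_def s2_def using h c by (auto intro!: Im_sig_neg)
 have i: "integrable H (hker z1 s1)" "integrable H (hker z2 s2)" "integrable H (hker2 z1 s1 z2 s2)" "integrable H (hker3 z1 s1 z2 s2)"
  using hker_bound s z hker2_bound hker3_bound by (auto intro!: integrable_bounded_nonneg[OF H])
 have "h1 - h2 = (LINT l|H. hker z1 s1 l - hker z2 s2 l)"
  using i by (simp add: eq[symmetric])
 also have "... = (LINT l|H. (z1 - z2) * hker2 z1 s1 z2 s2 l - (s1 - s2) * hker3 z1 s1 z2 s2 l)"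
 proof (rule integral_cong_AE)
  show "AE l in H. hker z1 s1 l - hker z2 s2 l = (z1 - z2) * hker2 z1 s1 z2 s2 l - (s1 - s2) * hker3 z1 s1 z2 s2 l"
   using nonneg_distrD(5)[OF H] by eventually_elim (use hker_diff s z in auto)
 qed (rule nonneg_distr_measurable[OF H], measurable)+
 also have "... = (z1 - z2) * (LINT l|H. hker2 z1 s1 z2 s2 l) - (s1 - s2) * (LINT l|H. hker3 z1 s1 z2 s2 l)"
  using i by simp
 also have "s1 - s2 = - (of_real c * (h1 - h2)) * sigd (of_real c * h1) (of_real c * h2)"
  unfolding s1_def s2_def using h c by (subst sig_diff) (auto simp: algebra_simps)
 finally show ?thesis by (simp add: algebra_simps)
qed

text \<open>The two summands of \<open>sigd\<close> are treated separately: in each, a product of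
  two reciprocals is replaced by half the sum of squares. A mixed term is thereby dominated by the
  mean of two diagonal ones.\<close>

lemma sigd_bound:
 assumes "0 \<le> a" "0 \<le> b"
 shows "cmod (sigd \<theta>1 \<theta>2) * (a * b) \<le> (sig2 \<theta>1 * a\<^sup>2 + sig2 \<theta>2 * b\<^sup>2) / 2"
proof -
 define p1 p2 q1 q2 where "p1 = 1 / cmod (1 + \<theta>1)" "p2 = 1 / cmod (1 + \<theta>2)" "q1 = 1 / cmod (- 1 + \<theta>1)" "q2 = 1 / cmod (- 1 + \<theta>2)"
 note d = this
 have "cmod (sigd \<theta>1 \<theta>2) \<le> p1 * p2 + q1 * q2"
  unfolding sigd_def d by (rule order_trans[OF norm_triangle_ineq]) (simp add: norm_divide norm_mult)
 then have "cmod (sigd \<theta>1 \<theta>2) * (a * b) \<le> (p1 * p2 + q1 * q2) * (a * b)"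
  using assms by (intro mult_right_mono) auto
 also have "... = (p1 * a) * (p2 * b) + (q1 * a) * (q2 * b)" by (simp add: algebra_simps)
 also have "... \<le> ((p1 * a)\<^sup>2 + (p2 * b)\<^sup>2) / 2 + ((q1 * a)\<^sup>2 + (q2 * b)\<^sup>2) / 2"
 proof (rule add_mono)
  show "x * y \<le> (x\<^sup>2 + y\<^sup>2) / 2" for x y :: real using sum_squares_bound[of x y] by simp
  then show "x * y \<le> (x\<^sup>2 + y\<^sup>2) / 2" for x y :: real .
 qed
 also have "... = (sig2 \<theta>1 * a\<^sup>2 + sig2 \<theta>2 * b\<^sup>2) / 2"
  by (simp add: sig2_def d power_mult_distrib power_divide algebra_simps add_divide_distrib)
 finally show ?thesis .
qed

text \<open>By \<open>sigd_bound\<close> under the integral, the mixed factor is at most the mean of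
  the two quantities in \<open>solves_contraction\<close>, and each of these is below 1 because it
  belongs to a solution.\<close>

lemma solutions_contraction:
 assumes H: "nonneg_distr H" "H \<noteq> return borel 0" and c: "0 < c" and z: "0 < Im z1" "0 < Im z2"
  and sol: "solves_h_eq c H z1 h1" "solves_h_eq c H z2 h2"
 defines "s1 \<equiv> sig (of_real c * h1)" and "s2 \<equiv> sig (of_real c * h2)"
 shows "cmod (of_real c * sigd (of_real c * h1) (of_real c * h2) * (LINT l|H. hker3 z1 s1 z2 s2 l)) < 1"
proof -
 let ?D1 = "\<lambda>l. cmod (- z1 + of_real l * s1)" and ?D2 = "\<lambda>l. cmod (- z2 + of_real l * s2)"
 let ?\<theta>1 = "of_real c * h1" and ?\<theta>2 = "of_real c * h2"
 have h: "0 < Im ?\<theta>1" "0 < Im ?\<theta>2" using sol c by (auto simp: solves_h_eq_alt)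
 have s: "Im s1 < 0" "Im s2 < 0" unfolding s1_def s2_def using h by (auto intro!: Im_sig_neg)
 have i3: "integrable H (hker3 z1 s1 z2 s2)" using hker3_bound s z by (auto intro!: integrable_bounded_nonneg[OF H(1)])
 note i1 = solves_Im_eq(2)[OF H(1) z(1) h(1), folded s1_def] and i2 = solves_Im_eq(2)[OF H(1) z(2) h(2), folded s2_def]
 note c1 = solves_contraction[OF H c z(1) sol(1), folded s1_def] and c2 = solves_contraction[OF H c z(2) sol(2), folded s2_def]
 have "cmod (of_real c * sigd ?\<theta>1 ?\<theta>2 * (LINT l|H. hker3 z1 s1 z2 s2 l))
   \<le> c * (cmod (sigd ?\<theta>1 ?\<theta>2) * (LINT l|H. cmod (hker3 z1 s1 z2 s2 l)))"
  using c by (auto simp: norm_mult intro!: mult_left_mono)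
 also have "... = c * (LINT l|H. cmod (sigd ?\<theta>1 ?\<theta>2) * cmod (hker3 z1 s1 z2 s2 l))" by simp
 also have "... \<le> c * (LINT l|H. (sig2 ?\<theta>1 * (l / ?D1 l)\<^sup>2 + sig2 ?\<theta>2 * (l / ?D2 l)\<^sup>2) / 2)"
 proof (intro mult_left_mono integral_mono_AE)
  show "AE l in H. cmod (sigd ?\<theta>1 ?\<theta>2) * cmod (hker3 z1 s1 z2 s2 l) \<le> (sig2 ?\<theta>1 * (l / ?D1 l)\<^sup>2 + sig2 ?\<theta>2 * (l / ?D2 l)\<^sup>2) / 2"
   using nonneg_distrD(5)[OF H(1)]
  proof eventually_elim
   case (elim l)
   then show ?case using sigd_bound[of "l / ?D1 l" "l / ?D2 l" ?\<theta>1 ?\<theta>2]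
    by (simp add: hker3_def hker_def norm_mult norm_divide)
  qed
 qed (use i1 i2 i3 c in auto)
 also have "... = (c * sig2 ?\<theta>1 * (LINT l|H. (l / ?D1 l)\<^sup>2) + c * sig2 ?\<theta>2 * (LINT l|H. (l / ?D2 l)\<^sup>2)) / 2"
  using i1 i2 by (simp add: algebra_simps)
 also have "... < 1" using c1 c2 by simp
 finally show ?thesis .
qed

lemma solves_h_eq_unique:
 assumes "nonneg_distr H" "H \<noteq> return borel 0" "0 < c" "0 < Im z" "solves_h_eq c H z h1" "solves_h_eq c H z h2"
 shows "h1 = h2"
 using solution_diff[OF assms(1,3,4,4,5,6)] solutions_contraction[OF assms(1-4,4-6)] by auto

lemma nonneg_distr_integral_rker_hker:
 assumes H: "nonneg_distr H" and s: "Im s < 0" and z: "0 < Im z"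
 shows "(LINT l|H. hker z s l) * s = 1 + z * (LINT l|H. rker z s l)"
proof -
 interpret prob_space H using nonneg_distrD(2)[OF H] .
 have i: "integrable H (hker z s)" "integrable H (rker z s)"
  using hker_bound[OF _ s z] rker_bound[OF _ less_imp_le[OF s] z] by (auto intro!: integrable_bounded_nonneg[OF H])
 have "(LINT l|H. hker z s l) * s = (LINT l|H. hker z s l * s)" by simp
 also have "... = (LINT l|H. 1 + z * rker z s l)"
 proof (rule integral_cong_AE)
  show "AE l in H. hker z s l * s = 1 + z * rker z s l"
   using nonneg_distrD(5)[OF H] by eventually_elim (use hker_rker s z in auto)
 qed (rule nonneg_distr_measurable[OF H], measurable)+
 also have "... = 1 + z * (LINT l|H. rker z s l)" using i by (simp add: prob_space)
 finally show ?thesis .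
qed

lemma norm_integral_rker_le:
 assumes H: "nonneg_distr H" and s: "Im s \<le> 0" and z: "0 < Im z"
 shows "cmod (LINT l|H. rker z s l) \<le> 1 / Im z"
proof -
 interpret prob_space H using nonneg_distrD(2)[OF H] .
 have i: "integrable H (rker z s)" using rker_bound[OF _ s z] by (auto intro!: integrable_bounded_nonneg[OF H])
 have "cmod (LINT l|H. rker z s l) \<le> (LINT l|H. cmod (rker z s l))" by (rule integral_norm_bound)
 also have "... \<le> (LINT l|H. 1 / Im z)"
 proof (rule integral_mono_AE)
  show "AE l in H. cmod (rker z s l) \<le> 1 / Im z"
   using nonneg_distrD(5)[OF H] by eventually_elim (use rker_bound s z in auto)
 qed (use i in auto)
 finally show ?thesis by (simp add: prob_space)
qed

section \<open>Limits of the integrals and compactness of approximate solutions\<close>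

lemma tendsto_den:
 fixes z s :: complex
 assumes "zs \<longlonglongrightarrow> z" "ss \<longlonglongrightarrow> s" "y \<longlonglongrightarrow> l"
 shows "(\<lambda>k. - zs k + of_real (y k) * ss k) \<longlonglongrightarrow> - z + of_real l * s"
 using assms by (intro tendsto_intros)

context
 fixes Hs :: "nat => real measure" and H :: "real measure" and zs ss :: "nat => complex" and z s :: complex and \<beta> :: real
 assumes Hs: "\<And>k. nonneg_distr (Hs k)" and H: "nonneg_distr H" and wc: "weak_conv_m Hs H"
  and zs: "zs \<longlonglongrightarrow> z" "0 < \<beta>" "\<And>k. \<beta> \<le> Im (zs k)"
  and ss: "ss \<longlonglongrightarrow> s" "\<And>k. Im (ss k) \<le> 0"
begin

lemma limits_Im: "\<beta> \<le> Im z" "Im s \<le> 0"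
 using LIMSEQ_le_const[OF tendsto_Im[OF zs(1)]] LIMSEQ_le_const2[OF tendsto_Im[OF ss(1)]] zs(3) ss(2) by auto

lemma limit_den_nonzero: "0 \<le> l ==> - z + of_real l * s \<noteq> 0"
 using den_nonzero limits_Im zs(2) by simp

lemma tendsto_integral_rker: "(\<lambda>k. LINT l|Hs k. rker (zs k) (ss k) l) \<longlonglongrightarrow> (LINT l|H. rker z s l)"
proof (rule weak_conv_integral_varying[OF Hs H wc, where B="1 / \<beta>"])
 fix k and l :: real assume "0 \<le> l"
 moreover have "0 < Im (zs k)" using zs(2,3) less_le_trans by blast
 ultimately have "cmod (rker (zs k) (ss k) l) \<le> 1 / Im (zs k)" using ss(2) by (intro rker_bound)
 also have "... \<le> 1 / \<beta>" using zs(2) zs(3)[of k] by (intro divide_left_mono mult_pos_pos) linarith+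
 finally show "cmod (rker (zs k) (ss k) l) \<le> 1 / \<beta>" .
next
 fix y and l :: real assume "0 \<le> l" "y \<longlonglongrightarrow> l"
 then show "(\<lambda>k. rker (zs k) (ss k) (y k)) \<longlonglongrightarrow> rker z s l"
  unfolding rker_def using limit_den_nonzero
  by (intro tendsto_divide tendsto_const tendsto_den zs(1) ss(1)) auto
qed auto

lemma tendsto_integral_hker:
 assumes b: "0 < b" "\<And>k. Im (ss k) \<le> - b"
 shows "(\<lambda>k. LINT l|Hs k. hker (zs k) (ss k) l) \<longlonglongrightarrow> (LINT l|H. hker z s l)"
proof (rule weak_conv_integral_varying[OF Hs H wc, where B="1 / b"])
 fix k and l :: real assume "0 \<le> l"
 moreover have "0 < Im (zs k)" using zs(2,3) less_le_trans by blast
 moreover have s: "Im (ss k) < 0" using b less_le_trans[of "Im (ss k)" "-b" 0] b(2)[of k] by linarith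
 ultimately have "cmod (hker (zs k) (ss k) l) \<le> 1 / (- Im (ss k))" by (intro hker_bound)
 also have "... \<le> 1 / b" using b(1) b(2)[of k] by (intro divide_left_mono mult_pos_pos) linarith+
 finally show "cmod (hker (zs k) (ss k) l) \<le> 1 / b" .
next
 fix y and l :: real assume "0 \<le> l" "y \<longlonglongrightarrow> l"
 then show "(\<lambda>k. hker (zs k) (ss k) (y k)) \<longlonglongrightarrow> hker z s l"
  unfolding hker_def using limit_den_nonzero
  by (intro tendsto_divide tendsto_of_real tendsto_den zs(1) ss(1)) auto
qed auto

text \<open>The limit must be strictly positive even though Im (\<open>ss k\<close>) may tend to 0,
  in which case \<open>hker\<close> has no uniform bound. Only the part of \<open>Im_hker\<close>
  carrying Im z is kept, with l in its numerator lowered to min l 1; the result is bounded and still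
  positive for l > 0.\<close>

lemma liminf_Im_integral_hker:
 assumes neg: "\<And>k. Im (ss k) < 0" and Hn: "H \<noteq> return borel 0"
  and lim: "(\<lambda>k. Im (LINT l|Hs k. hker (zs k) (ss k) l)) \<longlonglongrightarrow> L"
 shows "0 < L"
proof -
 let ?D = "\<lambda>z s l. cmod (- z + of_real l * s)"
 define f where "f z s l = Im z * (min l 1 / (?D z s l)\<^sup>2)" for z s and l :: real
 have fm [measurable]: "f z s \<in> borel_measurable borel" for z s unfolding f_def[abs_def] by measurable
 have zp: "0 < Im (zs k)" for k using zs(2,3) less_le_trans by blast
 have fb: "norm (f z s l) \<le> 1 / \<beta>" if "0 \<le> l" "Im s \<le> 0" "\<beta> \<le> Im z" for z s l
 proof -
  have z: "0 < Im z" using that zs(2) by linarith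
  have D: "Im z \<le> ?D z s l" using den_lower(1)[OF that(1,2)] .
  have "f z s l \<le> Im z * (1 / (Im z)\<^sup>2)"
   unfolding f_def using D z that by (intro mult_left_mono frac_le power_mono) auto
  also have "... = 1 / Im z" using z by (simp add: power2_eq_square)
  also have "... \<le> 1 / \<beta>" using that zs(2) z by (intro divide_left_mono) auto
  finally show ?thesis using that z by (simp add: f_def)
 qed
 have "(\<lambda>k. LINT l|Hs k. f (zs k) (ss k) l) \<longlonglongrightarrow> (LINT l|H. f z s l)"
 proof (rule weak_conv_integral_varying[OF Hs H wc, where B="1 / \<beta>"])
  fix y and l :: real assume "0 \<le> l" "y \<longlonglongrightarrow> l"
  then show "(\<lambda>k. f (zs k) (ss k) (y k)) \<longlonglongrightarrow> f z s l"
   unfolding f_def using limit_den_nonzero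
   by (intro tendsto_intros tendsto_den zs(1) ss(1)) auto
 next
  show "norm (f (zs k) (ss k) l) \<le> 1 / \<beta>" if "0 \<le> l" for k l by (rule fb[OF that ss(2) zs(3)])
 qed (rule fm)+
 moreover have "(LINT l|Hs k. f (zs k) (ss k) l) \<le> Im (LINT l|Hs k. hker (zs k) (ss k) l)" for k
 proof -
  have i: "integrable (Hs k) (hker (zs k) (ss k))" "integrable (Hs k) (f (zs k) (ss k))"
   using hker_bound[OF _ neg zp] integrable_bounded_nonneg[OF Hs fm fb[OF _ ss(2) zs(3)]]
   by (auto intro!: integrable_bounded_nonneg[OF Hs])
  have "(LINT l|Hs k. f (zs k) (ss k) l) \<le> (LINT l|Hs k. Im (hker (zs k) (ss k) l))"
  proof (rule integral_mono_AE)
   show "AE l in Hs k. f (zs k) (ss k) l \<le> Im (hker (zs k) (ss k) l)"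
    using nonneg_distrD(5)[OF Hs]
   proof eventually_elim
    case (elim l)
    have "Im (zs k) * (min l 1 / (?D (zs k) (ss k) l)\<^sup>2) \<le> Im (zs k) * (l / (?D (zs k) (ss k) l)\<^sup>2)"
     using zp[of k] by (intro mult_left_mono divide_right_mono) auto
    moreover have "0 \<le> - Im (ss k) * (l / ?D (zs k) (ss k) l)\<^sup>2" using ss(2)[of k] by (intro mult_nonneg_nonneg) auto
    ultimately show ?case unfolding f_def Im_hker by linarith
   qed
  qed (use i in auto)
  then show ?thesis using i by simp
 qed
 ultimately have "(LINT l|H. f z s l) \<le> L" using LIMSEQ_le[OF _ lim] by blast
 moreover have "0 < (LINT l|H. f z s l)"
 proof (rule integral_pos_nondegenerate[OF H Hn])
  show "integrable H (f z s)" using integrable_bounded_nonneg[OF H fm fb[OF _ limits_Im(2,1)]] by blast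
  show "0 < f z s l" if "0 < l" for l
   using limit_den_nonzero[of l] that limits_Im zs(2) by (auto simp: f_def intro!: mult_pos_pos divide_pos_pos)
 qed (simp add: f_def)
 ultimately show ?thesis by simp
qed

end

lemma not_bounded_imp_subseq_at_infinity:
 fixes f :: "nat => complex"
 assumes "\<not> bounded (range f)"
 shows "\<exists>r. strict_mono (r :: nat => nat) \<and> filterlim (f \<circ> r) at_infinity sequentially"
proof -
 have ex: "\<exists>n>m. K < norm (f n)" for m and K :: real
 proof (rule ccontr)
  assume "\<not> ?thesis"
  then have le: "norm (f n) \<le> K" if "n > m" for n using that by auto
  have "norm (f n) \<le> Max ((\<lambda>n. norm (f n)) ` {..m}) + \<bar>K\<bar>" for n
  proof (cases "n \<le> m")
   case True
   then have "norm (f n) \<le> Max ((\<lambda>n. norm (f n)) ` {..m})" by (intro Max_ge) auto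
   then show ?thesis by linarith
  next
   case False
   have "0 \<le> norm (f 0)" by simp
   also have "... \<le> Max ((\<lambda>n. norm (f n)) ` {..m})" by (intro Max_ge) auto
   finally show ?thesis using le[of n] False by linarith
  qed
  then show False using assms by (auto simp: bounded_iff)
 qed
 have "\<exists>r. \<forall>n. real n < norm (f (r n)) \<and> r n < r (Suc n)"
 proof (rule dependent_nat_choice)
  show "\<exists>x. real 0 < norm (f x)" using ex[where K="real 0"] by blast
  show "\<exists>y. real (Suc n) < norm (f y) \<and> x < y" for x n using ex[where K="real (Suc n)" and m=x] by blast
 qed
 then obtain r where r: "\<And>n. real n < norm (f (r n))" "\<And>n. r n < r (Suc n)" by blast
 have "filterlim (\<lambda>n. norm (f (r n))) at_top sequentially"
  by (rule filterlim_at_top_mono[OF filterlim_real_sequentially always_eventually]) (use r(1) less_imp_le in blast)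
 then have "filterlim (f \<circ> r) at_infinity sequentially"
  by (subst filterlim_norm_at_top_imp_at_infinity) (auto simp: o_def)
 then show ?thesis using r(2) strict_mono_Suc_iff by blast
qed

lemma weak_conv_m_subseq: "weak_conv_m Hs H ==> strict_mono r ==> weak_conv_m (\<lambda>k. Hs (r k)) H"
 using LIMSEQ_subseq_LIMSEQ[of "\<lambda>n. cdf (Hs n) x" _ r for x] by (auto simp: weak_conv_m_def weak_conv_def o_def)

lemma sig_tendsto:
 assumes "ts \<longlonglongrightarrow> \<theta>" "1 + \<theta> \<noteq> 0" "- 1 + \<theta> \<noteq> 0" shows "(\<lambda>k. sig (ts k)) \<longlonglongrightarrow> sig \<theta>"
 unfolding sig_def using assms by (intro tendsto_intros) auto

text \<open>The second limit is what forbids unbounded approximate solutions: along such a sequence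
  the equation would force the same product to tend to 0.\<close>

lemma sig_mult_at_infinity:
 assumes "filterlim ts at_infinity sequentially"
 shows "(\<lambda>k. sig (ts k)) \<longlonglongrightarrow> 0" "(\<lambda>k. ts k * sig (ts k)) \<longlonglongrightarrow> 2"
proof -
 have inv: "(\<lambda>k. inverse (e + ts k)) \<longlonglongrightarrow> 0" for e
  by (rule tendsto_inverse_0[THEN filterlim_compose]) (rule tendsto_add_filterlim_at_infinity[OF tendsto_const assms])
 show "(\<lambda>k. sig (ts k)) \<longlonglongrightarrow> 0"
  unfolding sig_def divide_inverse mult_1 using tendsto_add[OF inv[of 1] inv[of "- 1"]] by simp
 have ev: "\<forall>\<^sub>F k in sequentially. ts k \<noteq> e" for e
  using assms filterlim_at_infinity_imp_eventually_ne by blast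
 have "(\<lambda>k. (1 - inverse (1 + ts k)) + (1 + inverse (- 1 + ts k))) \<longlonglongrightarrow> (1 - 0) + (1 + 0)"
  by (intro tendsto_intros inv)
 moreover have "\<forall>\<^sub>F k in sequentially. (1 - inverse (1 + ts k)) + (1 + inverse (- 1 + ts k)) = ts k * sig (ts k)"
  using ev[of 1] ev[of "- 1"]
 proof eventually_elim
  case (elim k)
  then have "1 + ts k \<noteq> 0" "- 1 + ts k \<noteq> 0" by (auto simp: add_eq_0_iff)
  then have "1 - inverse (1 + ts k) = ts k * (1 / (1 + ts k))" "1 + inverse (- 1 + ts k) = ts k * (1 / (- 1 + ts k))"
   by (simp_all add: field_simps)
  then show ?case unfolding sig_def by (simp only: distrib_left)
 qed
 ultimately show "(\<lambda>k. ts k * sig (ts k)) \<longlonglongrightarrow> 2" by (simp add: filterlim_cong)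
qed

text \<open>In the form given by \<open>sig_eq\<close> the numerator 2 \<theta> has a nonzero limit.
  The denominator tends to 0 without vanishing, since Im (\<open>ts k\<close>) > 0.\<close>

lemma sig_mult_at_pole:
 assumes "ts \<longlonglongrightarrow> \<theta>" "\<theta>\<^sup>2 = 1" "\<And>k. 0 < Im (ts k)"
 shows "filterlim (\<lambda>k. sig (ts k)) at_infinity sequentially"
proof -
 have "(\<lambda>k. (ts k)\<^sup>2 - 1) \<longlonglongrightarrow> \<theta>\<^sup>2 - 1" by (intro tendsto_intros assms(1))
 then have "(\<lambda>k. (ts k)\<^sup>2 - 1) \<longlonglongrightarrow> 0" using assms(2) by simp
 moreover have ne: "(ts k)\<^sup>2 - 1 \<noteq> 0" for k
  using nonreal_not_pm1[OF assms(3)[of k]] by (auto simp: power2_eq_1_iff)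
 ultimately have g: "filterlim (\<lambda>k. (ts k)\<^sup>2 - 1) (at 0) sequentially" by (simp add: filterlim_at)
 have ne2: "2 * \<theta> \<noteq> 0" using assms(2) by auto
 have f: "(\<lambda>k. 2 * ts k) \<longlonglongrightarrow> 2 * \<theta>" by (intro tendsto_intros assms(1))
 have "filterlim (\<lambda>k. inverse ((ts k)\<^sup>2 - 1)) at_infinity sequentially"
  by (rule filterlim_compose[OF filterlim_inverse_at_infinity g])
 from tendsto_mult_filterlim_at_infinity[OF f ne2 this]
 have "filterlim (\<lambda>k. 2 * ts k / ((ts k)\<^sup>2 - 1)) at_infinity sequentially" by (simp add: divide_inverse)
 then show ?thesis using sig_eq[OF nonreal_not_pm1[OF assms(3)]] by simp
qed

text \<open>Approximate solutions could escape to infinity, to a pole \<theta> = 1 or \<theta> = -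
  1, or to the real axis; each case is excluded. The measure, the ratio c and the point z all vary
  with k, so that existence, continuity in z and in H, and the random matrix limit become instances
  of one statement.\<close>

theorem approximate_solutions_subseq:
 assumes Hs: "\<And>k. nonneg_distr (Hs k)" and H: "nonneg_distr H" "H \<noteq> return borel 0" and wc: "weak_conv_m Hs H"
  and c: "cs \<longlonglongrightarrow> c" "0 < c" "\<And>k. 0 < cs k"
  and zs: "zs \<longlonglongrightarrow> z" "0 < Im z" "\<And>k. 0 < Im (zs k)"
  and hs: "\<And>k. 0 < Im (hs k)"
  and err: "(\<lambda>k. hs k - (LINT l|Hs k. hker (zs k) (sig (of_real (cs k) * hs k)) l)) \<longlonglongrightarrow> 0"
 shows "\<exists>r h. strict_mono (r :: nat => nat) \<and> (hs \<circ> r) \<longlonglongrightarrow> h \<and> solves_h_eq c H z h"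
proof -
 \<comment> \<open>A positive lower bound for all Im (\<open>zs k\<close>): the tail lies above Im z
   / 2, and the finitely many earlier values are positive.\<close>
 obtain \<beta> where \<beta>: "0 < \<beta>" "\<And>k. \<beta> \<le> Im (zs k)"
 proof -
  have "\<forall>\<^sub>F k in sequentially. Im z / 2 < Im (zs k)"
   using order_tendstoD(1)[OF tendsto_Im[OF zs(1)], of "Im z / 2"] zs(2) by simp
  then obtain N where N: "\<And>k. k \<ge> N ==> Im z / 2 < Im (zs k)" by (auto simp: eventually_sequentially)
  let ?m = "Min (insert (Im z / 2) ((\<lambda>k. Im (zs k)) ` {..<N}))"
  have "0 < ?m" using zs(2,3) by (subst Min_gr_iff) auto
  moreover have "?m \<le> Im (zs k)" for k
  proof (cases "k < N")
   case False
   then have "?m \<le> Im z / 2" by (intro Min_le) auto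
   then show ?thesis using N[of k] False by simp
  qed (auto intro!: Min_le)
  ultimately show ?thesis using that by blast
 qed
 define ts where "ts k = of_real (cs k) * hs k" for k
 define ss where "ss k = sig (ts k)" for k
 define T where "T k = (LINT l|Hs k. hker (zs k) (ss k) l)" for k
 define J where "J k = (LINT l|Hs k. rker (zs k) (ss k) l)" for k
 have tp: "0 < Im (ts k)" for k using hs[of k] c(3)[of k] by (simp add: ts_def)
 have sn: "Im (ss k) < 0" for k unfolding ss_def by (rule Im_sig_neg[OF tp])
 have err': "(\<lambda>k. hs k - T k) \<longlonglongrightarrow> 0" using err by (simp add: T_def ss_def ts_def)
 have TJ: "T k * ss k = 1 + zs k * J k" for k
  unfolding T_def J_def by (rule nonneg_distr_integral_rker_hker[OF Hs sn zs(3)])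
 have Jb: "cmod (J k) \<le> 1 / \<beta>" for k
 proof -
  have "cmod (J k) \<le> 1 / Im (zs k)" unfolding J_def by (rule norm_integral_rker_le[OF Hs less_imp_le[OF sn] zs(3)])
  also have "... \<le> 1 / \<beta>" using \<beta>(1) \<beta>(2)[of k] by (intro divide_left_mono mult_pos_pos) linarith+
  finally show ?thesis .
 qed
 note lims = tendsto_integral_rker tendsto_integral_hker liminf_Im_integral_hker
 have sub: "(\<lambda>k. zs (r k)) \<longlonglongrightarrow> z" "(\<lambda>k. cs (r k)) \<longlonglongrightarrow> c" "(\<lambda>k. hs (r k) - T (r k)) \<longlonglongrightarrow> 0" "weak_conv_m (\<lambda>k. Hs (r k)) H"
  if "strict_mono r" for r
  using LIMSEQ_subseq_LIMSEQ[OF zs(1) that] LIMSEQ_subseq_LIMSEQ[OF c(1) that] LIMSEQ_subseq_LIMSEQ[OF err' that]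
   weak_conv_m_subseq[OF wc that] by (simp_all add: o_def)
 \<comment> \<open>If \<open>hs\<close> were unbounded, then along a subsequence s tends to 0 and J
   to - 1 / z, so that T s = 1 + z J tends to 0. Hence so does c h s, although this product must
   tend to 2.\<close>
 have bdd: "bounded (range hs)"
 proof (rule ccontr)
  assume "\<not> bounded (range hs)"
  then obtain r where r: "strict_mono r" "filterlim (hs \<circ> r) at_infinity sequentially"
   using not_bounded_imp_subseq_at_infinity by blast
  note sr = sub[OF r(1)]
  have cr: "(\<lambda>k. complex_of_real (cs (r k))) \<longlonglongrightarrow> of_real c" by (intro tendsto_of_real sr)
  have "filterlim (\<lambda>k. of_real (cs (r k)) * hs (r k)) at_infinity sequentially"
   by (rule tendsto_mult_filterlim_at_infinity[OF cr]) (use c(2) r(2) in \<open>auto simp: o_def\<close>)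
  then have tinf: "filterlim (\<lambda>k. ts (r k)) at_infinity sequentially" by (simp add: ts_def)
  note s0 = sig_mult_at_infinity(1)[OF tinf, folded ss_def] and st = sig_mult_at_infinity(2)[OF tinf, folded ss_def]
  have "(\<lambda>k. J (r k)) \<longlonglongrightarrow> (LINT l|H. rker z 0 l)"
   unfolding J_def using lims(1)[OF Hs H(1) sr(4) sr(1) \<beta> s0 less_imp_le[OF sn]] .
  also have "(LINT l|H. rker z 0 l) = - 1 / z"
   using prob_space.prob_space[OF nonneg_distrD(2)[OF H(1)]] by (simp add: rker_def[abs_def])
  finally have "(\<lambda>k. 1 + zs (r k) * J (r k)) \<longlonglongrightarrow> 1 + z * (- 1 / z)" by (intro tendsto_intros sr(1))
  moreover have "z \<noteq> 0" using zs(2) by auto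
  ultimately have "(\<lambda>k. T (r k) * ss (r k)) \<longlonglongrightarrow> 0" by (simp add: TJ)
  moreover have "(\<lambda>k. (hs (r k) - T (r k)) * ss (r k)) \<longlonglongrightarrow> 0 * 0" by (intro tendsto_intros sr(3) s0)
  ultimately have "(\<lambda>k. T (r k) * ss (r k) + (hs (r k) - T (r k)) * ss (r k)) \<longlonglongrightarrow> 0 + 0 * 0"
   by (intro tendsto_add)
  then have "(\<lambda>k. hs (r k) * ss (r k)) \<longlonglongrightarrow> 0" by (simp add: algebra_simps)
  then have "(\<lambda>k. of_real (cs (r k)) * (hs (r k) * ss (r k))) \<longlonglongrightarrow> of_real c * 0" by (intro tendsto_mult cr)
  then have "(\<lambda>k. ts (r k) * ss (r k)) \<longlonglongrightarrow> 0" by (simp add: ts_def mult_ac)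
  from LIMSEQ_unique[OF this st] show False by simp
 qed
 then obtain h r where r: "strict_mono (r :: nat => nat)" "(hs \<circ> r) \<longlonglongrightarrow> h"
  using bounded_imp_convergent_subsequence by blast
 note sr = sub[OF r(1)]
 have hr: "(\<lambda>k. hs (r k)) \<longlonglongrightarrow> h" using r(2) by (simp add: o_def)
 have tr: "(\<lambda>k. ts (r k)) \<longlonglongrightarrow> of_real c * h" unfolding ts_def by (intro tendsto_intros sr(2) hr)
 have Tr: "(\<lambda>k. T (r k)) \<longlonglongrightarrow> h" using tendsto_diff[OF hr sr(3)] by simp
 \<comment> \<open>At a pole s is unbounded while T tends to h, which is not 0. The product T s = 1
   + z J, however, stays bounded.\<close>
 have nopole: "(of_real c * h)\<^sup>2 \<noteq> 1"
 proof
  assume p: "(of_real c * h)\<^sup>2 = 1"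
  have sinf: "filterlim (\<lambda>k. ss (r k)) at_infinity sequentially"
   unfolding ss_def by (rule sig_mult_at_pole[OF tr p tp])
  have "h \<noteq> 0" using p by auto
  with Tr sinf have "filterlim (\<lambda>k. T (r k) * ss (r k)) at_infinity sequentially"
   by (intro tendsto_mult_filterlim_at_infinity)
  then have "filterlim (\<lambda>k. norm (T (r k) * ss (r k))) at_top sequentially"
   by (rule filterlim_at_infinity_imp_norm_at_top)
  moreover obtain K where K: "0 < K" "\<And>k. norm (zs k) \<le> K"
   using convergent_imp_Bseq[OF convergentI[OF zs(1)]] by (auto elim: BseqE)
  ultimately have "\<forall>\<^sub>F k in sequentially. 1 + K * (1 / \<beta>) < norm (T (r k) * ss (r k))"
   by (simp only: filterlim_at_top_dense)
  then obtain k where k: "1 + K * (1 / \<beta>) < norm (T (r k) * ss (r k))"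
   using eventually_happens' sequentially_bot by blast
  have "norm (1 + zs (r k) * J (r k)) \<le> 1 + norm (zs (r k)) * norm (J (r k))"
   using norm_triangle_ineq[of 1 "zs (r k) * J (r k)"] by (simp add: norm_mult)
  also have "norm (zs (r k)) * norm (J (r k)) \<le> K * (1 / \<beta>)"
   using K Jb by (intro mult_mono) auto
  finally show False using k unfolding TJ by simp
 qed
 then have ne: "1 + of_real c * h \<noteq> 0" "- 1 + of_real c * h \<noteq> 0"
  by (auto simp: power2_eq_1_iff add_eq_0_iff)
 have s: "(\<lambda>k. ss (r k)) \<longlonglongrightarrow> sig (of_real c * h)" unfolding ss_def by (rule sig_tendsto[OF tr ne])
 have "(\<lambda>k. Im (T (r k))) \<longlonglongrightarrow> Im h" by (rule tendsto_Im[OF Tr])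
 then have hpos: "0 < Im h"
  unfolding T_def by (rule lims(3)[OF Hs H(1) sr(4) sr(1) \<beta> s less_imp_le[OF sn] sn H(2)])
 then have sneg: "Im (sig (of_real c * h)) < 0" using c(2) by (intro Im_sig_neg) simp
 \<comment> \<open>Half of the gap in the limit. From some index on Im s stays below
   \<open>- ?b\<close>, which bounds \<open>hker\<close> uniformly.\<close>
 let ?b = "- Im (sig (of_real c * h)) / 2"
 have "\<forall>\<^sub>F k in sequentially. Im (ss (r k)) < - ?b"
  using order_tendstoD(2)[OF tendsto_Im[OF s], of "- ?b"] sneg by simp
 then obtain N where N: "\<And>k. k \<ge> N ==> Im (ss (r k)) < - ?b" by (auto simp: eventually_sequentially)
 define q where "q k = r (k + N)" for k
 have q: "strict_mono q" using r(1) by (auto simp: q_def strict_mono_def)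
 note sq = sub[OF q]
 have sq': "(\<lambda>k. ss (q k)) \<longlonglongrightarrow> sig (of_real c * h)" "(\<lambda>k. T (q k)) \<longlonglongrightarrow> h"
  unfolding q_def by (rule LIMSEQ_ignore_initial_segment, fact)+
 have "(\<lambda>k. T (q k)) \<longlonglongrightarrow> (LINT l|H. hker z (sig (of_real c * h)) l)"
  unfolding T_def
  by (rule lims(2)[OF Hs H(1) sq(4) sq(1) \<beta> sq'(1) less_imp_le[OF sn], of ?b])
    (use N sneg in \<open>auto simp: q_def intro!: less_imp_le\<close>)
 from LIMSEQ_unique[OF sq'(2) this] hpos have "solves_h_eq c H z h" by (simp add: solves_h_eq_alt)
 with r show ?thesis by blast
qed

text \<open>Every subsequence has a further one converging to some solution, and there is only one
  solution.\<close>

theorem approximate_solutions_tendsto: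
 assumes Hs: "\<And>k. nonneg_distr (Hs k)" and H: "nonneg_distr H" "H \<noteq> return borel 0" and wc: "weak_conv_m Hs H"
  and c: "cs \<longlonglongrightarrow> c" "0 < c" "\<And>k. 0 < cs k"
  and zs: "zs \<longlonglongrightarrow> z" "0 < Im z" "\<And>k. 0 < Im (zs k)"
  and hs: "\<And>k. 0 < Im (hs k)"
  and err: "(\<lambda>k. hs k - (LINT l|Hs k. hker (zs k) (sig (of_real (cs k) * hs k)) l)) \<longlonglongrightarrow> 0"
  and h: "solves_h_eq c H z h"
 shows "hs \<longlonglongrightarrow> h"
proof (rule ccontr)
 assume "\<not> hs \<longlonglongrightarrow> h"
 then obtain \<epsilon> where \<epsilon>: "\<epsilon> > 0" "infinite {n. \<not> dist (hs n) h < \<epsilon>}"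
  by (auto simp: tendsto_iff not_eventually INFM_iff_infinite cofinite_eq_sequentially[symmetric])
 then obtain r :: "nat => nat" where r: "strict_mono r" "\<And>n. \<not> dist (hs (r n)) h < \<epsilon>"
  using infinite_enumerate[OF \<epsilon>(2)] by auto
 have "\<exists>q h'. strict_mono (q :: nat => nat) \<and> ((\<lambda>k. hs (r k)) \<circ> q) \<longlonglongrightarrow> h' \<and> solves_h_eq c H z h'"
  by (rule approximate_solutions_subseq[where Hs="\<lambda>k. Hs (r k)" and cs="\<lambda>k. cs (r k)" and zs="\<lambda>k. zs (r k)"])
    (use Hs H weak_conv_m_subseq[OF wc r(1)] LIMSEQ_subseq_LIMSEQ[OF c(1) r(1)] c LIMSEQ_subseq_LIMSEQ[OF zs(1) r(1)]
     zs hs LIMSEQ_subseq_LIMSEQ[OF err r(1)] in \<open>simp_all add: o_def\<close>)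
 then obtain q h' where q: "(\<lambda>k. hs (r (q k))) \<longlonglongrightarrow> h'" "solves_h_eq c H z h'" by (auto simp: o_def)
 have "h' = h" by (rule solves_h_eq_unique[OF H c(2) zs(2) q(2) h])
 with q(1) \<epsilon>(1) have "\<forall>\<^sub>F k in sequentially. dist (hs (r (q k))) h < \<epsilon>" by (simp add: tendstoD)
 with r(2) show False by simp
qed

section \<open>Existence of solutions\<close>

lemma continuous_integral_hker:
 assumes H: "nonneg_distr H" and z: "0 < Im z"
 shows "continuous_on {s. Im s < 0} (\<lambda>s. LINT l|H. hker z s l)"
 unfolding continuous_on_sequentially o_def
proof (intro allI ballI impI, elim conjE)
 fix x :: "nat => complex" and a
 assume a: "a \<in> {s. Im s < 0}" and x: "\<forall>n. x n \<in> {s. Im s < 0}" "x \<longlonglongrightarrow> a"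
 let ?b = "- Im a / 2"
 have "\<forall>\<^sub>F k in sequentially. Im (x k) < - ?b"
  using order_tendstoD(2)[OF tendsto_Im[OF x(2)], of "- ?b"] a by simp
 then obtain N where N: "\<And>k. k \<ge> N ==> Im (x k) < - ?b" by (auto simp: eventually_sequentially)
 have "(\<lambda>k. LINT l|H. hker z (x (k + N)) l) \<longlonglongrightarrow> (LINT l|H. hker z a l)"
 proof (rule tendsto_integral_hker[where zs="\<lambda>_. z" and \<beta>="Im z" and b="?b" and s=a])
  show "(\<lambda>k. x (k + N)) \<longlonglongrightarrow> a" by (rule LIMSEQ_ignore_initial_segment[OF x(2)])
  show "weak_conv_m (\<lambda>_. H) H" by (rule weak_conv_const)
 qed (use H z a N x in \<open>auto intro!: less_imp_le\<close>)
 then show "(\<lambda>n. LINT l|H. hker z (x n) l) \<longlonglongrightarrow> (LINT l|H. hker z a l)" by (rule LIMSEQ_offset)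
qed

text \<open>Brouwer's theorem on the closed half disc \<open>K\<close>, which the bound l \<le>
  \<tau> makes invariant. As \<open>K\<close> reaches the real axis, where \<open>sig\<close> has
  poles and Im (\<open>sig\<close>) may vanish, the argument of the map is raised by i / (k + 1);
  compactness of approximate solutions removes the shift afterwards.\<close>

lemma solves_h_eq_exists_bounded:
 assumes H: "nonneg_distr H" "H \<noteq> return borel 0" and c: "0 < c" and z: "0 < Im z" and b: "AE l in H. l \<le> \<tau>"
 shows "\<exists>h. solves_h_eq c H z h"
proof -
 have \<tau>: "0 \<le> \<tau>"
 proof -
  have "AE l in H. 0 \<le> \<tau>" using b nonneg_distrD(5)[OF H(1)] by eventually_elim auto
  then show ?thesis using prob_space.AE_const nonneg_distrD(2)[OF H(1)] by metis
 qed
 define K where "K = cball 0 (\<tau> / Im z) \<inter> {h. 0 \<le> Im h}"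
 define e where "e k = 1 / real (Suc k)" for k
 define s where "s k h = sig (of_real c * (h + \<i> * of_real (e k)))" for k h
 define f where "f k h = (LINT l|H. hker z (s k h) l)" for k h
 have e: "0 < e k" for k by (simp add: e_def)
 have sn: "Im (s k h) < 0" if "0 \<le> Im h" for k h
  unfolding s_def using that e[of k] c by (intro Im_sig_neg) (auto intro!: mult_pos_pos add_nonneg_pos)
 interpret prob_space H using nonneg_distrD(2)[OF H(1)] .
 have f: "f k h \<in> K" if "h \<in> K" for k h
 proof -
  have "0 \<le> Im h" using that by (simp add: K_def)
  note sn = sn[OF this, of k]
  have i: "integrable H (hker z (s k h))" using hker_bound[OF _ sn z] by (auto intro!: integrable_bounded_nonneg[OF H(1)])
  have "cmod (f k h) \<le> (LINT l|H. cmod (hker z (s k h) l))" unfolding f_def by (rule integral_norm_bound)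
  also have "... \<le> (LINT l|H. \<tau> / Im z)"
  proof (rule integral_mono_AE)
   show "AE l in H. cmod (hker z (s k h) l) \<le> \<tau> / Im z"
    using nonneg_distrD(5)[OF H(1)] b
   proof eventually_elim
    case (elim l)
    have "cmod (hker z (s k h) l) = l * cmod (rker z (s k h) l)" using elim by (simp add: hker_def rker_def norm_divide)
    also have "... \<le> \<tau> * (1 / Im z)" using elim rker_bound[of l "s k h" z] sn z by (intro mult_mono) auto
    finally show ?case by simp
   qed
  qed (use i in auto)
  finally have 1: "cmod (f k h) \<le> \<tau> / Im z" by (simp add: prob_space)
  have "Im (f k h) = (LINT l|H. Im (hker z (s k h) l))" unfolding f_def using i by simp
  also have "... \<ge> 0"
  proof (rule integral_nonneg_AE)
   show "AE l in H. 0 \<le> Im (hker z (s k h) l)"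
    using nonneg_distrD(5)[OF H(1)]
   proof eventually_elim
    case (elim l)
    have "0 \<le> Im z * (l / (cmod (- z + of_real l * s k h))\<^sup>2)" using elim z by (intro mult_nonneg_nonneg) auto
    moreover have "0 \<le> - Im (s k h) * (l / cmod (- z + of_real l * s k h))\<^sup>2" using sn by (intro mult_nonneg_nonneg) auto
    ultimately show ?case unfolding Im_hker by linarith
   qed
  qed
  finally show ?thesis using 1 by (simp add: K_def)
 qed
 have "\<exists>h\<in>K. f k h = h" for k
 proof -
  have "compact K" unfolding K_def by (intro compact_Int_closed compact_cball closed_halfspace_Im_ge)
  moreover have "convex K" unfolding K_def by (intro convex_Int convex_cball convex_halfspace_Im_ge)
  moreover have "K \<noteq> {}" using \<tau> z by (auto simp: K_def set_eq_iff intro!: exI[of _ 0])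
  moreover have "continuous_on K (f k)"
   unfolding f_def
  proof (rule continuous_on_compose2[OF continuous_integral_hker[OF H(1) z]])
   have "1 + of_real c * (h + \<i> * of_real (e k)) \<noteq> 0 \<and> - 1 + of_real c * (h + \<i> * of_real (e k)) \<noteq> 0" if "h \<in> K" for h
   proof -
    have "0 < Im (of_real c * (h + \<i> * of_real (e k)))" using that e[of k] c by (simp add: K_def add_nonneg_pos)
    then show ?thesis using nonreal_not_pm1 by blast
   qed
   then show "continuous_on K (s k)"
    unfolding s_def sig_def by (intro continuous_intros) auto
   show "s k ` K \<subseteq> {s. Im s < 0}" using sn by (auto simp: K_def)
  qed
  moreover have "f k \<in> K \<rightarrow> K" using f by blast
  ultimately obtain x where "x \<in> K" "f k x = x" by (rule brouwer)
  then show ?thesis by blast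
 qed
 then obtain x where x: "\<And>k. x k \<in> K" "\<And>k. f k (x k) = x k" by metis
 define g where "g k = x k + \<i> * of_real (e k)" for k
 have "\<exists>r h. strict_mono (r :: nat => nat) \<and> (g \<circ> r) \<longlonglongrightarrow> h \<and> solves_h_eq c H z h"
 proof (rule approximate_solutions_subseq[OF H(1) H weak_conv_const tendsto_const c c tendsto_const z z])
  show "0 < Im (g k)" for k using x(1)[of k] e[of k] by (simp add: g_def K_def)
  \<comment> \<open>The raised fixed point misses the equation by exactly the shift.\<close>
  have eq: "g k - (LINT l|H. hker z (sig (of_real c * g k)) l) = \<i> * of_real (e k)" for k
   using x(2)[of k] by (simp add: f_def s_def g_def)
  have "e \<longlonglongrightarrow> 0" unfolding e_def by (rule LIMSEQ_Suc[OF lim_1_over_n])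
  then have "(\<lambda>k. \<i> * complex_of_real (e k)) \<longlonglongrightarrow> \<i> * of_real 0" by (intro tendsto_intros)
  then show "(\<lambda>k. g k - (LINT l|H. hker z (sig (of_real c * g k)) l)) \<longlonglongrightarrow> 0" by (simp add: eq)
 qed
 then show ?thesis by blast
qed

text \<open>Large values are moved to \<tau> rather than removed; capping the eigenvalues of a
  matrix does the same to their empirical measure.\<close>

definition cap_distr :: "real => real measure => real measure" where
 "cap_distr \<tau> H = distr H borel (\<lambda>l. min l \<tau>)"

lemma cap_distr_nonneg_distr:
 assumes H: "nonneg_distr H" and \<tau>: "0 \<le> \<tau>" shows "nonneg_distr (cap_distr \<tau> H)" "AE l in cap_distr \<tau> H. l \<le> \<tau>"
proof -
 interpret H: real_distribution H using nonneg_distrD(1)[OF H] .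
 have m: "(\<lambda>l. min l \<tau>) \<in> borel_measurable H" by simp
 have "real_distribution (cap_distr \<tau> H)" unfolding cap_distr_def by (rule H.real_distribution_distr[OF m])
 moreover have "AE x in cap_distr \<tau> H. 0 \<le> x"
  unfolding cap_distr_def by (subst AE_distr_iff[OF m]) (use nonneg_distrD(5)[OF H] \<tau> in auto)
 ultimately show "nonneg_distr (cap_distr \<tau> H)" by (simp add: nonneg_distr_def)
 show "AE l in cap_distr \<tau> H. l \<le> \<tau>"
  unfolding cap_distr_def by (subst AE_distr_iff[OF m]) auto
qed

lemma cap_distr_nondegenerate:
 assumes H: "nonneg_distr H" "H \<noteq> return borel 0" and \<tau>: "0 < \<tau>" shows "cap_distr \<tau> H \<noteq> return borel 0"
proof
 interpret H: real_distribution H using nonneg_distrD(1)[OF H(1)] .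
 have m: "(\<lambda>l. min l \<tau>) \<in> borel_measurable H" by simp
 assume "cap_distr \<tau> H = return borel 0"
 then have "AE x in cap_distr \<tau> H. x = 0" by (simp only:) (subst AE_return, auto)
 then have "AE x in H. min x \<tau> = 0" unfolding cap_distr_def by (subst (asm) AE_distr_iff[OF m]) auto
 then have "AE x in H. x = 0" by eventually_elim (use \<tau> in \<open>auto simp: min_def split: if_splits\<close>)
 then show False using nonneg_distr_eq_return_0[OF H(1)] H(2) by simp
qed

lemma integral_cap_distr:
 fixes f :: "real => 'b::{banach, second_countable_topology}"
 assumes "nonneg_distr H" "f \<in> borel_measurable borel"
 shows "(LINT l|cap_distr \<tau> H. f l) = (LINT l|H. f (min l \<tau>))"
 unfolding cap_distr_def
 by (rule integral_distr[OF nonneg_distr_measurable[OF assms(1)] assms(2)]) auto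

lemma cap_distr_weak_conv:
 assumes H: "nonneg_distr H"
 shows "weak_conv_m (\<lambda>k. cap_distr (real (Suc k)) H) H"
proof (rule integral_bdd_continuous_conv_imp_weak_conv)
 interpret H: real_distribution H using nonneg_distrD(1)[OF H] .
 show "real_distribution (cap_distr (real (Suc n)) H)" for n using nonneg_distrD(1)[OF cap_distr_nonneg_distr(1)[OF H]] by simp
 show "real_distribution H" by (rule nonneg_distrD(1)[OF H])
 fix f :: "real => real" assume f: "\<And>x. isCont f x" "\<And>x. \<bar>f x\<bar> \<le> 1"
 have [measurable]: "f \<in> borel_measurable borel" using f(1) by (intro borel_measurable_continuous_onI continuous_at_imp_continuous_on) auto
 have "(\<lambda>n. LINT l|H. f (min l (real (Suc n)))) \<longlonglongrightarrow> (LINT l|H. f l)"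
 proof (rule integral_dominated_convergence[where w="\<lambda>_. 1"])
  show "AE l in H. (\<lambda>n. f (min l (real (Suc n)))) \<longlonglongrightarrow> f l"
  proof (rule AE_I2)
   fix l
   obtain N where "l \<le> real N" using real_arch_simple by blast
   then have "f (min l (real (Suc n))) = f l" if "n \<ge> N" for n using that by (simp add: min_def)
   then show "(\<lambda>n. f (min l (real (Suc n)))) \<longlonglongrightarrow> f l" by (intro tendsto_eventually) (auto simp: eventually_sequentially)
  qed
 qed (use f in auto)
 then show "(\<lambda>n. LINT l|cap_distr (real (Suc n)) H. f l) \<longlonglongrightarrow> (LINT l|H. f l)"
  by (subst integral_cap_distr[OF H]) auto
qed

text \<open>The capped measures have exact solutions by the bounded case and converge weakly to H as
  the cap grows, so compactness provides a solution for H.\<close>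

theorem solves_h_eq_exists:
 assumes H: "nonneg_distr H" "H \<noteq> return borel 0" and c: "0 < c" and z: "0 < Im z"
 shows "\<exists>h. solves_h_eq c H z h"
proof -
 have "\<exists>h. solves_h_eq c (cap_distr (real (Suc k)) H) z h" for k
  using cap_distr_nonneg_distr[OF H(1), of "real (Suc k)"] cap_distr_nondegenerate[OF H, of "real (Suc k)"] c z
  by (intro solves_h_eq_exists_bounded[where \<tau>="real (Suc k)"]) simp_all
 then obtain hs where hs: "\<And>k. solves_h_eq c (cap_distr (real (Suc k)) H) z (hs k)" by metis
 have "\<exists>r h. strict_mono (r :: nat => nat) \<and> (hs \<circ> r) \<longlonglongrightarrow> h \<and> solves_h_eq c H z h"
  by (rule approximate_solutions_subseq[OF cap_distr_nonneg_distr(1)[OF H(1)] H cap_distr_weak_conv[OF H(1)] tendsto_const c c tendsto_const z z])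
    (use hs in \<open>auto simp: solves_h_eq_alt\<close>)
 then show ?thesis by blast
qed

lemma solves_h_eq_ex1:
 assumes "nonneg_distr H" "H \<noteq> return borel 0" "0 < c" "0 < Im z"
 shows "\<exists>!h. solves_h_eq c H z h"
 using solves_h_eq_exists[OF assms] solves_h_eq_unique[OF assms] by blast

lemma h_fun_solves:
 assumes "nonneg_distr H" "H \<noteq> return borel 0" "0 < c" "0 < Im z"
 shows "solves_h_eq c H z (h_fun c H z)"
 unfolding h_fun_def by (rule theI'[OF solves_h_eq_ex1[OF assms]])

section \<open>Dependence of h on z and on H\<close>

lemma h_fun_tendsto:
 assumes Hs: "\<And>k. nonneg_distr (Hs k)" "\<And>k. Hs k \<noteq> return borel 0" and H: "nonneg_distr H" "H \<noteq> return borel 0"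
  and wc: "weak_conv_m Hs H" and c: "0 < c"
  and zs: "zs \<longlonglongrightarrow> z" "0 < Im z" "\<And>k. 0 < Im (zs k)"
 shows "(\<lambda>k. h_fun c (Hs k) (zs k)) \<longlonglongrightarrow> h_fun c H z"
proof (rule approximate_solutions_tendsto[OF Hs(1) H wc tendsto_const c c zs _ _ h_fun_solves[OF H c zs(2)]])
 have "solves_h_eq c (Hs k) (zs k) (h_fun c (Hs k) (zs k))" for k by (rule h_fun_solves[OF Hs c zs(3)])
 then show "0 < Im (h_fun c (Hs k) (zs k))"
  "(\<lambda>k. h_fun c (Hs k) (zs k) - (LINT l|Hs k. hker (zs k) (sig (of_real c * h_fun c (Hs k) (zs k))) l)) \<longlonglongrightarrow> 0" for k
  by (auto simp: solves_h_eq_alt)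
qed

text \<open>By \<open>solution_diff\<close> the difference quotient equals A / (1 - B). The
  contraction bound keeps B different from 1, also in the limit w = z, and continuity of h makes A
  and B converge.\<close>

theorem h_fun_analytic:
 assumes H: "nonneg_distr H" "H \<noteq> return borel 0" and c: "0 < c"
 shows "h_fun c H analytic_on upper_half_plane"
proof -
 have op: "open upper_half_plane" by (rule open_halfspace_Im_gt)
 have "h_fun c H field_differentiable (at z)" if z: "0 < Im z" for z
 proof -
  let ?h = "h_fun c H"
  let ?s = "\<lambda>w. sig (of_real c * ?h w)"
  define A where "A w = (LINT l|H. hker2 w (?s w) z (?s z) l)" for w
  define B where "B w = of_real c * sigd (of_real c * ?h w) (of_real c * ?h z) * (LINT l|H. hker3 w (?s w) z (?s z) l)" for w
  have "((\<lambda>w. (?h w - ?h z) / (w - z)) \<longlongrightarrow> A z / (1 - B z)) (at z)"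
   unfolding tendsto_at_iff_sequentially o_def
  proof (intro allI impI)
   fix X :: "nat => complex" assume X: "\<forall>i. X i \<in> UNIV - {z}" "X \<longlonglongrightarrow> z"
   let ?b = "Im z / 2"
   have "\<forall>\<^sub>F k in sequentially. ?b < Im (X k)"
    using order_tendstoD(1)[OF tendsto_Im[OF X(2)], of ?b] z by simp
   then obtain N1 where N1: "\<And>k. k \<ge> N1 ==> ?b < Im (X k)" by (auto simp: eventually_sequentially)
   \<comment> \<open>The sequence is shifted twice: here to keep Im z bounded below, and again in
     \<open>W\<close>, once continuity of h is available, to keep Im (\<open>sig\<close>) away from
     0.\<close>
   define Y where "Y k = X (k + N1)" for k
   have Y: "Y \<longlonglongrightarrow> z" "?b < Im (Y k)" "Y k \<noteq> z" for k
    unfolding Y_def using N1[of "k + N1"] X(1) LIMSEQ_ignore_initial_segment[OF X(2), of N1] by auto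
   have Yp: "0 < Im (Y k)" for k using Y(2)[of k] z by linarith
   have hY: "(\<lambda>k. ?h (Y k)) \<longlonglongrightarrow> ?h z" by (rule h_fun_tendsto[OF H H weak_conv_const c Y(1) z Yp])
   have hp: "0 < Im (of_real c * ?h w)" if "0 < Im w" for w
    using h_fun_solves[OF H c that] c by (simp add: solves_h_eq_alt)
   note np = nonreal_not_pm1[OF hp[OF z]]
   have tY: "(\<lambda>k. of_real c * ?h (Y k)) \<longlonglongrightarrow> of_real c * ?h z" by (intro tendsto_intros hY)
   have sY: "(\<lambda>k. ?s (Y k)) \<longlonglongrightarrow> ?s z" by (rule sig_tendsto[OF tY np])
   have sz: "Im (?s z) < 0" by (rule Im_sig_neg[OF hp[OF z]])
   have sn: "Im (?s (Y k)) < 0" for k by (rule Im_sig_neg[OF hp[OF Yp]])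
   let ?d = "- Im (?s z) / 2"
   have "\<forall>\<^sub>F k in sequentially. Im (?s (Y k)) < - ?d"
    using order_tendstoD(2)[OF tendsto_Im[OF sY], of "- ?d"] sz by simp
   then obtain N where N: "\<And>k. k \<ge> N ==> Im (?s (Y k)) < - ?d" by (auto simp: eventually_sequentially)
   define W where "W k = Y (k + N)" for k
   have W: "W \<longlonglongrightarrow> z" "?b < Im (W k)" "W k \<noteq> z" "(\<lambda>k. ?s (W k)) \<longlonglongrightarrow> ?s z" "(\<lambda>k. of_real c * ?h (W k)) \<longlonglongrightarrow> of_real c * ?h z"
    "Im (?s (W k)) < - ?d" "0 < Im (W k)" "Im (?s (W k)) < 0" for k
    unfolding W_def using Y(2,3) N[of "k + N"] Yp sn LIMSEQ_ignore_initial_segment[OF Y(1), of N]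
     LIMSEQ_ignore_initial_segment[OF sY, of N] LIMSEQ_ignore_initial_segment[OF tY, of N] by auto
   have ib: "1 / (- Im (?s (W k))) \<le> 1 / ?d" for k
   proof -
    have "0 < ?d" "?d \<le> - Im (?s (W k))" using W(6)[of k] sz by linarith+
    then show ?thesis by (intro divide_left_mono mult_pos_pos) linarith+
   qed
   have dn: "- z + of_real l * ?s z \<noteq> 0" if "0 \<le> l" for l using den_nonzero[OF that less_imp_le[OF sz] z] .
   have AW: "(\<lambda>k. A (W k)) \<longlonglongrightarrow> A z"
    unfolding A_def
   proof (rule weak_conv_integral_varying[OF H(1) H(1) weak_conv_const, where B="1 / ?d * (1 / Im z)"])
    fix k and l :: real assume "0 \<le> l"
    from hker2_bound[OF this W(8) sz W(7) z]
    have "cmod (hker2 (W k) (?s (W k)) z (?s z) l) \<le> 1 / (- Im (?s (W k))) * (1 / Im z)" .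
    also have "... \<le> 1 / ?d * (1 / Im z)" using ib[of k] z by (intro mult_right_mono) auto
    finally show "cmod (hker2 (W k) (?s (W k)) z (?s z) l) \<le> 1 / ?d * (1 / Im z)" .
   next
    fix y and l :: real assume "0 \<le> l" "y \<longlonglongrightarrow> l"
    then show "(\<lambda>k. hker2 (W k) (?s (W k)) z (?s z) (y k)) \<longlonglongrightarrow> hker2 z (?s z) z (?s z) l"
     unfolding hker2_def using dn[of l] by (intro tendsto_divide tendsto_mult tendsto_of_real tendsto_den tendsto_const W) auto
   qed auto
   have BW: "(\<lambda>k. LINT l|H. hker3 (W k) (?s (W k)) z (?s z) l) \<longlonglongrightarrow> (LINT l|H. hker3 z (?s z) z (?s z) l)"
   proof (rule weak_conv_integral_varying[OF H(1) H(1) weak_conv_const, where B="1 / ?d * (1 / (- Im (?s z)))"])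
    fix k and l :: real assume "0 \<le> l"
    from hker3_bound[OF this W(8) sz W(7) z]
    have "cmod (hker3 (W k) (?s (W k)) z (?s z) l) \<le> 1 / (- Im (?s (W k))) * (1 / (- Im (?s z)))" .
    also have "... \<le> 1 / ?d * (1 / (- Im (?s z)))" using ib[of k] sz by (intro mult_right_mono) auto
    finally show "cmod (hker3 (W k) (?s (W k)) z (?s z) l) \<le> 1 / ?d * (1 / (- Im (?s z)))" .
   next
    fix y and l :: real assume "0 \<le> l" "y \<longlonglongrightarrow> l"
    then show "(\<lambda>k. hker3 (W k) (?s (W k)) z (?s z) (y k)) \<longlonglongrightarrow> hker3 z (?s z) z (?s z) l"
     unfolding hker3_def hker_def using dn[of l] by (intro tendsto_divide tendsto_mult tendsto_of_real tendsto_den tendsto_const W) auto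
   qed auto
   have BW: "(\<lambda>k. B (W k)) \<longlonglongrightarrow> B z"
    unfolding B_def sigd_def using np by (intro tendsto_intros BW W) auto
   note sol = h_fun_solves[OF H c]
   have Bn: "B w \<noteq> 1" if "0 < Im w" for w
    using solutions_contraction[OF H c that z sol[OF that] sol[OF z]] by (auto simp: B_def)
   have "(\<lambda>k. A (W k) / (1 - B (W k))) \<longlonglongrightarrow> A z / (1 - B z)"
    using Bn[OF z] by (intro tendsto_intros AW BW) auto
   moreover have "A (W k) / (1 - B (W k)) = (?h (W k) - ?h z) / (W k - z)" for k
   proof -
    have "(?h (W k) - ?h z) * (1 - B (W k)) = (W k - z) * A (W k)"
     unfolding A_def B_def by (rule solution_diff[OF H(1) c W(7) z sol[OF W(7)] sol[OF z]])
    moreover have "1 - B (W k) \<noteq> 0" using Bn[OF W(7)[of k]] by auto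
    ultimately show ?thesis using W(3)[of k] by (simp add: field_simps)
   qed
   ultimately have "(\<lambda>k. (?h (X (k + (N + N1))) - ?h z) / (X (k + (N + N1)) - z)) \<longlonglongrightarrow> A z / (1 - B z)"
    by (simp add: W_def Y_def add.assoc)
   then show "(\<lambda>k. (?h (X k) - ?h z) / (X k - z)) \<longlonglongrightarrow> A z / (1 - B z)"
    by (rule LIMSEQ_offset)
  qed
  then show ?thesis by (auto simp: field_differentiable_def has_field_derivative_iff)
 qed
 then have "h_fun c H holomorphic_on upper_half_plane"
  by (auto simp: holomorphic_on_def intro: field_differentiable_at_within)
 then show ?thesis using analytic_on_open[OF op] by blast
qed

text \<open>At a continuity point x the values \<open>cdf (Gs k) x\<close> are squeezed between
  \<open>cdf G\<close> at x - d and at x + d, where d tends to 0.\<close>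

lemma levy_dist_weak_conv:
 assumes G: "nonneg_distr G" and Gs: "\<And>k. nonneg_distr (Gs k)" and lim: "\<And>k. levy_dist (cdf G) (cdf (Gs k)) < e k" "e \<longlonglongrightarrow> 0"
 shows "weak_conv_m Gs G"
 unfolding weak_conv_m_def weak_conv_def
proof (intro allI impI)
 interpret G: real_distribution G using nonneg_distrD(1)[OF G] .
 fix x assume x: "isCont (cdf G) x"
 have ex: "\<exists>d>0. d < e k \<and> (\<forall>x. cdf G (x - d) - d \<le> cdf (Gs k) x \<and> cdf (Gs k) x \<le> cdf G (x + d) + d)" for k
 proof -
  interpret Gk: real_distribution "Gs k" using nonneg_distrD(1)[OF Gs] .
  let ?S = "{e. 0 < e \<and> (\<forall>x. cdf G (x - e) - e \<le> cdf (Gs k) x \<and> cdf (Gs k) x \<le> cdf G (x + e) + e)}"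
  have "cdf G y - 1 \<le> cdf (Gs k) y'" "cdf (Gs k) y' \<le> cdf G y + 1" for y y'
   using G.cdf_nonneg[of y] G.cdf_bounded_prob[of y] Gk.cdf_nonneg[of y'] Gk.cdf_bounded_prob[of y'] by auto
  \<comment> \<open>For distribution functions 1 is always admissible. The infimum is thus over a
    nonempty set, and some admissible number lies below any strict upper bound of it.\<close>
  then have "1 \<in> ?S" by auto
  then have "?S \<noteq> {}" by blast
  moreover have "Inf ?S < e k" using lim(1)[of k] by (simp add: levy_dist_def)
  ultimately show ?thesis using cInf_lessD[of ?S "e k"] by auto
 qed
 then obtain d where d: "\<And>k. 0 < d k" "\<And>k. d k < e k"
  "\<And>k x. cdf G (x - d k) - d k \<le> cdf (Gs k) x" "\<And>k x. cdf (Gs k) x \<le> cdf G (x + d k) + d k" by metis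
 have d0: "d \<longlonglongrightarrow> 0"
  by (rule tendsto_sandwich[OF _ _ tendsto_const lim(2)]) (auto intro!: always_eventually less_imp_le d)
 have "(\<lambda>k. x - d k) \<longlonglongrightarrow> x - 0" "(\<lambda>k. x + d k) \<longlonglongrightarrow> x + 0" by (intro tendsto_intros d0)+
 then have "(\<lambda>k. cdf G (x - d k)) \<longlonglongrightarrow> cdf G x" "(\<lambda>k. cdf G (x + d k)) \<longlonglongrightarrow> cdf G x"
  using isCont_tendsto_compose[OF x] by simp_all
 from tendsto_diff[OF this(1) d0] tendsto_add[OF this(2) d0]
 have "(\<lambda>k. cdf G (x - d k) - d k) \<longlonglongrightarrow> cdf G x" "(\<lambda>k. cdf G (x + d k) + d k) \<longlonglongrightarrow> cdf G x" by simp_all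
 then show "(\<lambda>k. cdf (Gs k) x) \<longlonglongrightarrow> cdf G x"
  by (rule tendsto_sandwich[rotated 2]) (auto intro!: always_eventually d)
qed

text \<open>A failure would produce measures at distance below 1 / (k + 1) whose values of h stay
  \<epsilon> away, against sequential continuity under weak convergence.\<close>

theorem h_fun_levy_continuous:
 assumes G: "nonneg_distr G" "G \<noteq> return borel 0" and c: "0 < c" and z: "0 < Im z" and \<epsilon>: "0 < \<epsilon>"
 shows "\<exists>\<delta>>0. \<forall>G'. nonneg_distr G' \<and> G' \<noteq> return borel 0 \<and> levy_dist (cdf G) (cdf G') < \<delta> \<longrightarrow>
      cmod (h_fun c G z - h_fun c G' z) < \<epsilon>"
proof (rule ccontr)
 assume neg: "\<not> ?thesis"
 have "\<exists>G'. nonneg_distr G' \<and> G' \<noteq> return borel 0 \<and> levy_dist (cdf G) (cdf G') < 1 / real (Suc k) \<and>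
  \<not> cmod (h_fun c G z - h_fun c G' z) < \<epsilon>" for k
  using neg by (metis of_nat_0_less_iff zero_less_Suc zero_less_divide_1_iff)
 then obtain Gs where Gs: "\<And>k. nonneg_distr (Gs k)" "\<And>k. Gs k \<noteq> return borel 0"
  "\<And>k. levy_dist (cdf G) (cdf (Gs k)) < 1 / real (Suc k)" "\<And>k. \<not> cmod (h_fun c G z - h_fun c (Gs k) z) < \<epsilon>" by metis
 have wc: "weak_conv_m Gs G"
  by (rule levy_dist_weak_conv[OF G(1) Gs(1,3)]) (rule LIMSEQ_Suc[OF lim_1_over_n])
 have "(\<lambda>k. h_fun c (Gs k) z) \<longlonglongrightarrow> h_fun c G z"
  by (rule h_fun_tendsto[OF Gs(1,2) G wc c tendsto_const z z])
 then have "\<forall>\<^sub>F k in sequentially. dist (h_fun c (Gs k) z) (h_fun c G z) < \<epsilon>" using \<epsilon> by (rule tendstoD)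
 then show False using Gs(4) by (simp add: dist_norm norm_minus_commute)
qed

section \<open>Stieltjes transforms and weak convergence\<close>

context real_distribution
begin

lemma prob_UNIV: "prob UNIV = 1"
 using prob_space by simp

lemma stieltjes_kernel_bound: "0 < Im z ==> cmod (1 / (of_real t - z)) \<le> 1 / Im z"
proof -
 assume z: "0 < Im z"
 have "\<bar>Im (of_real t - z)\<bar> \<le> cmod (of_real t - z)" by (rule abs_Im_le_cmod)
 then have "Im z \<le> cmod (of_real t - z)" using z by simp
 then show ?thesis using z by (simp add: norm_divide frac_le)
qed

lemma integrable_stieltjes_kernel: "0 < Im z ==> integrable M (\<lambda>t. 1 / (complex_of_real t - z))"
 by (rule integrable_const_bound[of _ "1 / Im z"]) (use stieltjes_kernel_bound in auto)

lemma Im_stieltjes: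
 assumes "0 < y"
 shows "Im (stieltjes M (Complex x y)) = (LINT t|M. y / ((x - t)\<^sup>2 + y\<^sup>2))"
proof -
 have "Im (stieltjes M (Complex x y)) = (LINT t|M. Im (1 / (complex_of_real t - Complex x y)))"
  unfolding stieltjes_def using integrable_stieltjes_kernel[of "Complex x y"] assms by simp
 also have "... = (LINT t|M. y / ((x - t)\<^sup>2 + y\<^sup>2))"
 proof (rule Bochner_Integration.integral_cong[OF refl])
  fix t
  show "Im (1 / (complex_of_real t - Complex x y)) = y / ((x - t)\<^sup>2 + y\<^sup>2)"
   by (subst Im_inverse_complex) (simp add: cmod_power2 power2_commute)
 qed
 finally show ?thesis .
qed

lemma stieltjes_Lipschitz:
 assumes "0 < Im z" "0 < Im w"
 shows "cmod (stieltjes M z - stieltjes M w) \<le> cmod (z - w) / (Im z * Im w)"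
proof -
 note i = integrable_stieltjes_kernel[OF assms(1)] integrable_stieltjes_kernel[OF assms(2)]
 have eq: "1 / (complex_of_real t - z) - 1 / (of_real t - w) = (z - w) * ((1 / (of_real t - z)) * (1 / (of_real t - w)))" for t
 proof -
  have "complex_of_real t - z \<noteq> 0" "complex_of_real t - w \<noteq> 0" using assms by (auto simp: complex_eq_iff)
  then show ?thesis by (simp add: divide_simps)
 qed
 have "stieltjes M z - stieltjes M w = (LINT t|M. 1 / (complex_of_real t - z) - 1 / (of_real t - w))"
  unfolding stieltjes_def using i by simp
 also have "cmod ... \<le> (LINT t|M. cmod (1 / (complex_of_real t - z) - 1 / (of_real t - w)))"
  by (rule integral_norm_bound)
 also have "... \<le> (LINT t|M. cmod (z - w) / (Im z * Im w))"
 proof (rule integral_mono)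
  fix t
  have "cmod (1 / (of_real t - z)) * cmod (1 / (of_real t - w)) \<le> 1 / Im z * (1 / Im w)"
   using stieltjes_kernel_bound assms by (intro mult_mono) auto
  then have "cmod (z - w) * (cmod (1 / (of_real t - z)) * cmod (1 / (of_real t - w))) \<le> cmod (z - w) * (1 / Im z * (1 / Im w))"
   by (rule mult_left_mono) simp
  then show "cmod (1 / (complex_of_real t - z) - 1 / (of_real t - w)) \<le> cmod (z - w) / (Im z * Im w)"
   unfolding eq norm_mult by simp
 qed (use i in \<open>auto intro!: integrable_norm Bochner_Integration.integrable_diff\<close>)
 finally show ?thesis by (simp add: prob_UNIV)
qed

text \<open>The antiderivative in x of the imaginary part of the Stieltjes transform at height y, up
  to a constant: the convolution of the measure with arctan(x / y). It replaces the integral of the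
  inversion formula by a bounded kernel with an elementary limit as y tends to 0.\<close>

definition arctan_transform :: "real => real => real" where
 "arctan_transform y x = (LINT t|M. arctan ((x - t) / y))"

lemma arctan_abs_le: "\<bar>arctan x\<bar> \<le> pi / 2"
 using arctan_bounded[of x] by linarith

lemma arctan_transform_deriv:
 assumes y: "0 < y"
 shows "(arctan_transform y has_real_derivative Im (stieltjes M (Complex x y))) (at x)"
 unfolding has_field_derivative_iff tendsto_at_iff_sequentially o_def
proof (intro allI impI)
 fix X assume X: "\<forall>i::nat. X i \<in> UNIV - {x}" "X \<longlonglongrightarrow> x"
 let ?q = "\<lambda>i t. (arctan ((X i - t) / y) - arctan ((x - t) / y)) / (X i - x)"
 have i: "integrable M (\<lambda>t. arctan ((x - t) / y))" for x
  by (rule integrable_const_bound[of _ "pi / 2"]) (use arctan_abs_le in auto)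
 have lip: "\<bar>arctan b - arctan a\<bar> \<le> \<bar>b - a\<bar>" for a b :: real
 proof -
  have "norm (arctan b - arctan a) \<le> 1 * norm (b - a)"
   by (rule field_differentiable_bound[of UNIV arctan "\<lambda>x. inverse (1 + x\<^sup>2)"])
     (auto intro!: DERIV_arctan simp: add_pos_nonneg inverse_le_1_iff)
  then show ?thesis by simp
 qed
 have "(\<lambda>i. LINT t|M. ?q i t) \<longlonglongrightarrow> (LINT t|M. y / ((x - t)\<^sup>2 + y\<^sup>2))"
 proof (rule integral_dominated_convergence[where w="\<lambda>_. 1 / y"])
  show "AE t in M. (\<lambda>i. ?q i t) \<longlonglongrightarrow> y / ((x - t)\<^sup>2 + y\<^sup>2)"
  proof (rule AE_I2)
   fix t
   have "((\<lambda>x. arctan ((x - t) / y)) has_real_derivative inverse (1 + ((x - t) / y)\<^sup>2) * (1 / y)) (at x)"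
    by (rule derivative_eq_intros | use y in simp)+
   also have "inverse (1 + ((x - t) / y)\<^sup>2) * (1 / y) = y / ((x - t)\<^sup>2 + y\<^sup>2)"
   proof -
    have "1 + ((x - t) / y)\<^sup>2 = ((x - t)\<^sup>2 + y\<^sup>2) / y\<^sup>2" using y by (simp add: field_simps)
    then show ?thesis using y by (simp add: power2_eq_square)
   qed
   finally have "((\<lambda>w. (arctan ((w - t) / y) - arctan ((x - t) / y)) / (w - x)) \<longlongrightarrow> y / ((x - t)\<^sup>2 + y\<^sup>2)) (at x)"
    by (simp only: has_field_derivative_iff)
   then show "(\<lambda>i. ?q i t) \<longlonglongrightarrow> y / ((x - t)\<^sup>2 + y\<^sup>2)"
    using X unfolding tendsto_at_iff_sequentially o_def by blast
  qed
  show "AE t in M. norm (?q i t) \<le> 1 / y" for i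
  proof (rule AE_I2)
   fix t
   have ne: "X i - x \<noteq> 0" using X(1) by auto
   have "\<bar>arctan ((X i - t) / y) - arctan ((x - t) / y)\<bar> \<le> \<bar>(X i - t) / y - (x - t) / y\<bar>" by (rule lip)
   also have "... = \<bar>X i - x\<bar> / y" using y by (simp add: diff_divide_distrib[symmetric])
   finally show "norm (?q i t) \<le> 1 / y" using ne y by (simp add: field_simps)
  qed
 qed auto
 moreover have "(LINT t|M. ?q i t) = (arctan_transform y (X i) - arctan_transform y x) / (X i - x)" for i
  unfolding arctan_transform_def using i by simp
 ultimately show "(\<lambda>i. (arctan_transform y (X i) - arctan_transform y x) / (X i - x)) \<longlonglongrightarrow> Im (stieltjes M (Complex x y))"
  unfolding Im_stieltjes[OF y] by (simp only:)
qed

text \<open>The limit is the same for all probability measures, which fixes the constant of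
  integration.\<close>

lemma arctan_transform_at_bot:
 assumes y: "0 < y"
 shows "(\<lambda>k. arctan_transform y (- real k)) \<longlonglongrightarrow> - (pi / 2)"
proof -
 have "(\<lambda>k. LINT t|M. arctan ((- real k - t) / y)) \<longlonglongrightarrow> (LINT t|M. - (pi / 2))"
 proof (rule integral_dominated_convergence[where w="\<lambda>_. pi / 2"])
  show "AE t in M. (\<lambda>k. arctan ((- real k - t) / y)) \<longlonglongrightarrow> - (pi / 2)"
  proof (rule AE_I2)
   fix t
   have "filterlim (\<lambda>k. (- real k - t) / y) at_bot sequentially" using y by real_asymp
   then show "(\<lambda>k. arctan ((- real k - t) / y)) \<longlonglongrightarrow> - (pi / 2)"
    by (rule filterlim_compose[OF tendsto_arctan_at_bot])
  qed
 qed (use arctan_abs_le in auto)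
 then show ?thesis by (simp add: arctan_transform_def prob_UNIV)
qed

text \<open>As the height tends to 0 the kernel tends to pi / 2 times the sign of x - t. Its value 0
  at t = x lets half of an atom at x count, so the left limit and the value of the distribution
  function appear together.\<close>

lemma arctan_transform_small:
 "(\<lambda>k. arctan_transform (1 / real (Suc k)) x) \<longlonglongrightarrow> pi / 2 * (measure M {..<x} + cdf M x - 1)"
proof -
 let ?g = "\<lambda>t. pi / 2 * (indicator {..<x} t + indicator {..x} t - 1)"
 have "(\<lambda>k. LINT t|M. arctan ((x - t) / (1 / real (Suc k)))) \<longlonglongrightarrow> (LINT t|M. ?g t)"
 proof (rule integral_dominated_convergence[where w="\<lambda>_. pi / 2"])
  show "AE t in M. (\<lambda>k. arctan ((x - t) / (1 / real (Suc k)))) \<longlonglongrightarrow> ?g t"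
  proof (rule AE_I2)
   fix t
   consider "t < x" | "t = x" | "x < t" by linarith
   then show "(\<lambda>k. arctan ((x - t) / (1 / real (Suc k)))) \<longlonglongrightarrow> ?g t"
   proof cases
    case 1
    then have "0 < x - t" by simp
    then have "filterlim (\<lambda>k. (x - t) / (1 / real (Suc k))) at_top sequentially" by real_asymp
    then show ?thesis using filterlim_compose[OF tendsto_arctan_at_top] 1 by fastforce
   next
    case 3
    then have "x - t < 0" by simp
    then have "filterlim (\<lambda>k. (x - t) / (1 / real (Suc k))) at_bot sequentially" by real_asymp
    then show ?thesis using filterlim_compose[OF tendsto_arctan_at_bot] 3 by fastforce
   qed simp
  qed
 qed (use arctan_abs_le in auto)
 also have "(LINT t|M. ?g t) = pi / 2 * (measure M {..<x} + cdf M x - 1)"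
 proof -
  have i: "integrable M (indicator {..<x} :: real => real)" "integrable M (indicator {..x} :: real => real)"
   by (auto intro!: integrable_const_bound[of _ 1] simp: indicator_def)
  have "(LINT t|M. ?g t) = pi / 2 * (LINT t|M. indicator {..<x} t + indicator {..x} t - 1)" by simp
  also have "(LINT t|M. indicator {..<x} t + indicator {..x} t - (1::real)) = measure M {..<x} + cdf M x - 1"
   using i by (subst Bochner_Integration.integral_diff, simp_all add: cdf_def prob_UNIV)
  finally show ?thesis .
 qed
 finally show ?thesis by (simp add: arctan_transform_def)
qed

end

text \<open>Equal transforms give equal derivatives of the arctan transforms, and the limit at minus
  infinity makes these functions themselves equal. Letting y tend to 0 determines, at every point,
  the sum of the left limit and the value of the distribution function.\<close>

theorem stieltjes_unique:
 assumes \<mu>: "real_distribution \<mu>" and \<nu>: "real_distribution \<nu>"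
  and eq: "\<And>z. 0 < Im z ==> stieltjes \<mu> z = stieltjes \<nu> z"
 shows "\<mu> = \<nu>"
proof (rule cdf_unique[OF \<mu> \<nu>], rule ext)
 interpret \<mu>: real_distribution \<mu> by fact
 interpret \<nu>: real_distribution \<nu> by fact
 have eqA: "\<mu>.arctan_transform y x = \<nu>.arctan_transform y x" if y: "0 < y" for x y
 proof -
  have "((\<lambda>x. \<mu>.arctan_transform y x - \<nu>.arctan_transform y x) has_real_derivative 0) (at x)" for x
   using DERIV_diff[OF \<mu>.arctan_transform_deriv[OF y, of x] \<nu>.arctan_transform_deriv[OF y, of x]] eq[of "Complex x y"] y by simp
  then have const: "\<mu>.arctan_transform y x - \<nu>.arctan_transform y x = \<mu>.arctan_transform y 0 - \<nu>.arctan_transform y 0" for x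
   using DERIV_isconst_all by blast
  have "(\<lambda>k. \<mu>.arctan_transform y (- real k) - \<nu>.arctan_transform y (- real k)) \<longlonglongrightarrow> - (pi / 2) - - (pi / 2)"
   by (intro tendsto_diff \<mu>.arctan_transform_at_bot \<nu>.arctan_transform_at_bot y)
  then have "(\<lambda>k::nat. \<mu>.arctan_transform y 0 - \<nu>.arctan_transform y 0) \<longlonglongrightarrow> - (pi / 2) - - (pi / 2)"
  proof -
   have "(\<lambda>k. \<mu>.arctan_transform y (- real k) - \<nu>.arctan_transform y (- real k)) = (\<lambda>k. \<mu>.arctan_transform y 0 - \<nu>.arctan_transform y 0)"
    by (rule ext) (rule const)
   then show ?thesis using \<open>(\<lambda>k. \<mu>.arctan_transform y (- real k) - \<nu>.arctan_transform y (- real k)) \<longlonglongrightarrow> - (pi / 2) - - (pi / 2)\<close> by simp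
  qed
  then have "\<mu>.arctan_transform y 0 - \<nu>.arctan_transform y 0 = 0" unfolding LIMSEQ_const_iff by simp
  then show ?thesis using const[of x] by linarith
 qed
 have eqM: "measure \<mu> {..<x} + cdf \<mu> x = measure \<nu> {..<x} + cdf \<nu> x" for x
 proof -
  have "(\<lambda>k. \<mu>.arctan_transform (1 / real (Suc k)) x) = (\<lambda>k. \<nu>.arctan_transform (1 / real (Suc k)) x)"
   by (rule ext, rule eqA) simp
  from LIMSEQ_unique[OF \<mu>.arctan_transform_small[of x, unfolded this] \<nu>.arctan_transform_small[of x]]
  show ?thesis by simp
 qed
 \<comment> \<open>For u > x that sum at u is at least twice \<open>cdf \<mu> x\<close> and at most
   twice \<open>cdf \<nu> u\<close>. Right continuity then lets u decrease to x.\<close>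
 have le: "cdf \<mu> x \<le> cdf \<nu> x" if \<mu>: "real_distribution \<mu>" and \<nu>: "real_distribution \<nu>"
  and eqM: "\<And>x. measure \<mu> {..<x} + cdf \<mu> x = measure \<nu> {..<x} + cdf \<nu> x" for \<mu> \<nu> x
 proof -
  interpret m1: real_distribution \<mu> by fact
  interpret m2: real_distribution \<nu> by fact
  have "cdf \<mu> x \<le> cdf \<nu> u" if "x < u" for u
  proof -
   have "cdf \<mu> x \<le> measure \<mu> {..<u}" unfolding cdf_def using that by (intro m1.finite_measure_mono) auto
   moreover have "cdf \<mu> x \<le> cdf \<mu> u" using that by (intro m1.cdf_nondecreasing) simp
   moreover have "measure \<nu> {..<u} \<le> cdf \<nu> u" unfolding cdf_def by (intro m2.finite_measure_mono) auto
   ultimately show ?thesis using eqM[of u] by linarith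
  qed
  then have "\<forall>\<^sub>F u in at_right x. cdf \<mu> x \<le> cdf \<nu> u"
   by (intro eventually_at_rightI[of x "x + 1"]) auto
  moreover have "(cdf \<nu> \<longlongrightarrow> cdf \<nu> x) (at_right x)"
   using m2.cdf_is_right_cont[of x] by (simp add: continuous_within)
  ultimately show ?thesis using tendsto_lowerbound trivial_limit_at_right_real by blast
 qed
 show "cdf \<mu> x = cdf \<nu> x" for x
  using le[OF \<mu> \<nu> eqM] le[OF \<nu> \<mu> eqM[symmetric]] by (rule antisym)
qed

lemma stieltjes_tendsto_weak_conv:
 assumes "\<And>n. real_distribution (\<mu> n)" "real_distribution F" "weak_conv_m \<mu> F" "0 < Im z"
 shows "(\<lambda>n. stieltjes (\<mu> n) z) \<longlonglongrightarrow> stieltjes F z"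
 unfolding stieltjes_def
proof (rule weak_conv_imp_integral_bdd_continuous_conv[OF assms(1-3)])
 have "complex_of_real x - z \<noteq> 0" for x using assms(4) by (auto simp: complex_eq_iff)
 then show "isCont (\<lambda>t. 1 / (complex_of_real t - z)) x" for x by (intro continuous_intros) auto
 show "norm (1 / (complex_of_real x - z)) \<le> 1 / Im z" for x
  by (rule real_distribution.stieltjes_kernel_bound[OF assms(2,4)])
qed

section \<open>The continuity theorem for Stieltjes transforms\<close>

context real_distribution
begin

lemma measure_symmetric_interval_tendsto: "(\<lambda>k. measure M {- real k<..real k}) \<longlonglongrightarrow> 1"
proof -
 have "(\<lambda>k. cdf M (real k) - cdf M (- real k)) \<longlonglongrightarrow> 1 - 0"
  by (intro tendsto_diff filterlim_compose[OF cdf_lim_at_top_prob filterlim_real_sequentially]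
   filterlim_compose[OF cdf_lim_at_bot] filterlim_compose[OF filterlim_uminus_at_bot_at_top filterlim_real_sequentially])
 then have lim: "(\<lambda>k. cdf M (real k) - cdf M (- real k)) \<longlonglongrightarrow> 1" by simp
 have "\<forall>\<^sub>F k in sequentially. cdf M (real k) - cdf M (- real k) = measure M {- real k<..real k}"
  using eventually_gt_at_top[of 0] by eventually_elim (intro cdf_diff_eq, simp)
 then show ?thesis by (rule Lim_transform_eventually[OF lim])
qed

text \<open>Outside the interval the integrand y^2 / (t^2 + y^2) of y Im s(iy) is at most 1 / 2, so
  its defect from 1 is at least half of the indicator of the tail.\<close>

lemma stieltjes_tail_bound:
 assumes "0 < y"
 shows "1 - measure M {- y<..y} \<le> 2 * (1 - y * Im (stieltjes M (Complex 0 y)))"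
proof -
 have i: "integrable M (\<lambda>t. y * (y / ((0 - t)\<^sup>2 + y\<^sup>2)))"
 proof (rule integrable_const_bound[of _ 1])
  show "AE t in M. norm (y * (y / ((0 - t)\<^sup>2 + y\<^sup>2))) \<le> 1"
   using assms by (auto simp: power2_eq_square[symmetric] divide_le_eq_1 add_nonneg_pos)
 qed auto
 have ind: "integrable M (indicator {- y<..y} :: real => real)"
  by (auto intro!: integrable_const_bound[of _ 1] simp: indicator_def)
 then have "1 - measure M {- y<..y} = (LINT t|M. 1 - indicator {- y<..y} t)"
  by (subst Bochner_Integration.integral_diff) (simp_all add: prob_UNIV)
 also have "... \<le> (LINT t|M. 2 * (1 - y * (y / ((0 - t)\<^sup>2 + y\<^sup>2))))"
 proof (rule integral_mono)
  show "integrable M (\<lambda>t. 2 * (1 - y * (y / ((0 - t)\<^sup>2 + y\<^sup>2))))"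
   by (intro integrable_mult_right Bochner_Integration.integrable_diff i) simp
  fix t
  have e: "y * (y / ((0 - t)\<^sup>2 + y\<^sup>2)) = y\<^sup>2 / (t\<^sup>2 + y\<^sup>2)" by (simp add: power2_eq_square)
  show "1 - indicator {- y<..y} t \<le> 2 * (1 - y * (y / ((0 - t)\<^sup>2 + y\<^sup>2)))"
  proof (cases "t \<in> {- y<..y}")
   case True
   have "y\<^sup>2 / (t\<^sup>2 + y\<^sup>2) \<le> 1" using assms by (simp add: divide_le_eq_1 add_nonneg_pos)
   then show ?thesis unfolding e using True by simp
  next
   case False
   then have "y \<le> \<bar>t\<bar>" by auto
   then have "y\<^sup>2 \<le> t\<^sup>2" using assms by (simp add: abs_le_square_iff[symmetric])
   then have "y\<^sup>2 / (t\<^sup>2 + y\<^sup>2) \<le> 1 / 2" using assms by (simp add: field_simps add_nonneg_pos)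
   moreover have "indicator {- y<..y} t = (0::real)" using False by simp
   moreover have "1 - i \<le> 2 * (1 - q)" if "q \<le> 1 / 2" "i = 0" for i q :: real using that by simp
   ultimately show ?thesis unfolding e by blast
  qed
 qed (use ind in auto)
 also have "... = 2 * (1 - y * Im (stieltjes M (Complex 0 y)))"
 proof -
  have "(LINT t|M. 2 * (1 - f t)) = 2 * (1 - (LINT t|M. f t))" if "integrable M f" for f :: "real => real"
   using that by (simp add: prob_UNIV)
  from this[OF i]
  show ?thesis unfolding Im_stieltjes[OF assms] by (simp only: integral_mult_right_zero)
 qed
 finally show ?thesis .
qed

end

text \<open>The hypothesis \<open>mass\<close> says that no mass is lost in the limit: through the
  tail bound it yields tightness. Uniqueness of transforms then identifies all subsequential weak
  limits.\<close>

theorem stieltjes_continuity: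
 fixes \<mu> :: "nat => real measure" and s :: "complex => complex"
 assumes \<mu>: "\<And>n. real_distribution (\<mu> n)"
  and conv: "\<And>z. 0 < Im z ==> (\<lambda>n. stieltjes (\<mu> n) z) \<longlonglongrightarrow> s z"
  and mass: "(\<lambda>k. real k * Im (s (Complex 0 (real k)))) \<longlonglongrightarrow> 1"
 shows "\<exists>F. real_distribution F \<and> (\<forall>z. 0 < Im z \<longrightarrow> stieltjes F z = s z) \<and> weak_conv_m \<mu> F"
proof -
 have tight: "tight \<mu>"
  unfolding tight_def
 proof (intro conjI allI impI \<mu>)
  fix \<epsilon> :: real assume \<epsilon>: "0 < \<epsilon>"
  have "\<forall>\<^sub>F k in sequentially. 1 - \<epsilon> / 2 < real k * Im (s (Complex 0 (real k))) \<and> 0 < k"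
   using \<epsilon> by (intro eventually_conj order_tendstoD(1)[OF mass] eventually_gt_at_top) auto
  then obtain k where k: "1 - \<epsilon> / 2 < real k * Im (s (Complex 0 (real k)))" "0 < k"
   using eventually_happens' sequentially_bot by blast
  have "(\<lambda>n. real k * Im (stieltjes (\<mu> n) (Complex 0 (real k)))) \<longlonglongrightarrow> real k * Im (s (Complex 0 (real k)))"
   using k(2) by (intro tendsto_intros conv) simp
  then have "\<forall>\<^sub>F n in sequentially. 1 - \<epsilon> / 2 < real k * Im (stieltjes (\<mu> n) (Complex 0 (real k)))"
   using k(1) by (rule order_tendstoD(1))
  then obtain N where N: "\<And>n. n \<ge> N ==> 1 - \<epsilon> / 2 < real k * Im (stieltjes (\<mu> n) (Complex 0 (real k)))"
   by (auto simp: eventually_sequentially)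
  have mono: "measure (\<mu> n) {- real i<..real i} \<le> measure (\<mu> n) {- real j<..real j}" if "i \<le> j" for n i j
  proof -
   interpret real_distribution "\<mu> n" by (rule \<mu>)
   show ?thesis using that by (intro finite_measure_mono) auto
  qed
  have "\<exists>j. 1 - \<epsilon> < measure (\<mu> n) {- real j<..real j}" for n
   using order_tendstoD(1)[OF real_distribution.measure_symmetric_interval_tendsto[OF \<mu>], of "1 - \<epsilon>"] \<epsilon>
    eventually_happens' sequentially_bot by fastforce
  then obtain j where j: "\<And>n. 1 - \<epsilon> < measure (\<mu> n) {- real (j n)<..real (j n)}" by metis
  \<comment> \<open>One interval for all n: k controls the tails for n \<ge> N, and each of the
    finitely many earlier measures has its own \<open>j n\<close>.\<close>
  define K where "K = Max (insert (Suc k) (j ` {..<N}))"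
  have K: "Suc k \<le> K" "n < N ==> j n \<le> K" for n by (auto simp: K_def)
  have "1 - \<epsilon> < measure (\<mu> n) {- real K<..real K}" for n
  proof (cases "n < N")
   case True
   then show ?thesis using j[of n] mono[OF K(2), of n n] by simp
  next
   case False
   have "1 - measure (\<mu> n) {- real k<..real k} < \<epsilon>"
    using real_distribution.stieltjes_tail_bound[OF \<mu>, of "real k" n] k(2) N[of n] False by simp
   then show ?thesis using mono[of k K n] K(1) by simp
  qed
  moreover have "- real K < real K" using K(1) by simp
  ultimately show "\<exists>a b. a < b \<and> (\<forall>n. 1 - \<epsilon> < measure (\<mu> n) {a<..b})" by blast
 qed
 from tight_imp_convergent_subsubsequence[OF tight strict_mono_id]
 obtain r F where F: "strict_mono (r :: nat => nat)" "real_distribution F" "weak_conv_m (\<mu> \<circ> r) F" by auto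
 have st: "stieltjes \<nu> z = s z"
  if "strict_mono (q :: nat => nat)" "real_distribution \<nu>" "weak_conv_m (\<mu> \<circ> q) \<nu>" "0 < Im z" for q \<nu> z
 proof (rule LIMSEQ_unique)
  show "(\<lambda>n. stieltjes ((\<mu> \<circ> q) n) z) \<longlonglongrightarrow> stieltjes \<nu> z"
   by (rule stieltjes_tendsto_weak_conv[OF _ that(2,3,4)]) (simp add: \<mu>)
  show "(\<lambda>n. stieltjes ((\<mu> \<circ> q) n) z) \<longlonglongrightarrow> s z"
   using LIMSEQ_subseq_LIMSEQ[OF conv[OF that(4)] that(1)] by (simp add: o_def)
 qed
 have "weak_conv_m \<mu> F"
 proof (rule tight_subseq_weak_converge[OF \<mu> F(2) tight])
  fix q \<nu> assume q: "strict_mono (q :: nat => nat)" "real_distribution \<nu>" "weak_conv_m (\<mu> \<circ> q) \<nu>"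
  have "\<nu> = F" by (rule stieltjes_unique[OF q(2) F(2)]) (simp add: st[OF q] st[OF F])
  with q(3) show "weak_conv_m (\<mu> \<circ> q) F" by simp
 qed
 with F(2) st[OF F] show ?thesis by blast
qed

text \<open>Almost sure statements are available for countably many z only. All Stieltjes transforms
  share one Lipschitz bound away from the real axis, and this extends convergence from rational
  points to all others.\<close>

lemma stieltjes_conv_dense:
 fixes \<mu> :: "nat => real measure" and s :: "complex => complex"
 assumes \<mu>: "\<And>n. real_distribution (\<mu> n)" and s: "continuous_on upper_half_plane s"
  and conv: "\<And>a b. a \<in> \<rat> ==> b \<in> \<rat> ==> 0 < b ==> (\<lambda>n. stieltjes (\<mu> n) (Complex a b)) \<longlonglongrightarrow> s (Complex a b)"
  and z: "0 < Im z"
 shows "(\<lambda>n. stieltjes (\<mu> n) z) \<longlonglongrightarrow> s z"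
proof (rule tendstoI)
 fix \<epsilon> :: real assume \<epsilon>: "0 < \<epsilon>"
 obtain \<delta> where \<delta>: "0 < \<delta>" "\<And>w. 0 < Im w ==> dist w z < \<delta> ==> dist (s w) (s z) < \<epsilon> / 3"
  using s z \<epsilon> unfolding continuous_on_iff by (metis divide_pos_pos mem_Collect_eq zero_less_numeral)
 \<comment> \<open>The three entries serve continuity of s, the bound b \<ge> Im z / 2, and a
   Lipschitz error of at most \<epsilon> / 3.\<close>
 define \<rho> where "\<rho> = Min {\<delta>, Im z / 2, \<epsilon> * (Im z)\<^sup>2 / 6}"
 have \<rho>: "0 < \<rho>" "\<rho> \<le> \<delta>" "\<rho> \<le> Im z / 2" "\<rho> \<le> \<epsilon> * (Im z)\<^sup>2 / 6" using \<delta> z \<epsilon> by (auto simp: \<rho>_def)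
 obtain a where a: "a \<in> \<rat>" "Re z - \<rho> / 2 < a" "a < Re z" using Rats_dense_in_real[of "Re z - \<rho> / 2" "Re z"] \<rho>(1) by auto
 obtain b where b: "b \<in> \<rat>" "Im z - \<rho> / 2 < b" "b < Im z" using Rats_dense_in_real[of "Im z - \<rho> / 2" "Im z"] \<rho>(1) by auto
 let ?w = "Complex a b"
 have bp: "Im z / 2 \<le> b" "0 < b" using b \<rho> z by linarith+
 have "cmod (z - ?w) \<le> \<bar>Re (z - ?w)\<bar> + \<bar>Im (z - ?w)\<bar>" by (rule cmod_le)
 also have "... < \<rho>" using a b by simp
 finally have d: "cmod (z - ?w) < \<rho>" .
 have "cmod (z - ?w) / (Im z * b) \<le> \<rho> / (Im z * (Im z / 2))"
  using d bp z \<rho> by (intro frac_le mult_left_mono) auto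
 also have "... \<le> (\<epsilon> * (Im z)\<^sup>2 / 6) / (Im z * (Im z / 2))"
  using \<rho>(4) z by (intro divide_right_mono) auto
 also have "... = \<epsilon> / 3" using z by (simp add: power2_eq_square field_simps)
 finally have lip: "cmod (stieltjes (\<mu> n) z - stieltjes (\<mu> n) ?w) \<le> \<epsilon> / 3" for n
  using order_trans[OF real_distribution.stieltjes_Lipschitz[OF \<mu>, of z ?w n]] z bp by (simp only: complex.sel)
 have sw: "dist (s ?w) (s z) < \<epsilon> / 3" using \<delta>(2)[of ?w] bp d \<rho> by (simp add: dist_norm norm_minus_commute)
 have "\<forall>\<^sub>F n in sequentially. dist (stieltjes (\<mu> n) ?w) (s ?w) < \<epsilon> / 3"
  using conv[OF a(1) b(1) bp(2)] \<epsilon> by (intro tendstoD) auto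
 then show "\<forall>\<^sub>F n in sequentially. dist (stieltjes (\<mu> n) z) (s z) < \<epsilon>"
 proof eventually_elim
  case (elim n)
  have "dist (stieltjes (\<mu> n) z) (s z) \<le> dist (stieltjes (\<mu> n) z) (stieltjes (\<mu> n) ?w) + dist (stieltjes (\<mu> n) ?w) (s ?w) + dist (s ?w) (s z)"
   using dist_triangle[of "stieltjes (\<mu> n) z" "s z" "stieltjes (\<mu> n) ?w"] dist_triangle[of "stieltjes (\<mu> n) ?w" "s z" "s ?w"] by linarith
  then show ?case using elim sw lip[of n] by (simp add: dist_norm)
 qed
qed

text \<open>The relation h \<sigma> = 1 + z J, where J is the integral of \<open>rker\<close>,
  solved for J. This shape keeps the link to the equation for h; partial fractions turn it into the
  closed formula.\<close>

definition s_lim :: "real => real measure => complex => complex" where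
 "s_lim c H z = (h_fun c H z * sig (of_real c * h_fun c H z) - 1) / z"

lemma s_lim_formula:
 assumes H: "nonneg_distr H" "H \<noteq> return borel 0" and c: "0 < c" and z: "0 < Im z"
 shows "s_lim c H z = 1 / z * (2 / of_real c - 1) +
   1 / (of_real c * z) * (1 / (- 1 + of_real c * h_fun c H z) - 1 / (1 + of_real c * h_fun c H z))"
proof -
 let ?\<theta> = "of_real c * h_fun c H z"
 have p: "0 < Im ?\<theta>" using h_fun_solves[OF assms] c by (simp add: solves_h_eq_alt)
 have nz: "z \<noteq> 0" "complex_of_real c \<noteq> 0" using z c by auto
 have "?\<theta> * sig ?\<theta> = ?\<theta> / (1 + ?\<theta>) + ?\<theta> / (- 1 + ?\<theta>)" by (simp add: sig_def distrib_left)
 also have "?\<theta> / (1 + ?\<theta>) = 1 - 1 / (1 + ?\<theta>)" using nonreal_not_pm1[OF p] by (simp add: field_simps)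
 also have "?\<theta> / (- 1 + ?\<theta>) = 1 + 1 / (- 1 + ?\<theta>)" using nonreal_not_pm1[OF p] by (simp add: field_simps)
 finally have "h_fun c H z * sig ?\<theta> = (2 + (1 / (- 1 + ?\<theta>) - 1 / (1 + ?\<theta>))) / of_real c"
  using nz by (simp add: eq_divide_eq mult_ac)
 then have "s_lim c H z = ((2 + (1 / (- 1 + ?\<theta>) - 1 / (1 + ?\<theta>))) / of_real c - 1) / z" by (simp only: s_lim_def)
 also have "... = 1 / z * (2 / of_real c - 1) + 1 / (of_real c * z) * (1 / (- 1 + ?\<theta>) - 1 / (1 + ?\<theta>))"
 proof -
  have "((2 + d) / a - 1) / z = 1 / z * (2 / a - 1) + 1 / (a * z) * d" if "a \<noteq> 0" for a d
   using nz(1) that by (simp add: field_simps)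
  from this[OF nz(2)] show ?thesis .
 qed
 finally show ?thesis .
qed

lemma s_lim_rker:
 assumes H: "nonneg_distr H" "H \<noteq> return borel 0" and c: "0 < c" and z: "0 < Im z"
 shows "s_lim c H z = (LINT l|H. rker z (sig (of_real c * h_fun c H z)) l)"
proof -
 let ?\<theta> = "of_real c * h_fun c H z"
 note sol = h_fun_solves[OF assms, unfolded solves_h_eq_alt]
 have "0 < Im ?\<theta>" using sol c by simp
 from nonneg_distr_integral_rker_hker[OF H(1) Im_sig_neg[OF this] z] sol
 have "h_fun c H z * sig ?\<theta> = 1 + z * (LINT l|H. rker z (sig ?\<theta>) l)" by simp
 then show ?thesis using z by (auto simp: s_lim_def)
qed

lemma s_lim_continuous:
 assumes H: "nonneg_distr H" "H \<noteq> return borel 0" and c: "0 < c"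
 shows "continuous_on upper_half_plane (s_lim c H)"
proof -
 have h: "continuous_on upper_half_plane (h_fun c H)"
  using h_fun_analytic[OF assms] analytic_imp_holomorphic holomorphic_on_imp_continuous_on by blast
 have p: "0 < Im (of_real c * h_fun c H z)" if "0 < Im z" for z
  using h_fun_solves[OF assms that] c by (simp add: solves_h_eq_alt)
 show ?thesis
  unfolding s_lim_def sig_def
  by (intro continuous_intros h) (use nonreal_not_pm1[OF p] in auto)
qed

text \<open>Reflection in the imaginary axis maps solutions to solutions: if h solves the equation
  at z, then - cnj h solves it at - cnj z. A point z = iy is fixed, so uniqueness forces h = - cnj
  h.\<close>

lemma h_fun_imaginary:
 assumes H: "nonneg_distr H" "H \<noteq> return borel 0" and c: "0 < c" and y: "0 < y"
 shows "Re (h_fun c H (Complex 0 y)) = 0"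
proof -
 let ?z = "Complex 0 y" let ?h = "h_fun c H ?z" let ?s = "sig (of_real c * ?h)"
 have z: "0 < Im ?z" using y by simp
 note sol = h_fun_solves[OF H c z, unfolded solves_h_eq_alt]
 have s: "Im ?s < 0" using sol c by (intro Im_sig_neg) simp
 have i: "integrable H (hker ?z ?s)" using hker_bound[OF _ s z] by (auto intro!: integrable_bounded_nonneg[OF H(1)])
 have sc: "sig (of_real c * (- cnj ?h)) = - cnj ?s"
 proof -
  have "1 / (1 - w) + 1 / (- 1 - w) = - (1 / (1 + w) + 1 / (- 1 + w))" for w :: complex
  proof -
   have "1 / (- 1 - w) = - (1 / (1 + w))" "1 / (1 - w) = - (1 / (- 1 + w))"
    by (simp_all add: minus_divide_right del: divide_minus_right)
   then show ?thesis by simp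
  qed
  from this[of "of_real c * cnj ?h"] show ?thesis by (simp add: sig_def)
 qed
 have kc: "hker ?z (- cnj ?s) l = - cnj (hker ?z ?s l)" for l
 proof -
  have "- ?z + of_real l * (- cnj ?s) = - cnj (- ?z + of_real l * ?s)" by (simp add: complex_eq_iff)
  then have "hker ?z (- cnj ?s) l = of_real l / (- cnj (- ?z + of_real l * ?s))" unfolding hker_def by (simp only:)
  also have "... = - cnj (hker ?z ?s l)" unfolding hker_def by (simp only: complex_cnj_divide complex_cnj_complex_of_real divide_minus_right)
  finally show ?thesis .
 qed
 have "(LINT l|H. hker ?z (sig (of_real c * (- cnj ?h))) l) = - cnj (LINT l|H. hker ?z ?s l)"
  unfolding sc kc by simp
 then have "solves_h_eq c H ?z (- cnj ?h)" using sol by (simp add: solves_h_eq_alt)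
 then have "- cnj ?h = ?h" using solves_h_eq_unique[OF H c z] h_fun_solves[OF H c z] by blast
 then have "Re (- cnj ?h) = Re ?h" by (rule arg_cong)
 then show ?thesis by simp
qed

text \<open>On the imaginary axis z times \<open>rker\<close> tends to - 1 boundedly, because s
  stays bounded there while |z| grows. The integral of this product is z times the limiting
  transform.\<close>

lemma s_lim_mass:
 assumes H: "nonneg_distr H" "H \<noteq> return borel 0" and c: "0 < c"
 shows "(\<lambda>k. real k * Im (s_lim c H (Complex 0 (real k)))) \<longlonglongrightarrow> 1"
proof -
 define z where "z k = Complex 0 (real (Suc k))" for k
 define s where "s k = sig (of_real c * h_fun c H (z k))" for k
 have zp: "0 < Im (z k)" for k by (simp add: z_def)
 have \<theta>: "0 < Im (of_real c * h_fun c H (z k))" for k using h_fun_solves[OF H c zp[of k]] c by (simp add: solves_h_eq_alt)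
 have sn: "Im (s k) < 0" for k unfolding s_def by (rule Im_sig_neg[OF \<theta>])
 \<comment> \<open>Here c h = i t with t > 0, so s = - 2 i t / (t^2 + 1), and 2 t \<le> t^2 +
   1.\<close>
 have sb: "cmod (s k) \<le> 1" for k
 proof -
  define t where "t = c * Im (h_fun c H (z k))"
  have t: "0 < t" using \<theta>[of k] by (simp add: t_def)
  have "of_real c * h_fun c H (z k) = \<i> * of_real t"
   using h_fun_imaginary[OF H c, of "real (Suc k)"] by (simp add: complex_eq_iff t_def z_def)
  then have "s k = 2 * (\<i> * of_real t) / ((\<i> * of_real t)\<^sup>2 - 1)"
   unfolding s_def using nonreal_not_pm1[OF \<theta>[of k]] by (metis sig_eq)
  also have "... = - (\<i> * of_real (2 * t / (t\<^sup>2 + 1)))"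
  proof -
   have "(\<i> * complex_of_real t)\<^sup>2 - 1 = - of_real (t\<^sup>2 + 1)" by (simp add: power_mult_distrib)
   then show ?thesis by (simp only: minus_divide_right[symmetric] of_real_divide times_divide_eq_right) simp
  qed
  finally have "cmod (s k) = 2 * t / (t\<^sup>2 + 1)" using t by (simp only: norm_minus_cancel norm_mult norm_of_real) (simp add: add_nonneg_pos)
  also have "... \<le> 1" using sum_squares_bound[of t 1] by (simp add: divide_le_eq_1 add_nonneg_pos)
  finally show ?thesis .
 qed
 have "(\<lambda>k. LINT l|H. z k * rker (z k) (s k) l) \<longlonglongrightarrow> (LINT l|H. - 1)"
 proof (rule weak_conv_integral_varying[OF H(1) H(1) weak_conv_const, where B=1])
  fix k and l :: real assume l: "0 \<le> l"
  have "cmod (z k * rker (z k) (s k) l) \<le> cmod (z k) * (1 / Im (z k))"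
   unfolding norm_mult by (intro mult_left_mono rker_bound[OF l less_imp_le[OF sn] zp]) auto
  also have "... = 1" by (simp add: z_def cmod_def)
  finally show "norm (z k * rker (z k) (s k) l) \<le> 1" .
 next
  fix y and l :: real assume "0 \<le> l" "y \<longlonglongrightarrow> l" and y: "\<And>k. 0 \<le> y k"
  have eq: "z k * rker (z k) (s k) (y k) = 1 / (- 1 + of_real (y k) * s k / z k)" for k
  proof -
   have "z k \<noteq> 0" using zp[of k] by auto
   then show ?thesis unfolding rker_def by (simp add: divide_simps)
  qed
  have "(\<lambda>k. of_real (y k) * s k / z k) \<longlonglongrightarrow> 0"
  proof (rule Lim_null_comparison)
   show "\<forall>\<^sub>F k in sequentially. norm (of_real (y k) * s k / z k) \<le> \<bar>y k\<bar> / real (Suc k)"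
   proof (rule always_eventually, rule allI)
    fix k
    have "norm (of_real (y k) * s k / z k) = \<bar>y k\<bar> * cmod (s k) / real (Suc k)"
    proof -
     have "cmod (z k) = real (Suc k)" by (simp add: z_def cmod_def)
     then show ?thesis by (simp only: norm_mult norm_divide norm_of_real)
    qed
    also have "... \<le> \<bar>y k\<bar> * 1 / real (Suc k)" using sb[of k] by (intro divide_right_mono mult_left_mono) auto
    finally show "norm (of_real (y k) * s k / z k) \<le> \<bar>y k\<bar> / real (Suc k)" by simp
   qed
   have "(\<lambda>k. \<bar>y k\<bar> * (1 / real (Suc k))) \<longlonglongrightarrow> \<bar>l\<bar> * 0"
    by (intro tendsto_mult tendsto_rabs \<open>y \<longlonglongrightarrow> l\<close> LIMSEQ_Suc[OF lim_1_over_n])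
   then show "(\<lambda>k. \<bar>y k\<bar> / real (Suc k)) \<longlonglongrightarrow> 0" by simp
  qed
  then have "(\<lambda>k. 1 / (- 1 + of_real (y k) * s k / z k)) \<longlonglongrightarrow> 1 / (- 1 + 0)"
   by (intro tendsto_intros) auto
  then show "(\<lambda>k. z k * rker (z k) (s k) (y k)) \<longlonglongrightarrow> - 1" by (simp add: eq)
 qed auto
 moreover have "(LINT l|H. z k * rker (z k) (s k) l) = z k * s_lim c H (z k)" for k
  using s_lim_rker[OF H c zp] by (simp add: s_def)
 moreover have "(LINT l|H. - 1 :: complex) = - 1"
  using prob_space.prob_space[OF nonneg_distrD(2)[OF H(1)]] by simp
 moreover have "(LINT l|H. z k * rker (z k) (s k) l) = z k * (LINT l|H. rker (z k) (s k) l)" for k by simp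
 ultimately have "(\<lambda>k. z k * s_lim c H (z k)) \<longlonglongrightarrow> - 1" by (simp only:)
 then have "(\<lambda>k. - Re (z k * s_lim c H (z k))) \<longlonglongrightarrow> - Re (- 1)" by (intro tendsto_intros)
 moreover have "- Re (z k * s_lim c H (z k)) = real (Suc k) * Im (s_lim c H (Complex 0 (real (Suc k))))" for k
  by (simp add: z_def)
 ultimately have "(\<lambda>k. real (Suc k) * Im (s_lim c H (Complex 0 (real (Suc k))))) \<longlonglongrightarrow> 1" by simp
 then show ?thesis by (rule LIMSEQ_imp_Suc)
qed

section \<open>Hermitian matrices and resolvents\<close>

unbundle no vec_syntax

notation mult_mat_vec (infixl "*v" 70)

lemma mult_mat_index:
 assumes "A \<in> carrier_mat m n" "B \<in> carrier_mat n r" "i < m" "j < r"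
 shows "(A * B) $$ (i, j) = (\<Sum>k<n. A $$ (i, k) * B $$ (k, j))"
 using assms by (simp add: scalar_prod_def lessThan_atLeast0)

lemma mult_mat_vec_index:
 assumes "A \<in> carrier_mat m n" "v \<in> carrier_vec n" "i < m"
 shows "(A *v v) $ i = (\<Sum>k<n. A $$ (i, k) * v $ k)"
 using assms by (simp add: scalar_prod_def lessThan_atLeast0)

lemma mat_adjoint_dim [simp]: "dim_row (mat_adjoint A) = dim_col A" "dim_col (mat_adjoint A) = dim_row A"
 by (simp_all add: mat_adjoint_def)

lemma mat_adjoint_carrier [simp]: "A \<in> carrier_mat m n ==> mat_adjoint A \<in> carrier_mat n m"
 by (intro carrier_matI) simp_all

lemma mat_adjoint_index:
 assumes "A \<in> carrier_mat m n" "i < n" "j < m" shows "mat_adjoint A $$ (i, j) = cnj ((A :: complex mat) $$ (j, i))"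
proof -
 have "mat_adjoint A $$ (i, j) = map conjugate (cols A) ! i $ j"
  unfolding mat_adjoint_def using assms by (intro mat_of_rows_index) auto
 then show ?thesis using assms by simp
qed

lemma mat_adjoint_mult:
 assumes "(A :: complex mat) \<in> carrier_mat m n" "B \<in> carrier_mat n r"
 shows "mat_adjoint (A * B) = mat_adjoint B * mat_adjoint A"
proof (rule eq_matI)
 note AB = mult_carrier_mat[OF assms] and aA = mat_adjoint_carrier[OF assms(1)] and aB = mat_adjoint_carrier[OF assms(2)]
 fix i j assume "i < dim_row (mat_adjoint B * mat_adjoint A)" "j < dim_col (mat_adjoint B * mat_adjoint A)"
 then have ij: "i < r" "j < m" using assms by auto
 have "mat_adjoint (A * B) $$ (i, j) = cnj (\<Sum>k<n. A $$ (j, k) * B $$ (k, i))"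
  by (simp only: mat_adjoint_index[OF AB ij] mult_mat_index[OF assms ij(2,1)])
 also have "... = (\<Sum>k<n. mat_adjoint B $$ (i, k) * mat_adjoint A $$ (k, j))"
  using mat_adjoint_index[OF assms(1) _ ij(2)] mat_adjoint_index[OF assms(2) ij(1)] by (simp add: mult.commute)
 also have "... = (mat_adjoint B * mat_adjoint A) $$ (i, j)" by (simp only: mult_mat_index[OF aB aA ij])
 finally show "mat_adjoint (A * B) $$ (i, j) = (mat_adjoint B * mat_adjoint A) $$ (i, j)" .
qed (use assms in auto)

lemma mat_adjoint_adjoint [simp]: "mat_adjoint (mat_adjoint (A :: complex mat)) = A"
proof (rule eq_matI)
 have A: "A \<in> carrier_mat (dim_row A) (dim_col A)" by auto
 fix i j assume "i < dim_row A" "j < dim_col A"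
 then show "mat_adjoint (mat_adjoint A) $$ (i, j) = A $$ (i, j)"
  using mat_adjoint_index[OF mat_adjoint_carrier[OF A]] mat_adjoint_index[OF A] by simp
qed auto

definition inn :: "nat => complex vec => complex vec => complex" where
 "inn p u v = (\<Sum>i<p. u $ i * cnj (v $ i))"

definition nsq :: "nat => complex vec => real" where
 "nsq p u = (\<Sum>i<p. (cmod (u $ i))\<^sup>2)"

lemma inn_cscalar_prod: "u \<in> carrier_vec p ==> v \<in> carrier_vec p ==> u \<bullet>c v = inn p u v"
 by (simp add: inn_def scalar_prod_def lessThan_atLeast0)

lemma inn_add_left: "v \<in> carrier_vec p ==> inn p (u + v) w = inn p u w + inn p v w"
 by (simp add: inn_def sum.distrib distrib_right)

lemma inn_add_right: "w \<in> carrier_vec p ==> inn p u (v + w) = inn p u v + inn p u w"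
 by (simp add: inn_def sum.distrib distrib_left)

lemma inn_smult_left: "u \<in> carrier_vec p ==> inn p (a \<cdot>\<^sub>v u) w = a * inn p u w"
 by (simp add: inn_def sum_distrib_left mult.assoc)

lemma inn_smult_right: "w \<in> carrier_vec p ==> inn p u (a \<cdot>\<^sub>v w) = cnj a * inn p u w"
 by (simp add: inn_def sum_distrib_left mult_ac)

lemma inn_cnj: "cnj (inn p u v) = inn p v u"
 by (simp add: inn_def mult.commute)

lemma inn_self: "inn p u u = of_real (nsq p u)"
 unfolding inn_def nsq_def of_real_sum by (intro sum.cong refl complex_norm_square[symmetric])

lemma nsq_nonneg [simp]: "0 \<le> nsq p u"
 by (simp add: nsq_def sum_nonneg)

lemma nsq_eq_0: "u \<in> carrier_vec p ==> nsq p u = 0 \<longleftrightarrow> u = 0\<^sub>v p"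
proof -
 assume u: "u \<in> carrier_vec p"
 have "nsq p u = 0 \<longleftrightarrow> (\<forall>i<p. u $ i = 0)" by (simp add: nsq_def sum_nonneg_eq_0_iff Ball_def)
 also have "... \<longleftrightarrow> u = 0\<^sub>v p"
 proof
  assume "\<forall>i<p. u $ i = 0"
  then show "u = 0\<^sub>v p" using u by (intro eq_vecI) auto
 qed simp
 finally show ?thesis .
qed

lemma nsq_smult: "u \<in> carrier_vec p ==> nsq p (a \<cdot>\<^sub>v u) = (cmod a)\<^sup>2 * nsq p u"
 by (simp add: nsq_def sum_distrib_left norm_mult power_mult_distrib)

lemma inn_Cauchy_Schwarz: "cmod (inn p u v) \<le> sqrt (nsq p u) * sqrt (nsq p v)"
proof -
 have "cmod (inn p u v) \<le> (\<Sum>i<p. \<bar>cmod (u $ i)\<bar> * \<bar>cmod (v $ i)\<bar>)"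
  unfolding inn_def by (rule order_trans[OF norm_sum]) (simp add: norm_mult)
 also have "... \<le> L2_set (\<lambda>i. cmod (u $ i)) {..<p} * L2_set (\<lambda>i. cmod (v $ i)) {..<p}"
  by (rule L2_set_mult_ineq)
 finally show ?thesis by (simp add: L2_set_def nsq_def)
qed

lemma inn_adjoint:
 assumes A: "A \<in> carrier_mat m n" and v: "v \<in> carrier_vec n" and w: "w \<in> carrier_vec m"
 shows "inn m (A *v v) w = inn n v (mat_adjoint A *v w)"
proof -
 have "inn m (A *v v) w = (\<Sum>i<m. \<Sum>k<n. A $$ (i, k) * v $ k * cnj (w $ i))"
  unfolding inn_def by (simp add: mult_mat_vec_index[OF A v] sum_distrib_right)
 also have "... = (\<Sum>k<n. \<Sum>i<m. A $$ (i, k) * v $ k * cnj (w $ i))" by (rule sum.swap)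
 also have "... = inn n v (mat_adjoint A *v w)"
  unfolding inn_def
  by (simp add: mult_mat_vec_index[OF mat_adjoint_carrier[OF A] w] mat_adjoint_index[OF A] sum_distrib_left mult_ac)
 finally show ?thesis .
qed

text \<open>An operator norm bound, stated through squared norms so that it combines directly with
  sums of squares.\<close>

definition opb :: "nat => complex mat => real => bool" where
 "opb p A \<kappa> \<longleftrightarrow> A \<in> carrier_mat p p \<and> 0 \<le> \<kappa> \<and> (\<forall>v \<in> carrier_vec p. nsq p (A *v v) \<le> \<kappa>\<^sup>2 * nsq p v)"

lemma opbD: "opb p A \<kappa> ==> A \<in> carrier_mat p p" "opb p A \<kappa> ==> 0 \<le> \<kappa>"
 "opb p A \<kappa> ==> v \<in> carrier_vec p ==> nsq p (A *v v) \<le> \<kappa>\<^sup>2 * nsq p v"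
 by (auto simp: opb_def)

lemma opb_sqrt: "opb p A \<kappa> ==> v \<in> carrier_vec p ==> sqrt (nsq p (A *v v)) \<le> \<kappa> * sqrt (nsq p v)"
 using real_sqrt_le_mono[OF opbD(3), of p A \<kappa> v] opbD(2)[of p A \<kappa>] by (simp add: real_sqrt_mult)

lemma opb_mult: assumes "opb p A \<alpha>" "opb p B \<beta>" shows "opb p (A * B) (\<alpha> * \<beta>)"
 unfolding opb_def
proof (intro conjI ballI)
 note c = opbD(1)[OF assms(1)] opbD(1)[OF assms(2)]
 show "A * B \<in> carrier_mat p p" using c by simp
 show "0 \<le> \<alpha> * \<beta>" using assms opbD(2) by simp
 fix v :: "complex vec" assume v: "v \<in> carrier_vec p"
 have "nsq p (A *v (B *v v)) \<le> \<alpha>\<^sup>2 * nsq p (B *v v)" using opbD(3)[OF assms(1)] c v by simp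
 also have "... \<le> \<alpha>\<^sup>2 * (\<beta>\<^sup>2 * nsq p v)" using opbD(3)[OF assms(2) v] by (intro mult_left_mono) auto
 finally show "nsq p (A * B *v v) \<le> (\<alpha> * \<beta>)\<^sup>2 * nsq p v"
  using c v by (simp add: power_mult_distrib mult.assoc)
qed

lemma opb_mono: "opb p A \<alpha> ==> \<alpha> \<le> \<beta> ==> opb p A \<beta>"
 unfolding opb_def
proof (elim conjE, intro conjI ballI)
 fix v :: "complex vec"
 assume a: "\<alpha> \<le> \<beta>" "0 \<le> \<alpha>" "\<forall>v\<in>carrier_vec p. nsq p (A *v v) \<le> \<alpha>\<^sup>2 * nsq p v" "v \<in> carrier_vec p"
 then have "nsq p (A *v v) \<le> \<alpha>\<^sup>2 * nsq p v" by blast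
 also have "... \<le> \<beta>\<^sup>2 * nsq p v" using a by (intro mult_right_mono power_mono) auto
 finally show "nsq p (A *v v) \<le> \<beta>\<^sup>2 * nsq p v" .
qed auto

lemma opb_one: "opb p (1\<^sub>m p) 1"
 by (auto simp: opb_def)

lemma opb_inn:
 assumes "opb p A \<kappa>" "v \<in> carrier_vec p"
 shows "cmod (inn p (A *v v) w) \<le> \<kappa> * sqrt (nsq p v) * sqrt (nsq p w)"
 using inn_Cauchy_Schwarz[of p "A *v v" w] mult_right_mono[OF opb_sqrt[OF assms], of "sqrt (nsq p w)"] by simp

lemma nsq_unit_vec: "j < p ==> nsq p (unit_vec p j) = 1"
proof -
 assume j: "j < p"
 have "(\<Sum>i<p. (cmod (unit_vec p j $ i))\<^sup>2) = (\<Sum>i<p. if i = j then 1 else 0)"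
  by (rule sum.cong) (auto simp: j)
 then show ?thesis using j by (simp add: nsq_def)
qed

lemma mat_col_index: "A \<in> carrier_mat m p ==> i < m ==> j < p ==> ((A :: complex mat) *v unit_vec p j) $ i = A $$ (i, j)"
proof -
 assume A: "A \<in> carrier_mat m p" and ij: "i < m" "j < p"
 have "(\<Sum>k<p. A $$ (i, k) * unit_vec p j $ k) = (\<Sum>k<p. if k = j then A $$ (i, k) else 0)"
  by (rule sum.cong) (auto simp: ij)
 then show ?thesis using ij by (simp add: mult_mat_vec_index[OF A])
qed

lemma opb_frobenius:
 assumes "opb p A \<kappa>"
 shows "(\<Sum>i<p. \<Sum>j<p. (cmod (A $$ (i, j)))\<^sup>2) \<le> real p * \<kappa>\<^sup>2"
proof -
 note A = opbD(1)[OF assms]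
 have "(\<Sum>i<p. \<Sum>j<p. (cmod (A $$ (i, j)))\<^sup>2) = (\<Sum>j<p. \<Sum>i<p. (cmod (A $$ (i, j)))\<^sup>2)" by (rule sum.swap)
 also have "... = (\<Sum>j<p. nsq p (A *v unit_vec p j))"
  unfolding nsq_def by (intro sum.cong refl) (simp add: mat_col_index[OF A])
 also have "... \<le> (\<Sum>j<p. \<kappa>\<^sup>2)"
 proof (rule sum_mono)
  fix j assume "j \<in> {..<p}"
  then show "nsq p (A *v unit_vec p j) \<le> \<kappa>\<^sup>2" using opbD(3)[OF assms, of "unit_vec p j"] by (simp add: nsq_unit_vec)
 qed
 finally show ?thesis by simp
qed

lemma mat_trace_carrier: "A \<in> carrier_mat p q ==> mat_trace A = (\<Sum>i<p. A $$ (i, i))"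
 by (simp add: mat_trace_def)

lemma opb_trace:
 assumes "opb p A \<kappa>" shows "cmod (mat_trace A) \<le> real p * \<kappa>"
proof -
 note A = opbD(1)[OF assms]
 have "cmod (mat_trace A) \<le> (\<Sum>i<p. cmod (A $$ (i, i)))" unfolding mat_trace_carrier[OF A] by (rule norm_sum)
 also have "... \<le> (\<Sum>i<p. \<kappa>)"
 proof (rule sum_mono)
  fix i assume i: "i \<in> {..<p}"
  have "(cmod (A $$ (i, i)))\<^sup>2 = (cmod ((A *v unit_vec p i) $ i))\<^sup>2" using i mat_col_index[OF A] by simp
  also have "... \<le> nsq p (A *v unit_vec p i)" unfolding nsq_def by (rule member_le_sum[OF i]) auto
  also have "... \<le> \<kappa>\<^sup>2" using opbD(3)[OF assms, of "unit_vec p i"] i by (simp add: nsq_unit_vec)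
  finally show "cmod (A $$ (i, i)) \<le> \<kappa>" using opbD(2)[OF assms] by (simp add: abs_le_square_iff[symmetric])
 qed
 finally show ?thesis by simp
qed

lemma mat_trace_mult_commute:
 assumes "A \<in> carrier_mat m n" "B \<in> carrier_mat n m" shows "mat_trace (A * B) = mat_trace (B * A)"
proof -
 have "mat_trace (A * B) = (\<Sum>i<m. \<Sum>k<n. A $$ (i, k) * B $$ (k, i))"
  using mult_mat_index[OF assms] by (subst mat_trace_carrier[OF mult_carrier_mat[OF assms]]) simp
 also have "... = (\<Sum>k<n. \<Sum>i<m. B $$ (k, i) * A $$ (i, k))" by (subst sum.swap) (simp add: mult.commute)
 also have "... = mat_trace (B * A)"
  using mult_mat_index[OF assms(2,1)] by (subst mat_trace_carrier[OF mult_carrier_mat[OF assms(2,1)]]) simp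
 finally show ?thesis .
qed

lemma mat_trace_add: "A \<in> carrier_mat p p ==> B \<in> carrier_mat p p ==> mat_trace (A + B) = mat_trace A + mat_trace B"
 by (simp add: mat_trace_def sum.distrib)

lemma mat_trace_diff: "A \<in> carrier_mat p p ==> B \<in> carrier_mat p p ==> mat_trace (A - B) = mat_trace A - mat_trace B"
 by (simp add: mat_trace_def sum_subtractf)

lemma mat_trace_smult: "A \<in> carrier_mat p p ==> mat_trace (a \<cdot>\<^sub>m A) = a * mat_trace A"
 by (simp add: mat_trace_def sum_distrib_left)

lemma mat_trace_one: "mat_trace (1\<^sub>m p) = of_nat p"
 by (simp add: mat_trace_def)

definition outer :: "nat => complex vec => complex vec => complex mat" where
 "outer p x y = mat p p (\<lambda>(i, j). x $ i * cnj (y $ j))"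

lemma outer_carrier [simp]: "outer p x y \<in> carrier_mat p p"
 by (simp add: outer_def)

lemma outer_index: "i < p ==> j < p ==> outer p x y $$ (i, j) = x $ i * cnj (y $ j)"
 by (simp add: outer_def)

lemma outer_mult_vec:
 assumes "v \<in> carrier_vec p" "x \<in> carrier_vec p" shows "outer p x y *v v = inn p v y \<cdot>\<^sub>v x"
proof (rule eq_vecI)
 fix i assume "i < dim_vec (inn p v y \<cdot>\<^sub>v x)"
 then have i: "i < p" using assms by simp
 have "(outer p x y *v v) $ i = (\<Sum>k<p. x $ i * cnj (y $ k) * v $ k)"
  using i by (simp add: mult_mat_vec_index[OF outer_carrier assms(1)] outer_index)
 also have "... = inn p v y * x $ i" by (simp add: inn_def sum_distrib_right sum_distrib_left mult_ac)
 finally show "(outer p x y *v v) $ i = (inn p v y \<cdot>\<^sub>v x) $ i" using i assms by simp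
qed (use assms in \<open>simp add: outer_def\<close>)

lemma mat_trace_mult_outer:
 assumes M: "M \<in> carrier_mat p p" and x: "x \<in> carrier_vec p"
 shows "mat_trace (M * outer p x y) = inn p (M *v x) y"
proof -
 have "mat_trace (M * outer p x y) = (\<Sum>i<p. \<Sum>k<p. M $$ (i, k) * (x $ k * cnj (y $ i)))"
  using mult_mat_index[OF M outer_carrier] by (subst mat_trace_carrier[OF mult_carrier_mat[OF M outer_carrier]]) (simp add: outer_index)
 also have "... = inn p (M *v x) y"
  unfolding inn_def by (simp add: mult_mat_vec_index[OF M x] sum_distrib_right sum_distrib_left mult_ac)
 finally show ?thesis .
qed

lemma mat_eq_vecI:
 assumes A: "(A :: complex mat) \<in> carrier_mat m n" and B: "B \<in> carrier_mat m n"
  and eq: "\<And>v. v \<in> carrier_vec n ==> A *v v = B *v v"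
 shows "A = B"
proof (rule eq_matI)
 fix i j assume "i < dim_row B" "j < dim_col B"
 then have ij: "i < m" "j < n" using B by auto
 show "A $$ (i, j) = B $$ (i, j)"
  using mat_col_index[OF A ij] mat_col_index[OF B ij] eq[of "unit_vec n j"] by simp
qed (use A B in auto)

text \<open>The adjugate formula is rational in the entries, which gives measurability of inverses
  directly. A singular matrix is sent to the zero matrix.\<close>

definition minv :: "complex mat => complex mat" where
 "minv A = (1 / det A) \<cdot>\<^sub>m adj_mat A"

lemma minv:
 assumes A: "A \<in> carrier_mat p p" and d: "det A \<noteq> 0"
 shows "minv A \<in> carrier_mat p p" "A * minv A = 1\<^sub>m p" "minv A * A = 1\<^sub>m p"
proof -
 note adj = adj_mat[OF A]
 have ds: "(1 / det A) \<cdot>\<^sub>m (det A \<cdot>\<^sub>m 1\<^sub>m p) = 1\<^sub>m p" using d by (intro eq_matI) auto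
 show "minv A \<in> carrier_mat p p" unfolding minv_def using adj(1) by simp
 have "A * minv A = (1 / det A) \<cdot>\<^sub>m (A * adj_mat A)" unfolding minv_def by (rule mult_smult_distrib[OF A adj(1)])
 then show "A * minv A = 1\<^sub>m p" using d by (simp add: adj(2) ds)
 have "minv A * A = (1 / det A) \<cdot>\<^sub>m (adj_mat A * A)" unfolding minv_def by (rule mult_smult_assoc_mat[OF adj(1) A])
 then show "minv A * A = 1\<^sub>m p" using d by (simp add: adj(3) ds)
qed

lemma minv_unique:
 assumes A: "A \<in> carrier_mat p p" and B: "B \<in> carrier_mat p p" and eq: "A * B = 1\<^sub>m p"
 shows "det A \<noteq> 0" "minv A = B"
proof -
 have "det A * det B = 1" using det_mult[OF A B] eq by simp
 then show d: "det A \<noteq> 0" by auto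
 note m = minv[OF A d]
 have "minv A = minv A * (A * B)" using m by (simp add: eq)
 also have "... = (minv A * A) * B" using m(1) A B by simp
 also have "... = B" unfolding m(3) using B by simp
 finally show "minv A = B" .
qed

section \<open>Resolvents of Hermitian matrices\<close>

definition shift :: "nat => complex mat => complex => complex mat" where
 "shift p S z = S - z \<cdot>\<^sub>m 1\<^sub>m p"

lemma shift_carrier [simp]: "S \<in> carrier_mat p p ==> shift p S z \<in> carrier_mat p p"
 unfolding shift_def by (intro minus_carrier_mat) auto

lemma shift_mult_vec:
 assumes "S \<in> carrier_mat p p" "v \<in> carrier_vec p" shows "shift p S z *v v = S *v v - z \<cdot>\<^sub>v v"
proof -
 have "(z \<cdot>\<^sub>m 1\<^sub>m p) *v v = z \<cdot>\<^sub>v v" using assms(2) by auto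
 then show ?thesis unfolding shift_def using assms by (subst minus_mult_distrib_mat_vec[of _ p p]) auto
qed

definition resolvent :: "nat => complex mat => complex => complex mat" where
 "resolvent p S z = minv (shift p S z)"

locale herm =
 fixes p :: nat and S :: "complex mat"
 assumes S: "S \<in> carrier_mat p p" and herm: "mat_adjoint S = S"
begin

lemma inn_herm_real: "v \<in> carrier_vec p ==> Im (inn p (S *v v) v) = 0"
proof -
 assume v: "v \<in> carrier_vec p"
 have "cnj (inn p (S *v v) v) = inn p (S *v v) v"
  using inn_adjoint[OF S v v] by (simp add: inn_cnj herm)
 then show ?thesis by (simp add: complex_eq_iff)
qed

lemma Im_inn_shift:
 assumes "v \<in> carrier_vec p" shows "Im (inn p (shift p S z *v v) v) = - Im z * nsq p v"
proof -
 have "shift p S z *v v = S *v v + (- z) \<cdot>\<^sub>v v" unfolding shift_mult_vec[OF S assms] using S assms by auto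
 then have "inn p (shift p S z *v v) v = inn p (S *v v) v - z * of_real (nsq p v)"
  using assms S by (simp add: inn_add_left inn_smult_left inn_self)
 then show ?thesis using inn_herm_real[OF assms] by simp
qed

lemma det_shift: assumes "Im z \<noteq> 0" shows "det (shift p S z) \<noteq> 0"
proof
 assume "det (shift p S z) = 0"
 then obtain v where v: "v \<in> carrier_vec p" "v \<noteq> 0\<^sub>v p" "shift p S z *v v = 0\<^sub>v p"
  using det_0_iff_vec_prod_zero[of "shift p S z" p] S by auto
 have "inn p (0\<^sub>v p) v = 0" by (simp add: inn_def)
 then have "nsq p v = 0" using Im_inn_shift[OF v(1), of z] v(3) assms by simp
 then show False using v nsq_eq_0 by blast
qed

lemma resolvent:
 assumes "Im z \<noteq> 0"
 shows "resolvent p S z \<in> carrier_mat p p" "shift p S z * resolvent p S z = 1\<^sub>m p" "resolvent p S z * shift p S z = 1\<^sub>m p"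
 unfolding resolvent_def by (rule minv[OF shift_carrier[OF S] det_shift[OF assms]])+

lemma shift_resolvent_vec:
 assumes "Im z \<noteq> 0" "v \<in> carrier_vec p"
 shows "shift p S z *v (resolvent p S z *v v) = v" "resolvent p S z *v (shift p S z *v v) = v"
 unfolding assoc_mult_mat_vec[OF shift_carrier[OF S] resolvent(1)[OF assms(1)] assms(2), symmetric]
  assoc_mult_mat_vec[OF resolvent(1)[OF assms(1)] shift_carrier[OF S] assms(2), symmetric]
  resolvent(2,3)[OF assms(1)] by (rule one_mult_mat_vec[OF assms(2)])+

text \<open>Let u = Q w. Then <u, w> is the conjugate of <(S - z) u, u>, whose imaginary part is -
  Im z |u|^2 because S contributes a real number.\<close>

lemma Im_inn_resolvent:
 assumes z: "Im z \<noteq> 0" and w: "w \<in> carrier_vec p"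
 shows "Im (inn p (resolvent p S z *v w) w) = Im z * nsq p (resolvent p S z *v w)"
proof -
 let ?u = "resolvent p S z *v w"
 have u: "?u \<in> carrier_vec p" using resolvent(1)[OF z] w by simp
 have "inn p ?u w = cnj (inn p w ?u)" by (simp add: inn_cnj)
 also have "inn p w ?u = inn p (shift p S z *v ?u) ?u" using shift_resolvent_vec(1)[OF z w] by simp
 finally show ?thesis using Im_inn_shift[OF u, of z] by simp
qed

lemma resolvent_adjoint:
 assumes z: "Im z \<noteq> 0" shows "mat_adjoint (resolvent p S z) = resolvent p S (cnj z)"
proof -
 have ash: "mat_adjoint (shift p S z) = shift p S (cnj z)"
 proof (rule eq_matI)
  fix i j assume "i < dim_row (shift p S (cnj z))" "j < dim_col (shift p S (cnj z))"
  then have ij: "i < p" "j < p" using S by (auto simp: shift_def)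
  have "cnj (S $$ (j, i)) = S $$ (i, j)" using mat_adjoint_index[OF S ij] herm by simp
  then show "mat_adjoint (shift p S z) $$ (i, j) = shift p S (cnj z) $$ (i, j)"
   using ij S by (subst mat_adjoint_index[OF shift_carrier[OF S]]) (auto simp: shift_def)
 qed (use S in \<open>auto simp: shift_def\<close>)
 have "shift p S (cnj z) * mat_adjoint (resolvent p S z) = mat_adjoint (resolvent p S z * shift p S z)"
  using mat_adjoint_mult[OF resolvent(1)[OF z] shift_carrier[OF S]] ash by simp
 also have "... = 1\<^sub>m p"
  unfolding resolvent(3)[OF z] by (rule eq_matI) (auto simp: mat_adjoint_index[of _ p p])
 finally have e: "shift p S (cnj z) * mat_adjoint (resolvent p S z) = 1\<^sub>m p" .
 show ?thesis
  using minv_unique(2)[OF shift_carrier[OF S] mat_adjoint_carrier[OF resolvent(1)[OF z]] e]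
  by (simp only: resolvent_def[of p S "cnj z"])
qed

text \<open>Both sides equal Im <Q w, w> / Im z: passing to the adjoint changes the sign of the
  numerator and of the denominator.\<close>

lemma nsq_resolvent_adjoint:
 assumes z: "Im z \<noteq> 0" and w: "w \<in> carrier_vec p"
 shows "nsq p (mat_adjoint (resolvent p S z) *v w) = nsq p (resolvent p S z *v w)"
proof -
 let ?Q = "resolvent p S z"
 have z': "Im (cnj z) \<noteq> 0" using z by simp
 have "Im (inn p (resolvent p S (cnj z) *v w) w) = Im (cnj z) * nsq p (resolvent p S (cnj z) *v w)"
  by (rule Im_inn_resolvent[OF z' w])
 moreover have "inn p (mat_adjoint ?Q *v w) w = cnj (inn p (?Q *v w) w)"
  using inn_adjoint[OF resolvent(1)[OF z] w w] by (simp add: inn_cnj)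
 ultimately show ?thesis using Im_inn_resolvent[OF z w] z by (simp add: resolvent_adjoint[OF z])
qed

lemma opb_resolvent:
 assumes z: "0 < Im z" shows "opb p (resolvent p S z) (1 / Im z)"
 unfolding opb_def
proof (intro conjI ballI)
 have z': "Im z \<noteq> 0" using z by simp
 show "resolvent p S z \<in> carrier_mat p p" using resolvent(1)[OF z'] .
 fix w :: "complex vec" assume w: "w \<in> carrier_vec p"
 let ?u = "resolvent p S z *v w"
 have "Im z * nsq p ?u \<le> cmod (inn p ?u w)" unfolding Im_inn_resolvent[OF z' w, symmetric]
  using abs_Im_le_cmod[of "inn p ?u w"] by linarith
 also have "... \<le> sqrt (nsq p ?u) * sqrt (nsq p w)" by (rule inn_Cauchy_Schwarz)
 finally have "(sqrt (nsq p ?u) * Im z) * sqrt (nsq p ?u) \<le> sqrt (nsq p w) * sqrt (nsq p ?u)" by (simp add: mult_ac)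
 then have "sqrt (nsq p ?u) * Im z \<le> sqrt (nsq p w)"
  by (cases "nsq p ?u = 0") (auto simp: less_le mult.commute)
 then have "(sqrt (nsq p ?u) * Im z)\<^sup>2 \<le> (sqrt (nsq p w))\<^sup>2" using z by (intro power_mono) auto
 then show "nsq p ?u \<le> (1 / Im z)\<^sup>2 * nsq p w" using z by (simp add: power_mult_distrib power_divide field_simps)
qed (use z in simp)

end

section \<open>Unitary matrices and the spectral theorem\<close>

definition unitary :: "nat => complex mat => bool" where
 "unitary p U \<longleftrightarrow> U \<in> carrier_mat p p \<and> mat_adjoint U * U = 1\<^sub>m p"

lemma unitaryD:
 assumes "unitary p U"
 shows "U \<in> carrier_mat p p" "mat_adjoint U \<in> carrier_mat p p" "mat_adjoint U * U = 1\<^sub>m p" "U * mat_adjoint U = 1\<^sub>m p"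
proof -
 show U: "U \<in> carrier_mat p p" and 1: "mat_adjoint U * U = 1\<^sub>m p" using assms by (auto simp: unitary_def)
 show a: "mat_adjoint U \<in> carrier_mat p p" using U by simp
 show "U * mat_adjoint U = 1\<^sub>m p" by (rule mat_mult_left_right_inverse[OF a U 1])
qed

lemma unitary_mult:
 assumes "unitary p U" "unitary p V" shows "unitary p (U * V)"
proof -
 note U = unitaryD[OF assms(1)] and V = unitaryD[OF assms(2)]
 have "mat_adjoint (U * V) * (U * V) = mat_adjoint V * ((mat_adjoint U * U) * V)"
  unfolding mat_adjoint_mult[OF U(1) V(1)]
  using assoc_mult_mat[OF V(2) U(2) mult_carrier_mat[OF U(1) V(1)]] assoc_mult_mat[OF U(2) U(1) V(1)] by simp
 also have "... = 1\<^sub>m p" unfolding U(3) using V by simp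
 finally show ?thesis using U V by (simp add: unitary_def)
qed

lemma nsq_unitary:
 assumes "unitary p U" "v \<in> carrier_vec p" shows "nsq p (U *v v) = nsq p v"
proof -
 note U = unitaryD[OF assms(1)]
 have "complex_of_real (nsq p (U *v v)) = inn p v (mat_adjoint U *v (U *v v))"
  using inn_adjoint[OF U(1) assms(2), of "U *v v"] U(1) assms(2) by (simp add: inn_self)
 also have "mat_adjoint U *v (U *v v) = v"
  unfolding assoc_mult_mat_vec[OF U(2) U(1) assms(2), symmetric] U(3) by (rule one_mult_mat_vec[OF assms(2)])
 finally show ?thesis by (simp add: inn_self)
qed

lemma unitary_adjoint: "unitary p U ==> unitary p (mat_adjoint U)"
proof -
 assume "unitary p U"
 note U = unitaryD[OF this]
 show ?thesis unfolding unitary_def mat_adjoint_adjoint by (intro conjI U(2,4))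
qed

definition diagm :: "nat => (nat => complex) => complex mat" where
 "diagm p f = mat p p (\<lambda>(i, j). if i = j then f i else 0)"

lemma diagm_carrier [simp]: "diagm p f \<in> carrier_mat p p"
 by (simp add: diagm_def)

lemma diagm_index: "i < p ==> j < p ==> diagm p f $$ (i, j) = (if i = j then f i else 0)"
 by (simp add: diagm_def)

lemma mult_diagm_index:
 assumes "A \<in> carrier_mat m p" "i < m" "j < p" shows "(A * diagm p f) $$ (i, j) = A $$ (i, j) * f j"
proof -
 have "(A * diagm p f) $$ (i, j) = (\<Sum>k<p. if k = j then A $$ (i, k) * f k else 0)"
  unfolding mult_mat_index[OF assms(1) diagm_carrier assms(2,3)]
  by (rule sum.cong) (auto simp: diagm_index assms(3))
 then show ?thesis using assms(3) by simp
qed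

lemma diagm_mult: "diagm p f * diagm p g = diagm p (\<lambda>i. f i * g i)"
proof (rule eq_matI)
 fix i j assume "i < dim_row (diagm p (\<lambda>i. f i * g i))" "j < dim_col (diagm p (\<lambda>i. f i * g i))"
 then have "i < p" "j < p" by (auto simp: diagm_def)
 then show "(diagm p f * diagm p g) $$ (i, j) = diagm p (\<lambda>i. f i * g i) $$ (i, j)"
  by (simp add: mult_diagm_index[OF diagm_carrier] diagm_index)
qed (auto simp: diagm_def)

text \<open>Functional calculus with fixed eigenvectors: one unitary serves all functions of a
  matrix. Complex values are allowed because resolvents and the test matrices built from
  \<open>hker\<close> have this form too.\<close>

definition spec :: "nat => complex mat => (nat => complex) => complex mat" where
 "spec p U f = U * diagm p f * mat_adjoint U"

abbreviation rspec :: "nat => complex mat => (nat => real) => complex mat" where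
 "rspec p U f \<equiv> spec p U (\<lambda>i. complex_of_real (f i))"

lemma spec_carrier [simp]: "U \<in> carrier_mat p p ==> spec p U f \<in> carrier_mat p p"
 unfolding spec_def by (rule mult_carrier_mat[OF mult_carrier_mat[OF _ diagm_carrier] mat_adjoint_carrier])

lemma spec_index:
 assumes "U \<in> carrier_mat p p" "i < p" "j < p"
 shows "spec p U f $$ (i, j) = (\<Sum>k<p. U $$ (i, k) * f k * cnj (U $$ (j, k)))"
 unfolding spec_def mult_mat_index[OF mult_carrier_mat[OF assms(1) diagm_carrier] mat_adjoint_carrier[OF assms(1)] assms(2,3)]
 by (rule sum.cong) (auto simp: mult_diagm_index[OF assms(1,2)] mat_adjoint_index[OF assms(1) _ assms(3)])

lemma spec_cong: "U \<in> carrier_mat p p ==> (\<And>i. i < p ==> f i = g i) ==> spec p U f = spec p U g"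
proof (rule eq_matI)
 assume U: "U \<in> carrier_mat p p" and eq: "\<And>i. i < p ==> f i = g i"
 fix i j assume "i < dim_row (spec p U g)" "j < dim_col (spec p U g)"
 then have "i < p" "j < p" using spec_carrier[OF U, of g] by auto
 then show "spec p U f $$ (i, j) = spec p U g $$ (i, j)" using eq by (simp add: spec_index[OF U])
next
 assume U: "U \<in> carrier_mat p p"
 show "dim_row (spec p U f) = dim_row (spec p U g)" "dim_col (spec p U f) = dim_col (spec p U g)"
  using spec_carrier[OF U, of f] spec_carrier[OF U, of g] by auto
qed

lemma spec_mult:
 assumes "unitary p U" shows "spec p U f * spec p U g = spec p U (\<lambda>i. f i * g i)"
proof -
 note U = unitaryD[OF assms]
 let ?F = "diagm p f" and ?G = "diagm p g"
 have F: "?F \<in> carrier_mat p p" and G: "?G \<in> carrier_mat p p" by simp_all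
 note UF = mult_carrier_mat[OF U(1) F] and UG = mult_carrier_mat[OF U(1) G]
 have "(U * ?F * mat_adjoint U) * (U * ?G * mat_adjoint U) = (U * ?F) * (mat_adjoint U * (U * ?G * mat_adjoint U))"
  by (rule assoc_mult_mat[OF UF U(2)]) (use UG U in auto)
 also have "mat_adjoint U * (U * ?G * mat_adjoint U) = (mat_adjoint U * (U * ?G)) * mat_adjoint U"
  by (rule assoc_mult_mat[OF U(2) UG U(2), symmetric])
 also have "mat_adjoint U * (U * ?G) = (mat_adjoint U * U) * ?G"
  by (rule assoc_mult_mat[OF U(2) U(1) G, symmetric])
 also have "... = ?G" unfolding U(3) by (rule left_mult_one_mat[OF G])
 also have "(U * ?F) * (?G * mat_adjoint U) = ((U * ?F) * ?G) * mat_adjoint U"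
  by (rule assoc_mult_mat[OF UF G U(2), symmetric])
 also have "(U * ?F) * ?G = U * (?F * ?G)" by (rule assoc_mult_mat[OF U(1) F G])
 finally show ?thesis unfolding spec_def diagm_mult .
qed

lemma spec_one: assumes "unitary p U" shows "spec p U (\<lambda>_. 1) = 1\<^sub>m p"
proof -
 note U = unitaryD[OF assms]
 have "diagm p (\<lambda>_. 1) = 1\<^sub>m p" by (rule eq_matI) (auto simp: diagm_def)
 then show ?thesis unfolding spec_def using U by simp
qed

lemma spec_diff: "U \<in> carrier_mat p p ==> spec p U f - spec p U g = spec p U (\<lambda>i. f i - g i)"
proof (rule eq_matI)
 assume U: "U \<in> carrier_mat p p"
 note c = spec_carrier[OF U, of f] spec_carrier[OF U, of g] spec_carrier[OF U, of "\<lambda>i. f i - g i"]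
 fix i j assume "i < dim_row (spec p U (\<lambda>i. f i - g i))" "j < dim_col (spec p U (\<lambda>i. f i - g i))"
 then have ij: "i < p" "j < p" using c by auto
 then have "(spec p U f - spec p U g) $$ (i, j) = spec p U f $$ (i, j) - spec p U g $$ (i, j)" using c by auto
 also have "... = spec p U (\<lambda>i. f i - g i) $$ (i, j)" using ij by (simp add: spec_index[OF U] sum_subtractf[symmetric] algebra_simps)
 finally show "(spec p U f - spec p U g) $$ (i, j) = spec p U (\<lambda>i. f i - g i) $$ (i, j)" .
next
 assume U: "U \<in> carrier_mat p p"
 show "dim_row (spec p U f - spec p U g) = dim_row (spec p U (\<lambda>i. f i - g i))"
  "dim_col (spec p U f - spec p U g) = dim_col (spec p U (\<lambda>i. f i - g i))"
  using spec_carrier[OF U, of g] spec_carrier[OF U, of "\<lambda>i. f i - g i"] by auto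
qed

lemma spec_smult: "U \<in> carrier_mat p p ==> a \<cdot>\<^sub>m spec p U f = spec p U (\<lambda>i. a * f i)"
proof (rule eq_matI)
 assume U: "U \<in> carrier_mat p p"
 note c = spec_carrier[OF U, of f] spec_carrier[OF U, of "\<lambda>i. a * f i"]
 fix i j assume "i < dim_row (spec p U (\<lambda>i. a * f i))" "j < dim_col (spec p U (\<lambda>i. a * f i))"
 then have ij: "i < p" "j < p" using c by auto
 then have "(a \<cdot>\<^sub>m spec p U f) $$ (i, j) = a * spec p U f $$ (i, j)" using c by auto
 also have "... = spec p U (\<lambda>i. a * f i) $$ (i, j)" using ij by (simp add: spec_index[OF U] sum_distrib_left mult_ac)
 finally show "(a \<cdot>\<^sub>m spec p U f) $$ (i, j) = spec p U (\<lambda>i. a * f i) $$ (i, j)" .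
next
 assume U: "U \<in> carrier_mat p p"
 show "dim_row (a \<cdot>\<^sub>m spec p U f) = dim_row (spec p U (\<lambda>i. a * f i))"
  "dim_col (a \<cdot>\<^sub>m spec p U f) = dim_col (spec p U (\<lambda>i. a * f i))"
  using spec_carrier[OF U, of f] spec_carrier[OF U, of "\<lambda>i. a * f i"] by auto
qed

lemma spec_adjoint: "U \<in> carrier_mat p p ==> mat_adjoint (spec p U f) = spec p U (\<lambda>i. cnj (f i))"
proof (rule eq_matI)
 assume U: "U \<in> carrier_mat p p"
 fix i j assume "i < dim_row (spec p U (\<lambda>i. cnj (f i)))" "j < dim_col (spec p U (\<lambda>i. cnj (f i)))"
 then have ij: "i < p" "j < p" using spec_carrier[OF U, of "\<lambda>i. cnj (f i)"] by auto
 then show "mat_adjoint (spec p U f) $$ (i, j) = spec p U (\<lambda>i. cnj (f i)) $$ (i, j)"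
  unfolding mat_adjoint_index[OF spec_carrier[OF U] ij] by (simp add: spec_index[OF U] mult_ac)
next
 assume U: "U \<in> carrier_mat p p"
 show "dim_row (mat_adjoint (spec p U f)) = dim_row (spec p U (\<lambda>i. cnj (f i)))"
  "dim_col (mat_adjoint (spec p U f)) = dim_col (spec p U (\<lambda>i. cnj (f i)))"
  using spec_carrier[OF U, of f] spec_carrier[OF U, of "\<lambda>i. cnj (f i)"] by auto
qed

lemma spec_trace: assumes "unitary p U" shows "mat_trace (spec p U f) = (\<Sum>i<p. f i)"
proof -
 note U = unitaryD[OF assms]
 have "mat_trace (spec p U f) = mat_trace (mat_adjoint U * (U * diagm p f))"
  unfolding spec_def by (rule mat_trace_mult_commute[of _ p p]) (use U in auto)
 also have "mat_adjoint U * (U * diagm p f) = diagm p f"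
  using assoc_mult_mat[OF U(2) U(1) diagm_carrier, of f] unfolding U(3) by (simp add: left_mult_one_mat[OF diagm_carrier])
 also have "mat_trace (diagm p f) = (\<Sum>i<p. f i)" by (simp add: mat_trace_carrier[OF diagm_carrier] diagm_index)
 finally show ?thesis .
qed

lemma spec_opb:
 assumes "unitary p U" "0 \<le> \<kappa>" "\<And>i. i < p ==> cmod (f i) \<le> \<kappa>" shows "opb p (spec p U f) \<kappa>"
 unfolding opb_def
proof (intro conjI ballI)
 note U = unitaryD[OF assms(1)]
 show "spec p U f \<in> carrier_mat p p" using U by simp
 fix v :: "complex vec" assume v: "v \<in> carrier_vec p"
 let ?w = "mat_adjoint U *v v"
 have w: "?w \<in> carrier_vec p" by (rule mult_mat_vec_carrier[OF U(2) v])
 have "spec p U f *v v = U *v (diagm p f *v ?w)"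
  unfolding spec_def assoc_mult_mat_vec[OF mult_carrier_mat[OF U(1) diagm_carrier] U(2) v]
  by (rule assoc_mult_mat_vec[OF U(1) diagm_carrier w])
 then have "nsq p (spec p U f *v v) = nsq p (diagm p f *v ?w)"
  using nsq_unitary[OF assms(1) mult_mat_vec_carrier[OF diagm_carrier w]] by simp
 also have "... = (\<Sum>i<p. (cmod (f i))\<^sup>2 * (cmod (?w $ i))\<^sup>2)"
 proof -
  have "(diagm p f *v ?w) $ i = f i * ?w $ i" if "i < p" for i
  proof -
   have "(diagm p f *v ?w) $ i = (\<Sum>k<p. if k = i then f k * ?w $ k else 0)"
    unfolding mult_mat_vec_index[OF diagm_carrier w that] by (rule sum.cong) (auto simp: diagm_index that)
   then show ?thesis using that by simp
  qed
  then show ?thesis by (simp add: nsq_def norm_mult power_mult_distrib)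
 qed
 also have "... \<le> (\<Sum>i<p. \<kappa>\<^sup>2 * (cmod (?w $ i))\<^sup>2)"
  using assms(2,3) by (intro sum_mono mult_right_mono power_mono) auto
 also have "... = \<kappa>\<^sup>2 * nsq p v"
  using nsq_unitary[OF unitary_adjoint[OF assms(1)] v] by (simp add: nsq_def sum_distrib_left[symmetric])
 finally show "nsq p (spec p U f *v v) \<le> \<kappa>\<^sup>2 * nsq p v" .
qed (use assms in auto)

text \<open>An eigenvector is completed to a basis. Gram-Schmidt keeps the first vector, and
  dividing by the lengths makes the result unitary.\<close>

lemma eigen_unitary_exists:
 assumes A: "A \<in> carrier_mat (Suc m) (Suc m)"
 shows "\<exists>W e. unitary (Suc m) W \<and> A *v col W 0 = e \<cdot>\<^sub>v col W 0"
proof -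
 let ?n = "Suc m"
 have "degree (char_poly A) = ?n" using degree_monic_char_poly[OF A] by simp
 then have "\<not> constant (poly (char_poly A))" by (simp add: constant_degree)
 then obtain e where "poly (char_poly A) e = 0" using fundamental_theorem_of_algebra by blast
 then have "eigenvalue A e" using eigenvalue_root_char_poly[OF A] by simp
 then obtain v where v: "v \<in> carrier_vec ?n" "v \<noteq> 0\<^sub>v ?n" "A *v v = e \<cdot>\<^sub>v v"
  using A by (auto simp: eigenvalue_def eigenvector_def)
 interpret cof_vec_space ?n "TYPE(complex)" .
 define b where "b = basis_completion v"
 define ws where "ws = gram_schmidt ?n b"
 note bc = basis_completion[OF v(1,2), folded b_def]
 from bc(6,7) obtain vs where bv: "b = v # vs" by (cases b) auto
 from gram_schmidt_result[OF bc(2) bc(4) bc(5) ws_def]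
 have ws: "set ws \<subseteq> carrier_vec ?n" "corthogonal ws" "length ws = ?n" using bc(6) by auto
 have hd: "hd ws = v" unfolding ws_def bv by (rule gram_schmidt_hd[OF v(1)])
 have wi: "ws ! i \<in> carrier_vec ?n" if "i < ?n" for i using ws that by auto
 have orth: "inn ?n (ws ! i) (ws ! j) = 0 \<longleftrightarrow> i \<noteq> j" if "i < ?n" "j < ?n" for i j
 proof -
  have "(ws ! i \<bullet>c ws ! j = 0) = (i \<noteq> j)" using ws(2) that unfolding corthogonal_def ws(3) by blast
  then show ?thesis by (simp only: inn_cscalar_prod[OF wi[OF that(1)] wi[OF that(2)]])
 qed
 define r where "r j = sqrt (nsq ?n (ws ! j))" for j
 have r: "0 < r j" if "j < ?n" for j
 proof -
  have "nsq ?n (ws ! j) \<noteq> 0" using orth[OF that that] by (simp add: inn_self)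
  then have "0 < nsq ?n (ws ! j)" using nsq_nonneg[of ?n "ws ! j"] by linarith
  then show ?thesis by (simp add: r_def)
 qed
 define W where "W = mat ?n ?n (\<lambda>(i, j). ws ! j $ i / of_real (r j))"
 have W: "W \<in> carrier_mat ?n ?n" by (simp add: W_def)
 have "mat_adjoint W * W = 1\<^sub>m ?n"
 proof (rule eq_matI)
  fix i j assume "i < dim_row (1\<^sub>m ?n)" "j < dim_col (1\<^sub>m ?n)"
  then have ij: "i < ?n" "j < ?n" by auto
  have "(mat_adjoint W * W) $$ (i, j) = (\<Sum>k<?n. cnj (W $$ (k, i)) * W $$ (k, j))"
   unfolding mult_mat_index[OF mat_adjoint_carrier[OF W] W ij] by (rule sum.cong) (auto simp: mat_adjoint_index[OF W ij(1)])
  also have "... = inn ?n (ws ! j) (ws ! i) / (of_real (r i) * of_real (r j))"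
   unfolding inn_def sum_divide_distrib by (rule sum.cong) (use ij in \<open>auto simp: W_def mult_ac\<close>)
  also have "... = 1\<^sub>m ?n $$ (i, j)"
  proof (cases "i = j")
   case True
   have "inn ?n (ws ! j) (ws ! j) = of_real (r j) * of_real (r j)"
    unfolding inn_self r_def of_real_mult[symmetric] by simp
   then show ?thesis using True r[OF ij(2)] ij by simp
  next
   case False
   then show ?thesis using orth[OF ij(2,1)] ij by simp
  qed
  finally show "(mat_adjoint W * W) $$ (i, j) = 1\<^sub>m ?n $$ (i, j)" .
 qed (use W in auto)
 then have U: "unitary ?n W" using W by (simp add: unitary_def)
 have "col W 0 = (1 / of_real (r 0)) \<cdot>\<^sub>v v"
 proof (rule eq_vecI)
  fix i assume "i < dim_vec ((1 / of_real (r 0)) \<cdot>\<^sub>v v)"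
  then have "i < ?n" using v by simp
  moreover have "ws ! 0 = v" using hd ws(3) by (cases ws) auto
  ultimately show "col W 0 $ i = ((1 / of_real (r 0)) \<cdot>\<^sub>v v) $ i" using v(1) by (simp add: W_def)
 qed (use v W in simp)
 then have "A *v col W 0 = e \<cdot>\<^sub>v col W 0"
  using mult_mat_vec[OF A v(1)] v by (simp add: smult_smult_assoc mult.commute)
 with U show ?thesis by blast
qed

text \<open>One eigenvector is split off. In the new basis the first column vanishes below the
  diagonal; Hermitian symmetry makes the first row vanish as well and the eigenvalue real, so a
  Hermitian block of size m remains.\<close>

theorem spectral_theorem:
 assumes "herm p S" shows "\<exists>U d. unitary p U \<and> S = rspec p U d"
 using assms
proof (induction p arbitrary: S)
 case 0
 then interpret herm 0 S .
 have "spec 0 (1\<^sub>m 0) (\<lambda>i. of_real 0) \<in> carrier_mat 0 0" by (rule spec_carrier) simp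
 then have "S = spec 0 (1\<^sub>m 0) (\<lambda>i. of_real 0)" using S unfolding carrier_mat_def by (intro eq_matI) simp_all
 moreover have "unitary 0 (1\<^sub>m 0)" by (auto simp: unitary_def)
 ultimately show ?case by (intro exI[of _ "1\<^sub>m 0"] exI[of _ "\<lambda>_. 0"]) simp
next
 case (Suc m)
 let ?n = "Suc m"
 interpret herm ?n S by fact
 obtain W e where W: "unitary ?n W" and ev: "S *v col W 0 = e \<cdot>\<^sub>v col W 0" using eigen_unitary_exists[OF S] by blast
 note Wc = unitaryD[OF W]
 define A where "A = mat_adjoint W * (S * W)"
 have SW: "S * W \<in> carrier_mat ?n ?n" by (rule mult_carrier_mat[OF S Wc(1)])
 have A: "A \<in> carrier_mat ?n ?n" unfolding A_def by (rule mult_carrier_mat[OF Wc(2) SW])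
 have Aadj: "mat_adjoint A = A"
  unfolding A_def mat_adjoint_mult[OF Wc(2) SW] mat_adjoint_mult[OF S Wc(1)] herm mat_adjoint_adjoint
  by (rule assoc_mult_mat[OF Wc(2) S Wc(1)])
 have Acnj: "cnj (A $$ (j, i)) = A $$ (i, j)" if "i < ?n" "j < ?n" for i j
  using mat_adjoint_index[OF A that] Aadj by simp
 have A0: "A $$ (i, 0) = (if i = 0 then e else 0)" if i: "i < ?n" for i
 proof -
  have "A $$ (i, 0) = (\<Sum>k<?n. mat_adjoint W $$ (i, k) * (S * W) $$ (k, 0))"
   unfolding A_def by (rule mult_mat_index[OF Wc(2) SW i]) simp
  also have "... = (\<Sum>k<?n. mat_adjoint W $$ (i, k) * (e * W $$ (k, 0)))"
  proof (rule sum.cong[OF refl])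
   fix k assume "k \<in> {..<?n}"
   then have k: "k < ?n" by simp
   have "(S * W) $$ (k, 0) = (S *v col W 0) $ k" using k S Wc(1) by simp
   then show "mat_adjoint W $$ (i, k) * (S * W) $$ (k, 0) = mat_adjoint W $$ (i, k) * (e * W $$ (k, 0))"
    using ev k Wc(1) by simp
  qed
  also have "... = e * (mat_adjoint W * W) $$ (i, 0)"
   unfolding mult_mat_index[OF Wc(2) Wc(1) i zero_less_Suc] by (simp add: sum_distrib_left mult_ac del: sum.lessThan_Suc)
  also have "... = (if i = 0 then e else 0)" unfolding Wc(3) using i by simp
  finally show ?thesis .
 qed
 have A0': "A $$ (0, i) = 0" if "i < ?n" "i \<noteq> 0" for i using Acnj[of 0 i] A0[of i] that by simp
 define B where "B = mat m m (\<lambda>(i, j). A $$ (Suc i, Suc j))"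
 have "herm m B"
 proof
  show B: "B \<in> carrier_mat m m" by (simp add: B_def)
  show "mat_adjoint B = B"
  proof (rule eq_matI)
   fix i j assume "i < dim_row B" "j < dim_col B"
   then have ij: "i < m" "j < m" by (auto simp: B_def)
   then show "mat_adjoint B $$ (i, j) = B $$ (i, j)" unfolding mat_adjoint_index[OF B ij] using Acnj[of "Suc i" "Suc j"] by (simp add: B_def)
  qed (auto simp: B_def)
 qed
 from Suc.IH[OF this] obtain V d where V: "unitary m V" "B = rspec m V d" by blast
 note Vc = unitaryD[OF V(1)]
 \<comment> \<open>The block sum of the number 1 and V.\<close>
 define V' where "V' = mat ?n ?n (\<lambda>(i, j). case (i, j) of (Suc i', Suc j') => V $$ (i', j') | (0, 0) => 1 | _ => 0)"
 define d' where "d' i = (case i of 0 => Re e | Suc j => d j)" for i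
 have V': "V' \<in> carrier_mat ?n ?n" by (simp add: V'_def)
 have V'i: "V' $$ (0, 0) = 1" "V' $$ (Suc i, 0) = 0" "V' $$ (0, Suc j) = 0" "V' $$ (Suc i, Suc j) = V $$ (i, j)"
  if "i < m" "j < m" for i j
  using that by (auto simp: V'_def)
 have V'00: "V' $$ (0, 0) = 1" by (simp add: V'_def)
 have V'U: "unitary ?n V'"
  unfolding unitary_def
 proof (intro conjI V' eq_matI)
  fix i j assume "i < dim_row (1\<^sub>m ?n)" "j < dim_col (1\<^sub>m ?n)"
  then have ij: "i < ?n" "j < ?n" by auto
  have "(mat_adjoint V' * V') $$ (i, j) = (\<Sum>k<?n. cnj (V' $$ (k, i)) * V' $$ (k, j))"
   unfolding mult_mat_index[OF mat_adjoint_carrier[OF V'] V' ij] by (rule sum.cong) (auto simp: mat_adjoint_index[OF V' ij(1)])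
  also have "... = cnj (V' $$ (0, i)) * V' $$ (0, j) + (\<Sum>k<m. cnj (V' $$ (Suc k, i)) * V' $$ (Suc k, j))"
   by (rule sum.lessThan_Suc_shift)
  also have "... = 1\<^sub>m ?n $$ (i, j)"
  proof (cases i; cases j)
   fix i' j' assume e: "i = Suc i'" "j = Suc j'"
   then have ij': "i' < m" "j' < m" using ij by auto
   have "(\<Sum>k<m. cnj (V $$ (k, i')) * V $$ (k, j')) = (mat_adjoint V * V) $$ (i', j')"
    unfolding mult_mat_index[OF Vc(2) Vc(1) ij'] by (rule sum.cong) (auto simp: mat_adjoint_index[OF Vc(1) ij'(1)])
   then have "(\<Sum>k<m. cnj (V $$ (k, i')) * V $$ (k, j')) = 1\<^sub>m m $$ (i', j')" unfolding Vc(3) .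
   then show ?thesis using e ij' V'i by simp
  qed (use ij V'i V'00 in auto)
  finally show "(mat_adjoint V' * V') $$ (i, j) = 1\<^sub>m ?n $$ (i, j)" .
 qed (use V' in auto)
 have AV: "A = spec ?n V' (\<lambda>i. complex_of_real (d' i))"
 proof (rule eq_matI)
  fix i j assume "i < dim_row (spec ?n V' (\<lambda>i. complex_of_real (d' i)))" "j < dim_col (spec ?n V' (\<lambda>i. complex_of_real (d' i)))"
  then have ij: "i < ?n" "j < ?n" using spec_carrier[OF V', of "\<lambda>i. complex_of_real (d' i)"] by auto
  have "spec ?n V' (\<lambda>i. complex_of_real (d' i)) $$ (i, j) = (\<Sum>k<?n. V' $$ (i, k) * of_real (d' k) * cnj (V' $$ (j, k)))"
   by (rule spec_index[OF V' ij])
  also have "... = V' $$ (i, 0) * of_real (d' 0) * cnj (V' $$ (j, 0)) + (\<Sum>k<m. V' $$ (i, Suc k) * of_real (d' (Suc k)) * cnj (V' $$ (j, Suc k)))"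
   by (rule sum.lessThan_Suc_shift)
  also have "... = A $$ (i, j)"
  proof (cases i; cases j)
   assume "i = 0" "j = 0"
   moreover have "of_real (Re e) = e" using Acnj[of 0 0] A0[of 0] by (simp add: complex_eq_iff)
   ultimately show ?thesis using V'i V'00 A0[of 0] by (simp add: d'_def)
  next
   fix i' j' assume e: "i = Suc i'" "j = Suc j'"
   then have ij': "i' < m" "j' < m" using ij by auto
   have "(\<Sum>k<m. V $$ (i', k) * of_real (d k) * cnj (V $$ (j', k))) = B $$ (i', j')"
    unfolding V(2) by (rule spec_index[OF Vc(1) ij', symmetric])
   also have "... = A $$ (i, j)" using ij' e by (simp add: B_def)
   finally show ?thesis using e ij' V'i by (simp add: d'_def)
  qed (use ij V'i V'00 A0 A0' in \<open>auto\<close>)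
  finally show "A $$ (i, j) = spec ?n V' (\<lambda>i. complex_of_real (d' i)) $$ (i, j)" by simp
 qed (use A spec_carrier[OF V', of "\<lambda>i. complex_of_real (d' i)"] in auto)
 have "S = W * A * mat_adjoint W"
 proof -
  have "W * A = (W * mat_adjoint W) * (S * W)" unfolding A_def by (rule assoc_mult_mat[OF Wc(1,2) SW, symmetric])
  also have "... = S * W" unfolding Wc(4) using SW by (rule left_mult_one_mat)
  finally have "W * A * mat_adjoint W = S * (W * mat_adjoint W)" using assoc_mult_mat[OF S Wc(1,2)] by simp
  then show ?thesis unfolding Wc(4) using S by simp
 qed
 also have "W * A * mat_adjoint W = spec ?n (W * V') (\<lambda>i. complex_of_real (d' i))"
 proof -
  let ?D = "diagm ?n (\<lambda>i. complex_of_real (d' i))"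
  have D: "?D \<in> carrier_mat ?n ?n" by simp
  note V'c = unitaryD[OF V'U]
  have "W * A * mat_adjoint W = W * ((V' * ?D) * mat_adjoint V') * mat_adjoint W" unfolding AV spec_def ..
  also have "W * ((V' * ?D) * mat_adjoint V') = (W * (V' * ?D)) * mat_adjoint V'"
   by (rule assoc_mult_mat[OF Wc(1) mult_carrier_mat[OF V' D] V'c(2), symmetric])
  also have "W * (V' * ?D) = (W * V') * ?D" by (rule assoc_mult_mat[OF Wc(1) V' D, symmetric])
  also have "(W * V') * ?D * mat_adjoint V' * mat_adjoint W = (W * V') * ?D * (mat_adjoint V' * mat_adjoint W)"
   by (rule assoc_mult_mat[OF mult_carrier_mat[OF mult_carrier_mat[OF Wc(1) V'] D] V'c(2) Wc(2)])
  finally show ?thesis unfolding spec_def mat_adjoint_mult[OF Wc(1) V'] .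
 qed
 finally show ?case using unitary_mult[OF W V'U] by blast
qed

section \<open>Perturbations of finite rank\<close>

lemma herm_outer_add:
 assumes "herm p S" "x \<in> carrier_vec p" "y \<in> carrier_vec p"
 shows "herm p (S + of_real e \<cdot>\<^sub>m outer p x x)" "herm p (S + of_real e \<cdot>\<^sub>m (outer p x y + outer p y x))"
proof -
 interpret herm p S by fact
 have S: "S \<in> carrier_mat p p" by (rule S)
 have Sij: "cnj (S $$ (j, i)) = S $$ (i, j)" if "i < p" "j < p" for i j
  using mat_adjoint_index[OF S that] herm by simp
 have *: "herm p (S + of_real e \<cdot>\<^sub>m M)" if M: "M \<in> carrier_mat p p" "\<And>i j. i < p ==> j < p ==> cnj (M $$ (j, i)) = M $$ (i, j)" for M
 proof
  let ?T = "S + of_real e \<cdot>\<^sub>m M"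
  show T: "?T \<in> carrier_mat p p" using S M by simp
  show "mat_adjoint ?T = ?T"
  proof (rule eq_matI)
   fix i j assume "i < dim_row ?T" "j < dim_col ?T"
   then have ij: "i < p" "j < p" using S M by auto
   show "mat_adjoint ?T $$ (i, j) = ?T $$ (i, j)"
    unfolding mat_adjoint_index[OF T ij] using S M(1) ij by (simp add: Sij M(2))
  qed (use T S M in auto)
 qed
 show "herm p (S + of_real e \<cdot>\<^sub>m outer p x x)" by (rule *) (auto simp: outer_index mult.commute)
 show "herm p (S + of_real e \<cdot>\<^sub>m (outer p x y + outer p y x))"
  by (rule *) (auto simp: outer_def mult.commute add.commute)
qed

context herm
begin

text \<open>The second resolvent identity. With u the new resolvent applied to v, one has v = (S -
  z) u + D u, to which the old resolvent is applied.\<close>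

lemma resolvent_diff_inn:
 assumes T: "herm p T" and z: "Im z \<noteq> 0" and D: "D \<in> carrier_mat p p" "T = S + D"
 shows "resolvent p T z - resolvent p S z = - (resolvent p S z * D * resolvent p T z)"
proof (rule mat_eq_vecI)
 interpret T: herm p T by fact
 note Q = resolvent(1)[OF z] and QT = T.resolvent(1)[OF z]
 show "resolvent p T z - resolvent p S z \<in> carrier_mat p p" using Q QT by auto
 show "- (resolvent p S z * D * resolvent p T z) \<in> carrier_mat p p" using Q QT D by auto
 fix v :: "complex vec" assume v: "v \<in> carrier_vec p"
 let ?u = "resolvent p T z *v v"
 have u: "?u \<in> carrier_vec p" using QT v by simp
 have "v = shift p T z *v ?u" using T.shift_resolvent_vec(1)[OF z v] by simp
 also have "... = shift p S z *v ?u + D *v ?u"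
 proof -
  have "T *v ?u = S *v ?u + D *v ?u" unfolding D(2) by (rule add_mult_distrib_mat_vec[OF S D(1)]) (use u D(2) in simp)
  moreover have "(a + b) - c = (a - c) + b" if "a \<in> carrier_vec p" "b \<in> carrier_vec p" "c \<in> carrier_vec p" for a b c :: "complex vec"
   using that by (intro eq_vecI) auto
  ultimately show ?thesis
   unfolding shift_mult_vec[OF T.S u] shift_mult_vec[OF S u] using S D(1) u by simp
 qed
 finally have "resolvent p S z *v v = resolvent p S z *v (shift p S z *v ?u + D *v ?u)" by (rule arg_cong)
 also have "... = ?u + resolvent p S z *v (D *v ?u)"
  unfolding mult_add_distrib_mat_vec[OF Q mult_mat_vec_carrier[OF shift_carrier[OF S] u] mult_mat_vec_carrier[OF D(1) u]]
   shift_resolvent_vec(2)[OF z u] ..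
 finally have e: "resolvent p S z *v v = ?u + resolvent p S z *v (D *v ?u)" .
 have a: "resolvent p S z *v (D *v ?u) \<in> carrier_vec p" using Q D u by simp
 have "(resolvent p T z - resolvent p S z) *v v = ?u - resolvent p S z *v v"
  by (rule minus_mult_distrib_mat_vec[OF QT Q v])
 also have "... = - (resolvent p S z *v (D *v ?u))" unfolding e using u a by (intro eq_vecI) auto
 also have "resolvent p S z *v (D *v ?u) = (resolvent p S z * D * resolvent p T z) *v v"
  unfolding assoc_mult_mat_vec[OF mult_carrier_mat[OF Q D(1)] QT v] assoc_mult_mat_vec[OF Q D(1) u] ..
 also have "- ((resolvent p S z * D * resolvent p T z) *v v) = (- (resolvent p S z * D * resolvent p T z)) *v v"
  using Q D QT v by (intro eq_vecI) auto
 finally show "(resolvent p T z - resolvent p S z) *v v = - (resolvent p S z * D * resolvent p T z) *v v" .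
qed

text \<open>The bound must contain neither e nor w. The change of the trace has modulus at most |e|
  \<kappa> |Q w| |Q' w|. Now Q' w = (1 - g) Q w with g = e <Q' w, w>, and |Im g| = |e| Im z |Q'
  w|^2, whence |e| |Q w| |Q' w| \<le> 1 / Im z.\<close>

lemma trace_rank_one:
 assumes z: "0 < Im z" and w: "w \<in> carrier_vec p" and N: "opb p N \<kappa>"
 shows "cmod (mat_trace (N * resolvent p (S + of_real e \<cdot>\<^sub>m outer p w w) z) - mat_trace (N * resolvent p S z)) \<le> \<kappa> / Im z"
proof -
 let ?T = "S + of_real e \<cdot>\<^sub>m outer p w w"
 let ?Q = "resolvent p S z" and ?Q' = "resolvent p ?T z"
 interpret T: herm p ?T using herm_outer_add(1)[OF herm_axioms w w] .
 have z': "Im z \<noteq> 0" using z by simp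
 note Q = resolvent(1)[OF z'] and Q' = T.resolvent(1)[OF z'] and Nc = opbD(1)[OF N]
 let ?a = "?Q' *v w" and ?b = "mat_adjoint ?Q *v w"
 have a: "?a \<in> carrier_vec p" using Q' w by simp
 define D where "D = of_real e \<cdot>\<^sub>m outer p w w"
 have D: "D \<in> carrier_mat p p" "?T = S + D" by (simp_all add: D_def)
 have Da: "D *v u = (of_real e * inn p u w) \<cdot>\<^sub>v w" if u: "u \<in> carrier_vec p" for u
 proof -
  have "D *v u = of_real e \<cdot>\<^sub>v (outer p w w *v u)" unfolding D_def using u by (intro eq_vecI) (auto simp: outer_def)
  then show ?thesis using u w by (simp add: outer_mult_vec smult_smult_assoc)
 qed
 define g where "g = of_real e * inn p ?a w"
 have diff: "?Q' - ?Q = - (?Q * D * ?Q')" by (rule resolvent_diff_inn[OF T.herm_axioms z' D])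
 have tr: "mat_trace (N * ?Q') - mat_trace (N * ?Q) = - (of_real e * inn p (N *v (?Q *v w)) (mat_adjoint ?Q' *v w))"
 proof -
  have "mat_trace (N * ?Q') - mat_trace (N * ?Q) = mat_trace (N * (?Q' - ?Q))"
   using mult_minus_distrib_mat[OF Nc Q' Q] mat_trace_diff[of "N * ?Q'" p "N * ?Q"] Nc Q Q' by simp
  also have "N * (?Q' - ?Q) = - (N * (?Q * D * ?Q'))"
   unfolding diff using Nc Q D(1) Q' by (intro uminus_mult_right_mat) auto
  also have "mat_trace ... = - mat_trace (N * (?Q * D * ?Q'))"
   using Nc Q D(1) Q' by (simp add: mat_trace_def sum_negf)
  also have "N * (?Q * D * ?Q') = (N * ?Q) * (D * ?Q')"
   using assoc_mult_mat[OF Nc Q, of "D * ?Q'" p] assoc_mult_mat[OF Q D(1) Q'] D(1) Q' by simp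
  also have "mat_trace ... = mat_trace ((D * ?Q') * (N * ?Q))"
   by (rule mat_trace_mult_commute[of _ p p]) (use Nc Q D(1) Q' in auto)
  also have "(D * ?Q') * (N * ?Q) = D * (?Q' * N * ?Q)"
   using assoc_mult_mat[OF D(1) Q', of "N * ?Q" p] assoc_mult_mat[OF Q' Nc Q] Nc Q by simp
  also have "mat_trace ... = mat_trace ((?Q' * N * ?Q) * D)"
   by (rule mat_trace_mult_commute[of _ p p]) (use Nc Q D(1) Q' in auto)
  also have "(?Q' * N * ?Q) * D = of_real e \<cdot>\<^sub>m ((?Q' * N * ?Q) * outer p w w)"
   unfolding D_def by (rule mult_smult_distrib[of _ p p _ p]) (use Nc Q Q' in auto)
  also have "mat_trace ... = of_real e * mat_trace ((?Q' * N * ?Q) * outer p w w)"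
   by (rule mat_trace_smult[OF mult_carrier_mat[OF mult_carrier_mat[OF mult_carrier_mat[OF Q' Nc] Q] outer_carrier]])
  also have "mat_trace ((?Q' * N * ?Q) * outer p w w) = inn p ((?Q' * N * ?Q) *v w) w"
   by (rule mat_trace_mult_outer) (use Nc Q Q' w in auto)
  also have "(?Q' * N * ?Q) *v w = ?Q' *v (N *v (?Q *v w))"
   unfolding assoc_mult_mat_vec[OF mult_carrier_mat[OF Q' Nc] Q w]
   by (rule assoc_mult_mat_vec[OF Q' Nc mult_mat_vec_carrier[OF Q w]])
  also have "inn p ... w = inn p (N *v (?Q *v w)) (mat_adjoint ?Q' *v w)"
   by (rule inn_adjoint[OF Q']) (use Nc Q w in auto)
  finally show ?thesis .
 qed
 have Qw: "?a = (1 - g) \<cdot>\<^sub>v (?Q *v w)"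
 proof -
  have b: "?Q *v w \<in> carrier_vec p" using Q w by simp
  have "?a - ?Q *v w = (?Q' - ?Q) *v w" by (rule minus_mult_distrib_mat_vec[OF Q' Q w, symmetric])
  also have "... = - ((?Q * D * ?Q') *v w)"
   unfolding diff using Q D(1) Q' w by (intro eq_vecI) auto
  also have "(?Q * D * ?Q') *v w = ?Q *v (D *v ?a)"
   unfolding assoc_mult_mat_vec[OF mult_carrier_mat[OF Q D(1)] Q' w] by (rule assoc_mult_mat_vec[OF Q D(1) a])
  also have "D *v ?a = g \<cdot>\<^sub>v w" unfolding g_def by (rule Da[OF a])
  also have "?Q *v (g \<cdot>\<^sub>v w) = g \<cdot>\<^sub>v (?Q *v w)" by (rule mult_mat_vec[OF Q w])
  finally have eq: "?a - ?Q *v w = - (g \<cdot>\<^sub>v (?Q *v w))" .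
  have "a = (1 - g) \<cdot>\<^sub>v b" if e: "a - b = - (g \<cdot>\<^sub>v b)" and c: "a \<in> carrier_vec p" "b \<in> carrier_vec p" for a b
  proof (rule eq_vecI)
   fix i assume "i < dim_vec ((1 - g) \<cdot>\<^sub>v b)"
   then have i: "i < p" using c by simp
   have "(a - b) $ i = (- (g \<cdot>\<^sub>v b)) $ i" by (simp only: e)
   then show "a $ i = ((1 - g) \<cdot>\<^sub>v b) $ i" using i c by (simp add: algebra_simps)
  qed (use c in simp)
  from this[OF eq a b] show ?thesis .
 qed
 define q q' where "q = sqrt (nsq p (?Q *v w))" and "q' = sqrt (nsq p ?a)"
 have q0: "0 \<le> q" "0 \<le> q'" "q'\<^sup>2 = nsq p ?a" by (simp_all add: q_def q'_def)
 have "q' = cmod (1 - g) * q"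
  unfolding q_def q'_def by (subst Qw, subst nsq_smult) (use Q w in \<open>simp_all add: real_sqrt_mult\<close>)
 moreover have "\<bar>e\<bar> * Im z * q'\<^sup>2 \<le> cmod (1 - g)"
 proof -
  have "Im (1 - g) = - e * (Im z * nsq p ?a)" unfolding g_def using T.Im_inn_resolvent[OF z' w] by simp
  then have "\<bar>Im (1 - g)\<bar> = \<bar>e\<bar> * Im z * q'\<^sup>2" using z q0(3) by (simp add: abs_mult)
  then show ?thesis using abs_Im_le_cmod[of "1 - g"] by simp
 qed
 \<comment> \<open>Multiplying |e| Im z q'^2 \<le> |1 - g| by q turns the right side into q', and
   one factor q' cancels.\<close>
 ultimately have "\<bar>e\<bar> * Im z * q'\<^sup>2 * q \<le> q'" using q0 by (simp add: mult_right_mono)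
 then have "(\<bar>e\<bar> * Im z * q' * q) * q' \<le> 1 * q'" by (simp add: power2_eq_square mult_ac)
 then have bnd: "\<bar>e\<bar> * Im z * q' * q \<le> 1"
  using q0(2) mult_right_le_imp_le[of "\<bar>e\<bar> * Im z * q' * q" q' 1] by (cases "q' = 0") auto
 have "cmod (mat_trace (N * ?Q') - mat_trace (N * ?Q)) = \<bar>e\<bar> * cmod (inn p (N *v (?Q *v w)) (mat_adjoint ?Q' *v w))"
  unfolding tr by (simp add: norm_mult)
 also have "... \<le> \<bar>e\<bar> * (\<kappa> * q * q')"
  using opb_inn[OF N, of "?Q *v w" "mat_adjoint ?Q' *v w"] Q w
  by (intro mult_left_mono) (auto simp: q_def q'_def T.nsq_resolvent_adjoint[OF z' w])
 also have "... = \<kappa> * (\<bar>e\<bar> * Im z * q' * q) / Im z" using z by (simp add: field_simps)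
 also have "... \<le> \<kappa> * 1 / Im z" using bnd opbD(2)[OF N] z by (intro divide_right_mono mult_left_mono) auto
 finally show ?thesis by simp
qed

text \<open>Polarisation: \<open>outer p x y + outer p y x\<close> is half the difference of the
  rank-one matrices of x + y and x - y, so the rank-one bound applies twice.\<close>

lemma trace_rank_two:
 assumes z: "0 < Im z" and x: "x \<in> carrier_vec p" and y: "y \<in> carrier_vec p" and N: "opb p N \<kappa>"
 shows "cmod (mat_trace (N * resolvent p (S + of_real e \<cdot>\<^sub>m (outer p x y + outer p y x)) z) - mat_trace (N * resolvent p S z)) \<le> 2 * \<kappa> / Im z"
proof -
 let ?S1 = "S + of_real (e / 2) \<cdot>\<^sub>m outer p (x + y) (x + y)"
 have xy: "x + y \<in> carrier_vec p" "x - y \<in> carrier_vec p" using x y by auto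
 interpret S1: herm p ?S1 using herm_outer_add(1)[OF herm_axioms xy(1) xy(1)] .
 have eq: "S + of_real e \<cdot>\<^sub>m (outer p x y + outer p y x) = ?S1 + of_real (- e / 2) \<cdot>\<^sub>m outer p (x - y) (x - y)"
  by (rule eq_matI) (use S x y in \<open>auto simp: outer_def field_simps\<close>)
 have "cmod (mat_trace (N * resolvent p (?S1 + of_real (- e / 2) \<cdot>\<^sub>m outer p (x - y) (x - y)) z) - mat_trace (N * resolvent p ?S1 z)) \<le> \<kappa> / Im z"
  by (rule S1.trace_rank_one[OF z xy(2) N])
 moreover have "cmod (mat_trace (N * resolvent p ?S1 z) - mat_trace (N * resolvent p S z)) \<le> \<kappa> / Im z"
  by (rule trace_rank_one[OF z xy(1) N])
 ultimately have "cmod (mat_trace (N * resolvent p (?S1 + of_real (- e / 2) \<cdot>\<^sub>m outer p (x - y) (x - y)) z) - mat_trace (N * resolvent p S z)) \<le> \<kappa> / Im z + \<kappa> / Im z"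
  using norm_triangle_le[of "_ - _" "_ - _"] by (smt (verit) norm_triangle_ineq diff_add_cancel add_diff_eq)
 then show ?thesis unfolding eq by simp
qed

end

section \<open>Functional calculus and positive square roots\<close>

lemma spec_conj:
 assumes "unitary p U" shows "mat_adjoint U * spec p U f = diagm p f * mat_adjoint U" "spec p U f * U = U * diagm p f"
proof -
 note U = unitaryD[OF assms]
 have D: "diagm p f \<in> carrier_mat p p" by simp
 have "mat_adjoint U * (U * diagm p f * mat_adjoint U) = (mat_adjoint U * (U * diagm p f)) * mat_adjoint U"
  by (rule assoc_mult_mat[OF U(2) mult_carrier_mat[OF U(1) D] U(2), symmetric])
 also have "mat_adjoint U * (U * diagm p f) = (mat_adjoint U * U) * diagm p f"
  by (rule assoc_mult_mat[OF U(2,1) D, symmetric])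
 finally show "mat_adjoint U * spec p U f = diagm p f * mat_adjoint U"
  unfolding spec_def U(3) left_mult_one_mat[OF D] .
 have "(U * diagm p f * mat_adjoint U) * U = (U * diagm p f) * (mat_adjoint U * U)"
  by (rule assoc_mult_mat[OF mult_carrier_mat[OF U(1) D] U(2,1)])
 then show "spec p U f * U = U * diagm p f"
  unfolding spec_def U(3) right_mult_one_mat[OF mult_carrier_mat[OF U(1) D]] .
qed

text \<open>The product X of the adjoint of V with U intertwines the two diagonal matrices: (f i - g
  j) X_ij = 0. Wherever X_ij is not 0 the hypothesis gives f' i = g' j, so X intertwines the new
  diagonal matrices too.\<close>

lemma spec_calculus:
 assumes V: "unitary p V" and U: "unitary p U" and eq: "spec p V f = spec p U g"
  and fg: "\<And>i j. i < p ==> j < p ==> f i = g j ==> f' i = g' j"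
 shows "spec p V f' = spec p U g'"
proof -
 note Vc = unitaryD[OF V] and Uc = unitaryD[OF U]
 define X where "X = mat_adjoint V * U"
 have X: "X \<in> carrier_mat p p" unfolding X_def by (rule mult_carrier_mat[OF Vc(2) Uc(1)])
 have D: "diagm p h \<in> carrier_mat p p" for h by simp
 have left: "mat_adjoint V * spec p V h * U = diagm p h * X" for h
  unfolding X_def spec_conj(1)[OF V] by (rule assoc_mult_mat[OF D Vc(2) Uc(1)])
 have right: "mat_adjoint V * spec p U h * U = X * diagm p h" for h
  unfolding X_def assoc_mult_mat[OF Vc(2) spec_carrier[OF Uc(1)] Uc(1)] spec_conj(2)[OF U]
  by (rule assoc_mult_mat[OF Vc(2) Uc(1) D, symmetric])
 have dX: "(diagm p h * X) $$ (i, j) = h i * X $$ (i, j)" if "i < p" "j < p" for h i j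
 proof -
  have "(diagm p h * X) $$ (i, j) = (\<Sum>k<p. if k = i then h i * X $$ (k, j) else 0)"
   unfolding mult_mat_index[OF D X that] by (rule sum.cong) (auto simp: diagm_index that)
  then show ?thesis using that by simp
 qed
 have "diagm p f' * X = X * diagm p g'"
 proof (rule eq_matI)
  fix i j assume "i < dim_row (X * diagm p g')" "j < dim_col (X * diagm p g')"
  then have ij: "i < p" "j < p" using X by (auto simp: diagm_def)
  have "f i * X $$ (i, j) = X $$ (i, j) * g j"
   using dX[OF ij, of f] mult_diagm_index[OF X ij, of g] left[of f] right[of g] eq by metis
  then have "X $$ (i, j) = 0 \<or> f i = g j" by (auto simp: mult.commute)
  then show "(diagm p f' * X) $$ (i, j) = (X * diagm p g') $$ (i, j)"
   unfolding dX[OF ij] mult_diagm_index[OF X ij] using fg[OF ij] by auto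
 qed (use X in \<open>auto simp: diagm_def\<close>)
 then have e: "mat_adjoint V * spec p V f' * U = mat_adjoint V * spec p U g' * U" unfolding left right .
 have cancel: "V * (mat_adjoint V * M * U) * mat_adjoint U = M" if M: "M \<in> carrier_mat p p" for M
 proof -
  have "V * (mat_adjoint V * M * U) = (V * (mat_adjoint V * M)) * U"
   by (rule assoc_mult_mat[OF Vc(1) mult_carrier_mat[OF Vc(2) M] Uc(1), symmetric])
  also have "V * (mat_adjoint V * M) = M"
   unfolding assoc_mult_mat[OF Vc(1,2) M, symmetric] Vc(4) by (rule left_mult_one_mat[OF M])
  also have "M * U * mat_adjoint U = M"
   unfolding assoc_mult_mat[OF M Uc(1,2)] Uc(4) by (rule right_mult_one_mat[OF M])
  finally show ?thesis .
 qed
 show ?thesis using cancel[OF spec_carrier[OF Vc(1), of f']] cancel[OF spec_carrier[OF Uc(1), of g']] unfolding e by metis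
qed

lemma spec_quadratic:
 assumes "unitary p U" "v \<in> carrier_vec p"
 shows "inn p (spec p U f *v v) v = (\<Sum>i<p. f i * of_real ((cmod ((mat_adjoint U *v v) $ i))\<^sup>2))"
proof -
 note U = unitaryD[OF assms(1)]
 let ?w = "mat_adjoint U *v v"
 have w: "?w \<in> carrier_vec p" by (rule mult_mat_vec_carrier[OF U(2) assms(2)])
 have "spec p U f *v v = U *v (diagm p f *v ?w)"
  unfolding spec_def assoc_mult_mat_vec[OF mult_carrier_mat[OF U(1) diagm_carrier] U(2) assms(2)]
  by (rule assoc_mult_mat_vec[OF U(1) diagm_carrier w])
 then have "inn p (spec p U f *v v) v = inn p (diagm p f *v ?w) ?w"
  using inn_adjoint[OF U(1) mult_mat_vec_carrier[OF diagm_carrier w] assms(2)] by simp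
 also have "... = (\<Sum>i<p. f i * of_real ((cmod (?w $ i))\<^sup>2))"
  unfolding inn_def
 proof (rule sum.cong[OF refl])
  fix i assume "i \<in> {..<p}"
  then have i: "i < p" by simp
  have "(diagm p f *v ?w) $ i = (\<Sum>k<p. if k = i then f k * ?w $ k else 0)"
   unfolding mult_mat_vec_index[OF diagm_carrier w i] by (rule sum.cong) (auto simp: diagm_index i)
  then have "(diagm p f *v ?w) $ i = f i * ?w $ i" using i by simp
  then show "(diagm p f *v ?w) $ i * cnj (?w $ i) = f i * of_real ((cmod (?w $ i))\<^sup>2)"
   by (simp only: mult.assoc complex_norm_square)
 qed
 finally show ?thesis .
qed

lemma psd_herm: "psd p A ==> herm p A"
 by (simp add: psd_def herm_def)

lemma psd_spec:
 assumes U: "unitary p U" and l: "\<And>i. i < p ==> 0 \<le> l i" shows "psd p (rspec p U l)"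
 unfolding psd_def
proof (intro conjI ballI)
 note Uc = unitaryD[OF U]
 let ?A = "rspec p U l"
 show A: "?A \<in> carrier_mat p p" by (rule spec_carrier[OF Uc(1)])
 show "mat_adjoint ?A = ?A" by (simp add: spec_adjoint[OF Uc(1)])
 fix v :: "complex vec" assume v: "v \<in> carrier_vec p"
 have "(?A *v v) \<bullet>c v = inn p (?A *v v) v" by (rule inn_cscalar_prod[OF mult_mat_vec_carrier[OF A v] v])
 also have "... = of_real (\<Sum>i<p. l i * (cmod ((mat_adjoint U *v v) $ i))\<^sup>2)"
  unfolding spec_quadratic[OF U v] by simp
 finally show "0 \<le> Re ((?A *v v) \<bullet>c v)" using l by (simp only: Re_complex_of_real) (auto intro!: sum_nonneg)
qed

theorem psd_spectral:
 assumes "psd p A" shows "\<exists>U l. unitary p U \<and> (\<forall>i<p. 0 \<le> l i) \<and> A = rspec p U l"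
proof -
 obtain U l where U: "unitary p U" and A: "A = rspec p U l" using spectral_theorem[OF psd_herm[OF assms]] by blast
 note Uc = unitaryD[OF U]
 have "0 \<le> l i" if i: "i < p" for i
 proof -
  have e: "unit_vec p i \<in> carrier_vec p" by simp
  let ?v = "U *v unit_vec p i"
  have v: "?v \<in> carrier_vec p" by (rule mult_mat_vec_carrier[OF Uc(1) e])
  have w: "mat_adjoint U *v ?v = unit_vec p i"
   unfolding assoc_mult_mat_vec[OF Uc(2,1) e, symmetric] Uc(3) by (rule one_mult_mat_vec[OF e])
  have "(\<Sum>k<p. complex_of_real (l k) * of_real ((cmod (unit_vec p i $ k))\<^sup>2)) = (\<Sum>k<p. if k = i then complex_of_real (l k) else 0)"
   by (rule sum.cong) (auto simp: i)
  then have "inn p (A *v ?v) ?v = of_real (l i)"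
   unfolding A spec_quadratic[OF U v] w using i by simp
  moreover have "A \<in> carrier_mat p p" using assms by (simp add: psd_def)
  ultimately have "(A *v ?v) \<bullet>c ?v = of_real (l i)" using inn_cscalar_prod[OF mult_mat_vec_carrier[OF _ v] v] by simp
  moreover have "0 \<le> Re ((A *v ?v) \<bullet>c ?v)" using assms v unfolding psd_def by blast
  ultimately show ?thesis by simp
 qed
 with U A show ?thesis by blast
qed

text \<open>A psd root B with eigenvalues b gives a second diagonalisation of its square, with
  eigenvalues b^2. Taking roots in both diagonalisations gives the same matrix, so the description
  in \<open>psd_sqrt\<close> is satisfied by exactly one matrix.\<close>

theorem psd_sqrt_spec:
 assumes U: "unitary p U" and l: "\<And>i. i < p ==> 0 \<le> l i"
 shows "psd_sqrt (rspec p U l) = rspec p U (\<lambda>i. sqrt (l i))"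
proof -
 note Uc = unitaryD[OF U]
 let ?A = "rspec p U l" and ?B = "rspec p U (\<lambda>i. sqrt (l i))"
 have dim: "dim_row ?A = p" using spec_carrier[OF Uc(1)] by auto
 show ?thesis
  unfolding psd_sqrt_def dim
 proof (rule the_equality)
  have "?B * ?B = spec p U (\<lambda>i. complex_of_real (sqrt (l i)) * complex_of_real (sqrt (l i)))" by (rule spec_mult[OF U])
  also have "... = ?A" using l by (intro spec_cong[OF Uc(1)]) (simp flip: of_real_mult)
  finally show "psd p ?B \<and> ?B * ?B = ?A" using psd_spec[OF U, of "\<lambda>i. sqrt (l i)"] l by simp
 next
  fix B assume B: "psd p B \<and> B * B = ?A"
  then obtain V b where V: "unitary p V" "\<And>i. i < p ==> 0 \<le> b i" "B = rspec p V b"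
   using psd_spectral by blast
  show "B = ?B"
   unfolding V(3)
  proof (rule spec_calculus[OF V(1) U])
   show "spec p V (\<lambda>i. complex_of_real (b i) * complex_of_real (b i)) = ?A"
    using B unfolding V(3) spec_mult[OF V(1)] by blast
   fix i j assume ij: "i < p" "j < p" and "complex_of_real (b i) * complex_of_real (b i) = complex_of_real (l j)"
   then have "b i * b i = l j" by (simp flip: of_real_mult)
   then show "complex_of_real (b i) = complex_of_real (sqrt (l j))" using V(2)[OF ij(1)] real_sqrt_abs2[of "b i"] by simp
  qed
 qed
qed

section \<open>Empirical spectral distributions\<close>

lemma proots_linear_factors: "proots (\<Prod>a\<leftarrow>as. [:- a, 1:]) = mset (as :: complex list)"
proof (induction as)
 case (Cons a as)
 have "(\<Prod>a\<leftarrow>as. [:- a, 1:]) \<noteq> 0" by (auto simp: prod_list_zero_iff)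
 then show ?case using Cons by (simp add: proots_mult del: mult_pCons_left)
qed simp

lemma char_poly_spec:
 assumes "unitary p U" shows "char_poly (spec p U f) = (\<Prod>a\<leftarrow>map f [0..<p]. [:- a, 1:])"
proof -
 note U = unitaryD[OF assms]
 have "similar_mat_wit (spec p U f) (diagm p f) U (mat_adjoint U)"
  by (rule similar_mat_witI[OF U(4,3) _ spec_carrier[OF U(1)] diagm_carrier U(1,2)]) (simp add: spec_def)
 then have "char_poly (spec p U f) = char_poly (diagm p f)" by (intro char_poly_similar) (auto simp: similar_mat_def)
 also have "... = (\<Prod>a\<leftarrow>diag_mat (diagm p f). [:- a, 1:])"
  by (rule char_poly_upper_triangular[OF diagm_carrier]) (auto simp: diagm_def)
 also have "diag_mat (diagm p f) = map f [0..<p]" by (auto simp: diag_mat_def diagm_def)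
 finally show ?thesis .
qed

text \<open>The measure behind an empirical spectral distribution, parametrised by a list of
  eigenvalues so that integrals are averages over the indices.\<close>

definition empirical :: "nat => (nat => real) => real measure" where
 "empirical p d = distr (uniform_count_measure {..<p}) borel d"

lemma empirical_real_distribution: assumes "0 < p" shows "real_distribution (empirical p d)"
proof -
 interpret prob_space "uniform_count_measure {..<p}" by (rule prob_space_uniform_count_measure) (use assms in auto)
 show ?thesis unfolding empirical_def by (rule real_distribution_distr) (simp add: uniform_count_measure_def measurable_point_measure_eq1)
qed

lemma integral_empirical:
 fixes f :: "real => 'b::{banach, second_countable_topology}"
 assumes "0 < p" "f \<in> borel_measurable borel"
 shows "(LINT x|empirical p d. f x) = (\<Sum>i<p. f (d i)) /\<^sub>R real p"
proof -
 have "(LINT x|empirical p d. f x) = (LINT i|uniform_count_measure {..<p}. f (d i))"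
  unfolding empirical_def using assms(2) by (intro integral_distr) (simp_all add: uniform_count_measure_def measurable_point_measure_eq1)
 also have "... = (\<Sum>i<p. f (d i)) /\<^sub>R real p"
  unfolding uniform_count_measure_def by (subst lebesgue_integral_point_measure_finite) (auto simp: scaleR_sum_right inverse_eq_divide)
 finally show ?thesis .
qed

lemma esd_spec:
 assumes "unitary p U" "0 < p" shows "esd (rspec p U d) = cdf (empirical p d)"
proof
 fix x
 have dim: "dim_row (rspec p U d) = p" using spec_carrier[OF unitaryD(1)[OF assms(1)]] by auto
 have "size {#l \<in># mset (map (\<lambda>i. complex_of_real (d i)) [0..<p]). Re l \<le> x#} = card {i. i < p \<and> d i \<le> x}"
 proof -
  have "mset (map (\<lambda>i. complex_of_real (d i)) [0..<p]) = image_mset (\<lambda>i. complex_of_real (d i)) (mset_set {..<p})"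
   by (simp add: lessThan_atLeast0)
  also have "{#l \<in># .... Re l \<le> x#} = image_mset (\<lambda>i. complex_of_real (d i)) {#i \<in># mset_set {..<p}. d i \<le> x#}"
   by (simp add: filter_mset_image_mset)
  also have "size ... = card {i \<in> {..<p}. d i \<le> x}" by (simp add: filter_mset_mset_set)
  finally show ?thesis by simp
 qed
 then have "esd (rspec p U d) x = real (card {i. i < p \<and> d i \<le> x}) / real p"
  unfolding esd_def char_poly_spec[OF assms(1)] proots_linear_factors dim by simp
 also have "... = cdf (empirical p d) x"
 proof -
  interpret real_distribution "empirical p d" by (rule empirical_real_distribution[OF assms(2)])
  have "cdf (empirical p d) x = (LINT y|empirical p d. indicator {..x} y)" by (simp add: cdf_def)
  also have "... = (\<Sum>i<p. indicator {..x} (d i)) /\<^sub>R real p" by (rule integral_empirical[OF assms(2)]) simp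
  also have "(\<Sum>i<p. indicator {..x} (d i)) = (\<Sum>i\<in>{i. i < p \<and> d i \<le> x}. 1 :: real)"
   by (rule sum.mono_neutral_cong_right) (auto simp: indicator_def)
  finally show ?thesis by (simp add: field_simps)
 qed
 finally show "esd (rspec p U d) x = cdf (empirical p d) x" .
qed

lemma resolvent_spec:
 assumes U: "unitary p U" and z: "Im z \<noteq> 0"
 shows "resolvent p (rspec p U d) z = spec p U (\<lambda>i. 1 / (complex_of_real (d i) - z))"
proof -
 note Uc = unitaryD[OF U]
 have nz: "complex_of_real (d i) - z \<noteq> 0" for i using z by (auto simp: complex_eq_iff)
 have sh: "shift p (rspec p U d) z = spec p U (\<lambda>i. complex_of_real (d i) - z)"
  unfolding shift_def spec_one[OF U, symmetric] spec_smult[OF Uc(1)] spec_diff[OF Uc(1)] by simp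
 have "spec p U (\<lambda>i. complex_of_real (d i) - z) * spec p U (\<lambda>i. 1 / (complex_of_real (d i) - z)) = 1\<^sub>m p"
  unfolding spec_mult[OF U] using nz by (simp add: spec_one[OF U])
 then show ?thesis unfolding resolvent_def sh by (rule minv_unique(2)[OF spec_carrier[OF Uc(1)] spec_carrier[OF Uc(1)]])
qed

lemma stieltjes_empirical:
 assumes U: "unitary p U" and p: "0 < p" and z: "0 < Im z"
 shows "stieltjes (empirical p d) z = mat_trace (resolvent p (rspec p U d) z) / of_nat p"
proof -
 have "stieltjes (empirical p d) z = (\<Sum>i<p. 1 / (complex_of_real (d i) - z)) /\<^sub>R real p"
  unfolding stieltjes_def by (rule integral_empirical[OF p]) measurable
 also have "... = mat_trace (resolvent p (rspec p U d) z) / of_nat p"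
  using z by (simp add: resolvent_spec[OF U] spec_trace[OF U] scaleR_conv_of_real divide_inverse mult.commute)
 finally show ?thesis .
qed

section \<open>The anticommutator as a function of its columns\<close>

definition Zm :: "nat => nat => (nat => nat \<times> nat => complex) => nat => complex mat" where
 "Zm p n w k = mat p n (\<lambda>(i, j). w j (k, i))"

text \<open>In \<open>w j (k, i)\<close> the column is j, the matrix is the first or second for k =
  0, 1, and the row is i. The column index comes first because columns are the independent blocks
  that are revealed or removed as a whole.\<close>

definition colv :: "nat => (nat \<times> nat => complex) => nat => complex vec" where
 "colv p u k = vec p (\<lambda>i. u (k, i))"

abbreviation xcol :: "nat => complex mat => (nat => nat \<times> nat => complex) => nat => nat => complex vec" where
 "xcol p B w j k \<equiv> B *v colv p (w j) k"

definition Smat :: "nat => nat => complex mat => (nat => nat \<times> nat => complex) => complex mat" where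
 "Smat p n B w = mat p p (\<lambda>(a, b). (\<Sum>j<n. (xcol p B w j 0) $ a * cnj ((xcol p B w j 1) $ b)
   + (xcol p B w j 1) $ a * cnj ((xcol p B w j 0) $ b)) / of_nat n)"

lemma smult_mat_mult_vec:
 assumes "(M :: complex mat) \<in> carrier_mat p q" "v \<in> carrier_vec q" shows "(a \<cdot>\<^sub>m M) *v v = a \<cdot>\<^sub>v (M *v v)"
 using assms by (intro eq_vecI) auto

lemma colv_carrier [simp]: "colv p u k \<in> carrier_vec p"
 by (simp add: colv_def)

lemma Smat_carrier [simp]: "Smat p n B w \<in> carrier_mat p p"
 by (simp add: Smat_def)

lemma Smat_index:
 "a < p ==> b < p ==> Smat p n B w $$ (a, b) = (\<Sum>j<n. (xcol p B w j 0) $ a * cnj ((xcol p B w j 1) $ b)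
   + (xcol p B w j 1) $ a * cnj ((xcol p B w j 0) $ b)) / of_nat n"
 by (simp add: Smat_def)

lemma Smat_herm: "herm p (Smat p n B w)"
proof
 show "mat_adjoint (Smat p n B w) = Smat p n B w"
 proof (rule eq_matI)
  fix i j assume "i < dim_row (Smat p n B w)" "j < dim_col (Smat p n B w)"
  then have ij: "i < p" "j < p" by (auto simp: Smat_def)
  show "mat_adjoint (Smat p n B w) $$ (i, j) = Smat p n B w $$ (i, j)"
   unfolding mat_adjoint_index[OF Smat_carrier ij] Smat_index[OF ij] Smat_index[OF ij(2,1)]
   by (simp add: mult.commute add.commute)
 qed (auto simp: Smat_def)
qed simp

lemma Zm_mult_index:
 assumes "B \<in> carrier_mat p p" "i < p" "j < n"
 shows "(B * Zm p n w k) $$ (i, j) = (xcol p B w j k) $ i"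
proof -
 have Z: "Zm p n w k \<in> carrier_mat p n" by (simp add: Zm_def)
 have "(\<Sum>l<p. B $$ (i, l) * Zm p n w k $$ (l, j)) = (\<Sum>l<p. B $$ (i, l) * colv p (w j) k $ l)"
  by (rule sum.cong) (use assms in \<open>auto simp: Zm_def colv_def\<close>)
 then show ?thesis
  unfolding mult_mat_index[OF assms(1) Z assms(2,3)] mult_mat_vec_index[OF assms(1) colv_carrier assms(2)] .
qed

lemma anticommutator_eq_Smat:
 assumes B: "B \<in> carrier_mat p p"
 shows "anticommutator n (B * Zm p n w 0) (B * Zm p n w 1) = Smat p n B w"
proof -
 have X: "B * Zm p n w k \<in> carrier_mat p n" for k using B by (auto simp: Zm_def)
 have pr: "((B * Zm p n w k) * mat_adjoint (B * Zm p n w l)) $$ (a, b)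
   = (\<Sum>j<n. (xcol p B w j k) $ a * cnj ((xcol p B w j l) $ b))" if "a < p" "b < p" for a b k l
  unfolding mult_mat_index[OF X mat_adjoint_carrier[OF X] that]
  by (rule sum.cong) (use that in \<open>auto simp: mat_adjoint_index[OF X] Zm_mult_index[OF B]\<close>)
 have c: "(B * Zm p n w k) * mat_adjoint (B * Zm p n w l) \<in> carrier_mat p p" for k l
  by (rule mult_carrier_mat[OF X mat_adjoint_carrier[OF X]])
 have gen: "(1 / of_nat n) \<cdot>\<^sub>m (M0 + M1) = Smat p n B w"
  if "M0 \<in> carrier_mat p p" "M1 \<in> carrier_mat p p"
   "\<And>a b. a < p ==> b < p ==> M0 $$ (a, b) + M1 $$ (a, b) = of_nat n * Smat p n B w $$ (a, b)" "n > 0" for M0 M1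
  using that by (intro eq_matI) (auto simp: Smat_def)
 show ?thesis
 proof (cases "n = 0")
  case True
  have "(1 / of_nat 0) \<cdot>\<^sub>m (M0 + M1) = Smat p 0 B w" if "M0 \<in> carrier_mat p p" "M1 \<in> carrier_mat p p" for M0 M1
   using that by (intro eq_matI) (auto simp: Smat_def)
  from this[OF c c] show ?thesis unfolding anticommutator_def True .
 next
  case False
  then show ?thesis unfolding anticommutator_def
   by (intro gen[OF c c]) (simp_all add: pr Smat_index sum.distrib)
 qed
qed

lemma Smat_update:
 assumes B: "B \<in> carrier_mat p p" and j: "j < n"
 shows "Smat p n B w = Smat p n B (w(j := \<lambda>_. 0)) + of_real (1 / real n) \<cdot>\<^sub>m
  (outer p (xcol p B w j 0) (xcol p B w j 1) + outer p (xcol p B w j 1) (xcol p B w j 0))"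
proof -
 let ?t = "\<lambda>w j a b. (xcol p B w j 0) $ a * cnj ((xcol p B w j 1) $ b)
   + (xcol p B w j 1) $ a * cnj ((xcol p B w j 0) $ b)"
 have zero: "(B *v colv p (\<lambda>_. 0) k) $ a = 0" if "a < p" for a k
  unfolding mult_mat_vec_index[OF B colv_carrier that] by (simp add: colv_def)
 show ?thesis
 proof (rule eq_matI)
  fix a b assume "a < dim_row (Smat p n B (w(j := \<lambda>_. 0)) + of_real (1 / real n) \<cdot>\<^sub>m
  (outer p (xcol p B w j 0) (xcol p B w j 1) + outer p (xcol p B w j 1) (xcol p B w j 0)))"
   "b < dim_col (Smat p n B (w(j := \<lambda>_. 0)) + of_real (1 / real n) \<cdot>\<^sub>m
  (outer p (xcol p B w j 0) (xcol p B w j 1) + outer p (xcol p B w j 1) (xcol p B w j 0)))"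
  then have ab: "a < p" "b < p" by (auto simp: outer_def)
  have "(\<Sum>i<n. ?t w i a b) = ?t w j a b + (\<Sum>i\<in>{..<n} - {j}. ?t w i a b)" using j by (simp add: sum.remove)
  also have "(\<Sum>i\<in>{..<n} - {j}. ?t w i a b) = (\<Sum>i\<in>{..<n} - {j}. ?t (w(j := \<lambda>_. 0)) i a b)" by (rule sum.cong) auto
  also have "... = (\<Sum>i<n. ?t (w(j := \<lambda>_. 0)) i a b)" using j zero ab by (subst sum.remove[of "{..<n}" j]) auto
  finally show "Smat p n B w $$ (a, b) = (Smat p n B (w(j := \<lambda>_. 0)) + of_real (1 / real n) \<cdot>\<^sub>m
  (outer p (xcol p B w j 0) (xcol p B w j 1) + outer p (xcol p B w j 1) (xcol p B w j 0))) $$ (a, b)"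
   using ab by (simp add: Smat_index outer_index Smat_carrier[THEN carrier_matD(1)] Smat_carrier[THEN carrier_matD(2)]
    outer_carrier[THEN carrier_matD(1)] outer_carrier[THEN carrier_matD(2)] add_divide_distrib)
 qed (auto simp: Smat_def outer_def)
qed

lemma mat_trace_mult_Smat:
 assumes M: "M \<in> carrier_mat p p" and B: "B \<in> carrier_mat p p"
 shows "mat_trace (M * Smat p n B w) = (\<Sum>j<n. inn p (M *v (xcol p B w j 0)) (xcol p B w j 1)
   + inn p (M *v (xcol p B w j 1)) (xcol p B w j 0)) / of_nat n"
proof -
 let ?x = "\<lambda>j. B *v colv p (w j) 0" and ?y = "\<lambda>j. B *v colv p (w j) 1"
 have c: "?x j \<in> carrier_vec p" "?y j \<in> carrier_vec p" for j using B by auto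
 have "mat_trace (M * Smat p n B w) = (\<Sum>a<p. \<Sum>b<p. M $$ (a, b) * Smat p n B w $$ (b, a))"
  unfolding mat_trace_carrier[OF mult_carrier_mat[OF M Smat_carrier]] by (simp add: mult_mat_index[OF M Smat_carrier])
 also have "... = (\<Sum>a<p. \<Sum>b<p. (\<Sum>j<n. M $$ (a, b) * ?x j $ b * cnj (?y j $ a) + M $$ (a, b) * ?y j $ b * cnj (?x j $ a)) / of_nat n)"
  by (simp add: Smat_index sum_distrib_left distrib_left mult.assoc)
 also have "... = (\<Sum>a<p. \<Sum>b<p. \<Sum>j<n. M $$ (a, b) * ?x j $ b * cnj (?y j $ a) + M $$ (a, b) * ?y j $ b * cnj (?x j $ a)) / of_nat n"
  by (simp only: sum_divide_distrib)
 also have "(\<Sum>a<p. \<Sum>b<p. \<Sum>j<n. M $$ (a, b) * ?x j $ b * cnj (?y j $ a) + M $$ (a, b) * ?y j $ b * cnj (?x j $ a))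
   = (\<Sum>a<p. \<Sum>j<n. \<Sum>b<p. M $$ (a, b) * ?x j $ b * cnj (?y j $ a) + M $$ (a, b) * ?y j $ b * cnj (?x j $ a))"
  by (intro sum.cong refl sum.swap)
 also have "... = (\<Sum>j<n. \<Sum>a<p. \<Sum>b<p. M $$ (a, b) * ?x j $ b * cnj (?y j $ a) + M $$ (a, b) * ?y j $ b * cnj (?x j $ a))"
  by (rule sum.swap)
 also have "... = (\<Sum>j<n. inn p (M *v ?x j) (?y j) + inn p (M *v ?y j) (?x j))"
  unfolding inn_def by (simp add: mult_mat_vec_index[OF M c(1)] mult_mat_vec_index[OF M c(2)] sum.distrib sum_distrib_right del: One_nat_def)
 finally show ?thesis .
qed

lemma trace_resolvent_update:
 assumes B: "B \<in> carrier_mat p p" and j: "j < n" and z: "0 < Im z" and N: "opb p N \<kappa>"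
 shows "cmod (mat_trace (N * resolvent p (Smat p n B w) z) - mat_trace (N * resolvent p (Smat p n B (w(j := \<lambda>_. 0))) z)) \<le> 2 * \<kappa> / Im z"
 unfolding Smat_update[OF B j, of w]
 by (rule herm.trace_rank_two[OF Smat_herm z _ _ N]) (use B in auto)

text \<open>Both configurations are compared with the one whose column j is zero, which doubles the
  constant.\<close>

lemma trace_resolvent_update_any:
 assumes B: "B \<in> carrier_mat p p" and j: "j < n" and z: "0 < Im z" and N: "opb p N \<kappa>"
 shows "cmod (mat_trace (N * resolvent p (Smat p n B w) z) - mat_trace (N * resolvent p (Smat p n B (w(j := u))) z)) \<le> 4 * \<kappa> / Im z"
proof -
 let ?f = "\<lambda>w. mat_trace (N * resolvent p (Smat p n B w) z)"
 have "cmod (?f w - ?f (w(j := u))) \<le> cmod (?f w - ?f (w(j := \<lambda>_. 0))) + cmod (?f (w(j := u)) - ?f (w(j := \<lambda>_. 0)))"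
  using norm_triangle_ineq4[of "?f w - ?f (w(j := \<lambda>_. 0))" "?f (w(j := u)) - ?f (w(j := \<lambda>_. 0))"] by simp
 also have "... \<le> 2 * \<kappa> / Im z + 2 * \<kappa> / Im z"
  using trace_resolvent_update[OF assms, of w] trace_resolvent_update[OF assms, of "w(j := u)"] by (intro add_mono) auto
 finally show ?thesis by simp
qed

text \<open>Let u = Q' t. Since S - S' has rank two, (S - z) u is t plus a combination of x and y;
  applying Q and then N gives the relation. For t = x and t = y these are two linear equations for
  the forms containing Q, and all other data involve only Q'.\<close>

lemma rank_two_system:
 assumes S': "herm p S'" and z: "Im z \<noteq> 0" and x: "x \<in> carrier_vec p" and y: "y \<in> carrier_vec p" and N: "N \<in> carrier_mat p p"
  and S: "S = S' + of_real e \<cdot>\<^sub>m (outer p x y + outer p y x)"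
 defines "Q \<equiv> resolvent p S z" and "Q' \<equiv> resolvent p S' z"
 assumes t: "t \<in> carrier_vec p"
 shows "inn p (N *v (Q' *v t)) g = inn p (N *v (Q *v t)) g
  + of_real e * inn p (Q' *v t) y * inn p (N *v (Q *v x)) g + of_real e * inn p (Q' *v t) x * inn p (N *v (Q *v y)) g"
proof -
 interpret S': herm p S' by fact
 interpret S: herm p S unfolding S by (rule herm_outer_add(2)[OF S' x y])
 have Q: "Q \<in> carrier_mat p p" and Q': "Q' \<in> carrier_mat p p" unfolding Q_def Q'_def using S.resolvent(1)[OF z] S'.resolvent(1)[OF z] by auto
 let ?u = "Q' *v t"
 have u: "?u \<in> carrier_vec p" by (rule mult_mat_vec_carrier[OF Q' t])
 have Su: "S *v ?u = S' *v ?u + ((of_real e * inn p ?u y) \<cdot>\<^sub>v x + (of_real e * inn p ?u x) \<cdot>\<^sub>v y)"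
 proof -
  have "S *v ?u = S' *v ?u + (of_real e \<cdot>\<^sub>m (outer p x y + outer p y x)) *v ?u"
   unfolding S by (rule add_mult_distrib_mat_vec[OF S'.S _ u]) (auto simp: outer_def)
  also have "(of_real e \<cdot>\<^sub>m (outer p x y + outer p y x)) *v ?u = of_real e \<cdot>\<^sub>v ((outer p x y + outer p y x) *v ?u)"
   by (rule smult_mat_mult_vec[OF _ u]) (auto simp: outer_def)
  also have "(outer p x y + outer p y x) *v ?u = inn p ?u y \<cdot>\<^sub>v x + inn p ?u x \<cdot>\<^sub>v y"
   by (simp add: add_mult_distrib_mat_vec[OF outer_carrier outer_carrier u] outer_mult_vec[OF u x] outer_mult_vec[OF u y])
  also have "of_real e \<cdot>\<^sub>v (inn p ?u y \<cdot>\<^sub>v x + inn p ?u x \<cdot>\<^sub>v y) = (of_real e * inn p ?u y) \<cdot>\<^sub>v x + (of_real e * inn p ?u x) \<cdot>\<^sub>v y"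
   using x y by (intro eq_vecI) (auto simp: algebra_simps)
  finally show ?thesis .
 qed
 have gen: "(a + b) - c = (a - c) + b" if "a \<in> carrier_vec p" "b \<in> carrier_vec p" "c \<in> carrier_vec p" for a b c :: "complex vec"
  using that by (intro eq_vecI) auto
 have "shift p S z *v ?u = shift p S' z *v ?u + ((of_real e * inn p ?u y) \<cdot>\<^sub>v x + (of_real e * inn p ?u x) \<cdot>\<^sub>v y)"
  unfolding shift_mult_vec[OF S.S u] shift_mult_vec[OF S'.S u] Su
  by (rule gen) (use u x y S'.S in auto)
 also have "shift p S' z *v ?u = t" unfolding Q'_def by (rule S'.shift_resolvent_vec(1)[OF z t])
 finally have "Q *v (shift p S z *v ?u) = Q *v (t + ((of_real e * inn p ?u y) \<cdot>\<^sub>v x + (of_real e * inn p ?u x) \<cdot>\<^sub>v y))" by (rule arg_cong)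
 also have "Q *v (shift p S z *v ?u) = ?u" using S.shift_resolvent_vec(2)[OF z u] by (simp only: Q_def)
 finally have e1: "?u = Q *v (t + ((of_real e * inn p ?u y) \<cdot>\<^sub>v x + (of_real e * inn p ?u x) \<cdot>\<^sub>v y))" .
 have lin: "M *v (a + (\<alpha> \<cdot>\<^sub>v b + \<beta> \<cdot>\<^sub>v c)) = M *v a + (\<alpha> \<cdot>\<^sub>v (M *v b) + \<beta> \<cdot>\<^sub>v (M *v c))"
  if M: "M \<in> carrier_mat p p" and "a \<in> carrier_vec p" "b \<in> carrier_vec p" "c \<in> carrier_vec p" for M :: "complex mat" and a b c \<alpha> \<beta>
  using that by (simp add: mult_add_distrib_mat_vec[OF M] mult_mat_vec[OF M])
 have c: "Q *v t \<in> carrier_vec p" "Q *v x \<in> carrier_vec p" "Q *v y \<in> carrier_vec p"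
  using mult_mat_vec_carrier[OF Q] t x y by auto
 have "N *v ?u = N *v (Q *v t) + ((of_real e * inn p ?u y) \<cdot>\<^sub>v (N *v (Q *v x)) + (of_real e * inn p ?u x) \<cdot>\<^sub>v (N *v (Q *v y)))"
  by (subst e1) (simp only: lin[OF Q t x y] lin[OF N c])
 then show ?thesis
  using mult_mat_vec_carrier[OF N c(1)] mult_mat_vec_carrier[OF N c(2)] mult_mat_vec_carrier[OF N c(3)]
  by (simp add: inn_add_left inn_smult_left)
qed

lemma (in herm) mult_resolvent:
 assumes z: "Im z \<noteq> 0"
 shows "S * resolvent p S z = 1\<^sub>m p + z \<cdot>\<^sub>m resolvent p S z" "resolvent p S z * S = 1\<^sub>m p + z \<cdot>\<^sub>m resolvent p S z"
proof -
 let ?Q = "resolvent p S z"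
 note Q = resolvent[OF z]
 have zc: "z \<cdot>\<^sub>m 1\<^sub>m p \<in> carrier_mat p p" by simp
 have e: "A = 1\<^sub>m p + z \<cdot>\<^sub>m ?Q" if "1\<^sub>m p = A - z \<cdot>\<^sub>m ?Q" "A \<in> carrier_mat p p" for A
  unfolding that(1) using that(2) Q(1) by (intro eq_matI) auto
 show "S * ?Q = 1\<^sub>m p + z \<cdot>\<^sub>m ?Q"
 proof (rule e[OF _ mult_carrier_mat[OF S Q(1)]])
  show "1\<^sub>m p = S * ?Q - z \<cdot>\<^sub>m ?Q"
   using Q(2) minus_mult_distrib_mat[OF S zc Q(1)] mult_smult_assoc_mat[OF one_carrier_mat Q(1), of z] left_mult_one_mat[OF Q(1)] by (simp add: shift_def)
 qed
 show "?Q * S = 1\<^sub>m p + z \<cdot>\<^sub>m ?Q"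
 proof (rule e[OF _ mult_carrier_mat[OF Q(1) S]])
  show "1\<^sub>m p = ?Q * S - z \<cdot>\<^sub>m ?Q"
   using Q(3) mult_minus_distrib_mat[OF Q(1) S zc] mult_smult_distrib[OF Q(1) one_carrier_mat, of z] right_mult_one_mat[OF Q(1)] by (simp add: shift_def)
 qed
qed

lemma (in herm) resolvent_mult:
 assumes z: "Im z \<noteq> 0" and N: "N \<in> carrier_mat p p"
 shows "mat_trace (N * resolvent p S z * S) = mat_trace N + z * mat_trace (N * resolvent p S z)"
proof -
 note Qc = resolvent(1)[OF z]
 have "N * resolvent p S z * S = N + z \<cdot>\<^sub>m (N * resolvent p S z)"
  unfolding assoc_mult_mat[OF N Qc S] mult_resolvent(2)[OF z] mult_add_distrib_mat[OF N one_carrier_mat smult_carrier_mat[OF Qc]]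
   right_mult_one_mat[OF N] mult_smult_distrib[OF N Qc] ..
 then show ?thesis
  by (simp only: mat_trace_add[OF N smult_carrier_mat[OF mult_carrier_mat[OF N Qc]]] mat_trace_smult[OF mult_carrier_mat[OF N Qc]])
qed

text \<open>This is a measurability device: the right side contains B only through B^2, so a random
  B enters through its square and not through a square root.\<close>

lemma trace_resolvent_similar:
 assumes W: "W \<in> carrier_mat p p" and B: "B \<in> carrier_mat p p" and h: "herm p (B * W * B)" and z: "Im z \<noteq> 0"
 shows "mat_trace (resolvent p (B * W * B) z) = mat_trace (minv (shift p (W * (B * B)) z))"
proof -
 interpret herm p "B * W * B" by fact
 let ?Q = "resolvent p (B * W * B) z"
 note Q = resolvent[OF z]
 have z0: "z \<noteq> 0" using z by auto
 have WB: "W * B \<in> carrier_mat p p" by (rule mult_carrier_mat[OF W B])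
 have QB: "?Q * B \<in> carrier_mat p p" by (rule mult_carrier_mat[OF Q(1) B])
 \<comment> \<open>With V = W B^2 one has V X = V + z X, so that (1 - X) / (- z) inverts V -
   z.\<close>
 define X where "X = (W * B) * (?Q * B)"
 have X: "X \<in> carrier_mat p p" unfolding X_def by (rule mult_carrier_mat[OF WB QB])
 define V where "V = W * (B * B)"
 have V: "V \<in> carrier_mat p p" unfolding V_def by (rule mult_carrier_mat[OF W mult_carrier_mat[OF B B]])
 define R where "R = (- 1 / z) \<cdot>\<^sub>m (1\<^sub>m p - X)"
 have R: "R \<in> carrier_mat p p" unfolding R_def using X by auto
 have VX: "V * X = V + z \<cdot>\<^sub>m X"
 proof -
  have cm[simp]: "A * C \<in> carrier_mat p p" if "A \<in> carrier_mat p p" "C \<in> carrier_mat p p" for A C :: "complex mat"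
   by (rule mult_carrier_mat[OF that])
  define q where "q = ?Q"
  have qc: "q \<in> carrier_mat p p" and qB: "q * B \<in> carrier_mat p p" unfolding q_def by (rule Q(1) QB)+
  note [simp] = assoc_mult_mat[of _ p p _ p _ p] W B qc
  have "(B * W * B) * q * B = (1\<^sub>m p + z \<cdot>\<^sub>m q) * B" unfolding q_def by (simp only: mult_resolvent[OF z])
  also have "... = B + z \<cdot>\<^sub>m (q * B)"
   using add_mult_distrib_mat[OF one_carrier_mat smult_carrier_mat[OF qc] B] mult_smult_assoc_mat[OF qc B] left_mult_one_mat[OF B] by simp
  finally have E: "B * (W * (B * (q * B))) = B + z \<cdot>\<^sub>m (q * B)" by simp
  have Xq: "X = W * B * (q * B)" unfolding X_def q_def ..
  have "V * X = W * (B * (B * (W * (B * (q * B)))))" by (simp add: V_def Xq)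
  also have "... = W * (B * B + z \<cdot>\<^sub>m (B * (q * B)))"
   unfolding E using mult_add_distrib_mat[OF B B, of "z \<cdot>\<^sub>m (q * B)"] mult_smult_distrib[OF B qB] by simp
  also have "... = V + z \<cdot>\<^sub>m X"
   using mult_add_distrib_mat[OF W, of "B * B" p "z \<cdot>\<^sub>m (B * (q * B))"] mult_smult_distrib[OF W, of "B * (q * B)" p z] by (simp add: V_def Xq)
  finally show ?thesis .
 qed
 have "shift p V z * R = 1\<^sub>m p"
 proof -
  have "shift p V z * (1\<^sub>m p - X) = shift p V z * 1\<^sub>m p - shift p V z * X"
   by (rule mult_minus_distrib_mat[OF shift_carrier[OF V] one_carrier_mat X])
  also have "shift p V z * X = V * X - (z \<cdot>\<^sub>m 1\<^sub>m p) * X"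
   unfolding shift_def by (rule minus_mult_distrib_mat[OF V _ X]) simp
  also have "(z \<cdot>\<^sub>m 1\<^sub>m p) * X = z \<cdot>\<^sub>m X" using mult_smult_assoc_mat[OF one_carrier_mat X, of z] X by simp
  also have "shift p V z * 1\<^sub>m p = shift p V z" by (rule right_mult_one_mat[OF shift_carrier[OF V]])
  also have "shift p V z - (V * X - z \<cdot>\<^sub>m X) = (- z) \<cdot>\<^sub>m 1\<^sub>m p"
   unfolding VX shift_def using V X by (intro eq_matI) auto
  finally have "shift p V z * (1\<^sub>m p - X) = (- z) \<cdot>\<^sub>m 1\<^sub>m p" .
  moreover have "1\<^sub>m p - X \<in> carrier_mat p p" using X by auto
  ultimately have "shift p V z * R = (- 1 / z) \<cdot>\<^sub>m ((- z) \<cdot>\<^sub>m 1\<^sub>m p)"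
   unfolding R_def using mult_smult_distrib[OF shift_carrier[OF V]] by simp
  also have "... = 1\<^sub>m p" using z0 by (intro eq_matI) auto
  finally show ?thesis .
 qed
 then have m: "minv (shift p V z) = R" by (rule minv_unique(2)[OF shift_carrier[OF V] R])
 have "mat_trace X = mat_trace ((?Q * B) * (W * B))" unfolding X_def by (rule mat_trace_mult_commute[OF WB QB])
 also have "(?Q * B) * (W * B) = ?Q * (B * W * B)"
  by (rule trans[OF assoc_mult_mat[OF Q(1) B WB] arg_cong[OF assoc_mult_mat[OF B W B, symmetric], of "\<lambda>X. ?Q * X"]])
 also have "... = 1\<^sub>m p + z \<cdot>\<^sub>m ?Q" by (rule mult_resolvent(2)[OF z])
 also have "mat_trace ... = of_nat p + z * mat_trace ?Q"
  by (simp only: mat_trace_add[OF one_carrier_mat smult_carrier_mat[OF Q(1)]] mat_trace_smult[OF Q(1)] mat_trace_one)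
 finally have tX: "mat_trace X = of_nat p + z * mat_trace ?Q" .
 have "mat_trace R = (- 1 / z) * (of_nat p - mat_trace X)"
  unfolding R_def using X by (subst mat_trace_smult[of _ p]) (auto simp: mat_trace_diff[of _ p] mat_trace_one)
 then show ?thesis unfolding m[unfolded V_def] tX using z0 by simp
qed

lemma Smat_factor:
 assumes B: "B \<in> carrier_mat p p" and h: "mat_adjoint B = B"
 shows "Smat p n B w = B * Smat p n (1\<^sub>m p) w * B"
proof -
 let ?Z = "Zm p n w" and ?Y = "\<lambda>k l. Zm p n w k * mat_adjoint (Zm p n w l)"
 have Z: "?Z k \<in> carrier_mat p n" "mat_adjoint (?Z k) \<in> carrier_mat n p" for k by (simp_all add: Zm_def)
 have Y: "?Y k l \<in> carrier_mat p p" for k l by (rule mult_carrier_mat[OF Z])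
 note YB = mult_carrier_mat[OF Y B]
 have t: "(B * ?Z k) * mat_adjoint (B * ?Z l) = B * (?Y k l * B)" for k l
  by (simp only: mat_adjoint_mult[OF B Z(1)] h assoc_mult_mat[OF B Z(1) mult_carrier_mat[OF Z(2) B]] assoc_mult_mat[OF Z(1) Z(2) B])
 have YY: "?Y 0 1 + ?Y 1 0 \<in> carrier_mat p p" by (rule add_carrier_mat[OF Y])
 have "Smat p n (1\<^sub>m p) w = (1 / of_nat n) \<cdot>\<^sub>m (?Y 0 1 + ?Y 1 0)"
  unfolding anticommutator_eq_Smat[OF one_carrier_mat, symmetric] anticommutator_def left_mult_one_mat[OF Z(1)] ..
 then have "B * Smat p n (1\<^sub>m p) w * B = (1 / of_nat n) \<cdot>\<^sub>m (B * (?Y 0 1 + ?Y 1 0) * B)"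
  by (simp only: mult_smult_distrib[OF B YY] mult_smult_assoc_mat[OF mult_carrier_mat[OF B YY] B])
 also have "B * (?Y 0 1 + ?Y 1 0) * B = B * (?Y 0 1 * B) + B * (?Y 1 0 * B)"
  by (simp only: assoc_mult_mat[OF B YY B] add_mult_distrib_mat[OF Y Y B] mult_add_distrib_mat[OF B YB YB])
 finally show ?thesis unfolding anticommutator_eq_Smat[OF B, symmetric] anticommutator_def t by simp
qed

section \<open>Bounded differences and quadratic forms\<close>

lemma norm_power4: "(cmod w) ^ 4 \<le> 2 * ((Re w) ^ 4 + (Im w) ^ 4)"
proof -
 have "(cmod w) ^ 4 = ((cmod w)\<^sup>2)\<^sup>2" by simp
 also have "... = ((Re w)\<^sup>2 + (Im w)\<^sup>2)\<^sup>2" by (simp add: cmod_power2)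
 also have "... \<le> 2 * (((Re w)\<^sup>2)\<^sup>2 + ((Im w)\<^sup>2)\<^sup>2)"
  using zero_le_power2[of "(Re w)\<^sup>2 - (Im w)\<^sup>2"] by (simp add: power2_eq_square algebra_simps)
 finally show ?thesis by simp
qed

text \<open>The second claim is nonnegativity of the variance of |X|.\<close>

lemma (in prob_space) expectation_abs_le_sqrt:
 fixes X :: "'a => real"
 assumes X: "X \<in> borel_measurable M" "integrable M (\<lambda>x. (X x)\<^sup>2)"
 shows "integrable M X" "expectation (\<lambda>x. \<bar>X x\<bar>) \<le> sqrt (expectation (\<lambda>x. (X x)\<^sup>2))"
proof -
 have le: "\<bar>x\<bar> \<le> 1 + x\<^sup>2" for x :: real
  using zero_le_power2[of "\<bar>x\<bar> - 1"] by (simp add: power2_eq_square algebra_simps abs_mult_self_eq)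
 show i: "integrable M X"
  by (rule Bochner_Integration.integrable_bound[of M "\<lambda>x. 1 + (X x)\<^sup>2"]) (use X le in \<open>auto intro!: AE_I2 order_trans[OF le]\<close>)
 let ?m = "expectation (\<lambda>x. \<bar>X x\<bar>)"
 have "0 \<le> expectation (\<lambda>x. (\<bar>X x\<bar> - ?m)\<^sup>2)" by (rule integral_nonneg_AE) auto
 also have "expectation (\<lambda>x. (\<bar>X x\<bar> - ?m)\<^sup>2) = expectation (\<lambda>x. (X x)\<^sup>2 - 2 * ?m * \<bar>X x\<bar> + ?m\<^sup>2)"
  by (rule Bochner_Integration.integral_cong) (auto simp: power2_diff)
 also have "... = expectation (\<lambda>x. (X x)\<^sup>2) - ?m\<^sup>2"
  using X i by (simp add: prob_space power2_eq_square)
 finally show "?m \<le> sqrt (expectation (\<lambda>x. (X x)\<^sup>2))" by (intro real_le_rsqrt) simp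
qed

lemma (in prob_space) integrable_power_of_bounded:
 fixes f :: "'a => real"
 assumes f: "f \<in> borel_measurable M" "\<And>x. x \<in> space M ==> \<bar>f x\<bar> \<le> K"
 shows "integrable M (\<lambda>x. (f x - E) ^ k)"
proof (rule integrable_const_bound[of _ "(K + \<bar>E\<bar>) ^ k"])
 have "\<bar>f x - E\<bar> ^ k \<le> (K + \<bar>E\<bar>) ^ k" if "x \<in> space M" for x using f(2)[OF that] by (intro power_mono) auto
 then show "AE x in M. norm ((f x - E) ^ k) \<le> (K + \<bar>E\<bar>) ^ k" by (intro AE_I2) (simp add: power_abs)
qed (use f(1) in measurable)

text \<open>The linear term has mean 0. The cubic term has no sign and is absorbed by 4 g X^3 \<le>
  2 g^2 X^2 + 2 X^4, which says 2 X^2 (g - X)^2 \<ge> 0. This gives the constants 8 = 6 + 2 and 3 =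
  2 + 1.\<close>

lemma (in prob_space) fourth_moment_step:
 fixes X :: "'a => real"
 assumes X: "X \<in> borel_measurable M" and b: "\<And>x. x \<in> space M ==> \<bar>X x\<bar> \<le> \<delta>" and m: "expectation X = 0"
 shows "expectation (\<lambda>x. (g + X x)\<^sup>2) \<le> g\<^sup>2 + \<delta>\<^sup>2"
  "expectation (\<lambda>x. (g + X x) ^ 4) \<le> g ^ 4 + 8 * \<delta>\<^sup>2 * g\<^sup>2 + 3 * \<delta> ^ 4"
proof -
 have bint: "integrable M (\<lambda>x. f (X x))" if "f \<in> borel_measurable borel" "\<And>x. \<bar>x\<bar> \<le> \<delta> ==> \<bar>f x\<bar> \<le> c" for f :: "real => real" and c
  by (rule integrable_const_bound[of _ c]) (use that X b in \<open>auto intro!: AE_I2\<close>)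
 have pw: "\<bar>x ^ k\<bar> \<le> \<delta> ^ k" if "\<bar>x\<bar> \<le> \<delta>" for x :: real and k
  unfolding power_abs by (rule power_mono[OF that]) simp
 have i: "integrable M (\<lambda>x. X x ^ k)" for k by (rule bint[of "\<lambda>x. x ^ k" "\<delta> ^ k"]) (use pw in auto)
 have i1: "integrable M X" using i[of 1] by simp
 have "expectation (\<lambda>x. (g + X x)\<^sup>2) = expectation (\<lambda>x. g\<^sup>2 + 2 * g * X x + X x ^ 2)"
  by (rule Bochner_Integration.integral_cong) (auto simp: power2_sum)
 also have "... = g\<^sup>2 + expectation (\<lambda>x. X x ^ 2)" using i[of 2] i1 m by (simp add: prob_space)
 also have "expectation (\<lambda>x. X x ^ 2) \<le> expectation (\<lambda>x. \<delta>\<^sup>2)"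
  using i[of 2] pw[of _ 2] b by (intro integral_mono) auto
 finally show "expectation (\<lambda>x. (g + X x)\<^sup>2) \<le> g\<^sup>2 + \<delta>\<^sup>2" by (simp add: prob_space)
 have "expectation (\<lambda>x. (g + X x) ^ 4) \<le> expectation (\<lambda>x. g ^ 4 + 4 * g ^ 3 * X x + (8 * \<delta>\<^sup>2 * g\<^sup>2 + 3 * \<delta> ^ 4))"
 proof (rule integral_mono)
  show "integrable M (\<lambda>x. (g + X x) ^ 4)"
  proof (rule bint[of "\<lambda>x. (g + x) ^ 4" "(\<bar>g\<bar> + \<delta>) ^ 4"])
   show "\<bar>(g + x) ^ 4\<bar> \<le> (\<bar>g\<bar> + \<delta>) ^ 4" if "\<bar>x\<bar> \<le> \<delta>" for x
    unfolding power_abs using that by (intro power_mono) auto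
  qed auto
  show "integrable M (\<lambda>x. g ^ 4 + 4 * g ^ 3 * X x + (8 * \<delta>\<^sup>2 * g\<^sup>2 + 3 * \<delta> ^ 4))" using i1 by simp
  fix x assume "x \<in> space M"
  then have x: "\<bar>X x\<bar> \<le> \<delta>" by (rule b)
  have e: "(g + X x) ^ 4 = g ^ 4 + 4 * g ^ 3 * X x + 6 * g\<^sup>2 * (X x)\<^sup>2 + 4 * g * X x ^ 3 + X x ^ 4"
   by (simp add: power4_eq_xxxx power3_eq_cube power2_eq_square algebra_simps)
  have s2: "(X x)\<^sup>2 \<le> \<delta>\<^sup>2" using pw[OF x, of 2] by simp
  then have "6 * g\<^sup>2 * (X x)\<^sup>2 \<le> 6 * g\<^sup>2 * \<delta>\<^sup>2" by (intro mult_left_mono) auto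
  moreover have "4 * g * X x ^ 3 \<le> 2 * g\<^sup>2 * \<delta>\<^sup>2 + 2 * \<delta> ^ 4"
  proof -
   have "0 \<le> 2 * (X x)\<^sup>2 * (g - X x)\<^sup>2" by simp
   then have "4 * g * X x ^ 3 \<le> 2 * g\<^sup>2 * (X x)\<^sup>2 + 2 * X x ^ 4"
    by (simp add: power4_eq_xxxx power3_eq_cube power2_eq_square algebra_simps)
   moreover have "2 * g\<^sup>2 * (X x)\<^sup>2 \<le> 2 * g\<^sup>2 * \<delta>\<^sup>2" using s2 by (intro mult_left_mono) auto
   ultimately show ?thesis using pw[OF x, of 4] by simp
  qed
  moreover have "X x ^ 4 \<le> \<delta> ^ 4" using pw[OF x, of 4] by simp
  ultimately show "(g + X x) ^ 4 \<le> g ^ 4 + 4 * g ^ 3 * X x + (8 * \<delta>\<^sup>2 * g\<^sup>2 + 3 * \<delta> ^ 4)"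
   unfolding e by (simp add: algebra_simps)
 qed
 also have "... = g ^ 4 + (8 * \<delta>\<^sup>2 * g\<^sup>2 + 3 * \<delta> ^ 4)" using i1 m by (simp add: prob_space)
 finally show "expectation (\<lambda>x. (g + X x) ^ 4) \<le> g ^ 4 + 8 * \<delta>\<^sup>2 * g\<^sup>2 + 3 * \<delta> ^ 4" by simp
qed

section \<open>Second and fourth moments under bounded differences\<close>

locale product_prob_spaces =
 fixes N :: "nat => 'b measure"
 assumes prob: "\<And>i. prob_space (N i)"
begin

lemma product_sigma_finite: "product_sigma_finite N"
 unfolding product_sigma_finite_def using prob by (auto intro: prob_space_imp_sigma_finite)

lemma prob_PiM: "prob_space (PiM {..<n} N)"
 by (rule prob_space_PiM[OF prob])

lemma fun_upd_space: "w \<in> space (PiM {..<n} N) ==> y \<in> space (N n) ==> w(n := y) \<in> space (PiM {..<Suc n} N)"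
 by (auto simp: space_PiM lessThan_Suc PiE_iff extensional_def)

lemma measurable_fun_upd: "(\<lambda>(w, y). w(n := y)) \<in> PiM {..<n} N \<Otimes>\<^sub>M N n \<rightarrow>\<^sub>M PiM {..<Suc n} N"
 using measurable_add_dim[of n "{..<n}" N] by (simp add: lessThan_Suc)

lemma integral_Suc:
 fixes f :: "(nat => 'b) => real"
 assumes "integrable (PiM {..<Suc n} N) f"
 shows "(LINT w|PiM {..<Suc n} N. f w) = (LINT w|PiM {..<n} N. LINT y|N n. f (w(n := y)))"
 using product_sigma_finite.product_integral_insert[OF product_sigma_finite, of "{..<n}" n f] assms by (simp add: lessThan_Suc)

text \<open>The martingale that reveals the coordinates one by one has increments bounded by \<open>\<delta>\<close>. The bound on
 its fourth moment needs the one on its second moment, so both are proved by one induction.\<close>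

theorem bounded_differences_moments:
 fixes f :: "(nat => 'b) => real"
 assumes "f \<in> borel_measurable (PiM {..<n} N)"
  and "\<And>w. w \<in> space (PiM {..<n} N) ==> \<bar>f w\<bar> \<le> K"
  and "\<And>w j y. w \<in> space (PiM {..<n} N) ==> j < n ==> y \<in> space (N j) ==> \<bar>f w - f (w(j := y))\<bar> \<le> \<delta>"
 shows "(LINT w|PiM {..<n} N. (f w - (LINT w|PiM {..<n} N. f w))\<^sup>2) \<le> real n * \<delta>\<^sup>2 \<and>
  (LINT w|PiM {..<n} N. (f w - (LINT w|PiM {..<n} N. f w)) ^ 4) \<le> 4 * (real n)\<^sup>2 * \<delta> ^ 4"
 using assms
proof (induction n arbitrary: f)
 case 0
 interpret P0: prob_space "PiM {..<0} N" by (rule prob_PiM)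
 have "f w = f (\<lambda>_. undefined)" if "w \<in> space (PiM {..<0} N)" for w using that by (simp add: space_PiM)
 then have e: "(LINT w|PiM {..<0} N. g (f w)) = (LINT w|PiM {..<0} N. g (f (\<lambda>_. undefined)))" for g :: "real => real"
  by (intro Bochner_Integration.integral_cong refl) (simp only:)
 have "(LINT w|PiM {..<0} N. g (f w)) = g (f (\<lambda>_. undefined))" for g :: "real => real"
  unfolding e[of g] using P0.prob_space by simp
 from this[of "\<lambda>x. x"] this[of "\<lambda>x. (x - c)\<^sup>2" for c] this[of "\<lambda>x. (x - c) ^ 4" for c] show ?case by simp
next
 case (Suc n)
 let ?P = "PiM {..<n} N" and ?P' = "PiM {..<Suc n} N"
 interpret Pn: prob_space ?P by (rule prob_PiM)
 interpret Ps: prob_space ?P' by (rule prob_PiM)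
 interpret Nn: prob_space "N n" by (rule prob)
 note f = Suc.prems
 \<comment> \<open>The conditional expectation of f given the first n coordinates. It inherits the
   bounds K and \<delta>, so the induction hypothesis applies to it.\<close>
 define g where "g w = (LINT y|N n. f (w(n := y)))" for w
 note [measurable] = f(1) measurable_fun_upd
 have f2: "(\<lambda>(w, y). f (w(n := y))) \<in> borel_measurable (?P \<Otimes>\<^sub>M N n)"
  using measurable_compose[OF measurable_fun_upd f(1)] by (simp add: case_prod_beta')
 have g: "g \<in> borel_measurable ?P" unfolding g_def using f2 by measurable
 have fy: "(\<lambda>y. f (w(n := y))) \<in> borel_measurable (N n)" if "w \<in> space ?P" for w
  using measurable_compose[OF measurable_Pair1'[OF that] f2] by simp
 have fK: "\<bar>f (w(n := y))\<bar> \<le> K" if "w \<in> space ?P" "y \<in> space (N n)" for w y by (rule f(2)[OF fun_upd_space[OF that]])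
 have fi: "integrable (N n) (\<lambda>y. f (w(n := y)))" if "w \<in> space ?P" for w
  by (rule Nn.integrable_const_bound[of _ K]) (use fK that fy in \<open>auto intro!: AE_I2\<close>)
 have gK: "\<bar>g w\<bar> \<le> K" if "w \<in> space ?P" for w
 proof -
  have "\<bar>g w\<bar> \<le> (LINT y|N n. \<bar>f (w(n := y))\<bar>)" unfolding g_def by (rule integral_abs_bound)
  also have "... \<le> (LINT y|N n. K)" using fi[OF that] fK[OF that] by (intro integral_mono) auto
  finally show ?thesis by (simp add: Nn.prob_space)
 qed
 have gd: "\<bar>g w - g (w(j := y))\<bar> \<le> \<delta>" if w: "w \<in> space ?P" and j: "j < n" and y: "y \<in> space (N j)" for w j y
 proof -
  have w': "w(j := y) \<in> space ?P" using w j y by (auto simp: space_PiM PiE_iff extensional_def)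
  have "g w - g (w(j := y)) = (LINT x|N n. f (w(n := x)) - f ((w(j := y))(n := x)))"
   unfolding g_def using fi[OF w] fi[OF w'] by simp
  also have "\<bar>...\<bar> \<le> (LINT x|N n. \<bar>f (w(n := x)) - f ((w(j := y))(n := x))\<bar>)" by (rule integral_abs_bound)
  also have "... \<le> (LINT x|N n. \<delta>)"
  proof (rule integral_mono)
   fix x assume x: "x \<in> space (N n)"
   have "(w(j := y))(n := x) = (w(n := x))(j := y)" using j by (simp add: fun_upd_twist)
   then show "\<bar>f (w(n := x)) - f ((w(j := y))(n := x))\<bar> \<le> \<delta>"
    using f(3)[OF fun_upd_space[OF w x] less_SucI[OF j] y] by (simp only:)
  qed (use fi[OF w] fi[OF w'] in auto)
  finally show ?thesis by (simp add: Nn.prob_space)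
 qed
 define E where "E = (LINT w|?P'. f w)"
 have fint: "integrable ?P' f" by (rule Ps.integrable_const_bound[of _ K]) (use f in \<open>auto intro!: AE_I2\<close>)
 have Eg: "E = (LINT w|?P. g w)" unfolding E_def g_def by (rule integral_Suc[OF fint])
 have IH: "(LINT w|?P. (g w - E)\<^sup>2) \<le> real n * \<delta>\<^sup>2" "(LINT w|?P. (g w - E) ^ 4) \<le> 4 * (real n)\<^sup>2 * \<delta> ^ 4"
  using Suc.IH[OF g gK gd] unfolding Eg by auto
 have step: "(LINT y|N n. (f (w(n := y)) - E)\<^sup>2) \<le> (g w - E)\<^sup>2 + \<delta>\<^sup>2"
  "(LINT y|N n. (f (w(n := y)) - E) ^ 4) \<le> (g w - E) ^ 4 + 8 * \<delta>\<^sup>2 * (g w - E)\<^sup>2 + 3 * \<delta> ^ 4" if w: "w \<in> space ?P" for w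
 proof -
  have X: "(\<lambda>y. f (w(n := y)) - g w) \<in> borel_measurable (N n)" using fy[OF w] by simp
  have m: "(LINT y|N n. f (w(n := y)) - g w) = 0" using fi[OF w] by (simp add: g_def Nn.prob_space)
  have b: "\<bar>f (w(n := y)) - g w\<bar> \<le> \<delta>" if y: "y \<in> space (N n)" for y
  proof -
   have "f (w(n := y)) - g w = (LINT x|N n. f (w(n := y)) - f (w(n := x)))"
    using fi[OF w] by (simp add: g_def Nn.prob_space)
   also have "\<bar>...\<bar> \<le> (LINT x|N n. \<bar>f (w(n := y)) - f (w(n := x))\<bar>)" by (rule integral_abs_bound)
   also have "... \<le> (LINT x|N n. \<delta>)"
   proof (rule integral_mono)
    fix x assume x: "x \<in> space (N n)"
    show "\<bar>f (w(n := y)) - f (w(n := x))\<bar> \<le> \<delta>" using f(3)[OF fun_upd_space[OF w y] lessI x] by (simp only: fun_upd_upd)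
   qed (use fi[OF w] in auto)
   finally show ?thesis by (simp add: Nn.prob_space)
  qed
  from Nn.fourth_moment_step[OF X b m, of "g w - E"]
  show "(LINT y|N n. (f (w(n := y)) - E)\<^sup>2) \<le> (g w - E)\<^sup>2 + \<delta>\<^sup>2"
   "(LINT y|N n. (f (w(n := y)) - E) ^ 4) \<le> (g w - E) ^ 4 + 8 * \<delta>\<^sup>2 * (g w - E)\<^sup>2 + 3 * \<delta> ^ 4" by simp_all
 qed
 have fpow: "integrable ?P' (\<lambda>w. (f w - E) ^ k)" for k by (rule Ps.integrable_power_of_bounded[OF f(1,2)])
 have gpow: "integrable ?P (\<lambda>w. (g w - E) ^ k)" for k by (rule Pn.integrable_power_of_bounded[OF g gK])
 have ip: "integrable ?P (\<lambda>w. LINT y|N n. (f (w(n := y)) - E) ^ k)" for k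
 proof (rule Pn.integrable_const_bound[of _ "(K + \<bar>E\<bar>) ^ k"])
  show "AE w in ?P. norm (LINT y|N n. (f (w(n := y)) - E) ^ k) \<le> (K + \<bar>E\<bar>) ^ k"
  proof (rule AE_I2)
   fix w assume w: "w \<in> space ?P"
   have le: "\<bar>(f (w(n := y)) - E) ^ k\<bar> \<le> (K + \<bar>E\<bar>) ^ k" if "y \<in> space (N n)" for y
    using fK[OF w that] unfolding power_abs by (intro power_mono) auto
   have i: "integrable (N n) (\<lambda>y. (f (w(n := y)) - E) ^ k)" by (rule Nn.integrable_power_of_bounded[OF fy[OF w] fK[OF w]])
   have "\<bar>LINT y|N n. (f (w(n := y)) - E) ^ k\<bar> \<le> (LINT y|N n. \<bar>(f (w(n := y)) - E) ^ k\<bar>)" by (rule integral_abs_bound)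
   also have "... \<le> (LINT y|N n. (K + \<bar>E\<bar>) ^ k)" using i le by (intro integral_mono) auto
   finally show "norm (LINT y|N n. (f (w(n := y)) - E) ^ k) \<le> (K + \<bar>E\<bar>) ^ k" by (simp add: Nn.prob_space)
  qed
  have "(\<lambda>(w, y). (f (w(n := y)) - E) ^ k) \<in> borel_measurable (?P \<Otimes>\<^sub>M N n)" using f2 by (simp add: case_prod_beta')
  then show "(\<lambda>w. LINT y|N n. (f (w(n := y)) - E) ^ k) \<in> borel_measurable ?P" by measurable
 qed
 have "(LINT w|?P'. (f w - E)\<^sup>2) = (LINT w|?P. LINT y|N n. (f (w(n := y)) - E)\<^sup>2)" by (rule integral_Suc[OF fpow])
 also have "... \<le> (LINT w|?P. (g w - E)\<^sup>2 + \<delta>\<^sup>2)"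
  using ip[of 2] gpow[of 2] step(1) by (intro integral_mono) auto
 also have "... = (LINT w|?P. (g w - E)\<^sup>2) + \<delta>\<^sup>2" using gpow[of 2] by (simp add: Pn.prob_space)
 finally have 1: "(LINT w|?P'. (f w - E)\<^sup>2) \<le> real (Suc n) * \<delta>\<^sup>2" using IH(1) by (simp add: algebra_simps)
 have "(LINT w|?P'. (f w - E) ^ 4) = (LINT w|?P. LINT y|N n. (f (w(n := y)) - E) ^ 4)" by (rule integral_Suc[OF fpow])
 also have "... \<le> (LINT w|?P. (g w - E) ^ 4 + 8 * \<delta>\<^sup>2 * (g w - E)\<^sup>2 + 3 * \<delta> ^ 4)"
  using ip[of 4] gpow[of 4] gpow[of 2] step(2) by (intro integral_mono) auto
 also have "... = (LINT w|?P. (g w - E) ^ 4) + 8 * \<delta>\<^sup>2 * (LINT w|?P. (g w - E)\<^sup>2) + 3 * \<delta> ^ 4"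
  using gpow[of 4] gpow[of 2] by (simp add: Pn.prob_space)
 also have "... \<le> 4 * (real n)\<^sup>2 * \<delta> ^ 4 + 8 * \<delta>\<^sup>2 * (real n * \<delta>\<^sup>2) + 3 * \<delta> ^ 4"
  using IH by (intro add_mono mult_left_mono) auto
 \<comment> \<open>The induction closes because 4 n^2 + 8 n + 3 \<le> 4 (n + 1)^2.\<close>
 also have "... \<le> 4 * (real (Suc n))\<^sup>2 * \<delta> ^ 4"
 proof -
  have "8 * \<delta>\<^sup>2 * (real n * \<delta>\<^sup>2) = 8 * real n * \<delta> ^ 4" by (simp add: power4_eq_xxxx power2_eq_square)
  moreover have gen: "4 * (real (Suc n))\<^sup>2 * d = 4 * (real n)\<^sup>2 * d + 8 * real n * d + 4 * d" for d
   by (simp add: power2_eq_square algebra_simps)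
  note gen[of "\<delta> ^ 4"]
  moreover have "0 \<le> \<delta> ^ 4" by simp
  ultimately show ?thesis by linarith
 qed
 finally show ?case using 1 unfolding E_def by blast
qed

text \<open>Real and imaginary parts are treated separately. The constant 16 is 2 (4 + 4), with the
  outer 2 from \<open>norm_power4\<close>.\<close>

corollary complex_bounded_differences_moments:
 fixes f :: "(nat => 'b) => complex"
 assumes f: "f \<in> borel_measurable (PiM {..<n} N)" and K: "\<And>w. cmod (f w) \<le> K"
  and d: "\<And>w j y. j < n ==> cmod (f w - f (w(j := y))) \<le> \<delta>"
 defines "m \<equiv> LINT w|PiM {..<n} N. f w"
 shows "integrable (PiM {..<n} N) f"
  "integrable (PiM {..<n} N) (\<lambda>w. (cmod (f w - m)) ^ k)"
  "(LINT w|PiM {..<n} N. (cmod (f w - m))\<^sup>2) \<le> 2 * (real n * \<delta>\<^sup>2)"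
  "(LINT w|PiM {..<n} N. (cmod (f w - m)) ^ 4) \<le> 16 * ((real n)\<^sup>2 * \<delta> ^ 4)"
proof -
 let ?P = "PiM {..<n} N"
 interpret P: prob_space ?P by (rule prob_PiM)
 show i: "integrable ?P f" by (rule P.integrable_const_bound[of _ K]) (use K f in auto)
 have "cmod (f w - m) \<le> K + cmod m" for w using norm_triangle_ineq4[of "f w" m] K[of w] by linarith
 then have i': "integrable ?P (\<lambda>w. (cmod (f w - m) - 0) ^ k)" for k
  using f by (intro P.integrable_power_of_bounded[of _ "K + cmod m"]) auto
 then show "integrable ?P (\<lambda>w. (cmod (f w - m)) ^ k)" by simp
 have part: "integrable ?P (\<lambda>w. (g (f w) - g m) ^ k)" "(LINT w|?P. (g (f w) - g m)\<^sup>2) \<le> real n * \<delta>\<^sup>2"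
  "(LINT w|?P. (g (f w) - g m) ^ 4) \<le> 4 * (real n)\<^sup>2 * \<delta> ^ 4"
  if g: "\<And>x. \<bar>g x\<bar> \<le> cmod x" "\<And>x y. g x - g y = g (x - y)" "g m = (LINT w|?P. g (f w))" "(\<lambda>w. g (f w)) \<in> borel_measurable ?P" for g :: "complex => real" and k
 proof -
  have gK: "\<bar>g (f w)\<bar> \<le> K" for w by (rule order_trans[OF g(1) K])
  have gd: "\<bar>g (f w) - g (f (w(j := y)))\<bar> \<le> \<delta>" if "j < n" for w j y unfolding g(2) by (rule order_trans[OF g(1) d[OF that]])
  show "integrable ?P (\<lambda>w. (g (f w) - g m) ^ k)" by (rule P.integrable_power_of_bounded[OF g(4) gK])
  show "(LINT w|?P. (g (f w) - g m)\<^sup>2) \<le> real n * \<delta>\<^sup>2" "(LINT w|?P. (g (f w) - g m) ^ 4) \<le> 4 * (real n)\<^sup>2 * \<delta> ^ 4"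
   unfolding g(3) using bounded_differences_moments[OF g(4) gK gd] by auto
 qed
 have R: "Re m = (LINT w|?P. Re (f w))" "(\<lambda>w. Re (f w)) \<in> borel_measurable ?P" and I: "Im m = (LINT w|?P. Im (f w))" "(\<lambda>w. Im (f w)) \<in> borel_measurable ?P"
  using i f by (simp_all add: m_def)
 note R = part[of Re, OF abs_Re_le_cmod _ R] and I = part[of Im, OF abs_Im_le_cmod _ I]
 have "(LINT w|?P. (cmod (f w - m))\<^sup>2) = (LINT w|?P. (Re (f w) - Re m)\<^sup>2) + (LINT w|?P. (Im (f w) - Im m)\<^sup>2)"
  using R(1)[of 2] I(1)[of 2] by (simp add: cmod_power2)
 then show "(LINT w|?P. (cmod (f w - m))\<^sup>2) \<le> 2 * (real n * \<delta>\<^sup>2)" using R(2) I(2) by simp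
 have "(LINT w|?P. (cmod (f w - m)) ^ 4) \<le> (LINT w|?P. 2 * ((Re (f w) - Re m) ^ 4 + (Im (f w) - Im m) ^ 4))"
  using i'[of 4] R(1)[of 4] I(1)[of 4] norm_power4[of "f _ - m"] by (intro integral_mono) auto
 also have "... = 2 * ((LINT w|?P. (Re (f w) - Re m) ^ 4) + (LINT w|?P. (Im (f w) - Im m) ^ 4))"
  using R(1)[of 4] I(1)[of 4] by simp
 finally show "(LINT w|?P. (cmod (f w - m)) ^ 4) \<le> 16 * ((real n)\<^sup>2 * \<delta> ^ 4)" using R(3) I(3) by simp
qed

end

section \<open>Measurability of matrix functions\<close>

lemma measurable_det:
 assumes "\<And>\<omega>. A \<omega> \<in> carrier_mat p p" "\<And>i j. i < p ==> j < p ==> (\<lambda>\<omega>. A \<omega> $$ (i, j)) \<in> borel_measurable M"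
 shows "(\<lambda>\<omega>. det (A \<omega>) :: complex) \<in> borel_measurable M"
proof -
 have "(\<lambda>\<omega>. det (A \<omega>)) = (\<lambda>\<omega>. \<Sum>q\<in>{q. q permutes {0..<p}}. signof q * (\<Prod>i = 0..<p. A \<omega> $$ (i, q i)))"
  by (rule ext) (rule det_def'[OF assms(1)])
 also have "... \<in> borel_measurable M"
 proof (intro borel_measurable_sum borel_measurable_times borel_measurable_prod borel_measurable_const)
  fix q i assume "q \<in> {q. q permutes {0..<p}}" "i \<in> {0..<p}"
  then show "(\<lambda>\<omega>. A \<omega> $$ (i, q i)) \<in> borel_measurable M"
   using permutes_in_image[of q "{0..<p}" i] by (intro assms(2)) auto
 qed
 finally show ?thesis .
qed

lemma measurable_minv:
 assumes A: "\<And>\<omega>. A \<omega> \<in> carrier_mat p p" "\<And>i j. i < p ==> j < p ==> (\<lambda>\<omega>. A \<omega> $$ (i, j)) \<in> borel_measurable M"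
  and ij: "i < p" "j < p"
 shows "(\<lambda>\<omega>. minv (A \<omega>) $$ (i, j)) \<in> borel_measurable M"
proof -
 have eq: "minv (A \<omega>) $$ (i, j) = (1 / det (A \<omega>)) * ((- 1) ^ (j + i) * det (mat_delete (A \<omega>) j i))" for \<omega>
  using A(1)[of \<omega>] ij by (simp add: minv_def adj_mat_def cofactor_def)
 have "(\<lambda>\<omega>. det (mat_delete (A \<omega>) j i)) \<in> borel_measurable M"
 proof (rule measurable_det[of _ "p - 1"])
  show "mat_delete (A \<omega>) j i \<in> carrier_mat (p - 1) (p - 1)" for \<omega> using A(1)[of \<omega>] by (rule mat_delete_carrier)
  fix a b assume ab: "a < p - 1" "b < p - 1"
  have "(\<lambda>\<omega>. mat_delete (A \<omega>) j i $$ (a, b)) = (\<lambda>\<omega>. A \<omega> $$ (if a < j then a else Suc a, if b < i then b else Suc b))"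
  proof
   fix \<omega>
   have "dim_row (A \<omega>) = p" "dim_col (A \<omega>) = p" using A(1)[of \<omega>] by auto
   then show "mat_delete (A \<omega>) j i $$ (a, b) = A \<omega> $$ (if a < j then a else Suc a, if b < i then b else Suc b)"
    using ab by (simp add: mat_delete_def)
  qed
  also have "... \<in> borel_measurable M" using ab by (intro A(2)) auto
  finally show "(\<lambda>\<omega>. mat_delete (A \<omega>) j i $$ (a, b)) \<in> borel_measurable M" .
 qed
 then show ?thesis unfolding eq using measurable_det[OF A] by measurable
qed

lemma measurable_shift:
 assumes "\<And>\<omega>. A \<omega> \<in> carrier_mat p p" "\<And>i j. i < p ==> j < p ==> (\<lambda>\<omega>. A \<omega> $$ (i, j)) \<in> borel_measurable M" "i < p" "j < p"
 shows "(\<lambda>\<omega>. shift p (A \<omega>) z $$ (i, j)) \<in> borel_measurable M"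
proof -
 have "(\<lambda>\<omega>. shift p (A \<omega>) z $$ (i, j)) = (\<lambda>\<omega>. A \<omega> $$ (i, j) - (if i = j then z else 0))"
  using assms(1,3,4) by (auto simp: shift_def)
 then show ?thesis using assms(2)[OF assms(3,4)] by simp
qed

lemma measurable_resolvent:
 assumes "\<And>\<omega>. A \<omega> \<in> carrier_mat p p" "\<And>i j. i < p ==> j < p ==> (\<lambda>\<omega>. A \<omega> $$ (i, j)) \<in> borel_measurable M" "i < p" "j < p"
 shows "(\<lambda>\<omega>. resolvent p (A \<omega>) z $$ (i, j)) \<in> borel_measurable M"
 unfolding resolvent_def
 by (rule measurable_minv[OF shift_carrier[OF assms(1)] measurable_shift[OF assms(1,2)] assms(3,4)])

lemma measurable_mult_mat:
 assumes "\<And>\<omega>. A \<omega> \<in> carrier_mat m n" "\<And>\<omega>. B \<omega> \<in> carrier_mat n r"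
  "\<And>i j. i < m ==> j < n ==> (\<lambda>\<omega>. A \<omega> $$ (i, j)) \<in> borel_measurable M"
  "\<And>i j. i < n ==> j < r ==> (\<lambda>\<omega>. B \<omega> $$ (i, j)) \<in> borel_measurable M" "i < m" "j < r"
 shows "(\<lambda>\<omega>. ((A \<omega> :: complex mat) * B \<omega>) $$ (i, j)) \<in> borel_measurable M"
 unfolding mult_mat_index[OF assms(1,2,5,6)] using assms by (intro borel_measurable_sum borel_measurable_times) auto

lemma measurable_mult_mat_vec:
 assumes "\<And>\<omega>. A \<omega> \<in> carrier_mat m n" "\<And>\<omega>. v \<omega> \<in> carrier_vec n"
  "\<And>i j. i < m ==> j < n ==> (\<lambda>\<omega>. A \<omega> $$ (i, j)) \<in> borel_measurable M"
  "\<And>i. i < n ==> (\<lambda>\<omega>. v \<omega> $ i) \<in> borel_measurable M" "i < m"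
 shows "(\<lambda>\<omega>. ((A \<omega> :: complex mat) *v v \<omega>) $ i) \<in> borel_measurable M"
 unfolding mult_mat_vec_index[OF assms(1,2,5)] using assms by (intro borel_measurable_sum borel_measurable_times) auto

lemma measurable_inn:
 assumes "\<And>i. i < p ==> (\<lambda>\<omega>. v \<omega> $ i) \<in> borel_measurable M" "\<And>i. i < p ==> (\<lambda>\<omega>. w \<omega> $ i) \<in> borel_measurable M"
 shows "(\<lambda>\<omega>. inn p (v \<omega>) (w \<omega>)) \<in> borel_measurable M"
proof -
 have "(\<lambda>\<omega>. cnj (w \<omega> $ i)) \<in> borel_measurable M" if "i < p" for i
  using measurable_compose[OF assms(2)[OF that] borel_measurable_continuous_onI[of cnj]] by (simp add: continuous_intros)
 then show ?thesis unfolding inn_def using assms(1) by (intro borel_measurable_sum borel_measurable_times) auto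
qed

lemma measurable_mat_trace:
 assumes "\<And>\<omega>. A \<omega> \<in> carrier_mat p p" "\<And>i j. i < p ==> j < p ==> (\<lambda>\<omega>. A \<omega> $$ (i, j)) \<in> borel_measurable M"
 shows "(\<lambda>\<omega>. mat_trace (A \<omega>)) \<in> borel_measurable M"
 unfolding mat_trace_carrier[OF assms(1)] using assms(2) by (intro borel_measurable_sum) auto

section \<open>Variance of quadratic forms in independent entries\<close>

locale entry_space =
 fixes J :: "'i set" and \<mu> :: "'i => complex measure" and K :: real
 assumes fin: "finite J"
  and prob: "\<And>i. prob_space (\<mu> i)" and sets [measurable_cong]: "\<And>i. sets (\<mu> i) = sets borel"
  and int4: "\<And>i. i \<in> J ==> integrable (\<mu> i) (\<lambda>y. cmod y ^ 4)" and le4: "\<And>i. i \<in> J ==> (LINT y|\<mu> i. cmod y ^ 4) \<le> K"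
  and mean: "\<And>i. i \<in> J ==> (LINT y|\<mu> i. y) = 0" and var: "\<And>i. i \<in> J ==> (LINT y|\<mu> i. (cmod y)\<^sup>2) = 1"
begin

abbreviation "\<nu> \<equiv> PiM J \<mu>"

lemma prob_\<nu>: "prob_space \<nu>"
 by (rule prob_space_PiM[OF prob])

lemma product_sigma_finite: "product_sigma_finite \<mu>"
 unfolding product_sigma_finite_def using prob by (auto intro: prob_space_imp_sigma_finite)

lemma K_nonneg: "J \<noteq> {} ==> 0 \<le> K"
proof -
 assume "J \<noteq> {}"
 then obtain i where i: "i \<in> J" by blast
 have "0 \<le> (LINT y|\<mu> i. cmod y ^ 4)" by (rule integral_nonneg_AE) auto
 then show ?thesis using le4[OF i] by (rule order_trans)
qed

lemma component_measurable [measurable]: "i \<in> J ==> (\<lambda>u. u i) \<in> borel_measurable \<nu>"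
 using measurable_component_singleton[of i J \<mu>] measurable_cong_sets[OF refl sets, of \<nu>] by blast

lemma measurable_\<mu>: "g \<in> borel_measurable borel ==> g \<in> borel_measurable (\<mu> i)"
 using measurable_cong_sets[OF sets refl] by blast

lemma distr_component: "i \<in> J ==> distr \<nu> (\<mu> i) (\<lambda>u. u i) = \<mu> i"
 using distr_PiM_component[of J \<mu> i] prob by blast

lemma component_integral:
 fixes g :: "complex => 'c::{banach, second_countable_topology}"
 assumes "i \<in> J" "g \<in> borel_measurable borel"
 shows "integrable \<nu> (\<lambda>u. g (u i)) \<longleftrightarrow> integrable (\<mu> i) g" "(LINT u|\<nu>. g (u i)) = (LINT y|\<mu> i. g y)"
proof -
 have g: "g \<in> borel_measurable (\<mu> i)" using assms(2) measurable_cong_sets[OF sets refl] by blast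
 have c: "(\<lambda>u. u i) \<in> \<nu> \<rightarrow>\<^sub>M \<mu> i" using assms(1) by (rule measurable_component_singleton)
 show "integrable \<nu> (\<lambda>u. g (u i)) \<longleftrightarrow> integrable (\<mu> i) g"
  using integrable_distr_eq[OF c g] unfolding distr_component[OF assms(1)] by simp
 show "(LINT u|\<nu>. g (u i)) = (LINT y|\<mu> i. g y)"
  using integral_distr[OF c g] unfolding distr_component[OF assms(1)] by simp
qed

text \<open>Fubini with coordinate i as the inner integral.\<close>

lemma integral_coordinate_zero:
 fixes F :: "('i => complex) => complex"
 assumes i: "i \<in> J" and F: "integrable \<nu> F" and z: "\<And>u. (LINT y|\<mu> i. F (u(i := y))) = 0"
 shows "(LINT u|\<nu>. F u) = 0"
proof -
 have ins: "insert i (J - {i}) = J" using i by blast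
 have "(LINT u|PiM (insert i (J - {i})) \<mu>. F u) = (LINT u|PiM (J - {i}) \<mu>. LINT y|\<mu> i. F (u(i := y)))"
  by (rule product_sigma_finite.product_integral_insert[OF product_sigma_finite]) (use fin in simp, simp, use F in \<open>simp only: ins\<close>)
 then show ?thesis by (simp only: ins z) simp
qed

text \<open>The centred product of two coordinates. A quadratic form minus its mean is a linear
  combination of these variables, and most pairs of them are orthogonal.\<close>

definition xi :: "'i => 'i => ('i => complex) => complex" where
 "xi a b u = u b * cnj (u a) - (if a = b then 1 else 0)"

lemma xi_measurable [measurable]: "a \<in> J ==> b \<in> J ==> xi a b \<in> borel_measurable \<nu>"
proof -
 assume "a \<in> J" "b \<in> J"
 then have [measurable]: "(\<lambda>u. cnj (u a)) \<in> borel_measurable \<nu>" "(\<lambda>u. u b) \<in> borel_measurable \<nu>"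
  using measurable_compose[OF component_measurable borel_measurable_continuous_onI[of cnj]] by (auto simp: continuous_intros)
 show ?thesis unfolding xi_def[abs_def] by measurable
qed

lemma xi_square_le: "(cmod (xi a b u))\<^sup>2 \<le> (cmod (u a) ^ 4 + cmod (u b) ^ 4) / 2 + 1"
proof (cases "a = b")
 case True
 have "u b * cnj (u b) = of_real ((cmod (u b))\<^sup>2)" by (rule complex_norm_square[symmetric])
 then have "xi a b u = of_real ((cmod (u a))\<^sup>2 - 1)" using True by (simp add: xi_def)
 then have "(cmod (xi a b u))\<^sup>2 = ((cmod (u a))\<^sup>2 - 1)\<^sup>2" by (simp only: norm_of_real power2_abs)
 also have "... = cmod (u a) ^ 4 - 2 * (cmod (u a))\<^sup>2 + 1" by (simp add: power2_diff)
 finally show ?thesis using True by simp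
next
 case False
 have "(cmod (xi a b u))\<^sup>2 = (cmod (u b))\<^sup>2 * (cmod (u a))\<^sup>2" using False by (simp add: xi_def norm_mult power_mult_distrib)
 also have "... \<le> (((cmod (u a))\<^sup>2)\<^sup>2 + ((cmod (u b))\<^sup>2)\<^sup>2) / 2"
  using sum_squares_bound[of "(cmod (u a))\<^sup>2" "(cmod (u b))\<^sup>2"] by (simp add: mult_ac)
 finally have "(cmod (xi a b u))\<^sup>2 \<le> (((cmod (u a))\<^sup>2)\<^sup>2 + ((cmod (u b))\<^sup>2)\<^sup>2) / 2" .
 moreover have "((cmod w)\<^sup>2)\<^sup>2 = cmod w ^ 4" for w by simp
 ultimately have "(cmod (xi a b u))\<^sup>2 \<le> (cmod (u a) ^ 4 + cmod (u b) ^ 4) / 2" by (simp only:)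
 then show ?thesis by linarith
qed

lemma xi_square:
 assumes "a \<in> J" "b \<in> J"
 shows "integrable \<nu> (\<lambda>u. (cmod (xi a b u))\<^sup>2)" "(LINT u|\<nu>. (cmod (xi a b u))\<^sup>2) \<le> K + 1"
proof -
 interpret prob_space \<nu> by (rule prob_\<nu>)
 have i4: "integrable \<nu> (\<lambda>u. cmod (u i) ^ 4)" "(LINT u|\<nu>. cmod (u i) ^ 4) \<le> K" if "i \<in> J" for i
  using component_integral[OF that, of "\<lambda>y. cmod y ^ 4"] int4[OF that] le4[OF that] by auto
 have i: "integrable \<nu> (\<lambda>u. (cmod (u a) ^ 4 + cmod (u b) ^ 4) / 2 + 1)" using i4 assms by auto
 show j: "integrable \<nu> (\<lambda>u. (cmod (xi a b u))\<^sup>2)"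
  by (rule Bochner_Integration.integrable_bound[OF i]) (use assms xi_square_le in \<open>auto intro!: AE_I2 order_trans[OF xi_square_le]\<close>)
 have "(LINT u|\<nu>. (cmod (xi a b u))\<^sup>2) \<le> (LINT u|\<nu>. (cmod (u a) ^ 4 + cmod (u b) ^ 4) / 2 + 1)"
  using j i xi_square_le by (intro integral_mono) auto
 also have "... = ((LINT u|\<nu>. cmod (u a) ^ 4) + (LINT u|\<nu>. cmod (u b) ^ 4)) / 2 + 1"
  using i4(1)[OF assms(1)] i4(1)[OF assms(2)] by (simp add: prob_space)
 finally show "(LINT u|\<nu>. (cmod (xi a b u))\<^sup>2) \<le> K + 1"
 proof (rule order_trans)
  have "(x + y) / 2 + 1 \<le> K + 1" if "x \<le> K" "y \<le> K" for x y :: real using that by simp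
  then show "((LINT u|\<nu>. cmod (u a) ^ 4) + (LINT u|\<nu>. cmod (u b) ^ 4)) / 2 + 1 \<le> K + 1"
   using i4(2)[OF assms(1)] i4(2)[OF assms(2)] by blast
 qed
qed

lemma xi_product_integrable:
 assumes "a \<in> J" "b \<in> J" "c \<in> J" "d \<in> J"
 shows "integrable \<nu> (\<lambda>u. xi a b u * cnj (xi c d u))"
proof -
 have i: "integrable \<nu> (\<lambda>u. (cmod (xi a b u))\<^sup>2 + (cmod (xi c d u))\<^sup>2)" using xi_square assms by auto
 have m: "(\<lambda>u. xi a b u * cnj (xi c d u)) \<in> borel_measurable \<nu>"
 proof -
  have "(\<lambda>u. cnj (xi c d u)) \<in> borel_measurable \<nu>"
   using measurable_compose[OF xi_measurable[OF assms(3,4)] borel_measurable_continuous_onI[of cnj]] by (simp add: continuous_intros)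
  then show ?thesis using xi_measurable[OF assms(1,2)] by measurable
 qed
 have le: "x * y \<le> x\<^sup>2 + y\<^sup>2" if "0 \<le> x" "0 \<le> y" for x y :: real
  using sum_squares_bound[of x y] mult_nonneg_nonneg[OF that] by simp
 show ?thesis
  by (rule Bochner_Integration.integrable_bound[OF i m]) (use le in \<open>auto simp: norm_mult intro!: AE_I2\<close>)
qed

lemma integrable_coordinate: "i \<in> J ==> integrable (\<mu> i) (\<lambda>y. y)" "i \<in> J ==> integrable (\<mu> i) (\<lambda>y. (cmod y)\<^sup>2)"
proof -
 assume i: "i \<in> J"
 interpret prob_space "\<mu> i" by (rule prob)
 have I: "integrable (\<mu> i) (\<lambda>y. 1 + cmod y ^ 4)" using int4[OF i] by simp
 have le2: "x\<^sup>2 \<le> 1 + x ^ 4" for x :: real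
 proof -
  have "2 * x\<^sup>2 \<le> x ^ 4 + 1" using zero_le_power2[of "x\<^sup>2 - 1"] by (simp add: power2_diff)
  moreover have "0 \<le> x\<^sup>2" by simp
  ultimately show ?thesis by linarith
 qed
 show i2: "integrable (\<mu> i) (\<lambda>y. (cmod y)\<^sup>2)"
  by (rule Bochner_Integration.integrable_bound[OF I measurable_\<mu>]) (use le2 in \<open>auto intro!: AE_I2\<close>)
 have le1: "x \<le> 1 + x\<^sup>2" for x :: real
 proof -
  have "2 * x \<le> x\<^sup>2 + 1" using zero_le_power2[of "x - 1"] by (simp add: power2_diff)
  moreover have "0 \<le> x\<^sup>2" by simp
  ultimately show ?thesis by linarith
 qed
 have I2: "integrable (\<mu> i) (\<lambda>y. 1 + (cmod y)\<^sup>2)" using i2 by simp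
 show "integrable (\<mu> i) (\<lambda>y. y)"
  by (rule Bochner_Integration.integrable_bound[OF I2 measurable_\<mu>]) (use le1 in \<open>auto intro!: AE_I2\<close>)
qed

text \<open>Integrating out a coordinate that occurs in only one of the two factors gives 0.\<close>

lemma xi_orthogonal:
 assumes J: "a \<in> J" "b \<in> J" "c \<in> J" "d \<in> J" and i: "i \<in> {a, b}" "i \<notin> {c, d}"
 shows "(LINT u|\<nu>. xi a b u * cnj (xi c d u)) = 0"
proof (rule integral_coordinate_zero[of i])
 show iJ: "i \<in> J" using i J by auto
 show "integrable \<nu> (\<lambda>u. xi a b u * cnj (xi c d u))" by (rule xi_product_integrable[OF J])
 fix u
 interpret prob_space "\<mu> i" by (rule prob)
 have cd: "xi c d (u(i := y)) = xi c d u" for y using i by (auto simp: xi_def)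
 note m = mean[OF iJ] and I = integrable_coordinate[OF iJ]
 have cm: "(LINT y|\<mu> i. cnj y) = 0" using m Bochner_Integration.integral_cnj[where M="\<mu> i" and f="\<lambda>y. y"] by simp
 have "(LINT y|\<mu> i. xi a b (u(i := y))) = 0"
 proof (cases "a = b")
  case True
  then have ab: "a = i" "b = i" using i by auto
  have "(LINT y|\<mu> i. xi a b (u(i := y))) = (LINT y|\<mu> i. complex_of_real ((cmod y)\<^sup>2 - 1))"
  proof (rule Bochner_Integration.integral_cong[OF refl])
   fix y show "xi a b (u(i := y)) = complex_of_real ((cmod y)\<^sup>2 - 1)"
    using complex_norm_square[of y] by (simp add: xi_def ab)
  qed
  also have "... = complex_of_real (LINT y|\<mu> i. (cmod y)\<^sup>2 - 1)"
   by (rule integral_of_real[OF Bochner_Integration.integrable_diff[OF I(2) integrable_const]])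
  also have "(LINT y|\<mu> i. (cmod y)\<^sup>2 - 1) = 0" using Bochner_Integration.integral_diff[OF I(2) integrable_const[of 1]] var[OF iJ] by (simp add: prob_space)
  finally show ?thesis by (simp only: of_real_0)
 next
  case False
  then consider "i = a" "b \<noteq> i" | "i = b" "a \<noteq> i" using i by auto
  then show ?thesis
  proof cases
   case 1
   then have "(LINT y|\<mu> i. xi a b (u(i := y))) = (LINT y|\<mu> i. u b * cnj y)" by (auto simp: xi_def)
   then show ?thesis using cm by simp
  next
   case 2
   then have "(LINT y|\<mu> i. xi a b (u(i := y))) = (LINT y|\<mu> i. y * cnj (u a))" by (auto simp: xi_def)
   then show ?thesis using m by simp
  qed
 qed
 then show "(LINT y|\<mu> i. xi a b (u(i := y)) * cnj (xi c d (u(i := y)))) = 0" unfolding cd by simp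
qed

lemma xi_orthogonal':
 assumes J: "a \<in> J" "b \<in> J" "c \<in> J" "d \<in> J" and ne: "{a, b} \<noteq> {c, d}"
 shows "(LINT u|\<nu>. xi a b u * cnj (xi c d u)) = 0"
proof -
 consider i where "i \<in> {a, b}" "i \<notin> {c, d}" | i where "i \<in> {c, d}" "i \<notin> {a, b}" using ne by blast
 then show ?thesis
 proof cases
  case 1
  then show ?thesis by (rule xi_orthogonal[OF J])
 next
  case 2
  have "(LINT u|\<nu>. xi a b u * cnj (xi c d u)) = (LINT u|\<nu>. cnj (xi c d u * cnj (xi a b u)))"
   by (rule Bochner_Integration.integral_cong) (auto simp: mult.commute)
  also have "... = 0" unfolding Bochner_Integration.integral_cnj xi_orthogonal[OF J(3,4,1,2) 2] by (rule complex_cnj_zero)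
  finally show ?thesis .
 qed
qed

text \<open>Expanding the square, only index pairs (a, b) and (c, d) with the same underlying set
  survive. The mean of u_a^2 may be nonzero, so (a, b) can correlate with (b, a); hence the factor
  2. Every surviving expectation is at most K + 1.\<close>

theorem quadratic_form_variance:
 fixes m :: "'i => 'i => complex"
 defines "X \<equiv> \<lambda>u. (\<Sum>a\<in>J. \<Sum>b\<in>J. m a b * (u b * cnj (u a))) - (\<Sum>a\<in>J. m a a)"
 shows "integrable \<nu> (\<lambda>u. (cmod (X u))\<^sup>2)" "(LINT u|\<nu>. (cmod (X u))\<^sup>2) \<le> 2 * (K + 1) * (\<Sum>a\<in>J. \<Sum>b\<in>J. (cmod (m a b))\<^sup>2)"
proof -
 let ?I = "J \<times> J"
 let ?c = "\<lambda>e f :: 'i \<times> 'i. {fst e, snd e} = {fst f, snd f}"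
 let ?m = "\<lambda>(a, b). m a b" and ?x = "\<lambda>(a, b). xi a b"
 have X: "X u = (\<Sum>e\<in>?I. ?m e * ?x e u)" for u
 proof -
  have "(\<Sum>a\<in>J. m a a) = (\<Sum>a\<in>J. \<Sum>b\<in>J. m a b * (if a = b then 1 else 0))"
   by (rule sum.cong) (auto simp: fin if_distrib[of "(*) _"] cong: if_cong)
  then have "X u = (\<Sum>a\<in>J. \<Sum>b\<in>J. m a b * xi a b u)"
   unfolding X_def by (simp only: sum_subtractf[symmetric] xi_def right_diff_distrib)
  then show ?thesis by (simp add: sum.cartesian_product case_prod_beta')
 qed
 have sq: "complex_of_real ((cmod (X u))\<^sup>2) = (\<Sum>e\<in>?I. \<Sum>f\<in>?I. ?m e * cnj (?m f) * (?x e u * cnj (?x f u)))" for u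
  unfolding complex_norm_square X cnj_sum sum_product by (simp add: mult_ac)
 have ip: "integrable \<nu> (\<lambda>u. ?x e u * cnj (?x f u))" if "e \<in> ?I" "f \<in> ?I" for e f
  using that xi_product_integrable by auto
 have "integrable \<nu> (\<lambda>u. complex_of_real ((cmod (X u))\<^sup>2))" unfolding sq using ip
  by (intro Bochner_Integration.integrable_sum integrable_mult_right) auto
 from integrable_Re[OF this] show iX: "integrable \<nu> (\<lambda>u. (cmod (X u))\<^sup>2)" by simp
 let ?A = "\<Sum>e\<in>?I. \<Sum>f\<in>?I. if ?c e f then (cmod (?m e))\<^sup>2 else 0"
 let ?E = "\<lambda>e f. (LINT u|\<nu>. ?x e u * cnj (?x f u))"
 have EB: "cmod (?E e f) \<le> (if ?c e f then K + 1 else 0)" if ef: "e \<in> ?I" "f \<in> ?I" for e f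
 proof -
  obtain a b c d where e: "e = (a, b)" "f = (c, d)" by (cases e; cases f) auto
  have J: "a \<in> J" "b \<in> J" "c \<in> J" "d \<in> J" using ef e by auto
  show ?thesis
  proof (cases "{a, b} = {c, d}")
   case True
   then have "cmod (xi c d u) = cmod (xi a b u)" for u
    by (auto simp: doubleton_eq_iff xi_def norm_mult mult.commute)
   then have "cmod (?E e f) \<le> (LINT u|\<nu>. (cmod (xi a b u))\<^sup>2)"
    using integral_norm_bound[of \<nu> "\<lambda>u. xi a b u * cnj (xi c d u)"] by (simp add: e norm_mult power2_eq_square)
   also have "... \<le> K + 1" by (rule xi_square(2)[OF J(1,2)])
   finally show ?thesis using True by (simp add: e)
  next
   case False
   then show ?thesis using xi_orthogonal'[OF J False] by (simp add: e)
  qed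
 qed
 have "complex_of_real (LINT u|\<nu>. (cmod (X u))\<^sup>2) = (LINT u|\<nu>. complex_of_real ((cmod (X u))\<^sup>2))" by (rule integral_of_real[OF iX, symmetric])
 also have "... = (\<Sum>e\<in>?I. \<Sum>f\<in>?I. ?m e * cnj (?m f) * ?E e f)"
  unfolding sq
 proof (subst Bochner_Integration.integral_sum)
  show "integrable \<nu> (\<lambda>u. \<Sum>f\<in>?I. ?m e * cnj (?m f) * (?x e u * cnj (?x f u)))" if "e \<in> ?I" for e
   using ip that by (intro Bochner_Integration.integrable_sum integrable_mult_right) auto
  show "(\<Sum>e\<in>?I. (LINT u|\<nu>. (\<Sum>f\<in>?I. ?m e * cnj (?m f) * (?x e u * cnj (?x f u))))) = (\<Sum>e\<in>?I. \<Sum>f\<in>?I. ?m e * cnj (?m f) * ?E e f)"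
  proof (rule sum.cong[OF refl])
   fix e assume e: "e \<in> ?I"
   show "(LINT u|\<nu>. (\<Sum>f\<in>?I. ?m e * cnj (?m f) * (?x e u * cnj (?x f u)))) = (\<Sum>f\<in>?I. ?m e * cnj (?m f) * ?E e f)"
    by (subst Bochner_Integration.integral_sum) (use ip[OF e] in \<open>auto intro!: integrable_mult_right\<close>)
  qed
 qed
 finally have "cmod (complex_of_real (LINT u|\<nu>. (cmod (X u))\<^sup>2)) = cmod (\<Sum>e\<in>?I. \<Sum>f\<in>?I. ?m e * cnj (?m f) * ?E e f)" by (rule arg_cong)
 also have "... \<le> (\<Sum>e\<in>?I. \<Sum>f\<in>?I. cmod (?m e) * cmod (?m f) * cmod (?E e f))"
  by (rule order_trans[OF norm_sum], rule sum_mono, rule order_trans[OF norm_sum]) (simp add: norm_mult)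
 \<comment> \<open>The product of two coefficients is replaced by half the sum of their squares;
   afterwards the sums in e and in f agree by symmetry.\<close>
 also have "... \<le> (\<Sum>e\<in>?I. \<Sum>f\<in>?I. if ?c e f then (K + 1) * (((cmod (?m e))\<^sup>2 + (cmod (?m f))\<^sup>2) / 2) else 0)"
 proof (intro sum_mono)
  fix e f assume ef: "e \<in> ?I" "f \<in> ?I"
  then have K: "0 \<le> K" using K_nonneg by auto
  have "cmod (?m e) * cmod (?m f) * cmod (?E e f) \<le> (((cmod (?m e))\<^sup>2 + (cmod (?m f))\<^sup>2) / 2) * (if ?c e f then K + 1 else 0)"
   using sum_squares_bound[of "cmod (?m e)" "cmod (?m f)"] EB[OF ef] by (intro mult_mono) auto
  then show "cmod (?m e) * cmod (?m f) * cmod (?E e f) \<le> (if ?c e f then (K + 1) * (((cmod (?m e))\<^sup>2 + (cmod (?m f))\<^sup>2) / 2) else 0)"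
   by (simp add: mult.commute split: if_splits)
 qed
 also have "... = (K + 1) / 2 * ((\<Sum>e\<in>?I. \<Sum>f\<in>?I. if ?c e f then (cmod (?m e))\<^sup>2 else 0)
   + (\<Sum>e\<in>?I. \<Sum>f\<in>?I. if ?c e f then (cmod (?m f))\<^sup>2 else 0))"
  unfolding sum.distrib[symmetric] sum_distrib_left
 proof (intro sum.cong refl)
  have gen: "(if Q then (K + 1) * ((x + y) / 2) else 0) = (K + 1) / 2 * ((if Q then x else 0) + (if Q then y else 0))" for Q x y
   by (cases Q) simp_all
  fix e f
  show "(if ?c e f then (K + 1) * (((cmod (?m e))\<^sup>2 + (cmod (?m f))\<^sup>2) / 2) else 0)
   = (K + 1) / 2 * ((if ?c e f then (cmod (?m e))\<^sup>2 else 0) + (if ?c e f then (cmod (?m f))\<^sup>2 else 0))"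
   by (rule gen)
 qed
 also have "(\<Sum>e\<in>?I. \<Sum>f\<in>?I. if ?c e f then (cmod (?m f))\<^sup>2 else 0)
   = (\<Sum>e\<in>?I. \<Sum>f\<in>?I. if ?c e f then (cmod (?m e))\<^sup>2 else 0)"
  by (subst sum.swap) (intro sum.cong refl, auto)
 finally have *: "abs (LINT u|\<nu>. (cmod (X u))\<^sup>2) \<le> (K + 1) / 2 * (?A + ?A)" by simp
 \<comment> \<open>For given e at most two indices f qualify: e and its transpose.\<close>
 have AB: "(\<Sum>e\<in>?I. \<Sum>f\<in>?I. if ?c e f then (cmod (?m e))\<^sup>2 else 0) \<le> (\<Sum>e\<in>?I. 2 * (cmod (?m e))\<^sup>2)"
 proof (rule sum_mono)
  fix e assume e: "e \<in> ?I"
  have "(\<Sum>f\<in>?I. if ?c e f then (cmod (?m e))\<^sup>2 else 0) \<le> (\<Sum>f\<in>{e, (snd e, fst e)}. (cmod (?m e))\<^sup>2)"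
  proof -
   have "(\<Sum>f\<in>?I. if ?c e f then (cmod (?m e))\<^sup>2 else 0) = (\<Sum>f\<in>{f \<in> ?I. ?c e f}. (cmod (?m e))\<^sup>2)"
    using fin by (subst sum.inter_filter[symmetric]) auto
   also have "... \<le> (\<Sum>f\<in>{e, (snd e, fst e)}. (cmod (?m e))\<^sup>2)"
    by (rule sum_mono2) (auto simp: doubleton_eq_iff)
   finally show ?thesis .
  qed
  also have "... \<le> 2 * (cmod (?m e))\<^sup>2" by (cases "e = (snd e, fst e)") auto
  finally show "(\<Sum>f\<in>?I. if ?c e f then (cmod (?m e))\<^sup>2 else 0) \<le> 2 * (cmod (?m e))\<^sup>2" .
 qed
 show "(LINT u|\<nu>. (cmod (X u))\<^sup>2) \<le> 2 * (K + 1) * (\<Sum>a\<in>J. \<Sum>b\<in>J. (cmod (m a b))\<^sup>2)"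
 proof (cases "J = {}")
  case True
  then show ?thesis by (simp add: X_def)
 next
  case False
  have "(LINT u|\<nu>. (cmod (X u))\<^sup>2) \<le> (K + 1) / 2 * (?A + ?A)" using * by linarith
  also have "... \<le> (K + 1) / 2 * ((\<Sum>e\<in>?I. 2 * (cmod (?m e))\<^sup>2) + (\<Sum>e\<in>?I. 2 * (cmod (?m e))\<^sup>2))"
   using AB K_nonneg[OF False] by (intro mult_left_mono add_mono) auto
  also have "... = 2 * (K + 1) * (\<Sum>e\<in>?I. (cmod (?m e))\<^sup>2)" by (simp add: sum_distrib_left[symmetric])
  also have "(\<Sum>e\<in>?I. (cmod (?m e))\<^sup>2) = (\<Sum>a\<in>J. \<Sum>b\<in>J. (cmod (m a b))\<^sup>2)"
   by (simp add: sum.cartesian_product case_prod_beta')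
  finally show ?thesis .
 qed
qed

end

section \<open>The leave-one-out estimate\<close>

text \<open>Pure algebra for one column. a and d are diagonal forms close to \<theta>, b, e and r
  are mixed forms close to 0, s is close to t, and u is the unknown. In the ideal case the system
  reads (1 - \<theta>^2) u = - \<theta> t. The size \<rho> of the column is random: for |D| \<le> 1
  all forms are bounded by multiples of G and the errors enter linearly, otherwise a crude bound is
  paid for by D^2.\<close>

lemma leave_one_out_pointwise:
 fixes a b d e u r s t \<theta> :: complex and g \<kappa> R D \<rho> :: real
 assumes sys: "((1 + b) * (1 + e) - a * d) * u = (1 + e) * r - a * s"
  and nn: "0 \<le> g" "0 \<le> \<kappa>" "0 \<le> R" "0 \<le> \<rho>" and \<rho>: "\<rho> \<le> R + \<bar>D\<bar>"
  and bd: "cmod a \<le> g * \<rho>" "cmod b \<le> g * \<rho>" "cmod d \<le> g * \<rho>" "cmod e \<le> g * \<rho>" "cmod u \<le> \<kappa> * (g * \<rho>)"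
  and th: "cmod \<theta> \<le> g * R" "cmod t \<le> \<kappa> * (g * R)"
 defines "G \<equiv> g * (R + 1)"
 shows "cmod ((1 - \<theta>\<^sup>2) * u + \<theta> * t) \<le> (1 + \<kappa>) * (1 + G)\<^sup>2 * (cmod (a - \<theta>) + cmod (d - \<theta>) + cmod b + cmod e + cmod r + cmod (s - t))
  + (\<kappa> * G * (1 + G\<^sup>2) + \<kappa> * G\<^sup>2) * D\<^sup>2"
proof -
 have G: "0 \<le> G" using nn by (simp add: G_def)
 have gR: "g * R \<le> G" using nn by (simp add: G_def distrib_left)
 have \<theta>G: "cmod \<theta> \<le> G" using th(1) gR by linarith
 have tG: "cmod t \<le> \<kappa> * G" using th(2) mult_left_mono[OF gR nn(2)] by linarith
 have C1: "0 \<le> (1 + \<kappa>) * (1 + G)\<^sup>2" using nn by simp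
 have C2: "0 \<le> \<kappa> * G * (1 + G\<^sup>2) + \<kappa> * G\<^sup>2" using nn G by simp
 show ?thesis
 proof (cases "\<bar>D\<bar> \<le> 1")
  case True
  have "g * \<rho> \<le> G" unfolding G_def using \<rho> True nn by (intro mult_left_mono) auto
  then have B: "cmod a \<le> G" "cmod b \<le> G" "cmod d \<le> G" "cmod e \<le> G" "cmod u \<le> \<kappa> * G"
   using bd nn order_trans[OF bd(5) mult_left_mono[OF _ nn(2)]] by auto
  \<comment> \<open>Each summand contains one of the small quantities a - \<theta>, d - \<theta>, b,
    e, r, s - t; the remaining factors are bounded.\<close>
  have id: "(1 - \<theta>\<^sup>2) * u + \<theta> * t = ((a - \<theta>) * d + \<theta> * (d - \<theta>) - b - e - b * e) * u + (1 + e) * r - a * (s - t) - (a - \<theta>) * t"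
  proof -
   have "(1 - \<theta>\<^sup>2) * u + \<theta> * t = ((1 - \<theta>\<^sup>2) - ((1 + b) * (1 + e) - a * d)) * u + ((1 + e) * r - a * s) + \<theta> * t"
    unfolding sys[symmetric] by (simp add: algebra_simps)
   then show ?thesis by (simp add: algebra_simps power2_eq_square)
  qed
  let ?A = "cmod (a - \<theta>)" and ?D = "cmod (d - \<theta>)" and ?S = "cmod (s - t)"
  have "cmod ((1 - \<theta>\<^sup>2) * u + \<theta> * t) \<le> (?A * cmod d + cmod \<theta> * ?D + cmod b + cmod e + cmod b * cmod e) * cmod u + (1 + cmod e) * cmod r + cmod a * ?S + ?A * cmod t"
  proof -
   have t1: "cmod ((a - \<theta>) * d + \<theta> * (d - \<theta>) - b - e - b * e) \<le> ?A * cmod d + cmod \<theta> * ?D + cmod b + cmod e + cmod b * cmod e"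
    unfolding norm_mult[symmetric]
    using norm_triangle_ineq4[of "(a - \<theta>) * d + \<theta> * (d - \<theta>) - b - e" "b * e"] norm_triangle_ineq4[of "(a - \<theta>) * d + \<theta> * (d - \<theta>) - b" e]
     norm_triangle_ineq4[of "(a - \<theta>) * d + \<theta> * (d - \<theta>)" b] norm_triangle_ineq[of "(a - \<theta>) * d" "\<theta> * (d - \<theta>)"] by linarith
   have t2: "cmod (1 + e) \<le> 1 + cmod e" using norm_triangle_ineq[of 1 e] by simp
   let ?X = "((a - \<theta>) * d + \<theta> * (d - \<theta>) - b - e - b * e) * u"
   have "cmod ((1 - \<theta>\<^sup>2) * u + \<theta> * t) \<le> cmod ?X + cmod ((1 + e) * r) + cmod (a * (s - t)) + cmod ((a - \<theta>) * t)"
    unfolding id using norm_triangle_ineq4[of "?X + (1 + e) * r - a * (s - t)" "(a - \<theta>) * t"]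
     norm_triangle_ineq4[of "?X + (1 + e) * r" "a * (s - t)"] norm_triangle_ineq[of ?X "(1 + e) * r"] by linarith
   also have "... \<le> (?A * cmod d + cmod \<theta> * ?D + cmod b + cmod e + cmod b * cmod e) * cmod u + (1 + cmod e) * cmod r + cmod a * ?S + ?A * cmod t"
    unfolding norm_mult using t1 t2 by (intro add_mono mult_right_mono) auto
   finally show ?thesis .
  qed
  also have "... \<le> (?A * G + G * ?D + cmod b + cmod e + G * cmod e) * (\<kappa> * G) + (1 + G) * cmod r + G * ?S + ?A * (\<kappa> * G)"
   using B \<theta>G tG G nn by (intro add_mono mult_mono mult_right_mono mult_left_mono) auto
  also have "... \<le> (1 + \<kappa>) * (1 + G)\<^sup>2 * (?A + ?D + cmod b + cmod e + cmod r + ?S)"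
  proof -
   have kG: "0 \<le> \<kappa> * G" "0 \<le> \<kappa> * G\<^sup>2" "0 \<le> G\<^sup>2" using nn G by auto
   have e: "(1 + \<kappa>) * (1 + G)\<^sup>2 = 1 + 2 * G + G\<^sup>2 + \<kappa> + 2 * (\<kappa> * G) + \<kappa> * G\<^sup>2" by (simp add: power2_eq_square algebra_simps)
   have c: "\<kappa> * G\<^sup>2 + \<kappa> * G \<le> (1 + \<kappa>) * (1 + G)\<^sup>2" "\<kappa> * G\<^sup>2 \<le> (1 + \<kappa>) * (1 + G)\<^sup>2" "\<kappa> * G \<le> (1 + \<kappa>) * (1 + G)\<^sup>2"
    "1 + G \<le> (1 + \<kappa>) * (1 + G)\<^sup>2" "G \<le> (1 + \<kappa>) * (1 + G)\<^sup>2"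
    unfolding e using kG nn G by linarith+
   have "(?A * G + G * ?D + cmod b + cmod e + G * cmod e) * (\<kappa> * G) + (1 + G) * cmod r + G * ?S + ?A * (\<kappa> * G)
    = (\<kappa> * G\<^sup>2 + \<kappa> * G) * ?A + \<kappa> * G\<^sup>2 * ?D + \<kappa> * G * cmod b + (\<kappa> * G\<^sup>2 + \<kappa> * G) * cmod e + (1 + G) * cmod r + G * ?S"
    by (simp add: power2_eq_square algebra_simps)
   also have "... \<le> (1 + \<kappa>) * (1 + G)\<^sup>2 * ?A + (1 + \<kappa>) * (1 + G)\<^sup>2 * ?D + (1 + \<kappa>) * (1 + G)\<^sup>2 * cmod b
    + (1 + \<kappa>) * (1 + G)\<^sup>2 * cmod e + (1 + \<kappa>) * (1 + G)\<^sup>2 * cmod r + (1 + \<kappa>) * (1 + G)\<^sup>2 * ?S"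
    using c by (intro add_mono mult_right_mono) auto
   finally show ?thesis by (simp only: distrib_left)
  qed
  finally show ?thesis using mult_nonneg_nonneg[OF C2 zero_le_power2[of D]] by linarith
 next
  case False
  \<comment> \<open>Here nothing is small, but every bounded term may be multiplied by D^2, whose
    mean is small.\<close>
  have D1: "1 \<le> D\<^sup>2" using False by (metis abs_le_square_iff abs_one linorder_linear one_power2)
  have DD: "\<bar>D\<bar> \<le> D\<^sup>2" using False mult_left_mono[of 1 "\<bar>D\<bar>" "\<bar>D\<bar>"] by (simp add: power2_eq_square)
  have "R \<le> R * D\<^sup>2" using mult_left_mono[OF D1 nn(3)] by simp
  then have "\<rho> \<le> (R + 1) * D\<^sup>2" using \<rho> DD by (simp add: distrib_right)
  then have "g * \<rho> \<le> G * D\<^sup>2" unfolding G_def using mult_left_mono[OF _ nn(1)] by (simp add: mult.assoc)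
  then have u: "cmod u \<le> \<kappa> * G * D\<^sup>2" using bd(5) mult_left_mono[OF _ nn(2)] by (fastforce simp: mult.assoc)
  have "cmod ((1 - \<theta>\<^sup>2) * u + \<theta> * t) \<le> cmod (1 - \<theta>\<^sup>2) * cmod u + cmod \<theta> * cmod t"
   using norm_triangle_ineq[of "(1 - \<theta>\<^sup>2) * u" "\<theta> * t"] by (simp add: norm_mult)
  also have "... \<le> (1 + G\<^sup>2) * (\<kappa> * G * D\<^sup>2) + G * (\<kappa> * G)"
  proof (intro add_mono mult_mono)
   have "cmod (1 - \<theta>\<^sup>2) \<le> 1 + (cmod \<theta>)\<^sup>2" using norm_triangle_ineq4[of 1 "\<theta>\<^sup>2"] by (simp add: norm_power)
   also have "... \<le> 1 + G\<^sup>2" using power_mono[OF \<theta>G, of 2] by simp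
   finally show "cmod (1 - \<theta>\<^sup>2) \<le> 1 + G\<^sup>2" .
  qed (use u \<theta>G tG G nn in auto)
  also have "... \<le> (1 + G\<^sup>2) * (\<kappa> * G * D\<^sup>2) + (G * (\<kappa> * G)) * D\<^sup>2"
   using mult_left_mono[OF D1, of "G * (\<kappa> * G)"] G nn by simp
  also have "... = (\<kappa> * G * (1 + G\<^sup>2) + \<kappa> * G\<^sup>2) * D\<^sup>2" by (simp add: power2_eq_square algebra_simps)
  finally show ?thesis using mult_nonneg_nonneg[OF C1, of "cmod (a - \<theta>) + cmod (d - \<theta>) + cmod b + cmod e + cmod r + cmod (s - t)"] by simp
 qed
qed

abbreviation idx :: "nat => (nat \<times> nat) set" where
 "idx p \<equiv> {..<2} \<times> {..<p}"

lemma sum_first_component: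
 assumes "l < (2::nat)"
 shows "(\<Sum>x\<in>idx p. if fst x = l then g (snd x) else 0) = (\<Sum>a<p. g a :: 'c::comm_monoid_add)"
proof -
 have "(\<Sum>x\<in>idx p. if fst x = l then g (snd x) else 0) = (\<Sum>l'<2. \<Sum>a<p. if l' = l then g a else 0)"
  by (simp add: sum.cartesian_product case_prod_beta')
 also have "... = (\<Sum>l'<2. if l' = l then (\<Sum>a<p. g a) else 0)" by (rule sum.cong) auto
 also have "... = (\<Sum>a<p. g a)" using assms by (simp only: sum.delta' finite_lessThan lessThan_iff if_True sum.delta)
 finally show ?thesis .
qed

lemma colv_index: "i < p ==> colv p u k $ i = u (k, i)"
 by (simp add: colv_def)

text \<open>M is placed in block (l, k) of a 2 x 2 block matrix indexed by \<open>idx p\<close>. A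
  form in one or two column vectors thereby becomes a form in all entries of the pair, with the same
  Frobenius norm and with trace 0 unless k = l.\<close>

lemma inn_quadratic_form:
 assumes M: "M \<in> carrier_mat p p" and kl: "k < 2" "l < 2"
 defines "m \<equiv> \<lambda>x y. if fst x = l then (if fst y = k then M $$ (snd x, snd y) else 0) else (0 :: complex)"
 shows "inn p (M *v colv p u k) (colv p u l) = (\<Sum>x\<in>idx p. \<Sum>y\<in>idx p. m x y * (u y * cnj (u x)))"
  "(\<Sum>x\<in>idx p. m x x) = (if k = l then mat_trace M else 0)"
  "(\<Sum>x\<in>idx p. \<Sum>y\<in>idx p. (cmod (m x y))\<^sup>2) = (\<Sum>a<p. \<Sum>b<p. (cmod (M $$ (a, b)))\<^sup>2)"
proof -
 have "(\<Sum>x\<in>idx p. \<Sum>y\<in>idx p. m x y * (u y * cnj (u x)))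
  = (\<Sum>x\<in>idx p. if fst x = l then (\<Sum>b<p. M $$ (snd x, b) * (u (k, b) * cnj (u (l, snd x)))) else 0)"
 proof (rule sum.cong[OF refl])
  fix x :: "nat \<times> nat"
  show "(\<Sum>y\<in>idx p. m x y * (u y * cnj (u x))) = (if fst x = l then (\<Sum>b<p. M $$ (snd x, b) * (u (k, b) * cnj (u (l, snd x)))) else 0)"
  proof (cases "fst x = l")
   case True
   have "(\<Sum>y\<in>idx p. m x y * (u y * cnj (u x))) = (\<Sum>y\<in>idx p. if fst y = k then M $$ (snd x, snd y) * (u (k, snd y) * cnj (u (l, snd x))) else 0)"
    by (rule sum.cong) (use True in \<open>auto simp: m_def\<close>)
   also have "... = (\<Sum>b<p. M $$ (snd x, b) * (u (k, b) * cnj (u (l, snd x))))" by (rule sum_first_component[OF kl(1)])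
   finally show ?thesis using True by simp
  qed (simp add: m_def)
 qed
 also have "... = (\<Sum>a<p. \<Sum>b<p. M $$ (a, b) * (u (k, b) * cnj (u (l, a))))" by (rule sum_first_component[OF kl(2)])
 also have "... = inn p (M *v colv p u k) (colv p u l)"
  unfolding inn_def
  by (rule sum.cong) (auto simp: mult_mat_vec_index[OF M colv_carrier] colv_index sum_distrib_right mult.assoc)
 finally show "inn p (M *v colv p u k) (colv p u l) = (\<Sum>x\<in>idx p. \<Sum>y\<in>idx p. m x y * (u y * cnj (u x)))" by simp
 have "(\<Sum>x\<in>idx p. m x x) = (\<Sum>x\<in>idx p. if fst x = l then (if k = l then M $$ (snd x, snd x) else 0) else 0)"
  by (rule sum.cong) (auto simp: m_def)
 also have "... = (\<Sum>a<p. if k = l then M $$ (a, a) else 0)" by (rule sum_first_component[OF kl(2)])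
 finally show "(\<Sum>x\<in>idx p. m x x) = (if k = l then mat_trace M else 0)" by (simp add: mat_trace_carrier[OF M])
 have "(\<Sum>x\<in>idx p. \<Sum>y\<in>idx p. (cmod (m x y))\<^sup>2) = (\<Sum>x\<in>idx p. if fst x = l then (\<Sum>b<p. (cmod (M $$ (snd x, b)))\<^sup>2) else 0)"
 proof (rule sum.cong[OF refl])
  fix x :: "nat \<times> nat"
  show "(\<Sum>y\<in>idx p. (cmod (m x y))\<^sup>2) = (if fst x = l then (\<Sum>b<p. (cmod (M $$ (snd x, b)))\<^sup>2) else 0)"
  proof (cases "fst x = l")
   case True
   have "(\<Sum>y\<in>idx p. (cmod (m x y))\<^sup>2) = (\<Sum>y\<in>idx p. if fst y = k then (cmod (M $$ (snd x, snd y)))\<^sup>2 else 0)"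
    by (rule sum.cong) (use True in \<open>auto simp: m_def\<close>)
   also have "... = (\<Sum>b<p. (cmod (M $$ (snd x, b)))\<^sup>2)" by (rule sum_first_component[OF kl(1)])
   finally show ?thesis using True by simp
  qed (simp add: m_def)
 qed
 also have "... = (\<Sum>a<p. \<Sum>b<p. (cmod (M $$ (a, b)))\<^sup>2)" by (rule sum_first_component[OF kl(2)])
 finally show "(\<Sum>x\<in>idx p. \<Sum>y\<in>idx p. (cmod (m x y))\<^sup>2) = (\<Sum>a<p. \<Sum>b<p. (cmod (M $$ (a, b)))\<^sup>2)" .
qed

section \<open>The model with independent columns\<close>

locale column_model =
 fixes p n :: nat and \<mu> :: "nat => nat \<times> nat => complex measure" and K :: real
 assumes n: "0 < n" and p: "0 < p"
  and entries: "\<And>j. entry_space (idx p) (\<mu> j) K"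
begin

abbreviation "J \<equiv> {..<2::nat} \<times> {..<p}"

definition \<nu> :: "nat => (nat \<times> nat => complex) measure" where
 "\<nu> j = PiM J (\<mu> j)"

abbreviation "P \<equiv> PiM {..<n} \<nu>"

lemma prob_\<nu>: "prob_space (\<nu> j)"
 unfolding \<nu>_def by (rule entry_space.prob_\<nu>[OF entries])

sublocale cols: product_prob_spaces \<nu>
 by (rule product_prob_spaces.intro) (rule prob_\<nu>)

sublocale PP: prob_space P
 by (rule cols.prob_PiM)

lemma K_nonneg: "0 \<le> K"
 by (rule entry_space.K_nonneg[OF entries]) (use p in \<open>auto simp: lessThan_empty_iff\<close>)

lemma measurable_entry [measurable]: "j < n ==> x \<in> J ==> (\<lambda>w. w j x) \<in> borel_measurable P"
proof -
 assume j: "j < n" and x: "x \<in> J"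
 have "(\<lambda>w. w j) \<in> P \<rightarrow>\<^sub>M \<nu> j" using j by (intro measurable_component_singleton) simp
 moreover have "(\<lambda>u. u x) \<in> borel_measurable (\<nu> j)" unfolding \<nu>_def by (rule entry_space.component_measurable[OF entries x])
 ultimately show ?thesis by (rule measurable_compose)
qed

lemma measurable_Smat_gen:
 assumes B: "B \<in> carrier_mat p p" and F: "\<And>j x. j < n ==> x \<in> J ==> (\<lambda>\<omega>. F \<omega> j x) \<in> borel_measurable M"
  and ab: "a < p" "b < p"
 shows "(\<lambda>\<omega>. Smat p n B (F \<omega>) $$ (a, b)) \<in> borel_measurable M"
proof -
 have v: "(\<lambda>\<omega>. (B *v colv p (F \<omega> j) k) $ i) \<in> borel_measurable M" if "j < n" "k < 2" "i < p" for j k i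
 proof (rule measurable_mult_mat_vec[OF B colv_carrier _ _ that(3)])
  show "(\<lambda>\<omega>. colv p (F \<omega> j) k $ i) \<in> borel_measurable M" if "i < p" for i
   using F[of j "(k, i)"] that \<open>j < n\<close> \<open>k < 2\<close> by (simp add: colv_def)
 qed simp
 have vc: "(\<lambda>\<omega>. cnj ((B *v colv p (F \<omega> j) k) $ i)) \<in> borel_measurable M" if "j < n" "k < 2" "i < p" for j k i
  using measurable_compose[OF v[OF that] borel_measurable_continuous_onI[of cnj]] by (simp add: continuous_intros)
 show ?thesis unfolding Smat_index[OF ab]
  using v vc ab by (intro borel_measurable_divide borel_measurable_sum borel_measurable_add borel_measurable_times borel_measurable_const) auto
qed

lemma second_moment_column:
 fixes X :: "(nat => nat \<times> nat => complex) => complex"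
 assumes X: "X \<in> borel_measurable P" and j: "j < n" and c: "0 \<le> c"
  and le: "\<And>w. (\<integral>\<^sup>+y. ennreal ((cmod (X (w(j := y))))\<^sup>2) \<partial>\<nu> j) \<le> ennreal c"
 shows "integrable P (\<lambda>w. (cmod (X w))\<^sup>2)" "(LINT w|P. (cmod (X w))\<^sup>2) \<le> c"
proof -
 let ?I = "{..<n} - {j}"
 have ins: "insert j ?I = {..<n}" using j by auto
 have m: "(\<lambda>w. ennreal ((cmod (X w))\<^sup>2)) \<in> borel_measurable P" using X by measurable
 interpret I: prob_space "PiM ?I \<nu>" by (rule prob_space_PiM[OF prob_\<nu>])
 have "(\<integral>\<^sup>+w. ennreal ((cmod (X w))\<^sup>2) \<partial>PiM (insert j ?I) \<nu>) = (\<integral>\<^sup>+w. (\<integral>\<^sup>+y. ennreal ((cmod (X (w(j := y))))\<^sup>2) \<partial>\<nu> j) \<partial>PiM ?I \<nu>)"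
  by (rule product_sigma_finite.product_nn_integral_insert[OF cols.product_sigma_finite]) (simp, simp, use m in \<open>simp only: ins\<close>)
 also have "... \<le> (\<integral>\<^sup>+w. ennreal c \<partial>PiM ?I \<nu>)" by (rule nn_integral_mono) (rule le)
 also have "... = ennreal c" by (simp add: I.emeasure_space_1)
 finally have nn: "(\<integral>\<^sup>+w. ennreal ((cmod (X w))\<^sup>2) \<partial>P) \<le> ennreal c" unfolding ins .
 show i: "integrable P (\<lambda>w. (cmod (X w))\<^sup>2)"
 proof (rule integrableI_bounded)
  show "(\<integral>\<^sup>+w. ennreal (norm ((cmod (X w))\<^sup>2)) \<partial>P) < \<infinity>" using nn by (simp add: le_less_trans[OF _ ennreal_less_top])
 qed (use X in measurable)
 show "(LINT w|P. (cmod (X w))\<^sup>2) \<le> c"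
  using nn nn_integral_eq_integral[OF i] c by simp
qed

lemma quadratic_variance:
 assumes M: "M \<in> carrier_mat p p" and kl: "k < 2" "l < 2"
 shows "(\<integral>\<^sup>+u. ennreal ((cmod (inn p (M *v colv p u k) (colv p u l) - (if k = l then mat_trace M else 0)))\<^sup>2) \<partial>\<nu> j)
  \<le> ennreal (2 * (K + 1) * (\<Sum>a<p. \<Sum>b<p. (cmod (M $$ (a, b)))\<^sup>2))"
proof -
 let ?m = "\<lambda>x y. if fst x = l then (if fst y = k then M $$ (snd x, snd y) else 0) else (0 :: complex)"
 note V = entry_space.quadratic_form_variance[OF entries[of j], where m = ?m]
 note I = inn_quadratic_form[OF M kl]
 have "(\<integral>\<^sup>+u. ennreal ((cmod (inn p (M *v colv p u k) (colv p u l) - (if k = l then mat_trace M else 0)))\<^sup>2) \<partial>\<nu> j)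
  = ennreal (LINT u|\<nu> j. (cmod (inn p (M *v colv p u k) (colv p u l) - (if k = l then mat_trace M else 0)))\<^sup>2)"
  unfolding I(1) I(2)[symmetric] \<nu>_def by (rule nn_integral_eq_integral[OF V(1)]) simp
 also have "... \<le> ennreal (2 * (K + 1) * (\<Sum>a<p. \<Sum>b<p. (cmod (M $$ (a, b)))\<^sup>2))"
  unfolding I(1) I(2)[symmetric] I(3)[symmetric] \<nu>_def by (rule ennreal_leI[OF V(2)])
 finally show ?thesis .
qed

end

text \<open>The pointwise estimate with R = 2 \<gamma>, averaged: it has 6 deviations, each of mean
  at most the displayed square root over sqrt n, and 8 (K + 1) \<gamma> / n bounds the mean of D^2.
  What matters is that n and p enter only through the ratio bound \<gamma>, and B only through
  g.\<close>

definition estimate_const :: "real => real => real => real => real" where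
 "estimate_const g K \<gamma> \<kappa> = (let G = g * (2 * \<gamma> + 1) in
   6 * (1 + \<kappa>) * (1 + G)\<^sup>2 * sqrt (3 * (g * \<kappa>)\<^sup>2 * (2 * (K + 1) * \<gamma> + 48))
   + (\<kappa> * G * (1 + G\<^sup>2) + \<kappa> * G\<^sup>2) * (8 * (K + 1) * \<gamma>))"

lemma cmod_add_square_le: "(cmod (x + y + w))\<^sup>2 \<le> 3 * ((cmod x)\<^sup>2 + (cmod y)\<^sup>2 + (cmod w)\<^sup>2)"
proof -
 have "cmod (x + y + w) \<le> cmod x + cmod y + cmod w"
  using norm_triangle_ineq[of "x + y" w] norm_triangle_ineq[of x y] by linarith
 then have "(cmod (x + y + w))\<^sup>2 \<le> (cmod x + cmod y + cmod w)\<^sup>2" by (intro power_mono) auto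
 also have "... \<le> 3 * ((cmod x)\<^sup>2 + (cmod y)\<^sup>2 + (cmod w)\<^sup>2)"
  using sum_squares_bound[of "cmod x" "cmod y"] sum_squares_bound[of "cmod x" "cmod w"] sum_squares_bound[of "cmod y" "cmod w"]
  by (simp add: power2_eq_square algebra_simps)
 finally show ?thesis .
qed

locale matrix_model = column_model +
 fixes B :: "complex mat" and z :: complex and \<beta> \<gamma> :: real
 assumes opB: "opb p B \<beta>" and hermB: "mat_adjoint B = B" and z: "0 < Im z" and p_le: "real p \<le> \<gamma> * real n"
begin

text \<open>Here A = B^2, so \<open>T (1\<^sub>m p)\<close> is the mean trace \<theta> and
  \<open>T N\<close> is E tr(A N Q) / n. The number \<open>g\<close> bounds the norm of B Q
  B.\<close>

definition "Q w = resolvent p (Smat p n B w) z"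
definition "g = \<beta>\<^sup>2 / Im z"
definition "tr N w = mat_trace (B * B * N * Q w) / of_nat n"
definition "T N = (LINT w|P. tr N w)"
abbreviation "rm j w \<equiv> w(j := (\<lambda>_. 0))"
text \<open>\<open>q\<close> uses the resolvent without column j, hence is a quadratic form with a
  matrix independent of that column. \<open>uu\<close> uses the full resolvent and supplies the
  unknowns of the linear system.\<close>

definition "q N j k l w = inn p (N *v (Q (rm j w) *v (xcol p B w j k))) (xcol p B w j l) / of_nat n"
definition "uu N j k l w = inn p (N *v (Q w *v (xcol p B w j k))) (xcol p B w j l) / of_nat n"
text \<open>The squared length of the two j-th columns over n, by which all forms in them are
  bounded. Its mean is 2 p / n, which \<open>D\<close> subtracts.\<close>

definition "\<rho> j w = (nsq p (colv p (w j) 0) + nsq p (colv p (w j) 1)) / real n"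
definition "D j w = \<rho> j w - 2 * real p / real n"
definition "cA \<kappa> = 3 * (g * \<kappa>)\<^sup>2 * (2 * (K + 1) * \<gamma> + 48)"

lemma Bc: "B \<in> carrier_mat p p" by (rule opbD(1)[OF opB])

lemma Qop: "opb p (Q w) (1 / Im z)" unfolding Q_def by (rule herm.opb_resolvent[OF Smat_herm z])

lemma Qc: "Q w \<in> carrier_mat p p" by (rule opbD(1)[OF Qop])

lemma g_nonneg: "0 \<le> g" using z by (simp add: g_def)

lemma gamma_nonneg: "0 \<le> \<gamma>"
proof (rule ccontr)
 assume "\<not> 0 \<le> \<gamma>"
 then have "\<gamma> * real n \<le> 0" by (simp add: mult_le_0_iff)
 then show False using p_le p by simp
qed

lemma pn: "real p / real n \<le> \<gamma>" using p_le n by (simp add: divide_le_eq)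

lemma BBop: "opb p N \<kappa> ==> opb p (B * B * N) (\<beta>\<^sup>2 * \<kappa>)"
 using opb_mult[OF opb_mult[OF opB opB]] by (simp add: power2_eq_square)

lemma trop: "opb p N \<kappa> ==> opb p (B * B * N * Q w) (g * \<kappa>)"
 using opb_mult[OF BBop Qop, of N \<kappa> w] by (simp add: g_def)

lemma tr_bound: assumes "opb p N \<kappa>" shows "cmod (tr N w) \<le> \<kappa> * (g * \<gamma>)"
proof -
 have "cmod (tr N w) \<le> real p * (g * \<kappa>) / real n"
  unfolding tr_def norm_divide using opb_trace[OF trop[OF assms, of w]] n by (simp add: divide_right_mono)
 also have "... = real p / real n * (g * \<kappa>)" by simp
 also have "... \<le> \<gamma> * (g * \<kappa>)" by (rule mult_right_mono[OF pn]) (simp add: g_nonneg opbD(2)[OF assms])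
 finally show ?thesis by (simp add: mult_ac)
qed

lemma tr_update:
 assumes N: "opb p N \<kappa>" and j: "j < n"
 shows "cmod (tr N w - tr N (w(j := u))) \<le> 4 * (g * \<kappa>) / real n"
proof -
 have "cmod (tr N w - tr N (w(j := u))) = cmod (mat_trace (B * B * N * Q w) - mat_trace (B * B * N * Q (w(j := u)))) / real n"
  by (simp add: tr_def diff_divide_distrib[symmetric] norm_divide)
 also have "... \<le> (4 * (\<beta>\<^sup>2 * \<kappa>) / Im z) / real n"
  unfolding Q_def by (rule divide_right_mono[OF trace_resolvent_update_any[OF Bc j z BBop[OF N]]]) simp
 also have "... = 4 * (g * \<kappa>) / real n" by (simp add: g_def)
 finally show ?thesis .
qed

lemma meas_rm: "j < n ==> i < n ==> x \<in> J ==> (\<lambda>w. rm j w i x) \<in> borel_measurable P"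
 by (cases "i = j") (simp_all add: measurable_entry)

lemma meas_Q: assumes "a < p" "b < p" shows "(\<lambda>w. Q w $$ (a, b)) \<in> borel_measurable P"
 unfolding Q_def by (rule measurable_resolvent[OF Smat_carrier _ assms]) (rule measurable_Smat_gen[OF Bc measurable_entry], assumption+)

lemma meas_Q_rm: assumes "j < n" "a < p" "b < p" shows "(\<lambda>w. Q (rm j w) $$ (a, b)) \<in> borel_measurable P"
 unfolding Q_def by (rule measurable_resolvent[OF Smat_carrier _ assms(2,3)]) (rule measurable_Smat_gen[OF Bc meas_rm[OF assms(1)]], assumption+)

lemma meas_tr_gen:
 assumes N: "N \<in> carrier_mat p p" and F: "\<And>w. F w \<in> carrier_mat p p" "\<And>a b. a < p ==> b < p ==> (\<lambda>w. F w $$ (a, b)) \<in> borel_measurable M"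
 shows "(\<lambda>w. mat_trace (N * F w)) \<in> borel_measurable M"
 by (rule measurable_mat_trace[OF mult_carrier_mat[OF N F(1)]], rule measurable_mult_mat[OF N F(1) _ F(2)]) auto

lemma BBN: "N \<in> carrier_mat p p ==> B * B * N \<in> carrier_mat p p"
 by (rule mult_carrier_mat[OF mult_carrier_mat[OF Bc Bc]])

lemma meas_tr: "N \<in> carrier_mat p p ==> tr N \<in> borel_measurable P"
 unfolding tr_def by (intro borel_measurable_divide borel_measurable_const meas_tr_gen[OF BBN Qc meas_Q])

lemma meas_tr_rm: "N \<in> carrier_mat p p ==> j < n ==> (\<lambda>w. tr N (rm j w)) \<in> borel_measurable P"
 unfolding tr_def by (intro borel_measurable_divide borel_measurable_const meas_tr_gen[OF BBN Qc meas_Q_rm])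

lemma meas_Bcol: "j < n ==> k < 2 ==> a < p ==> (\<lambda>w. (xcol p B w j k) $ a) \<in> borel_measurable P"
 by (rule measurable_mult_mat_vec[OF Bc colv_carrier]) (auto simp: colv_index intro: measurable_entry)

lemma meas_form:
 assumes N: "N \<in> carrier_mat p p" and F: "\<And>w. F w \<in> carrier_mat p p" "\<And>a b. a < p ==> b < p ==> (\<lambda>w. F w $$ (a, b)) \<in> borel_measurable P"
  and jkl: "j < n" "k < 2" "l < 2"
 shows "(\<lambda>w. inn p (N *v (F w *v (xcol p B w j k))) (xcol p B w j l) / of_nat n) \<in> borel_measurable P"
proof -
 have c1: "B *v colv p (w j) k \<in> carrier_vec p" for w k by (rule mult_mat_vec_carrier[OF Bc colv_carrier])
 have c2: "F w *v (xcol p B w j k) \<in> carrier_vec p" for w by (rule mult_mat_vec_carrier[OF F(1) c1])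
 have m2: "(\<lambda>w. (F w *v (xcol p B w j k)) $ a) \<in> borel_measurable P" if "a < p" for a
  by (rule measurable_mult_mat_vec[where A = F and v = "\<lambda>w. B *v colv p (w j) k" and m = p and n = p]) (fact F c1 | rule F(2) meas_Bcol[OF jkl(1,2)] that, assumption?)+
 have m3: "(\<lambda>w. (N *v (F w *v (xcol p B w j k))) $ a) \<in> borel_measurable P" if "a < p" for a
  by (rule measurable_mult_mat_vec[where A = "\<lambda>_. N" and v = "\<lambda>w. F w *v (xcol p B w j k)" and m = p and n = p]) (use N c2 m2 that in auto)
 show ?thesis
  by (intro borel_measurable_divide borel_measurable_const measurable_inn m3 meas_Bcol[OF jkl(1,3)])
qed

lemma meas_q: "N \<in> carrier_mat p p ==> j < n ==> k < 2 ==> l < 2 ==> q N j k l \<in> borel_measurable P"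
 unfolding q_def by (rule meas_form[OF _ Qc meas_Q_rm])

lemma meas_uu: "N \<in> carrier_mat p p ==> j < n ==> k < 2 ==> l < 2 ==> uu N j k l \<in> borel_measurable P"
 unfolding uu_def by (rule meas_form[OF _ Qc meas_Q])

text \<open>Each of the n columns moves \<open>tr\<close> by at most 4 g \<kappa> / n, and 2 n (4 g
  \<kappa> / n)^2 is the stated bound.\<close>

lemma tr_variance:
 assumes N: "opb p N \<kappa>"
 shows "(LINT w|P. (cmod (tr N w - T N))\<^sup>2) \<le> 32 * (g * \<kappa>)\<^sup>2 / real n" "integrable P (\<lambda>w. (cmod (tr N w - T N))\<^sup>2)" "integrable P (tr N)"
proof -
 note V = cols.complex_bounded_differences_moments[OF meas_tr[OF opbD(1)[OF N]] tr_bound[OF N] tr_update[OF N], folded T_def]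
 show "integrable P (tr N)" by (rule V(1))
 show "integrable P (\<lambda>w. (cmod (tr N w - T N))\<^sup>2)" by (rule V(2))
 have "2 * (real n * (4 * (g * \<kappa>) / real n)\<^sup>2) = 32 * (g * \<kappa>)\<^sup>2 / real n" using n by (simp add: power2_eq_square field_simps)
 with V(3) show "(LINT w|P. (cmod (tr N w - T N))\<^sup>2) \<le> 32 * (g * \<kappa>)\<^sup>2 / real n" by simp
qed

lemma T_bound: assumes N: "opb p N \<kappa>" shows "cmod (T N) \<le> \<kappa> * (g * \<gamma>)"
proof -
 have "cmod (T N) \<le> (LINT w|P. \<kappa> * (g * \<gamma>))"
  unfolding T_def by (rule order_trans[OF integral_norm_bound integral_mono]) (auto intro: tr_bound[OF N] integrable_norm[OF tr_variance(3)[OF N]])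
 then show ?thesis by (simp add: PP.prob_space)
qed

text \<open>One factor B is moved across the inner product, so that \<open>q\<close> becomes a form
  in the raw entries of column j. Cyclicity identifies the trace of its matrix with the
  leave-one-out value of \<open>tr\<close>.\<close>

lemma q_column:
 assumes N: "N \<in> carrier_mat p p"
 defines "M w j \<equiv> B * (N * (Q (rm j w) * B))"
 shows "q N j k l w = inn p (M w j *v colv p (w j) k) (colv p (w j) l) / of_nat n" "mat_trace (M w j) / of_nat n = tr N (rm j w)"
  "M w j \<in> carrier_mat p p"
proof -
 have c: "Q (rm j w) * B \<in> carrier_mat p p" "N * (Q (rm j w) * B) \<in> carrier_mat p p" "colv p (w j) k \<in> carrier_vec p"
  by (auto intro!: mult_carrier_mat[OF N] mult_carrier_mat[OF Qc Bc])
 show Mc: "M w j \<in> carrier_mat p p" unfolding M_def by (rule mult_carrier_mat[OF Bc c(2)])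
 have "inn p (M w j *v colv p (w j) k) (colv p (w j) l) = inn p (B *v (N *v (Q (rm j w) *v (xcol p B w j k)))) (colv p (w j) l)"
  unfolding M_def by (simp only: assoc_mult_mat_vec[OF Bc c(2,3)] assoc_mult_mat_vec[OF N c(1,3)] assoc_mult_mat_vec[OF Qc Bc c(3)])
 also have "... = inn p (N *v (Q (rm j w) *v (xcol p B w j k))) (xcol p B w j l)"
  using inn_adjoint[OF Bc mult_mat_vec_carrier[OF N mult_mat_vec_carrier[OF Qc mult_mat_vec_carrier[OF Bc c(3)]]] colv_carrier] by (simp only: hermB)
 finally show "q N j k l w = inn p (M w j *v colv p (w j) k) (colv p (w j) l) / of_nat n" by (simp add: q_def)
 have "mat_trace (M w j) = mat_trace ((N * (Q (rm j w) * B)) * B)" unfolding M_def by (rule mat_trace_mult_commute[OF Bc c(2)])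
 also have "(N * (Q (rm j w) * B)) * B = (N * Q (rm j w)) * (B * B)"
  by (simp only: assoc_mult_mat[OF N c(1) Bc] assoc_mult_mat[OF Qc Bc Bc] assoc_mult_mat[OF N Qc mult_carrier_mat[OF Bc Bc]])
 also have "mat_trace ... = mat_trace ((B * B) * (N * Q (rm j w)))" by (rule mat_trace_mult_commute[OF mult_carrier_mat[OF N Qc] mult_carrier_mat[OF Bc Bc]])
 also have "(B * B) * (N * Q (rm j w)) = B * B * N * Q (rm j w)" by (rule assoc_mult_mat[OF mult_carrier_mat[OF Bc Bc] N Qc, symmetric])
 finally show "mat_trace (M w j) / of_nat n = tr N (rm j w)" by (simp add: tr_def)
qed

lemma q_variance:
 assumes N: "opb p N \<kappa>" and jkl: "j < n" "k < 2" "l < 2"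
 defines "X w \<equiv> q N j k l w - (if k = l then tr N (rm j w) else 0)"
 shows "integrable P (\<lambda>w. (cmod (X w))\<^sup>2)" "(LINT w|P. (cmod (X w))\<^sup>2) \<le> (2 * (K + 1) * \<gamma>) * (g * \<kappa>)\<^sup>2 / real n"
proof -
 note Nc = opbD(1)[OF N]
 have mX: "X \<in> borel_measurable P" unfolding X_def using meas_q[OF Nc jkl] meas_tr_rm[OF Nc jkl(1)] by simp
 have c0: "0 \<le> (2 * (K + 1) * \<gamma>) * (g * \<kappa>)\<^sup>2 / real n" using K_nonneg gamma_nonneg by simp
 have le: "(\<integral>\<^sup>+y. ennreal ((cmod (X (w(j := y))))\<^sup>2) \<partial>\<nu> j) \<le> ennreal ((2 * (K + 1) * \<gamma>) * (g * \<kappa>)\<^sup>2 / real n)" for w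
 proof -
  \<comment> \<open>Replacing column j by y leaves this matrix unchanged, since \<open>rm j\<close>
    erases that column anyway.\<close>
  let ?M = "B * (N * (Q (rm j w) * B))"
  have Mop: "opb p ?M (g * \<kappa>)"
   using opb_mult[OF opB opb_mult[OF N opb_mult[OF Qop opB]], of "rm j w"] by (simp add: g_def power2_eq_square mult_ac)
  have Xe: "X (w(j := y)) = (inn p (?M *v colv p y k) (colv p y l) - (if k = l then mat_trace ?M else 0)) / of_nat n" for y
   unfolding X_def using q_column(1)[OF Nc, where j = j and w = "w(j := y)"] q_column(2)[OF Nc, where j = j and w = "w(j := y)"] by (simp add: diff_divide_distrib)
  have "(\<integral>\<^sup>+y. ennreal ((cmod (X (w(j := y))))\<^sup>2) \<partial>\<nu> j)
   = (\<integral>\<^sup>+y. ennreal (1 / (real n)\<^sup>2) * ennreal ((cmod (inn p (?M *v colv p y k) (colv p y l) - (if k = l then mat_trace ?M else 0)))\<^sup>2) \<partial>\<nu> j)"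
   unfolding Xe by (intro nn_integral_cong) (simp add: norm_divide power_divide ennreal_mult[symmetric] del: ennreal_1)
  also have "... = ennreal (1 / (real n)\<^sup>2) * (\<integral>\<^sup>+y. ennreal ((cmod (inn p (?M *v colv p y k) (colv p y l) - (if k = l then mat_trace ?M else 0)))\<^sup>2) \<partial>\<nu> j)"
  proof (rule nn_integral_cmult)
   have cm: "(\<lambda>y. colv p y k' $ a) \<in> borel_measurable (\<nu> j)" if "k' < 2" "a < p" for k' a
    using entry_space.component_measurable[OF entries[of j], of "(k', a)"] that by (simp add: colv_index \<nu>_def)
   have "(\<lambda>y. inn p (?M *v colv p y k) (colv p y l)) \<in> borel_measurable (\<nu> j)"
    by (intro measurable_inn measurable_mult_mat_vec[OF opbD(1)[OF Mop] colv_carrier]) (auto intro: cm jkl)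
   then show "(\<lambda>y. ennreal ((cmod (inn p (?M *v colv p y k) (colv p y l) - (if k = l then mat_trace ?M else 0)))\<^sup>2)) \<in> borel_measurable (\<nu> j)"
    by measurable
  qed
  also have "... \<le> ennreal (1 / (real n)\<^sup>2) * ennreal (2 * (K + 1) * (\<Sum>a<p. \<Sum>b<p. (cmod (?M $$ (a, b)))\<^sup>2))"
   by (intro mult_left_mono quadratic_variance[OF opbD(1)[OF Mop] jkl(2,3)]) simp
  also have "... = ennreal (1 / (real n)\<^sup>2 * (2 * (K + 1) * (\<Sum>a<p. \<Sum>b<p. (cmod (?M $$ (a, b)))\<^sup>2)))"
   using K_nonneg by (intro ennreal_mult[symmetric]) (auto intro!: mult_nonneg_nonneg sum_nonneg)
  also have "... \<le> ennreal ((2 * (K + 1) * \<gamma>) * (g * \<kappa>)\<^sup>2 / real n)"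
  proof (rule ennreal_leI)
   have "(\<Sum>a<p. \<Sum>b<p. (cmod (?M $$ (a, b)))\<^sup>2) \<le> (\<gamma> * real n) * (g * \<kappa>)\<^sup>2"
    by (rule order_trans[OF opb_frobenius[OF Mop] mult_right_mono[OF p_le]]) simp
   then have "1 / (real n)\<^sup>2 * (2 * (K + 1) * (\<Sum>a<p. \<Sum>b<p. (cmod (?M $$ (a, b)))\<^sup>2)) \<le> 1 / (real n)\<^sup>2 * (2 * (K + 1) * ((\<gamma> * real n) * (g * \<kappa>)\<^sup>2))"
    using K_nonneg by (intro mult_left_mono) auto
   also have "... = (2 * (K + 1) * \<gamma>) * (g * \<kappa>)\<^sup>2 / real n" using n by (simp add: power2_eq_square)
   finally show "1 / (real n)\<^sup>2 * (2 * (K + 1) * (\<Sum>a<p. \<Sum>b<p. (cmod (?M $$ (a, b)))\<^sup>2)) \<le> (2 * (K + 1) * \<gamma>) * (g * \<kappa>)\<^sup>2 / real n" .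
  qed
  finally show ?thesis .
 qed
 show "integrable P (\<lambda>w. (cmod (X w))\<^sup>2)" "(LINT w|P. (cmod (X w))\<^sup>2) \<le> (2 * (K + 1) * \<gamma>) * (g * \<kappa>)\<^sup>2 / real n"
  using second_moment_column[OF mX jkl(1) c0 le] by auto
qed

text \<open>The deviation has three sources: the fluctuation of the form given the other columns,
  the removal of column j from the trace, and the fluctuation of the trace. In \<open>cA\<close>
  they account for 2 (K + 1) \<gamma>, 16 and 32; the factor 3 comes from squaring a sum of three
  terms.\<close>

lemma q_mean_deviation:
 assumes N: "opb p N \<kappa>" and jkl: "j < n" "k < 2" "l < 2"
 defines "X w \<equiv> q N j k l w - (if k = l then T N else 0)"
 shows "integrable P (\<lambda>w. cmod (X w))" "(LINT w|P. cmod (X w)) \<le> sqrt (cA \<kappa> / real n)"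
proof -
 note Nc = opbD(1)[OF N]
 define X1 where "X1 w = q N j k l w - (if k = l then tr N (rm j w) else 0)" for w
 define X2 where "X2 w = (if k = l then tr N (rm j w) - tr N w else 0)" for w
 define X3 where "X3 w = (if k = l then tr N w - T N else 0)" for w
 have X: "X w = X1 w + X2 w + X3 w" for w by (simp add: X_def X1_def X2_def X3_def)
 have mX: "X \<in> borel_measurable P" unfolding X_def using meas_q[OF Nc jkl] by simp
 have m2: "X2 \<in> borel_measurable P" unfolding X2_def using meas_tr_rm[OF Nc jkl(1)] meas_tr[OF Nc] by simp
 note V1 = q_variance[OF N jkl, folded X1_def]
 have gk: "0 \<le> g * \<kappa>" using g_nonneg opbD(2)[OF N] by simp
 have b2: "(cmod (X2 w))\<^sup>2 \<le> 16 * (g * \<kappa>)\<^sup>2 / (real n)\<^sup>2" for w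
 proof -
  have "cmod (X2 w) \<le> 4 * (g * \<kappa>) / real n" using tr_update[OF N jkl(1), of w "\<lambda>_. 0"] gk by (simp add: X2_def norm_minus_commute)
  from power_mono[OF this, of 2] show ?thesis by (simp add: power_divide power_mult_distrib)
 qed
 have i2: "integrable P (\<lambda>w. (cmod (X2 w))\<^sup>2)"
  by (rule PP.integrable_const_bound[of _ "16 * (g * \<kappa>)\<^sup>2 / (real n)\<^sup>2"]) (use b2 m2 in \<open>auto\<close>)
 have V2: "(LINT w|P. (cmod (X2 w))\<^sup>2) \<le> 16 * (g * \<kappa>)\<^sup>2 / real n"
 proof -
  have "(LINT w|P. (cmod (X2 w))\<^sup>2) \<le> (LINT w|P. 16 * (g * \<kappa>)\<^sup>2 / (real n)\<^sup>2)" by (rule integral_mono[OF i2 _ b2]) simp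
  also have "... = 16 * (g * \<kappa>)\<^sup>2 / (real n)\<^sup>2" by (simp add: PP.prob_space)
  also have "... \<le> 16 * (g * \<kappa>)\<^sup>2 / real n" using n by (intro divide_left_mono) (auto simp: power2_eq_square)
  finally show ?thesis .
 qed
 have i3: "integrable P (\<lambda>w. (cmod (X3 w))\<^sup>2)" using tr_variance(2)[OF N] by (cases "k = l") (simp_all add: X3_def)
 have V3: "(LINT w|P. (cmod (X3 w))\<^sup>2) \<le> 32 * (g * \<kappa>)\<^sup>2 / real n" using tr_variance(1)[OF N] by (cases "k = l") (simp_all add: X3_def)
 have iB: "integrable P (\<lambda>w. 3 * ((cmod (X1 w))\<^sup>2 + (cmod (X2 w))\<^sup>2 + (cmod (X3 w))\<^sup>2))" using V1(1) i2 i3 by simp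
 have iX: "integrable P (\<lambda>w. (cmod (X w))\<^sup>2)"
  by (rule Bochner_Integration.integrable_bound[OF iB]) (use mX in measurable, use cmod_add_square_le in \<open>auto simp: X\<close>)
 have "(LINT w|P. (cmod (X w))\<^sup>2) \<le> (LINT w|P. 3 * ((cmod (X1 w))\<^sup>2 + (cmod (X2 w))\<^sup>2 + (cmod (X3 w))\<^sup>2))"
  by (rule integral_mono[OF iX iB]) (unfold X, rule cmod_add_square_le)
 also have "... = 3 * ((LINT w|P. (cmod (X1 w))\<^sup>2) + (LINT w|P. (cmod (X2 w))\<^sup>2) + (LINT w|P. (cmod (X3 w))\<^sup>2))"
  using V1(1) i2 i3 by simp
 also have "... \<le> 3 * ((2 * (K + 1) * \<gamma>) * (g * \<kappa>)\<^sup>2 / real n + 16 * (g * \<kappa>)\<^sup>2 / real n + 32 * (g * \<kappa>)\<^sup>2 / real n)"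
  using V1(2) V2 V3 by (intro mult_left_mono add_mono) auto
 also have "... = 3 * (g * \<kappa>)\<^sup>2 * (2 * (K + 1) * \<gamma> + 48) / real n" using n by (simp add: field_simps)
 finally have V: "(LINT w|P. (cmod (X w))\<^sup>2) \<le> cA \<kappa> / real n" by (simp add: cA_def)
 have mc: "(\<lambda>w. cmod (X w)) \<in> borel_measurable P" using mX by measurable
 from PP.expectation_abs_le_sqrt[OF mc iX] V show "integrable P (\<lambda>w. cmod (X w))" "(LINT w|P. cmod (X w)) \<le> sqrt (cA \<kappa> / real n)"
  by (auto intro: order_trans real_sqrt_le_mono)
qed

text \<open>B and the resolvent are bounded in norm, and the product of two column lengths is at
  most the sum of both squared lengths, also when the two columns coincide.\<close>

lemma q_bound:
 assumes N: "opb p N \<kappa>" and F: "opb p F (1 / Im z)" and kl: "k < 2" "l < 2"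
 shows "cmod (inn p (N *v (F *v (xcol p B w j k))) (xcol p B w j l) / of_nat n) \<le> \<kappa> * (g * \<rho> j w)"
proof -
 let ?s = "\<lambda>k. sqrt (nsq p (colv p (w j) k))"
 have gk: "0 \<le> g * \<kappa>" using g_nonneg opbD(2)[OF N] by simp
 have c: "B *v colv p (w j) k \<in> carrier_vec p" for k by (rule mult_mat_vec_carrier[OF Bc colv_carrier])
 have b: "sqrt (nsq p (xcol p B w j k)) \<le> \<beta> * ?s k" for k by (rule opb_sqrt[OF opB colv_carrier])
 have "cmod (inn p (N *v (F *v (xcol p B w j k))) (xcol p B w j l))
  = cmod (inn p ((N * F) *v (xcol p B w j k)) (xcol p B w j l))"
  by (simp only: assoc_mult_mat_vec[OF opbD(1)[OF N] opbD(1)[OF F] c])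
 also have "... \<le> (\<kappa> * (1 / Im z)) * sqrt (nsq p (xcol p B w j k)) * sqrt (nsq p (xcol p B w j l))"
  by (rule opb_inn[OF opb_mult[OF N F] c])
 also have "... \<le> (\<kappa> * (1 / Im z)) * (\<beta> * ?s k) * (\<beta> * ?s l)"
  using b opbD(2)[OF N] z opbD(2)[OF opB] by (intro mult_mono mult_nonneg_nonneg) (auto intro!: mult_nonneg_nonneg)
 also have "... = (g * \<kappa>) * (?s k * ?s l)" by (simp add: g_def power2_eq_square)
 also have "... \<le> (g * \<kappa>) * (nsq p (colv p (w j) 0) + nsq p (colv p (w j) 1))"
 proof (rule mult_left_mono[OF _ gk])
  have "2 * (?s k * ?s l) \<le> nsq p (colv p (w j) k) + nsq p (colv p (w j) l)"
   using sum_squares_bound[of "?s k" "?s l"] by simp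
  moreover have "nsq p (colv p (w j) i) \<le> nsq p (colv p (w j) 0) + nsq p (colv p (w j) 1)" if "i < 2" for i
   using that less_2_cases[OF that] nsq_nonneg[of p "colv p (w j) 0"] nsq_nonneg[of p "colv p (w j) 1"] by (auto simp del: nsq_nonneg)
  note this[OF kl(1)] this[OF kl(2)]
  ultimately show "?s k * ?s l \<le> nsq p (colv p (w j) 0) + nsq p (colv p (w j) 1)" by linarith
 qed
 finally have "cmod (inn p (N *v (F *v (xcol p B w j k))) (xcol p B w j l)) / real n
  \<le> (g * \<kappa>) * (nsq p (colv p (w j) 0) + nsq p (colv p (w j) 1)) / real n" by (rule divide_right_mono) simp
 then show ?thesis by (simp add: \<rho>_def norm_divide mult_ac)
qed

lemma rho_nonneg: "0 \<le> \<rho> j w" by (simp add: \<rho>_def)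

text \<open>A squared column length is the quadratic form of the identity matrix, so the variance
  bound applies with squared Frobenius norm p.\<close>

lemma D_moment:
 assumes j: "j < n"
 shows "integrable P (\<lambda>w. (D j w)\<^sup>2)" "(LINT w|P. (D j w)\<^sup>2) \<le> 8 * (K + 1) * \<gamma> / real n"
proof -
 define Y where "Y k w = inn p (1\<^sub>m p *v colv p (w j) k) (colv p (w j) k) - (if k = k then mat_trace (1\<^sub>m p) else 0)" for k and w :: "nat => nat \<times> nat => complex"
 have Y: "Y k w = of_real (nsq p (colv p (w j) k) - real p)" for k w
  by (simp add: Y_def one_mult_mat_vec[OF colv_carrier] inn_self mat_trace_one)
 have fro: "(\<Sum>a<p. \<Sum>b<p. (cmod (1\<^sub>m p $$ (a, b)))\<^sup>2) \<le> real p" using opb_frobenius[OF opb_one, of p] by simp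
 have c0: "0 \<le> 2 * (K + 1) * real p" using K_nonneg by simp
 have mY: "Y k \<in> borel_measurable P" if "k < 2" for k
 proof -
  have "(\<lambda>w. colv p (w j) k $ i) \<in> borel_measurable P" if "i < p" for i
   using measurable_entry[OF j, of "(k, i)"] that \<open>k < 2\<close> by (simp add: colv_index)
  then show ?thesis unfolding Y_def one_mult_mat_vec[OF colv_carrier] by (intro borel_measurable_diff measurable_inn) simp_all
 qed
 have le: "(\<integral>\<^sup>+y. ennreal ((cmod (Y k (w(j := y))))\<^sup>2) \<partial>\<nu> j) \<le> ennreal (2 * (K + 1) * real p)" if k: "k < 2" for k w
 proof -
  have "(\<integral>\<^sup>+y. ennreal ((cmod (Y k (w(j := y))))\<^sup>2) \<partial>\<nu> j) \<le> ennreal (2 * (K + 1) * (\<Sum>a<p. \<Sum>b<p. (cmod (1\<^sub>m p $$ (a, b)))\<^sup>2))"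
   unfolding Y_def fun_upd_same by (rule quadratic_variance[OF one_carrier_mat k k])
  also have "... \<le> ennreal (2 * (K + 1) * real p)" by (rule ennreal_leI[OF mult_left_mono[OF fro]]) (use K_nonneg in simp)
  finally show ?thesis .
 qed
 have k01: "(0::nat) < 2" "(1::nat) < 2" by auto
 note V0 = second_moment_column[OF mY[OF k01(1)] j c0 le[OF k01(1)]] and V1 = second_moment_column[OF mY[OF k01(2)] j c0 le[OF k01(2)]]
 have D: "D j w = Re (Y 0 w + Y 1 w) / real n" for w
  by (simp add: D_def \<rho>_def Y diff_divide_distrib add_divide_distrib)
 have DY: "(D j w)\<^sup>2 \<le> 2 * ((cmod (Y 0 w))\<^sup>2 + (cmod (Y 1 w))\<^sup>2) / (real n)\<^sup>2" for w
 proof -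
  have "(Re (Y 0 w + Y 1 w))\<^sup>2 \<le> 2 * ((Re (Y 0 w))\<^sup>2 + (Re (Y 1 w))\<^sup>2)"
   using sum_squares_bound[of "Re (Y 0 w)" "Re (Y 1 w)"] by (simp add: power2_sum)
  also have "... \<le> 2 * ((cmod (Y 0 w))\<^sup>2 + (cmod (Y 1 w))\<^sup>2)" by (simp add: cmod_power2)
  finally show ?thesis unfolding D power_divide by (rule divide_right_mono) simp
 qed
 have mD: "D j \<in> borel_measurable P" unfolding D[abs_def] using mY[OF k01(1)] mY[OF k01(2)] by measurable
 have iB: "integrable P (\<lambda>w. 2 * ((cmod (Y 0 w))\<^sup>2 + (cmod (Y 1 w))\<^sup>2) / (real n)\<^sup>2)" using V0(1) V1(1) by simp
 show iD: "integrable P (\<lambda>w. (D j w)\<^sup>2)"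
  by (rule Bochner_Integration.integrable_bound[OF iB]) (use mD in measurable, use DY in auto)
 have "(LINT w|P. (D j w)\<^sup>2) \<le> (LINT w|P. 2 * ((cmod (Y 0 w))\<^sup>2 + (cmod (Y 1 w))\<^sup>2) / (real n)\<^sup>2)" by (rule integral_mono[OF iD iB DY])
 also have "... = 2 * ((LINT w|P. (cmod (Y 0 w))\<^sup>2) + (LINT w|P. (cmod (Y 1 w))\<^sup>2)) / (real n)\<^sup>2" using V0(1) V1(1) by simp
 also have "... \<le> 2 * (2 * (K + 1) * real p + 2 * (K + 1) * real p) / (real n)\<^sup>2" by (intro divide_right_mono mult_left_mono add_mono V0(2) V1(2)) auto
 also have "... = 8 * (K + 1) * (real p / real n) / real n" by (simp add: power2_eq_square)
 also have "... \<le> 8 * (K + 1) * \<gamma> / real n" using pn K_nonneg n by (intro divide_right_mono mult_left_mono) auto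
 finally show "(LINT w|P. (D j w)\<^sup>2) \<le> 8 * (K + 1) * \<gamma> / real n" .
qed

text \<open>The rank-two relation for t = x and t = y expresses \<open>q N j k l\<close> and
  \<open>q N j l l\<close> by the two unknowns; eliminating the second unknown gives the hypothesis
  of the pointwise estimate. The condition \<kappa> \<ge> 1 lets the identity matrix share the
  constant of N.\<close>

lemma column_estimate:
 assumes N: "opb p N \<kappa>" and \<kappa>: "1 \<le> \<kappa>" and j: "j < n" and kl: "k < 2" "l < 2" "k \<noteq> l"
 shows "cmod ((1 - (T (1\<^sub>m p))\<^sup>2) * (LINT w|P. uu N j k l w) + T (1\<^sub>m p) * T N) \<le> estimate_const g K \<gamma> \<kappa> / sqrt (real n)"
  "integrable P (uu N j k l)"
proof -
 note Nc = opbD(1)[OF N] and gn = g_nonneg and kn = opbD(2)[OF N]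
 have O: "opb p (1\<^sub>m p) \<kappa>" by (rule opb_mono[OF opb_one \<kappa>])
 define I where "I = (1\<^sub>m p :: complex mat)"
 have O1: "opb p I 1" "opb p I \<kappa>" unfolding I_def by (rule opb_one, rule O)
 define G where "G = g * (2 * \<gamma> + 1)"
 define C1 where "C1 = (1 + \<kappa>) * (1 + G)\<^sup>2"
 define C2 where "C2 = \<kappa> * G * (1 + G\<^sup>2) + \<kappa> * G\<^sup>2"
 have G: "0 \<le> G" using gn gamma_nonneg by (simp add: G_def)
 have C: "0 \<le> C1" "0 \<le> C2" using kn G by (simp_all add: C1_def C2_def)
 define W where "W w = cmod (q I j k k w - T I) + cmod (q I j l l w - T I) + cmod (q I j k l w) + cmod (q I j l k w) + cmod (q N j k l w) + cmod (q N j l l w - T N)" for w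
 have pw: "cmod ((1 - (T I)\<^sup>2) * uu N j k l w + T I * T N) \<le> C1 * W w + C2 * (D j w)\<^sup>2" for w
 proof -
  let ?x = "B *v colv p (w j) k" and ?y = "B *v colv p (w j) l"
  let ?S' = "Smat p n B (rm j w)"
  have xc: "?x \<in> carrier_vec p" "?y \<in> carrier_vec p" by (rule mult_mat_vec_carrier[OF Bc colv_carrier])+
  have S: "Smat p n B w = ?S' + of_real (1 / real n) \<cdot>\<^sub>m (outer p ?x ?y + outer p ?y ?x)"
  proof (cases "k = 0")
   case True
   then have "l = 1" using kl by auto
   then show ?thesis using True by (simp only: Smat_update[OF Bc j, of w])
  next
   case False
   then have "k = 1" "l = 0" using kl by auto
   show ?thesis unfolding \<open>k = 1\<close> \<open>l = 0\<close>
    by (subst Smat_update[OF Bc j, of w], subst comm_add_mat[OF outer_carrier outer_carrier], rule refl)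
  qed
  have z0: "Im z \<noteq> 0" using z by simp
  note sys = rank_two_system[OF Smat_herm z0 xc Nc S, folded Q_def]
  have IM: "I *v (Q (rm j w) *v (xcol p B w j i)) = Q (rm j w) *v (xcol p B w j i)" for i
   unfolding I_def by (rule one_mult_mat_vec[OF mult_mat_vec_carrier[OF Qc mult_mat_vec_carrier[OF Bc colv_carrier]]])
  have r: "q N j k l w = (1 + q I j k l w) * uu N j k l w + q I j k k w * uu N j l l w"
   using sys[OF xc(1), of ?y] unfolding q_def uu_def IM using n by (simp add: field_simps)
  have s: "q N j l l w = q I j l l w * uu N j k l w + (1 + q I j l k w) * uu N j l l w"
   using sys[OF xc(2), of ?y] unfolding q_def uu_def IM using n by (simp add: field_simps)
  have "((1 + q I j k l w) * (1 + q I j l k w) - q I j k k w * q I j l l w) * uu N j k l w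
   = (1 + q I j l k w) * q N j k l w - q I j k k w * q N j l l w"
   unfolding r s by (simp add: algebra_simps)
  note P = leave_one_out_pointwise[OF this gn kn, of "2 * \<gamma>" "\<rho> j w" "D j w" "T I" "T N", folded G_def]
  have qb: "cmod (q I j a b w) \<le> g * \<rho> j w" if "a < 2" "b < 2" for a b
   using q_bound[OF O1(1) Qop[of "rm j w"] that, where j = j and w = w] by (simp add: q_def)
  have "\<rho> j w \<le> 2 * \<gamma> + \<bar>D j w\<bar>" using pn unfolding D_def by linarith
  moreover have "cmod (uu N j k l w) \<le> \<kappa> * (g * \<rho> j w)" unfolding uu_def by (rule q_bound[OF N Qop kl(1,2)])
  moreover have "cmod (T I) \<le> g * (2 * \<gamma>)"
   using T_bound[OF O1(1)] mult_nonneg_nonneg[OF gn gamma_nonneg] by simp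
  moreover have "cmod (T N) \<le> \<kappa> * (g * (2 * \<gamma>))"
   using T_bound[OF N] mult_nonneg_nonneg[OF kn mult_nonneg_nonneg[OF gn gamma_nonneg]] by simp
  ultimately have "cmod ((1 - (T I)\<^sup>2) * uu N j k l w + T I * T N)
   \<le> (1 + \<kappa>) * (1 + G)\<^sup>2 * (cmod (q I j k k w - T I) + cmod (q I j l l w - T I) + cmod (q I j k l w) + cmod (q I j l k w) + cmod (q N j k l w) + cmod (q N j l l w - T N))
   + (\<kappa> * G * (1 + G\<^sup>2) + \<kappa> * G\<^sup>2) * (D j w)\<^sup>2"
   using qb kl rho_nonneg gamma_nonneg by (intro P) auto
  then show ?thesis unfolding C1_def C2_def W_def .
 qed
 have dev: "integrable P (\<lambda>w. cmod (q I j k k w - T I))" "integrable P (\<lambda>w. cmod (q I j l l w - T I))" "integrable P (\<lambda>w. cmod (q I j k l w))"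
  "integrable P (\<lambda>w. cmod (q I j l k w))" "integrable P (\<lambda>w. cmod (q N j k l w))" "integrable P (\<lambda>w. cmod (q N j l l w - T N))"
  "(LINT w|P. cmod (q I j k k w - T I)) \<le> sqrt (cA \<kappa> / real n)" "(LINT w|P. cmod (q I j l l w - T I)) \<le> sqrt (cA \<kappa> / real n)" "(LINT w|P. cmod (q I j k l w)) \<le> sqrt (cA \<kappa> / real n)"
  "(LINT w|P. cmod (q I j l k w)) \<le> sqrt (cA \<kappa> / real n)" "(LINT w|P. cmod (q N j k l w)) \<le> sqrt (cA \<kappa> / real n)" "(LINT w|P. cmod (q N j l l w - T N)) \<le> sqrt (cA \<kappa> / real n)"
  using q_mean_deviation[OF O1(2) j kl(1) kl(1)] q_mean_deviation[OF O1(2) j kl(2) kl(2)] q_mean_deviation[OF O1(2) j kl(1,2)]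
   q_mean_deviation[OF O1(2) j kl(2,1)] q_mean_deviation[OF N j kl(1,2)] q_mean_deviation[OF N j kl(2) kl(2)] kl(3) kl(3)[symmetric]
  by simp_all
 have iW: "integrable P W" unfolding W_def using dev(1-6) by (intro Bochner_Integration.integrable_add)
 have EW: "(LINT w|P. W w) \<le> 6 * sqrt (cA \<kappa> / real n)"
 proof -
  have "(LINT w|P. W w) = (LINT w|P. cmod (q I j k k w - T I)) + (LINT w|P. cmod (q I j l l w - T I)) + (LINT w|P. cmod (q I j k l w))
   + (LINT w|P. cmod (q I j l k w)) + (LINT w|P. cmod (q N j k l w)) + (LINT w|P. cmod (q N j l l w - T N))"
   unfolding W_def using dev(1-6) by simp
  then show ?thesis using dev(7-12) by linarith
 qed
 note Dm = D_moment[OF j]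
 have iB: "integrable P (\<lambda>w. C1 * W w + C2 * (D j w)\<^sup>2)" using iW Dm(1) by simp
 show iu: "integrable P (uu N j k l)"
 proof (rule Bochner_Integration.integrable_bound)
  \<comment> \<open>\<open>uu\<close> has no deterministic bound, because column lengths are
    unbounded. The integrable majorant comes from \<rho> \<le> 2 \<gamma> + 1 + D^2.\<close>
  show "integrable P (\<lambda>w. \<kappa> * (g * (2 * \<gamma> + 1 + (D j w)\<^sup>2)))" using Dm(1) by simp
  show "uu N j k l \<in> borel_measurable P" by (rule meas_uu[OF Nc j kl(1,2)])
  have "cmod (uu N j k l w) \<le> \<kappa> * (g * (2 * \<gamma> + 1 + (D j w)\<^sup>2))" for w
  proof -
   have "\<bar>x\<bar> \<le> 1 + x\<^sup>2" for x :: real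
   proof -
    have "0 \<le> (\<bar>x\<bar> - 1)\<^sup>2" by simp
    then have "2 * \<bar>x\<bar> \<le> 1 + x\<^sup>2" by (simp add: power2_diff)
    then show ?thesis using abs_ge_zero[of x] by linarith
   qed
   from this[of "D j w"] have "\<rho> j w \<le> 2 * \<gamma> + 1 + (D j w)\<^sup>2" using pn unfolding D_def by linarith
   then have "\<kappa> * (g * \<rho> j w) \<le> \<kappa> * (g * (2 * \<gamma> + 1 + (D j w)\<^sup>2))" using gn kn by (intro mult_left_mono)
   moreover have "cmod (uu N j k l w) \<le> \<kappa> * (g * \<rho> j w)" unfolding uu_def by (rule q_bound[OF N Qop kl(1,2)])
   ultimately show ?thesis by linarith
  qed
  then show "AE w in P. norm (uu N j k l w) \<le> norm (\<kappa> * (g * (2 * \<gamma> + 1 + (D j w)\<^sup>2)))"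
   by (intro AE_I2) (metis abs_ge_self order_trans real_norm_def)
 qed
 have E: "(1 - (T I)\<^sup>2) * (LINT w|P. uu N j k l w) + T I * T N = (LINT w|P. (1 - (T I)\<^sup>2) * uu N j k l w + T I * T N)"
  using iu by (simp add: PP.prob_space)
 have "cmod ((1 - (T I)\<^sup>2) * (LINT w|P. uu N j k l w) + T I * T N) \<le> (LINT w|P. C1 * W w + C2 * (D j w)\<^sup>2)"
  unfolding E by (rule order_trans[OF integral_norm_bound integral_mono[OF _ iB pw]]) (use iu in \<open>auto intro!: integrable_norm\<close>)
 also have "... = C1 * (LINT w|P. W w) + C2 * (LINT w|P. (D j w)\<^sup>2)" using iW Dm(1) by simp
 also have "... \<le> C1 * (6 * sqrt (cA \<kappa> / real n)) + C2 * (8 * (K + 1) * \<gamma> / real n)"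
  using EW Dm(2) C by (intro add_mono mult_left_mono)
 also have "... \<le> C1 * (6 * sqrt (cA \<kappa> / real n)) + C2 * (8 * (K + 1) * \<gamma> / sqrt (real n))"
 proof -
  \<comment> \<open>As n \<ge> 1, the rate 1 / n is absorbed into 1 / sqrt n.\<close>
  have "sqrt (real n) \<le> real n" using n real_sqrt_le_iff[of "real n" "(real n)\<^sup>2"] by (simp add: power2_eq_square)
  then show ?thesis using C K_nonneg gamma_nonneg n by (intro add_mono order_refl mult_left_mono divide_left_mono) auto
 qed
 also have "... = (6 * C1 * sqrt (cA \<kappa>) + C2 * (8 * (K + 1) * \<gamma>)) / sqrt (real n)"
  by (simp add: real_sqrt_divide add_divide_distrib)
 also have "6 * C1 * sqrt (cA \<kappa>) + C2 * (8 * (K + 1) * \<gamma>) = estimate_const g K \<gamma> \<kappa>"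
  by (simp add: estimate_const_def Let_def C1_def C2_def cA_def G_def)
 finally show "cmod ((1 - (T (1\<^sub>m p))\<^sup>2) * (LINT w|P. uu N j k l w) + T (1\<^sub>m p) * T N) \<le> estimate_const g K \<gamma> \<kappa> / sqrt (real n)"
  unfolding I_def .
qed

text \<open>The normalised trace of N Q S is the average over the columns of two mixed forms, one
  for each order of the pair. Both satisfy the same relation, which produces the factor 2.\<close>

theorem expectation_estimate:
 assumes N: "opb p N \<kappa>" and \<kappa>: "1 \<le> \<kappa>"
 shows "cmod ((1 - (T (1\<^sub>m p))\<^sup>2) * (LINT w|P. mat_trace (N * Q w * Smat p n B w) / of_nat n) + 2 * T (1\<^sub>m p) * T N)
  \<le> 2 * estimate_const g K \<gamma> \<kappa> / sqrt (real n)"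
  "integrable P (\<lambda>w. mat_trace (N * Q w * Smat p n B w) / of_nat n)"
proof -
 note Nc = opbD(1)[OF N]
 define \<theta> where "\<theta> = T (1\<^sub>m p)"
 have k01: "(0::nat) < 2" "(1::nat) < 2" "(0::nat) \<noteq> 1" "(1::nat) \<noteq> 0" by auto
 note e01 = column_estimate[OF N \<kappa> _ k01(1,2,3), folded \<theta>_def] and e10 = column_estimate[OF N \<kappa> _ k01(2,1,4), folded \<theta>_def]
 have S: "mat_trace (N * Q w * Smat p n B w) / of_nat n = (\<Sum>j<n. uu N j 0 1 w + uu N j 1 0 w) / of_nat n" for w
 proof -
  have a: "N * Q w *v (xcol p B w j k) = N *v (Q w *v (xcol p B w j k))" for j k
   by (rule assoc_mult_mat_vec[OF Nc Qc mult_mat_vec_carrier[OF Bc colv_carrier]])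
  have "mat_trace (N * Q w * Smat p n B w) = (\<Sum>j<n. uu N j 0 1 w + uu N j 1 0 w)"
   unfolding mat_trace_mult_Smat[OF mult_carrier_mat[OF Nc Qc] Bc] a uu_def add_divide_distrib[symmetric] sum_divide_distrib[symmetric] ..
  then show ?thesis by simp
 qed
 have i: "integrable P (\<lambda>w. uu N j 0 1 w + uu N j 1 0 w)" if "j < n" for j using e01(2)[OF that] e10(2)[OF that] by simp
 show "integrable P (\<lambda>w. mat_trace (N * Q w * Smat p n B w) / of_nat n)" unfolding S using i by (intro integrable_divide Bochner_Integration.integrable_sum) auto
 let ?U = "\<lambda>j. (LINT w|P. uu N j 0 1 w) + (LINT w|P. uu N j 1 0 w)"
 have "(LINT w|P. mat_trace (N * Q w * Smat p n B w) / of_nat n) = (\<Sum>j<n. (LINT w|P. uu N j 0 1 w + uu N j 1 0 w)) / of_nat n"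
  unfolding S integral_divide_zero by (subst Bochner_Integration.integral_sum) (use i in auto)
 also have "... = (\<Sum>j<n. ?U j) / of_nat n"
  by (rule arg_cong[of _ _ "\<lambda>x. x / of_nat n"], rule sum.cong[OF refl], rule Bochner_Integration.integral_add) (auto intro: e01(2) e10(2) simp del: One_nat_def)
 finally have L: "(LINT w|P. mat_trace (N * Q w * Smat p n B w) / of_nat n) = (\<Sum>j<n. ?U j) / of_nat n" .
 have e: "(\<Sum>j<n. b * V j + c) / of_nat n = b * ((\<Sum>j<n. V j) / of_nat n) + c" for V :: "nat => complex" and b c
  using n by (simp add: sum.distrib sum_distrib_left[symmetric] add_divide_distrib)
 have EQ: "(1 - \<theta>\<^sup>2) * (LINT w|P. mat_trace (N * Q w * Smat p n B w) / of_nat n) + 2 * \<theta> * T N = (\<Sum>j<n. (1 - \<theta>\<^sup>2) * ?U j + 2 * \<theta> * T N) / of_nat n"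
  by (simp only: L e)
 have "cmod ((1 - \<theta>\<^sup>2) * ?U j + 2 * \<theta> * T N) \<le> 2 * estimate_const g K \<gamma> \<kappa> / sqrt (real n)" if j: "j < n" for j
 proof -
  have "(1 - \<theta>\<^sup>2) * ?U j + 2 * \<theta> * T N = ((1 - \<theta>\<^sup>2) * (LINT w|P. uu N j 0 1 w) + \<theta> * T N) + ((1 - \<theta>\<^sup>2) * (LINT w|P. uu N j 1 0 w) + \<theta> * T N)"
   by (simp add: algebra_simps)
  also have "cmod ... \<le> estimate_const g K \<gamma> \<kappa> / sqrt (real n) + estimate_const g K \<gamma> \<kappa> / sqrt (real n)"
   by (rule order_trans[OF norm_triangle_ineq add_mono[OF e01(1)[OF j] e10(1)[OF j]]])
  finally show ?thesis by simp
 qed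
 then have le: "cmod (\<Sum>j<n. (1 - \<theta>\<^sup>2) * ?U j + 2 * \<theta> * T N) \<le> real (card {..<n}) * (2 * estimate_const g K \<gamma> \<kappa> / sqrt (real n))"
  by (intro sum_norm_bound) auto
 show "cmod ((1 - (T (1\<^sub>m p))\<^sup>2) * (LINT w|P. mat_trace (N * Q w * Smat p n B w) / of_nat n) + 2 * T (1\<^sub>m p) * T N)
  \<le> 2 * estimate_const g K \<gamma> \<kappa> / sqrt (real n)"
  unfolding \<theta>_def[symmetric] EQ norm_divide using divide_right_mono[OF le, of "real n"] n by simp
qed

end

section \<open>The limit of the mean\<close>

abbreviation column_space :: "nat => nat => (nat => nat \<times> nat => complex measure) => (nat => nat \<times> nat => complex) measure" where
 "column_space p n \<mu> \<equiv> PiM {..<n} (\<lambda>j. PiM (idx p) (\<mu> j))"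

definition mean_trace :: "nat => nat => (nat => nat \<times> nat => complex measure) => complex mat => complex => complex" where
 "mean_trace p n \<mu> B z = (LINT w|column_space p n \<mu>. mat_trace (resolvent p (Smat p n B w) z) / of_nat p)"

text \<open>Cyclicity turns the trace into a sum over the eigenvectors u_i of l_i <Q u_i, u_i>, with
  imaginary part l_i Im z |Q u_i|^2. As Q is injective, one positive l_i suffices. This is what
  places \<theta> in the upper half plane.\<close>

lemma (in herm) Im_trace_spec_resolvent_pos:
 assumes z: "0 < Im z" and U: "unitary p U" and l: "\<And>i. i < p ==> 0 \<le> l i" and pos: "i0 < p" "0 < l i0"
 shows "0 < Im (mat_trace (rspec p U l * resolvent p S z))"
proof -
 let ?Q = "resolvent p S z" and ?D = "diagm p (\<lambda>i. complex_of_real (l i))" and ?Ua = "mat_adjoint U"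
 have z0: "Im z \<noteq> 0" using z by simp
 note Qc = resolvent(1)[OF z0] and Uc = unitaryD(1)[OF U] and Uac = unitaryD(2)[OF U]
 have Dc: "?D \<in> carrier_mat p p" by simp
 have QUc: "?Q * U \<in> carrier_mat p p" by (rule mult_carrier_mat[OF Qc Uc])
 have Xc: "?Ua * (?Q * U) \<in> carrier_mat p p" by (rule mult_carrier_mat[OF Uac QUc])
 have "mat_trace (rspec p U l * ?Q) = mat_trace ((U * (?D * ?Ua)) * ?Q)"
  unfolding spec_def by (simp only: assoc_mult_mat[OF Uc Dc Uac])
 also have "(U * (?D * ?Ua)) * ?Q = U * (?D * ?Ua * ?Q)" by (rule assoc_mult_mat[OF Uc mult_carrier_mat[OF Dc Uac] Qc])
 also have "mat_trace ... = mat_trace ((?D * ?Ua * ?Q) * U)"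
  by (rule mat_trace_mult_commute[OF Uc mult_carrier_mat[OF mult_carrier_mat[OF Dc Uac] Qc]])
 also have "(?D * ?Ua * ?Q) * U = ?D * (?Ua * (?Q * U))"
  by (simp only: assoc_mult_mat[OF mult_carrier_mat[OF Dc Uac] Qc Uc] assoc_mult_mat[OF Dc Uac QUc])
 also have "mat_trace ... = mat_trace ((?Ua * (?Q * U)) * ?D)" by (rule mat_trace_mult_commute[OF Dc Xc])
 also have "... = (\<Sum>i<p. (?Ua * (?Q * U)) $$ (i, i) * of_real (l i))"
  unfolding mat_trace_carrier[OF mult_carrier_mat[OF Xc Dc]] by (rule sum.cong) (simp_all add: mult_diagm_index[OF Xc])
 also have "Im ... = (\<Sum>i<p. l i * (Im z * nsq p (?Q *v (U *v unit_vec p i))))"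
  unfolding Im_sum
 proof (rule sum.cong[OF refl])
  fix i assume "i \<in> {..<p}"
  then have i: "i < p" by simp
  have uc: "unit_vec p i \<in> carrier_vec p" by simp
  have Uu: "U *v unit_vec p i \<in> carrier_vec p" by (rule mult_mat_vec_carrier[OF Uc uc])
  have unit: "inn p v (unit_vec p i) = v $ i" for v
  proof -
   have "inn p v (unit_vec p i) = (\<Sum>j<p. if j = i then v $ j else 0)" unfolding inn_def by (rule sum.cong) (use i in auto)
   then show ?thesis using i by (simp only: sum.delta finite_lessThan lessThan_iff if_True)
  qed
  have "(?Ua * (?Q * U)) $$ (i, i) = inn p ((?Ua * (?Q * U)) *v unit_vec p i) (unit_vec p i)"
   unfolding unit using mat_col_index[OF Xc i i] by simp
  also have "(?Ua * (?Q * U)) *v unit_vec p i = ?Ua *v (?Q *v (U *v unit_vec p i))"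
   by (simp only: assoc_mult_mat_vec[OF Uac QUc uc] assoc_mult_mat_vec[OF Qc Uc uc])
  also have "inn p ... (unit_vec p i) = inn p (?Q *v (U *v unit_vec p i)) (U *v unit_vec p i)"
   using inn_adjoint[OF Uac mult_mat_vec_carrier[OF Qc Uu] uc] by (simp only: mat_adjoint_adjoint)
  finally show "Im ((?Ua * (?Q * U)) $$ (i, i) * of_real (l i)) = l i * (Im z * nsq p (?Q *v (U *v unit_vec p i)))"
   using Im_inn_resolvent[OF z0 Uu] by simp
 qed
 also have "0 < ..."
 proof (rule sum_pos2[of _ i0])
  let ?u = "U *v unit_vec p i0"
  have uc: "?u \<in> carrier_vec p" by (rule mult_mat_vec_carrier[OF Uc]) simp
  have "nsq p (?Q *v ?u) \<noteq> 0"
  proof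
   assume "nsq p (?Q *v ?u) = 0"
   then have Q0: "?Q *v ?u = 0\<^sub>v p" using nsq_eq_0[OF mult_mat_vec_carrier[OF Qc uc]] by simp
   have "?u = shift p S z *v (?Q *v ?u)" by (rule shift_resolvent_vec(1)[OF z0 uc, symmetric])
   also have "... = shift p S z *v 0\<^sub>v p" by (simp only: Q0)
   also have "... = 0\<^sub>v p" using S by (intro eq_vecI) (auto simp: shift_def scalar_prod_def)
   finally have "nsq p ?u = 0" using nsq_eq_0[of "0\<^sub>v p" p] by simp
   then show False using nsq_unitary[OF U, of "unit_vec p i0"] nsq_unit_vec[OF pos(1)] by simp
  qed
  then have "0 < nsq p (?Q *v ?u)" using nsq_nonneg[of p "?Q *v ?u"] by linarith
  then show "0 < l i0 * (Im z * nsq p (?Q *v ?u))" using pos z by simp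
 qed (use pos l z in \<open>auto intro!: mult_nonneg_nonneg\<close>)
 finally show ?thesis .
qed

lemma (in prob_space) expectation_pos:
 fixes X :: "'a => real"
 assumes "integrable M X" "\<And>x. 0 < X x" shows "0 < expectation X"
proof -
 have "expectation X \<noteq> 0"
 proof
  assume "expectation X = 0"
  then have "AE x in M. X x = 0" using integral_nonneg_eq_0_iff_AE[OF assms(1)] assms(2) by (simp add: less_imp_le)
  then have "AE x in M. False" using assms(2) by (auto elim!: AE_mp intro!: AE_I2 simp: less_le)
  then show False by simp
 qed
 moreover have "0 \<le> expectation X" using assms(2) by (intro Bochner_Integration.integral_nonneg) (simp add: less_imp_le)
 ultimately show ?thesis by linarith
qed

context matrix_model
begin

lemma mean_trace_eq: "mean_trace p n \<mu> B z = (LINT w|P. mat_trace (Q w) / of_nat p)"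
proof -
 have "\<nu> = (\<lambda>j. PiM J (\<mu> j))" by (rule ext) (rule \<nu>_def)
 then show ?thesis unfolding mean_trace_def Q_def by simp
qed

lemma integrable_trace_resolvent:
 assumes N: "opb p N \<kappa>" shows "integrable P (\<lambda>w. mat_trace (N * Q w))"
 by (rule PP.integrable_const_bound[OF AE_I2[OF opb_trace[OF opb_mult[OF N Qop]]] meas_tr_gen[OF opbD(1)[OF N] Qc meas_Q]])

lemma norm_mean_trace_le: "cmod (mean_trace p n \<mu> B z) \<le> 1 / Im z"
proof -
 have Q1: "1\<^sub>m p * Q w = Q w" for w by (rule left_mult_one_mat[OF Qc])
 have i: "integrable P (\<lambda>w. mat_trace (Q w))" using integrable_trace_resolvent[OF opb_one] unfolding Q1 .
 have b: "cmod (mat_trace (Q w) / of_nat p) \<le> 1 / Im z" for w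
  using opb_trace[OF Qop, of w] p z by (simp add: norm_divide field_simps)
 have "cmod (mean_trace p n \<mu> B z) \<le> (LINT w|P. 1 / Im z)" unfolding mean_trace_eq
  by (rule order_trans[OF integral_norm_bound integral_mono]) (use i b in \<open>auto intro!: integrable_norm\<close>)
 then show ?thesis by (simp add: PP.prob_space)
qed

text \<open>For the second test matrix, A = \<sigma> A N - z N. With tr(N Q S) = tr N + z tr(N Q)
  this gives \<theta> - tr N / n = \<sigma> T(N) - X exactly, where X = E tr(N Q S) / n. Multiplied
  by 1 - \<theta>^2, the right side is, up to sign, the quantity already estimated.\<close>

theorem self_consistency:
 fixes U l \<tau>
 assumes U: "unitary p U" and l: "\<And>i. i < p ==> 0 \<le> l i \<and> l i \<le> \<tau>" and B: "B = rspec p U (\<lambda>i. sqrt (l i))"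
  and pos: "\<exists>i<p. 0 < l i"
 shows "\<exists>\<theta>. 0 < Im \<theta> \<and>
  cmod ((1 - \<theta>\<^sup>2) * (of_real (real p / real n) * (1 + z * mean_trace p n \<mu> B z)) + 2 * \<theta>\<^sup>2) \<le> 2 * estimate_const g K \<gamma> 1 / sqrt (real n) \<and>
  cmod (1 - \<theta>\<^sup>2) * cmod (\<theta> - of_real (real p / real n) * (LINT x|empirical p l. hker z (sig \<theta>) x))
   \<le> 2 * estimate_const g K \<gamma> (1 + \<tau> / Im z) / sqrt (real n)"
proof (intro exI conjI)
 define \<theta> where "\<theta> = T (1\<^sub>m p)"
 define s where "s = sig \<theta>"
 let ?A = "rspec p U l"
 have z0: "Im z \<noteq> 0" using z by simp
 have n0: "complex_of_nat n \<noteq> 0" "complex_of_nat p \<noteq> 0" using n p by auto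
 have Uc: "U \<in> carrier_mat p p" by (rule unitaryD(1)[OF U])
 have BB: "B * B = ?A" unfolding B spec_mult[OF U]
  by (rule spec_cong[OF Uc]) (use l in \<open>simp add: of_real_mult[symmetric] del: of_real_mult\<close>)
 have Ac: "?A \<in> carrier_mat p p" by (rule spec_carrier[OF Uc])
 have A1: "?A * 1\<^sub>m p = ?A" by (rule right_mult_one_mat[OF Ac])
 have \<theta>: "\<theta> = (LINT w|P. mat_trace (?A * Q w) / of_nat n)" unfolding \<theta>_def T_def tr_def BB A1 ..
 have iA: "integrable P (\<lambda>w. mat_trace (?A * Q w))"
  using integrable_trace_resolvent[OF opb_mult[OF opB opB]] unfolding BB .
 obtain i0 where i0: "i0 < p" "0 < l i0" using pos by auto
 have \<tau>: "0 \<le> \<tau>" using l[OF i0(1)] by linarith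
 have "0 < (LINT w|P. Im (mat_trace (?A * Q w)))"
  by (rule PP.expectation_pos[OF integrable_Im[OF iA]])
   (unfold Q_def, rule herm.Im_trace_spec_resolvent_pos[OF Smat_herm z U], use l in force, fact i0(1), fact i0(2))
 then have "0 < Im (LINT w|P. mat_trace (?A * Q w))" using integral_Im[OF iA] by simp
 then show Im: "0 < Im (T (1\<^sub>m p))" unfolding \<theta>_def[symmetric] \<theta> using n by (simp add: Im_divide_of_nat)
 have Q1: "1\<^sub>m p * Q w = Q w" for w by (rule left_mult_one_mat[OF Qc])
 have i1: "integrable P (\<lambda>w. mat_trace (Q w))" using integrable_trace_resolvent[OF opb_one] unfolding Q1 .
 have "(LINT w|P. mat_trace (1\<^sub>m p * Q w * Smat p n B w) / of_nat n) = (LINT w|P. (of_nat p + z * mat_trace (Q w)) / of_nat n)"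
 proof (rule arg_cong[of _ _ "integral\<^sup>L P"], rule ext)
  fix w show "mat_trace (1\<^sub>m p * Q w * Smat p n B w) / of_nat n = (of_nat p + z * mat_trace (Q w)) / of_nat n"
   using herm.resolvent_mult[OF Smat_herm[of p n B w] z0 one_carrier_mat] by (simp add: Q_def mat_trace_one left_mult_one_mat[OF Qc[unfolded Q_def]])
 qed
 also have "... = of_real (real p / real n) * (1 + z * mean_trace p n \<mu> B z)"
  unfolding mean_trace_eq using i1 n0 by (simp add: PP.prob_space field_simps)
 finally have "(LINT w|P. mat_trace (1\<^sub>m p * Q w * Smat p n B w) / of_nat n) = of_real (real p / real n) * (1 + z * mean_trace p n \<mu> B z)" .
 with expectation_estimate(1)[OF opb_one order_refl]
 show "cmod ((1 - (T (1\<^sub>m p))\<^sup>2) * (of_real (real p / real n) * (1 + z * mean_trace p n \<mu> B z)) + 2 * (T (1\<^sub>m p))\<^sup>2) \<le> 2 * estimate_const g K \<gamma> 1 / sqrt (real n)"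
  by (simp only: power2_eq_square mult.assoc)
 have Ims: "Im s < 0" unfolding s_def using Im_sig_neg Im by (simp add: \<theta>_def)
 let ?N = "spec p U (\<lambda>i. hker z s (l i))"
 have Nc: "?N \<in> carrier_mat p p" by (rule spec_carrier[OF Uc])
 \<comment> \<open>The norm is at most \<tau> / Im z. The summand 1 secures \<kappa> \<ge> 1, as the
   estimate demands.\<close>
 have Nop: "opb p ?N (1 + \<tau> / Im z)"
 proof (rule spec_opb[OF U])
  show "0 \<le> 1 + \<tau> / Im z" using \<tau> z by simp
  fix i assume i: "i < p"
  have "hker z s (l i) = of_real (l i) * rker z s (l i)" by (simp add: hker_def rker_def)
  then have "cmod (hker z s (l i)) = l i * cmod (rker z s (l i))" using l[OF i] by (simp add: norm_mult)
  also have "... \<le> \<tau> * (1 / Im z)" using rker_bound[of "l i" s z] l[OF i] Ims z \<tau> by (intro mult_mono) auto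
  finally show "cmod (hker z s (l i)) \<le> 1 + \<tau> / Im z" by simp
 qed
 have k1: "1 \<le> 1 + \<tau> / Im z" using \<tau> z by simp
 have iN: "integrable P (\<lambda>w. mat_trace (?N * Q w))" by (rule integrable_trace_resolvent[OF Nop])
 have iAN: "integrable P (\<lambda>w. mat_trace (?A * ?N * Q w))" using integrable_trace_resolvent[OF BBop[OF Nop]] unfolding BB .
 have AN: "?A = s \<cdot>\<^sub>m (?A * ?N) - z \<cdot>\<^sub>m ?N"
 proof -
  have "of_real (l i) = s * (of_real (l i) * hker z s (l i)) - z * hker z s (l i)" if "i < p" for i
  proof -
   have "s * (of_real (l i) * hker z s (l i)) - z * hker z s (l i) = hker z s (l i) * (- z + of_real (l i) * s)" by (simp add: algebra_simps)
   also have "... = of_real (l i)" using den_nonzero[of "l i" s z] l[OF that] Ims z by (simp add: hker_def)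
   finally show ?thesis by simp
  qed
  then show ?thesis unfolding spec_mult[OF U] spec_smult[OF Uc] spec_diff[OF Uc] by (intro spec_cong[OF Uc])
 qed
 have ANc: "?A * ?N \<in> carrier_mat p p" by (rule mult_carrier_mat[OF Ac Nc])
 have trA: "mat_trace (?A * Q w) = s * mat_trace (?A * ?N * Q w) - z * mat_trace (?N * Q w)" for w
 proof -
  have "mat_trace (?A * Q w) = mat_trace ((s \<cdot>\<^sub>m (?A * ?N) - z \<cdot>\<^sub>m ?N) * Q w)" using AN by simp
  also have "(s \<cdot>\<^sub>m (?A * ?N) - z \<cdot>\<^sub>m ?N) * Q w = s \<cdot>\<^sub>m (?A * ?N * Q w) - z \<cdot>\<^sub>m (?N * Q w)"
   using minus_mult_distrib_mat[OF smult_carrier_mat[OF ANc] smult_carrier_mat[OF Nc] Qc, of s z w]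
    mult_smult_assoc_mat[OF ANc Qc, of s w] mult_smult_assoc_mat[OF Nc Qc, of z w] by simp
  finally show ?thesis
   by (simp only: mat_trace_diff[OF smult_carrier_mat[OF mult_carrier_mat[OF ANc Qc]] smult_carrier_mat[OF mult_carrier_mat[OF Nc Qc]]]
     mat_trace_smult[OF mult_carrier_mat[OF ANc Qc]] mat_trace_smult[OF mult_carrier_mat[OF Nc Qc]])
 qed
 define X where "X = (LINT w|P. mat_trace (?N * Q w * Smat p n B w) / of_nat n)"
 have X: "X = (mat_trace ?N + z * (LINT w|P. mat_trace (?N * Q w))) / of_nat n"
 proof -
  have "X = (LINT w|P. (mat_trace ?N + z * mat_trace (?N * Q w)) / of_nat n)"
   unfolding X_def Q_def herm.resolvent_mult[OF Smat_herm z0 Nc] ..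
  also have "... = (mat_trace ?N + z * (LINT w|P. mat_trace (?N * Q w))) / of_nat n" using iN by (simp add: PP.prob_space)
  finally show ?thesis .
 qed
 have TN: "T ?N = (LINT w|P. mat_trace (?A * ?N * Q w)) / of_nat n" unfolding T_def tr_def BB by simp
 have "\<theta> = (s * (LINT w|P. mat_trace (?A * ?N * Q w)) - z * (LINT w|P. mat_trace (?N * Q w))) / of_nat n"
  unfolding \<theta> trA using iN iAN by simp
 then have key: "\<theta> - mat_trace ?N / of_nat n = s * T ?N - X" unfolding X TN by (simp add: add_divide_distrib diff_divide_distrib)
 \<comment> \<open>The trace of the test matrix is the right side of the equation for h at the
   spectral measure of A, scaled by p / n.\<close>
 have H: "mat_trace ?N / of_nat n = of_real (real p / real n) * (LINT x|empirical p l. hker z (sig \<theta>) x)"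
  unfolding integral_empirical[OF p hker_measurable] spec_trace[OF U] s_def using n0 by (simp add: scaleR_conv_of_real field_simps)
 have \<theta>1: "1 + \<theta> \<noteq> 0" "- 1 + \<theta> \<noteq> 0" using nonreal_not_pm1 Im by (auto simp: \<theta>_def)
 have sq: "\<theta>\<^sup>2 - 1 \<noteq> 0"
 proof -
  have "\<theta>\<^sup>2 - 1 = (1 + \<theta>) * (- 1 + \<theta>)" by (simp add: power2_eq_square algebra_simps)
  then show ?thesis using \<theta>1 by simp
 qed
 have s2: "(1 - \<theta>\<^sup>2) * s = - (2 * \<theta>)" unfolding s_def sig_eq[OF \<theta>1] using sq by (simp add: field_simps)
 have "(1 - \<theta>\<^sup>2) * (s * T ?N - X) = ((1 - \<theta>\<^sup>2) * s) * T ?N - (1 - \<theta>\<^sup>2) * X" by (simp add: algebra_simps)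
 then have "(1 - \<theta>\<^sup>2) * (\<theta> - mat_trace ?N / of_nat n) = - ((1 - \<theta>\<^sup>2) * X + 2 * \<theta> * T ?N)" unfolding key s2 by simp
 then have "cmod (1 - \<theta>\<^sup>2) * cmod (\<theta> - mat_trace ?N / of_nat n) = cmod ((1 - \<theta>\<^sup>2) * X + 2 * \<theta> * T ?N)"
  by (metis norm_minus_cancel norm_mult)
 also have "... \<le> 2 * estimate_const g K \<gamma> (1 + \<tau> / Im z) / sqrt (real n)"
  using expectation_estimate(1)[OF Nop k1] unfolding X_def \<theta>_def .
 finally show "cmod (1 - (T (1\<^sub>m p))\<^sup>2) * cmod (T (1\<^sub>m p) - of_real (real p / real n) * (LINT x|empirical p l. hker z (sig (T (1\<^sub>m p))) x))
   \<le> 2 * estimate_const g K \<gamma> (1 + \<tau> / Im z) / sqrt (real n)"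
  unfolding H \<theta>_def[symmetric] .
qed

end

lemma empirical_nonneg_distr:
 assumes "0 < p" "\<And>i. i < p ==> 0 \<le> l i" shows "nonneg_distr (empirical p l)"
proof -
 have "AE x in empirical p l. 0 \<le> x" unfolding empirical_def
  by (subst AE_distr_iff) (auto intro!: AE_I2 assms simp: uniform_count_measure_def space_point_measure sets_point_measure)
 then show ?thesis unfolding nonneg_distr_def using empirical_real_distribution[OF assms(1)] by simp
qed

text \<open>The first bound of \<open>self_consistency\<close> is used twice: it keeps 1 -
  \<theta>^2 away from 0, so that the second bound makes \<theta> over p / n an approximate
  solution; and, solved for the mean trace, it gives the limit once \<theta> converges.\<close>

theorem bounded_spectrum_limit:
 fixes p n :: "nat => nat" and \<mu> :: "nat => nat => nat \<times> nat => complex measure" and U :: "nat => complex mat" and l :: "nat => nat => real"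
 assumes cm: "\<And>k. column_model (p k) (n k) (\<mu> k) K" and n: "filterlim n at_top sequentially"
  and c: "(\<lambda>k. real (p k) / real (n k)) \<longlonglongrightarrow> c" "0 < c"
  and U: "\<And>k. unitary (p k) (U k)" and l: "\<And>k i. i < p k ==> 0 \<le> l k i \<and> l k i \<le> \<tau>"
  and H: "nonneg_distr H" "H \<noteq> return borel 0" and wc: "weak_conv_m (\<lambda>k. empirical (p k) (l k)) H" and z: "0 < Im z"
 shows "(\<lambda>k. mean_trace (p k) (n k) (\<mu> k) (rspec (p k) (U k) (\<lambda>i. sqrt (l k i))) z) \<longlonglongrightarrow> s_lim c H z"
proof -
 have pn: "0 < p k" "0 < n k" for k using cm[of k] by (simp_all add: column_model_def)
 have Hk: "nonneg_distr (empirical (p k) (l k))" for k by (rule empirical_nonneg_distr[OF pn(1)]) (use l in auto)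
 \<comment> \<open>A bounded continuous function, positive exactly for x > 0. Its integrals converge
   to a positive limit, which forces a positive eigenvalue for large k.\<close>
 let ?f = "\<lambda>x :: real. min 1 (max 0 x)"
 have ev: "eventually (\<lambda>k. \<exists>i<p k. 0 < l k i) sequentially"
 proof -
  have mf: "?f \<in> borel_measurable borel" by measurable
  have "(\<lambda>k. LINT x|empirical (p k) (l k). ?f x) \<longlonglongrightarrow> (LINT x|H. ?f x)"
   by (rule weak_conv_integral_varying[OF Hk H(1) wc mf mf, where B = 1]) (auto intro!: tendsto_intros)
  moreover have "0 < (LINT x|H. ?f x)"
   by (rule integral_pos_nondegenerate[OF H]) (auto intro!: integrable_bounded_nonneg[OF H(1) mf, where B = 1])
  ultimately have "eventually (\<lambda>k. 0 < (LINT x|empirical (p k) (l k). ?f x)) sequentially" by (rule order_tendstoD)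
  then show ?thesis
  proof (rule eventually_mono)
   fix k assume *: "0 < (LINT x|empirical (p k) (l k). ?f x)"
   show "\<exists>i<p k. 0 < l k i"
   proof (rule ccontr)
    assume "\<not> (\<exists>i<p k. 0 < l k i)"
    then have "l k i \<le> 0" if "i < p k" for i using that not_less by blast
    then have "(\<Sum>i<p k. ?f (l k i)) = 0" by (intro sum.neutral) simp
    then show False using * integral_empirical[OF pn(1) mf, of k "l k"] by simp
   qed
  qed
 qed
 then obtain k0 where k0: "\<And>k. k0 \<le> k ==> \<exists>i<p k. 0 < l k i" unfolding eventually_sequentially by blast
 obtain \<gamma> where \<gamma>: "\<And>k. real (p k) / real (n k) \<le> \<gamma>"
 proof -
  have "Bseq (\<lambda>k. real (p k) / real (n k))" using c(1) by (intro convergent_imp_Bseq) (auto simp: convergent_def)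
  then obtain \<gamma> where "\<forall>k. norm (real (p k) / real (n k)) \<le> \<gamma>" by (auto simp: Bseq_def)
  then have "real (p k) / real (n k) \<le> \<gamma>" for k by (simp add: abs_le_iff)
  then show ?thesis using that by blast
 qed
 define B where "B k = rspec (p k) (U k) (\<lambda>i. sqrt (l k i))" for k
 have \<tau>: "0 \<le> \<tau>" using l[of 0 0] pn[of 0] by auto
 have M: "matrix_model (p k) (n k) (\<mu> k) K (B k) z (sqrt \<tau>) \<gamma>" for k
 proof (rule matrix_model.intro[OF cm], unfold_locales)
  have Uc: "U k \<in> carrier_mat (p k) (p k)" by (rule unitaryD(1)[OF U])
  show "opb (p k) (B k) (sqrt \<tau>)" unfolding B_def by (rule spec_opb[OF U]) (use l \<tau> in auto)
  show "mat_adjoint (B k) = B k" unfolding B_def spec_adjoint[OF Uc] by simp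
  show "real (p k) \<le> \<gamma> * real (n k)" using \<gamma>[of k] pn[of k] by (simp add: divide_le_eq)
 qed (rule z)
 define m where "m k = mean_trace (p k) (n k) (\<mu> k) (B k) z" for k
 define ck where "ck k = real (p k) / real (n k)" for k
 define C1 where "C1 = 2 * estimate_const (\<tau> / Im z) K \<gamma> 1"
 define C2 where "C2 = 2 * estimate_const (\<tau> / Im z) K \<gamma> (1 + \<tau> / Im z)"
 define e where "e k = 1 / sqrt (real (n k))" for k
 have g: "(sqrt \<tau>)\<^sup>2 / Im z = \<tau> / Im z" using \<tau> by simp
 have "\<exists>\<theta>. 0 < Im \<theta> \<and> cmod ((1 - \<theta>\<^sup>2) * (of_real (ck k) * (1 + z * m k)) + 2 * \<theta>\<^sup>2) \<le> C1 * e k \<and>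
  cmod (1 - \<theta>\<^sup>2) * cmod (\<theta> - of_real (ck k) * (LINT x|empirical (p k) (l k). hker z (sig \<theta>) x)) \<le> C2 * e k" if "k0 \<le> k" for k
  using matrix_model.self_consistency[OF M U l B_def k0[OF that], unfolded matrix_model.g_def[OF M] g]
  by (simp add: C1_def C2_def e_def m_def ck_def)
 then have "\<forall>k. \<exists>\<theta>. k0 \<le> k \<longrightarrow> 0 < Im \<theta> \<and> cmod ((1 - \<theta>\<^sup>2) * (of_real (ck k) * (1 + z * m k)) + 2 * \<theta>\<^sup>2) \<le> C1 * e k \<and>
  cmod (1 - \<theta>\<^sup>2) * cmod (\<theta> - of_real (ck k) * (LINT x|empirical (p k) (l k). hker z (sig \<theta>) x)) \<le> C2 * e k" by blast
 from choice[OF this] obtain \<theta> where \<theta>: "\<And>k. k0 \<le> k ==> 0 < Im (\<theta> k)"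
  "\<And>k. k0 \<le> k ==> cmod ((1 - (\<theta> k)\<^sup>2) * (of_real (ck k) * (1 + z * m k)) + 2 * (\<theta> k)\<^sup>2) \<le> C1 * e k"
  "\<And>k. k0 \<le> k ==> cmod (1 - (\<theta> k)\<^sup>2) * cmod (\<theta> k - of_real (ck k) * (LINT x|empirical (p k) (l k). hker z (sig (\<theta> k)) x)) \<le> C2 * e k" by blast
 have ck0: "0 < ck k" for k using pn[of k] by (simp add: ck_def)
 have e0: "e \<longlonglongrightarrow> 0"
 proof -
  have "filterlim (\<lambda>k. sqrt (real (n k))) at_top sequentially"
   by (rule filterlim_compose[OF sqrt_at_top filterlim_compose[OF filterlim_real_sequentially n]])
  then show ?thesis unfolding e_def using tendsto_divide_0[OF tendsto_const filterlim_at_top_imp_at_infinity] by blast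
 qed
 have C1e: "(\<lambda>k. C1 * e k) \<longlonglongrightarrow> 0" "(\<lambda>k. C2 * e k) \<longlonglongrightarrow> 0" using tendsto_mult_right_zero[OF e0] by auto
 \<comment> \<open>An upper bound for 2 + |x|, where x = c_k (1 + z m_k) and c_k, m_k stand for
   \<open>ck k\<close>, \<open>m k\<close>. Since 2 = r + (1 - \<theta>^2) (2 - x) with a small
   residual r, eventually |1 - \<theta>^2| \<ge> 1 / L.\<close>
 define L where "L = 2 + \<gamma> * (1 + cmod z / Im z)"
 have \<gamma>0: "0 \<le> \<gamma>" using \<gamma>[of 0] order_trans[OF _ \<gamma>[of 0]] by simp
 have L: "0 < L" unfolding L_def using \<gamma>0 z by (intro add_pos_nonneg) auto
 have mb: "cmod (m k) \<le> 1 / Im z" for k unfolding m_def by (rule matrix_model.norm_mean_trace_le[OF M])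
 have d: "2 - C1 * e k \<le> cmod (1 - (\<theta> k)\<^sup>2) * L" if k: "k0 \<le> k" for k
 proof -
  let ?d = "1 - (\<theta> k)\<^sup>2" and ?x = "of_real (ck k) * (1 + z * m k)"
  have "2 = (?d * ?x + 2 * (\<theta> k)\<^sup>2) + (2 * ?d - ?d * ?x)" by simp
  then have "2 \<le> cmod (?d * ?x + 2 * (\<theta> k)\<^sup>2) + cmod (2 * ?d - ?d * ?x)" by (metis norm_numeral norm_triangle_ineq)
  moreover have "cmod (2 * a - a * b) \<le> 2 * cmod a + cmod a * cmod b" for a b
   using norm_triangle_ineq4[of "2 * a" "a * b"] by (simp add: norm_mult)
  note this[of ?d ?x]
  moreover have "cmod ?x \<le> \<gamma> * (1 + cmod z / Im z)"
  proof -
   have "cmod (1 + z * m k) \<le> 1 + cmod z * cmod (m k)" using norm_triangle_ineq[of 1 "z * m k"] by (simp add: norm_mult)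
   also have "... \<le> 1 + cmod z * (1 / Im z)" using mult_left_mono[OF mb, of "cmod z"] by simp
   finally have "ck k * cmod (1 + z * m k) \<le> \<gamma> * (1 + cmod z / Im z)"
    using \<gamma>[of k] \<gamma>0 unfolding ck_def by (intro mult_mono) auto
   then show ?thesis using ck0[of k] by (simp add: norm_mult)
  qed
  then have "cmod ?d * cmod ?x \<le> cmod ?d * (\<gamma> * (1 + cmod z / Im z))" by (rule mult_left_mono) simp
  ultimately show ?thesis using \<theta>(2)[OF k] unfolding L_def by (simp only: distrib_left)
 qed
 have dev: "eventually (\<lambda>k. 1 / L \<le> cmod (1 - (\<theta> k)\<^sup>2) \<and> k0 \<le> k) sequentially"
 proof -
  have "eventually (\<lambda>k. C1 * e k < 1) sequentially" by (rule order_tendstoD[OF C1e(1)]) simp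
  then show ?thesis using eventually_ge_at_top[of k0]
  proof eventually_elim
   case (elim k)
   then have "1 \<le> cmod (1 - (\<theta> k)\<^sup>2) * L" using d[of k] by linarith
   then show ?case using L elim by (simp add: divide_le_eq)
  qed
 qed
 define h where "h k = \<theta> k / of_real (ck k)" for k
 have ch: "of_real (ck k) * h k = \<theta> k" for k using ck0[of k] by (simp add: h_def)
 have err: "(\<lambda>k. h k - (LINT x|empirical (p k) (l k). hker z (sig (of_real (ck k) * h k)) x)) \<longlonglongrightarrow> 0"
 proof (rule Lim_null_comparison)
  have "(\<lambda>k. L * (C2 * e k) / ck k) \<longlonglongrightarrow> L * 0 / c"
   unfolding ck_def using C1e(2) c by (intro tendsto_intros) auto
  then show "(\<lambda>k. L * (C2 * e k) / ck k) \<longlonglongrightarrow> 0" by simp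
  show "\<forall>\<^sub>F k in sequentially. norm (h k - (LINT x|empirical (p k) (l k). hker z (sig (of_real (ck k) * h k)) x)) \<le> L * (C2 * e k) / ck k"
   using dev
  proof eventually_elim
   case (elim k)
   let ?y = "\<theta> k - of_real (ck k) * (LINT x|empirical (p k) (l k). hker z (sig (\<theta> k)) x)"
   have "1 / L * cmod ?y \<le> C2 * e k" using mult_right_mono[of "1 / L" "cmod (1 - (\<theta> k)\<^sup>2)" "cmod ?y"] elim \<theta>(3)[of k] by simp
   then have "cmod ?y \<le> L * (C2 * e k)" using L by (simp add: divide_le_eq mult.commute)
   moreover have "h k - (LINT x|empirical (p k) (l k). hker z (sig (of_real (ck k) * h k)) x) = ?y / of_real (ck k)"
    unfolding ch using ck0[of k] by (simp add: h_def diff_divide_distrib)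
   ultimately show ?case using ck0[of k] by (simp add: norm_divide divide_right_mono)
  qed
 qed
 \<comment> \<open>Below k0 the choice of \<theta> carries no information, so the sequence is
   started there.\<close>
 have "(\<lambda>k. h (k + k0)) \<longlonglongrightarrow> h_fun c H z"
 proof (rule approximate_solutions_tendsto[where Hs = "\<lambda>k. empirical (p (k + k0)) (l (k + k0))" and cs = "\<lambda>k. ck (k + k0)" and zs = "\<lambda>_. z" and z = z])
  show "weak_conv_m (\<lambda>k. empirical (p (k + k0)) (l (k + k0))) H" using weak_conv_m_subseq[OF wc, of "\<lambda>k. k + k0"] by (simp add: strict_mono_def)
  show "(\<lambda>k. ck (k + k0)) \<longlonglongrightarrow> c" using LIMSEQ_ignore_initial_segment[OF c(1)] unfolding ck_def .
  show "0 < Im (h (k + k0))" for k using \<theta>(1)[of "k + k0"] ck0[of "k + k0"] by (simp add: h_def Im_divide_of_real)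
  show "(\<lambda>k. h (k + k0) - (LINT x|empirical (p (k + k0)) (l (k + k0)). hker z (sig (of_real (ck (k + k0)) * h (k + k0))) x)) \<longlonglongrightarrow> 0"
   by (rule LIMSEQ_ignore_initial_segment[OF err])
  show "solves_h_eq c H z (h_fun c H z)" by (rule h_fun_solves[OF H c(2) z])
 qed (use Hk H c z ck0 in auto)
 then have hl: "h \<longlonglongrightarrow> h_fun c H z" by (rule LIMSEQ_offset)
 have ckl: "ck \<longlonglongrightarrow> c" using c(1) unfolding ck_def .
 define \<theta>0 where "\<theta>0 = of_real c * h_fun c H z"
 have \<theta>l: "\<theta> \<longlonglongrightarrow> \<theta>0"
 proof -
  have "(\<lambda>k. of_real (ck k) * h k) \<longlonglongrightarrow> \<theta>0" unfolding \<theta>0_def by (intro tendsto_intros hl ckl)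
  then show ?thesis unfolding ch .
 qed
 have "0 < Im (h_fun c H z)" using h_fun_solves[OF H c(2) z] by (simp add: solves_h_eq_alt)
 then have I0: "0 < Im \<theta>0" using c(2) by (simp add: \<theta>0_def)
 note \<theta>01 = nonreal_not_pm1[OF I0]
 have sq: "1 - \<theta>0\<^sup>2 \<noteq> 0"
 proof -
  have "1 - \<theta>0\<^sup>2 = - ((1 + \<theta>0) * (- 1 + \<theta>0))" by (simp add: power2_eq_square algebra_simps)
  then show ?thesis using \<theta>01 by simp
 qed
 have r0: "(\<lambda>k. (1 - (\<theta> k)\<^sup>2) * (of_real (ck k) * (1 + z * m k)) + 2 * (\<theta> k)\<^sup>2) \<longlonglongrightarrow> 0"
  by (rule Lim_null_comparison[OF _ C1e(1)]) (use \<theta>(2) in \<open>auto simp: eventually_sequentially\<close>)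
 define r where "r k = (1 - (\<theta> k)\<^sup>2) * (of_real (ck k) * (1 + z * m k)) + 2 * (\<theta> k)\<^sup>2" for k
 \<comment> \<open>The definition of the residual r, solved for the mean trace; r itself tends to
   0.\<close>
 have "(\<lambda>k. ((r k - 2 * (\<theta> k)\<^sup>2) / (1 - (\<theta> k)\<^sup>2) / of_real (ck k) - 1) / z) \<longlonglongrightarrow> ((0 - 2 * \<theta>0\<^sup>2) / (1 - \<theta>0\<^sup>2) / of_real c - 1) / z"
  using r0[folded r_def] \<theta>l ckl sq c(2) z by (intro tendsto_intros) auto
 moreover have "((0 - 2 * \<theta>0\<^sup>2) / (1 - \<theta>0\<^sup>2) / of_real c - 1) / z = s_lim c H z"
 proof -
  have "(0 - 2 * \<theta>0\<^sup>2) / (1 - \<theta>0\<^sup>2) = \<theta>0 * sig \<theta>0"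
   unfolding sig_eq[OF \<theta>01] using sq by (simp add: field_simps power2_eq_square)
  then show ?thesis using c(2) by (simp add: s_lim_def \<theta>0_def)
 qed
 moreover have "eventually (\<lambda>k. ((r k - 2 * (\<theta> k)\<^sup>2) / (1 - (\<theta> k)\<^sup>2) / of_real (ck k) - 1) / z = m k) sequentially"
  using dev
 proof eventually_elim
  case (elim k)
  have "1 - (\<theta> k)\<^sup>2 \<noteq> 0" using elim L by (auto simp: divide_le_eq)
  moreover have "z \<noteq> 0" "complex_of_real (ck k) \<noteq> 0" using z ck0[of k] by auto
  ultimately show ?case by (simp add: r_def)
 qed
 ultimately have "m \<longlonglongrightarrow> s_lim c H z" using Lim_transform_eventually by fastforce
 then show ?thesis unfolding m_def B_def .
qed

section \<open>Capping the spectrum\<close>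

lemma conjugate_rank_one_update:
 assumes W: "herm p W" and B: "herm p B" and u: "u \<in> carrier_vec p" and B': "B' = B + of_real e \<cdot>\<^sub>m outer p u u"
 shows "\<exists>y\<in>carrier_vec p. B' * W * B' = B * W * B + of_real 1 \<cdot>\<^sub>m (outer p u y + outer p y u)"
proof
 note Wc = herm.S[OF W] and Wh = herm.herm[OF W] and Bc = herm.S[OF B] and Bh = herm.herm[OF B]
 define t where "t = Re (inn p (W *v u) u)"
 \<comment> \<open>With b = B W u, expanding B' W B' gives the correction e (outer of u, b plus
   outer of b, u) and a term e^2 t times the outer square of u. Half of the latter is moved into y,
   so that one symmetric rank-two correction remains.\<close>
 define y where "y = of_real e \<cdot>\<^sub>v (B *v (W *v u)) + of_real (e\<^sup>2 * t / 2) \<cdot>\<^sub>v u"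
 have Wu: "W *v u \<in> carrier_vec p" and BWu: "B *v (W *v u) \<in> carrier_vec p"
  using mult_mat_vec_carrier[OF Wc u] mult_mat_vec_carrier[OF Bc mult_mat_vec_carrier[OF Wc u]] by auto
 show yc: "y \<in> carrier_vec p" unfolding y_def using BWu u by simp
 have t: "inn p (W *v u) u = of_real t" using herm.inn_herm_real[OF W u] by (simp add: t_def complex_eq_iff)
 have B'c: "B' \<in> carrier_mat p p" unfolding B' using Bc by simp
 show "B' * W * B' = B * W * B + of_real 1 \<cdot>\<^sub>m (outer p u y + outer p y u)"
 proof (rule mat_eq_vecI)
  show "B' * W * B' \<in> carrier_mat p p" by (rule mult_carrier_mat[OF mult_carrier_mat[OF B'c Wc] B'c])
  have BWBc: "B * W * B \<in> carrier_mat p p" by (rule mult_carrier_mat[OF mult_carrier_mat[OF Bc Wc] Bc])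
  then show "B * W * B + of_real 1 \<cdot>\<^sub>m (outer p u y + outer p y u) \<in> carrier_mat p p" by simp
  fix v :: "complex vec" assume v: "v \<in> carrier_vec p"
  have app: "B' *v x = B *v x + (of_real e * inn p x u) \<cdot>\<^sub>v u" if x: "x \<in> carrier_vec p" for x
   unfolding B' using add_mult_distrib_mat_vec[OF Bc smult_carrier_mat[OF outer_carrier] x, of "of_real e" u u]
    smult_mat_mult_vec[OF outer_carrier x, of "of_real e" u u] outer_mult_vec[OF x u, of u] by (simp add: smult_smult_assoc)
  let ?a = "of_real e * inn p v u"
  have Bv: "B *v v \<in> carrier_vec p" "W *v (B *v v) \<in> carrier_vec p" "B *v (W *v (B *v v)) \<in> carrier_vec p"
   using mult_mat_vec_carrier[OF Bc v] mult_mat_vec_carrier[OF Wc mult_mat_vec_carrier[OF Bc v]] mult_mat_vec_carrier[OF Bc mult_mat_vec_carrier[OF Wc mult_mat_vec_carrier[OF Bc v]]] by auto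
  have "B' * W * B' *v v = B' *v (W *v (B' *v v))"
   by (simp only: assoc_mult_mat_vec[OF mult_carrier_mat[OF B'c Wc] B'c v] assoc_mult_mat_vec[OF B'c Wc mult_mat_vec_carrier[OF B'c v]])
  also have "W *v (B' *v v) = W *v (B *v v) + ?a \<cdot>\<^sub>v (W *v u)"
   unfolding app[OF v] using mult_add_distrib_mat_vec[OF Wc Bv(1), of "?a \<cdot>\<^sub>v u"] mult_mat_vec[OF Wc u, of ?a] u by simp
  also have "B' *v ... = B *v (W *v (B *v v)) + ?a \<cdot>\<^sub>v (B *v (W *v u))
    + (of_real e * inn p (W *v (B *v v) + ?a \<cdot>\<^sub>v (W *v u)) u) \<cdot>\<^sub>v u"
   using app[of "W *v (B *v v) + ?a \<cdot>\<^sub>v (W *v u)"] mult_add_distrib_mat_vec[OF Bc Bv(2), of "?a \<cdot>\<^sub>v (W *v u)"] mult_mat_vec[OF Bc Wu, of ?a] Wu Bv by simp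
  also have "inn p (W *v (B *v v) + ?a \<cdot>\<^sub>v (W *v u)) u = inn p v (B *v (W *v u)) + ?a * of_real t"
  proof -
   have "inn p (W *v (B *v v)) u = inn p v (B *v (W *v u))"
    using inn_adjoint[OF Wc Bv(1) u] inn_adjoint[OF Bc v Wu] by (simp only: Wh Bh)
   then show ?thesis using inn_add_left[of "?a \<cdot>\<^sub>v (W *v u)" p "W *v (B *v v)" u] inn_smult_left[OF Wu, of ?a u] Wu Bv by (simp add: t)
  qed
  finally have L: "B' * W * B' *v v = B *v (W *v (B *v v)) + ?a \<cdot>\<^sub>v (B *v (W *v u)) + (of_real e * (inn p v (B *v (W *v u)) + ?a * of_real t)) \<cdot>\<^sub>v u" .
  have oc: "outer p u y + outer p y u \<in> carrier_mat p p" by simp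
  have "(B * W * B + of_real 1 \<cdot>\<^sub>m (outer p u y + outer p y u)) *v v = (B * W * B) *v v + (outer p u y *v v + outer p y u *v v)"
   using add_mult_distrib_mat_vec[OF BWBc smult_carrier_mat[OF oc] v, of "of_real 1"] smult_mat_mult_vec[OF oc v, of "of_real 1"]
    add_mult_distrib_mat_vec[OF outer_carrier outer_carrier v, of u y y u] by simp
  also have "(B * W * B) *v v = B *v (W *v (B *v v))"
   by (simp only: assoc_mult_mat_vec[OF mult_carrier_mat[OF Bc Wc] Bc v] assoc_mult_mat_vec[OF Bc Wc Bv(1)])
  also have "outer p u y *v v + outer p y u *v v = inn p v y \<cdot>\<^sub>v u + inn p v u \<cdot>\<^sub>v y"
   using outer_mult_vec[OF v u, of y] outer_mult_vec[OF v yc, of u] by simp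
  also have "inn p v y = of_real e * inn p v (B *v (W *v u)) + of_real (e\<^sup>2 * t / 2) * inn p v u"
   unfolding y_def using inn_add_right[of "of_real (e\<^sup>2 * t / 2) \<cdot>\<^sub>v u" p v "of_real e \<cdot>\<^sub>v (B *v (W *v u))"]
    inn_smult_right[OF BWu, of v "of_real e"] inn_smult_right[OF u, of v "of_real (e\<^sup>2 * t / 2)"] BWu u by simp
  finally have R: "(B * W * B + of_real 1 \<cdot>\<^sub>m (outer p u y + outer p y u)) *v v = B *v (W *v (B *v v))
   + ((of_real e * inn p v (B *v (W *v u)) + of_real (e\<^sup>2 * t / 2) * inn p v u) \<cdot>\<^sub>v u + inn p v u \<cdot>\<^sub>v y)" .
  show "B' * W * B' *v v = (B * W * B + of_real 1 \<cdot>\<^sub>m (outer p u y + outer p y u)) *v v"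
   unfolding L R
  proof (rule eq_vecI)
   fix i assume "i < dim_vec (B *v (W *v (B *v v)) + ((of_real e * inn p v (B *v (W *v u)) + of_real (e\<^sup>2 * t / 2) * inn p v u) \<cdot>\<^sub>v u + inn p v u \<cdot>\<^sub>v y))"
   then have i: "i < p" using yc by simp
   define b where "b = B *v (W *v u)"
   define d where "d = B *v (W *v (B *v v))"
   have dims: "dim_vec b = p" "dim_vec u = p" "dim_vec d = p" "dim_vec y = p" using BWu u Bv(3) yc by (auto simp: b_def d_def simp del: dim_mult_mat_vec)
   have yi: "y $ i = of_real e * b $ i + of_real (e\<^sup>2 * t / 2) * u $ i"
    unfolding y_def b_def[symmetric] using i dims by simp
   show "(B *v (W *v (B *v v)) + ?a \<cdot>\<^sub>v (B *v (W *v u)) + (of_real e * (inn p v (B *v (W *v u)) + ?a * of_real t)) \<cdot>\<^sub>v u) $ i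
    = (B *v (W *v (B *v v)) + ((of_real e * inn p v (B *v (W *v u)) + of_real (e\<^sup>2 * t / 2) * inn p v u) \<cdot>\<^sub>v u + inn p v u \<cdot>\<^sub>v y)) $ i"
    unfolding b_def[symmetric] d_def[symmetric] using i dims yi by (simp add: power2_eq_square algebra_simps)
  qed (use yc u in auto)
 qed
qed

lemma spec_update:
 assumes U: "U \<in> carrier_mat p p" and k: "k < p"
 shows "spec p U (f(k := a)) = spec p U f + (a - f k) \<cdot>\<^sub>m outer p (col U k) (col U k)"
proof (rule eq_matI)
 fix i j assume "i < dim_row (spec p U f + (a - f k) \<cdot>\<^sub>m outer p (col U k) (col U k))" "j < dim_col (spec p U f + (a - f k) \<cdot>\<^sub>m outer p (col U k) (col U k))"
 then have ij: "i < p" "j < p" by (simp_all add: outer_def)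
 have "(\<Sum>m<p. U $$ (i, m) * (f(k := a)) m * cnj (U $$ (j, m)))
  = (\<Sum>m<p. U $$ (i, m) * f m * cnj (U $$ (j, m)) + (if m = k then (a - f k) * (U $$ (i, k) * cnj (U $$ (j, k))) else 0))"
  by (rule sum.cong) (auto simp: algebra_simps)
 also have "... = (\<Sum>m<p. U $$ (i, m) * f m * cnj (U $$ (j, m))) + (a - f k) * (U $$ (i, k) * cnj (U $$ (j, k)))"
  unfolding sum.distrib using k by (simp only: sum.delta finite_lessThan lessThan_iff if_True)
 finally show "spec p U (f(k := a)) $$ (i, j) = (spec p U f + (a - f k) \<cdot>\<^sub>m outer p (col U k) (col U k)) $$ (i, j)"
  using ij k U by (simp add: spec_index[OF U] outer_index outer_def[of p "col U k"] )
qed (simp_all add: carrier_matD[OF spec_carrier[OF U]] outer_def)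

lemma spec_real_herm:
 assumes "U \<in> carrier_mat p p" shows "herm p (rspec p U f)"
 by unfold_locales (use assms in \<open>auto simp: spec_adjoint\<close>)

text \<open>The eigenvalues are exchanged one at a time. Each exchange changes B by rank one and S
  by rank two, at a cost of 2 / Im z however far the eigenvalue moves; only the number of exchanges
  counts.\<close>

lemma trace_resolvent_cap:
 fixes f f' :: "nat => real"
 assumes U: "U \<in> carrier_mat p p" and z: "0 < Im z"
 shows "cmod (mat_trace (resolvent p (Smat p n (rspec p U f) w) z)
   - mat_trace (resolvent p (Smat p n (rspec p U f') w) z)) \<le> 2 * real (card {i. i < p \<and> f i \<noteq> f' i}) / Im z"
proof -
 let ?t = "\<lambda>g. mat_trace (resolvent p (Smat p n (rspec p U g) w) z)"
 define h where "h k i = (if i < k then f' i else f i)" for k i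
 have h0: "h 0 = f" by (auto simp: h_def)
 have hp: "?t (h p) = ?t f'"
  by (rule arg_cong[of _ _ "\<lambda>B. mat_trace (resolvent p (Smat p n B w) z)"], rule spec_cong[OF U]) (simp add: h_def)
 have step: "cmod (?t (h k) - ?t (h (Suc k))) \<le> (if f k \<noteq> f' k then 2 / Im z else 0)" if k: "k < p" for k
 proof (cases "f k = f' k")
  case True
  then have hk: "h (Suc k) = h k" by (auto simp: h_def less_Suc_eq)
  then show ?thesis using True by simp
 next
  case False
  let ?B = "rspec p U (h k)" and ?B' = "rspec p U (h (Suc k))" and ?W = "Smat p n (1\<^sub>m p) w" and ?u = "col U k"
  note HB = spec_real_herm[OF U, of "h k"] and HB' = spec_real_herm[OF U, of "h (Suc k)"]
  have u: "?u \<in> carrier_vec p" using U by (intro carrier_vecI) simp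
  have eq: "(\<lambda>i. complex_of_real (h (Suc k) i)) = (\<lambda>i. complex_of_real (h k i))(k := complex_of_real (f' k))"
  proof
   fix i show "complex_of_real (h (Suc k) i) = ((\<lambda>i. complex_of_real (h k i))(k := complex_of_real (f' k))) i"
    by (cases "i = k") (auto simp: h_def)
  qed
  have "?B' = ?B + (complex_of_real (f' k) - complex_of_real (h k k)) \<cdot>\<^sub>m outer p ?u ?u"
   unfolding eq by (rule spec_update[OF U k])
  then have B': "?B' = ?B + of_real (f' k - h k k) \<cdot>\<^sub>m outer p ?u ?u" by (simp only: of_real_diff)
  obtain y where y: "y \<in> carrier_vec p" "?B' * ?W * ?B' = ?B * ?W * ?B + of_real 1 \<cdot>\<^sub>m (outer p ?u y + outer p y ?u)"
   using conjugate_rank_one_update[OF Smat_herm HB u B'] by blast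
  have S: "Smat p n ?B' w = Smat p n ?B w + of_real 1 \<cdot>\<^sub>m (outer p ?u y + outer p y ?u)"
   unfolding Smat_factor[OF herm.S[OF HB] herm.herm[OF HB], of n w] Smat_factor[OF herm.S[OF HB'] herm.herm[OF HB'], of n w] by (rule y(2))
  have one: "1\<^sub>m p * resolvent p (Smat p n B w) z = resolvent p (Smat p n B w) z" for B
   by (rule left_mult_one_mat[OF herm.resolvent(1)[OF Smat_herm]]) (use z in simp)
  show ?thesis using herm.trace_rank_two[OF Smat_herm z u y(1) opb_one, of n ?B w 1] False unfolding S[symmetric] one
   by (simp add: norm_minus_commute)
 qed
 have "cmod (?t f - ?t f') \<le> (\<Sum>k<p. cmod (?t (h k) - ?t (h (Suc k))))"
 proof -
  have "?t f - ?t f' = (\<Sum>k<p. ?t (h k) - ?t (h (Suc k)))" unfolding h0[symmetric] hp[symmetric] by (rule sum_lessThan_telescope'[symmetric])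
  then show ?thesis using norm_sum[of "\<lambda>k. ?t (h k) - ?t (h (Suc k))" "{..<p}"] by simp
 qed
 also have "... \<le> (\<Sum>k<p. if f k \<noteq> f' k then 2 / Im z else 0)" by (rule sum_mono) (use step in auto)
 also have "... = (\<Sum>k\<in>{i. i < p \<and> f i \<noteq> f' i}. 2 / Im z)"
  by (subst sum.inter_filter[symmetric]) (auto intro!: sum.cong)
 finally show ?thesis by (simp add: mult.commute)
qed

text \<open>The norm bound by the sum of all eigenvalues is crude. It serves results whose
  conclusions do not contain the norm of B.\<close>

lemma matrix_model_spec:
 assumes cm: "column_model p n \<mu> K" and U: "unitary p U" and l: "\<And>i. i < p ==> 0 \<le> l i" and z: "0 < Im z"
 shows "matrix_model p n \<mu> K (rspec p U (\<lambda>i. sqrt (l i))) z (sqrt (\<Sum>i<p. l i)) (real p / real n)"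
proof (rule matrix_model.intro[OF cm], unfold_locales)
 show "opb p (rspec p U (\<lambda>i. sqrt (l i))) (sqrt (\<Sum>i<p. l i))"
  by (rule spec_opb[OF U]) (use l in \<open>auto intro!: sum_nonneg member_le_sum\<close>)
 show "mat_adjoint (rspec p U (\<lambda>i. sqrt (l i))) = rspec p U (\<lambda>i. sqrt (l i))"
  by (rule herm.herm[OF spec_real_herm[OF unitaryD(1)[OF U]]])
 show "real p \<le> real p / real n * real n" using cm by (simp add: column_model_def)
qed (rule z)

text \<open>The number of capped eigenvalues is the integral of the indicator of x > \<tau>. A
  continuous majorant of that indicator is used, so that the bound passes to the limit under weak
  convergence.\<close>

lemma mean_trace_cap:
 assumes cm: "column_model p n \<mu> K" and U: "unitary p U" and l: "\<And>i. i < p ==> 0 \<le> l i" and z: "0 < Im z" and \<tau>: "0 \<le> \<tau>"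
 shows "cmod (mean_trace p n \<mu> (rspec p U (\<lambda>i. sqrt (l i))) z
   - mean_trace p n \<mu> (rspec p U (\<lambda>i. sqrt (min (l i) \<tau>))) z)
  \<le> 2 / Im z * (LINT x|empirical p l. min 1 (max 0 (x - \<tau> + 1)))"
proof -
 have p: "0 < p" using cm by (simp add: column_model_def)
 let ?B = "\<lambda>l. rspec p U (\<lambda>i. sqrt (l i))"
 let ?P = "column_space p n \<mu>"
 let ?X = "\<lambda>l w. mat_trace (resolvent p (Smat p n (?B l) w) z) / of_nat p"
 have P: "?P = PiM {..<n} (column_model.\<nu> p \<mu>)" using column_model.\<nu>_def[OF cm] by presburger
 interpret P: prob_space ?P unfolding P by (rule product_prob_spaces.prob_PiM[OF product_prob_spaces.intro[OF column_model.prob_\<nu>[OF cm]]])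
 have i: "integrable ?P (?X l')" if l': "\<And>i. i < p ==> 0 \<le> l' i" for l'
 proof -
  note M = matrix_model_spec[where l = l', OF cm U l' z]
  have "1\<^sub>m p * matrix_model.Q p n (?B l') z w = resolvent p (Smat p n (?B l') w) z" for w
   using left_mult_one_mat[OF matrix_model.Qc[OF M]] by (simp add: matrix_model.Q_def[OF M])
  then show ?thesis using matrix_model.integrable_trace_resolvent[OF M opb_one] unfolding P by simp
 qed
 let ?l = "\<lambda>i. min (l i) \<tau>"
 let ?f = "\<lambda>x :: real. min 1 (max 0 (x - \<tau> + 1))"
 have i1: "integrable ?P (?X l)" "integrable ?P (?X ?l)" using i[of l] i[of ?l] l \<tau> by auto
 have b: "cmod (?X l w - ?X ?l w) \<le> 2 / Im z * (LINT x|empirical p l. ?f x)" for w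
 proof -
  let ?C = "{i. i < p \<and> sqrt (l i) \<noteq> sqrt (?l i)}"
  have "real (card ?C) = (\<Sum>i\<in>?C. 1)" by simp
  also have "... \<le> (\<Sum>i\<in>?C. ?f (l i))" by (rule sum_mono) auto
  also have "... \<le> (\<Sum>i<p. ?f (l i))" by (rule sum_mono2) auto
  finally have C: "real (card ?C) / real p \<le> (LINT x|empirical p l. ?f x)"
   unfolding integral_empirical[OF p, of ?f, simplified] using p by (simp add: field_simps)
  have "cmod (?X l w - ?X ?l w) = cmod (mat_trace (resolvent p (Smat p n (?B l) w) z) - mat_trace (resolvent p (Smat p n (?B ?l) w) z)) / real p"
   by (simp add: diff_divide_distrib[symmetric] norm_divide)
  also have "... \<le> (2 * real (card ?C) / Im z) / real p" by (rule divide_right_mono[OF trace_resolvent_cap[OF unitaryD(1)[OF U] z]]) simp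
  also have "... = 2 / Im z * (real (card ?C) / real p)" by simp
  also have "... \<le> 2 / Im z * (LINT x|empirical p l. ?f x)" by (rule mult_left_mono[OF C]) (use z in simp)
  finally show ?thesis .
 qed
 have "mean_trace p n \<mu> (?B l) z - mean_trace p n \<mu> (?B ?l) z = (LINT w|?P. ?X l w - ?X ?l w)"
  unfolding mean_trace_def using i1 by (rule Bochner_Integration.integral_diff[symmetric])
 also have "cmod ... \<le> (LINT w|?P. 2 / Im z * (LINT x|empirical p l. ?f x))"
  by (rule order_trans[OF integral_norm_bound integral_mono]) (use i1 b in \<open>auto intro!: integrable_norm Bochner_Integration.integrable_diff\<close>)
 also have "... = 2 / Im z * (LINT x|empirical p l. ?f x)" using P.prob_space by simp
 finally show ?thesis .
qed

lemma empirical_cap: "empirical p (\<lambda>i. min (l i) \<tau>) = cap_distr \<tau> (empirical p l)"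
proof -
 have "l \<in> uniform_count_measure {..<p} \<rightarrow>\<^sub>M borel"
  by (auto simp: measurable_def space_uniform_count_measure sets_uniform_count_measure)
 then show ?thesis unfolding empirical_def cap_distr_def by (subst distr_distr) (auto simp: comp_def)
qed

lemma cap_distr_weak_conv_map:
 assumes Hs: "\<And>k. nonneg_distr (Hs k)" and H: "nonneg_distr H" and wc: "weak_conv_m Hs H" and \<tau>: "0 \<le> \<tau>"
 shows "weak_conv_m (\<lambda>k. cap_distr \<tau> (Hs k)) (cap_distr \<tau> H)"
proof (rule integral_bdd_continuous_conv_imp_weak_conv)
 show "real_distribution (cap_distr \<tau> (Hs k))" "real_distribution (cap_distr \<tau> H)" for k
  using nonneg_distrD(1)[OF cap_distr_nonneg_distr(1)] Hs H \<tau> by auto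
 fix f :: "real => real" assume f: "\<And>x. isCont f x" "\<And>x. \<bar>f x\<bar> \<le> 1"
 have mf[measurable]: "f \<in> borel_measurable borel" using f(1) by (intro borel_measurable_continuous_onI continuous_at_imp_continuous_on) auto
 have "(\<lambda>n. LINT x|Hs n. f (min x \<tau>)) \<longlonglongrightarrow> (LINT x|H. f (min x \<tau>))"
  by (rule weak_conv_integral_varying[OF Hs H wc, where B = 1]) (use f in \<open>auto intro!: isCont_tendsto_compose[OF f(1)] tendsto_intros\<close>)
 then show "(\<lambda>n. LINT x|cap_distr \<tau> (Hs n). f x) \<longlonglongrightarrow> (LINT x|cap_distr \<tau> H. f x)"
  unfolding integral_cap_distr[OF Hs mf] integral_cap_distr[OF H mf] .
qed

text \<open>Three errors are kept below e / 3: between the limits for H and for its capped version,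
  between mean traces with and without cap, and between the capped mean trace and its limit. The cap
  is fixed first, from H alone, before k grows.\<close>

theorem spectrum_limit:
 fixes p n :: "nat => nat" and \<mu> :: "nat => nat => nat \<times> nat => complex measure" and U :: "nat => complex mat" and l :: "nat => nat => real"
 assumes cm: "\<And>k. column_model (p k) (n k) (\<mu> k) K" and n: "filterlim n at_top sequentially"
  and c: "(\<lambda>k. real (p k) / real (n k)) \<longlonglongrightarrow> c" "0 < c"
  and U: "\<And>k. unitary (p k) (U k)" and l: "\<And>k i. i < p k ==> 0 \<le> l k i"
  and H: "nonneg_distr H" "H \<noteq> return borel 0" and wc: "weak_conv_m (\<lambda>k. empirical (p k) (l k)) H" and z: "0 < Im z"
 shows "(\<lambda>k. mean_trace (p k) (n k) (\<mu> k) (rspec (p k) (U k) (\<lambda>i. sqrt (l k i))) z) \<longlonglongrightarrow> s_lim c H z"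
proof (rule metric_LIMSEQ_I)
 fix e :: real assume e: "0 < e"
 have pn: "0 < p k" "0 < n k" for k using cm[of k] by (simp_all add: column_model_def)
 have Hk: "nonneg_distr (empirical (p k) (l k))" for k by (rule empirical_nonneg_distr[OF pn(1)]) (use l in auto)
 let ?cap = "\<lambda>j. cap_distr (real (Suc j)) H"
 let ?f = "\<lambda>j x. min 1 (max 0 (x - real (Suc j) + 1)) :: real"
 have capn: "nonneg_distr (?cap j)" "?cap j \<noteq> return borel 0" for j
  using cap_distr_nonneg_distr(1)[OF H(1), of "real (Suc j)"] cap_distr_nondegenerate[OF H, of "real (Suc j)"] by simp_all
 have I0: "0 < Im (of_real c * h_fun c H z)" using h_fun_solves[OF H c(2) z] c(2) by (simp add: solves_h_eq_alt)
 have hl: "(\<lambda>j. h_fun c (?cap j) z) \<longlonglongrightarrow> h_fun c H z"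
  by (rule h_fun_tendsto[OF capn H cap_distr_weak_conv[OF H(1)] c(2) tendsto_const z z])
 then have "(\<lambda>j. sig (of_real c * h_fun c (?cap j) z)) \<longlonglongrightarrow> sig (of_real c * h_fun c H z)"
  by (intro sig_tendsto nonreal_not_pm1[OF I0] tendsto_intros)
 then have s1: "(\<lambda>j. s_lim c (?cap j) z) \<longlonglongrightarrow> s_lim c H z" unfolding s_lim_def using hl z by (intro tendsto_intros) auto
 interpret H: real_distribution H by (rule nonneg_distrD(1)[OF H(1)])
 have mf: "?f j \<in> borel_measurable borel" for j by measurable
 have "(\<lambda>j. LINT x|H. ?f j x) \<longlonglongrightarrow> (LINT x|H. 0)"
 proof (rule integral_dominated_convergence[where w = "\<lambda>_. 1"])
  show "AE x in H. (\<lambda>j. ?f j x) \<longlonglongrightarrow> 0"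
  proof (rule AE_I2)
   fix x obtain N where "x \<le> real N" using real_arch_simple by blast
   then have "?f j x = 0" if "N \<le> j" for j using that by simp
   then show "(\<lambda>j. ?f j x) \<longlonglongrightarrow> 0" by (intro tendsto_eventually) (auto simp: eventually_sequentially simp del: of_nat_Suc)
  qed
 qed (use mf in auto)
 from tendsto_mult_left[OF this, of "2 / Im z"] have s2: "(\<lambda>j. 2 / Im z * (LINT x|H. ?f j x)) \<longlonglongrightarrow> 0"
  by (simp only: integral_zero mult_zero_right)
 have "eventually (\<lambda>j. dist (s_lim c (?cap j) z) (s_lim c H z) < e / 3 \<and> 2 / Im z * (LINT x|H. ?f j x) < e / 3) sequentially"
  using tendstoD[OF s1, of "e / 3"] order_tendstoD(2)[OF s2, of "e / 3"] e by (intro eventually_conj) auto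
 then obtain j where j: "dist (s_lim c (?cap j) z) (s_lim c H z) < e / 3" "2 / Im z * (LINT x|H. ?f j x) < e / 3"
  by (auto simp: eventually_sequentially)
 define \<tau> where "\<tau> = real (Suc j)"
 have \<tau>: "0 \<le> \<tau>" by (simp add: \<tau>_def)
 have f: "(\<lambda>k. 2 / Im z * (LINT x|empirical (p k) (l k). ?f j x)) \<longlonglongrightarrow> 2 / Im z * (LINT x|H. ?f j x)"
  by (intro tendsto_mult_left weak_conv_integral_varying[OF Hk H(1) wc mf mf, where B = 1]) (auto intro!: tendsto_intros)
 let ?m = "\<lambda>k l. mean_trace (p k) (n k) (\<mu> k) (rspec (p k) (U k) (\<lambda>i. sqrt (l i))) z"
 have "(\<lambda>k. ?m k (\<lambda>i. min (l k i) \<tau>)) \<longlonglongrightarrow> s_lim c (?cap j) z"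
 proof (rule bounded_spectrum_limit[where l = "\<lambda>k i. min (l k i) \<tau>" and \<tau> = \<tau>, OF cm n c U _ capn _ z])
  show "weak_conv_m (\<lambda>k. empirical (p k) (\<lambda>i. min (l k i) \<tau>)) (?cap j)"
   unfolding empirical_cap \<tau>_def[symmetric] by (rule cap_distr_weak_conv_map[OF Hk H(1) wc \<tau>])
 qed (use l \<tau> in auto)
 from tendstoD[OF this, of "e / 3"] e have E1: "eventually (\<lambda>k. dist (?m k (\<lambda>i. min (l k i) \<tau>)) (s_lim c (?cap j) z) < e / 3) sequentially"
  by simp
 from E1 order_tendstoD(2)[OF f j(2)] have "eventually (\<lambda>k. dist (?m k (l k)) (s_lim c H z) < e) sequentially"
 proof eventually_elim
  case (elim k)
  have "dist (?m k (l k)) (?m k (\<lambda>i. min (l k i) \<tau>)) \<le> 2 / Im z * (LINT x|empirical (p k) (l k). ?f j x)"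
   unfolding dist_norm using mean_trace_cap[where l = "l k", OF cm U l z \<tau>] by (simp add: \<tau>_def)
  then show ?case
   using elim j(1) dist_triangle[of "?m k (l k)" "s_lim c H z" "?m k (\<lambda>i. min (l k i) \<tau>)"]
    dist_triangle[of "?m k (\<lambda>i. min (l k i) \<tau>)" "s_lim c H z" "s_lim c (?cap j) z"] by linarith
 qed
 then show "\<exists>N. \<forall>k\<ge>N. dist (?m k (l k)) (s_lim c H z) < e" by (simp add: eventually_sequentially)
qed

section \<open>Almost sure convergence\<close>

text \<open>An intersection of events factorises first over the independent pair V, W and then
  within each of the two families.\<close>

lemma (in prob_space) indep_vars_join:
 assumes VW: "indep_var S V T W" and I: "finite I" "I \<noteq> {}"
  and f: "\<And>i. i \<in> I ==> f i \<in> S \<rightarrow>\<^sub>M N" "\<And>i. i \<in> I ==> g i \<in> T \<rightarrow>\<^sub>M N"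
  and ind: "indep_vars (\<lambda>_. N) (\<lambda>i \<omega>. f i (V \<omega>)) I" "indep_vars (\<lambda>_. N) (\<lambda>i \<omega>. g i (W \<omega>)) I"
 shows "indep_vars (\<lambda>_. N) (\<lambda>x \<omega>. if fst x = 0 then f (snd x) (V \<omega>) else g (snd x) (W \<omega>)) ({..<2::nat} \<times> I)"
proof -
 let ?K = "{..<2::nat} \<times> I" and ?X = "\<lambda>x \<omega>. if fst x = 0 then f (snd x) (V \<omega>) else g (snd x) (W \<omega>)"
 let ?F = "\<lambda>x. {?X x -` A \<inter> space M |A. A \<in> sets N}"
 have V: "random_variable S V" "random_variable T W" using VW unfolding indep_var_eq by auto
 have rv: "random_variable N (?X x)" if "x \<in> ?K" for x
  using measurable_compose[OF V(1) f(1)] measurable_compose[OF V(2) f(2)] that by auto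
 \<comment> \<open>Each family contains the whole space, so it is enough to factorise over the full
   finite index set.\<close>
 have "indep_sets ?F ?K"
 proof (subst indep_sets_finite)
  show "?F x \<subseteq> events" if "x \<in> ?K" for x using measurable_sets[OF rv[OF that]] by auto
  show "space M \<in> ?F x" if "x \<in> ?K" for x
  proof -
   have "?X x -` space N \<inter> space M = space M" using measurable_space[OF rv[OF that]] by auto
   then show ?thesis using sets.top[of N] by blast
  qed
  show "\<forall>A\<in>Pi ?K ?F. prob (\<Inter>x\<in>?K. A x) = (\<Prod>x\<in>?K. prob (A x))"
  proof
   fix A assume A: "A \<in> Pi ?K ?F"
   have "\<forall>x\<in>?K. \<exists>a. a \<in> sets N \<and> A x = ?X x -` a \<inter> space M"
   proof
    fix x assume "x \<in> ?K"
    from Pi_mem[OF A this] show "\<exists>a. a \<in> sets N \<and> A x = ?X x -` a \<inter> space M" by blast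
   qed
   then obtain a where a: "\<And>x. x \<in> ?K ==> a x \<in> sets N" "\<And>x. x \<in> ?K ==> A x = ?X x -` a x \<inter> space M" by metis
   have A0: "A (0, i) = (\<lambda>\<omega>. f i (V \<omega>)) -` a (0, i) \<inter> space M" "a (0, i) \<in> sets N" if "i \<in> I" for i using a[of "(0, i)"] that by auto
   have A1: "A (1, i) = (\<lambda>\<omega>. g i (W \<omega>)) -` a (1, i) \<inter> space M" "a (1, i) \<in> sets N" if "i \<in> I" for i using a[of "(1, i)"] that by auto
   define E0 where "E0 = (\<Inter>i\<in>I. f i -` a (0, i) \<inter> space S)"
   define E1 where "E1 = (\<Inter>i\<in>I. g i -` a (1, i) \<inter> space T)"
   have F0: "f i -` a (0, i) \<inter> space S \<in> sets S" if "i \<in> I" for i by (rule measurable_sets[OF f(1)[OF that] A0(2)[OF that]])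
   have F1: "g i -` a (1, i) \<inter> space T \<in> sets T" if "i \<in> I" for i by (rule measurable_sets[OF f(2)[OF that] A1(2)[OF that]])
   have E: "E0 \<in> sets S" "E1 \<in> sets T" unfolding E0_def E1_def by (rule sets.finite_INT[OF I F0] sets.finite_INT[OF I F1], assumption)+
   have "(\<Inter>i\<in>I. A (0, i)) = (\<Inter>i\<in>I. (\<lambda>\<omega>. f i (V \<omega>)) -` a (0, i) \<inter> space M)" by (rule INF_cong[OF refl A0(1)])
   also have "... = V -` E0 \<inter> space M" unfolding E0_def using I(2) measurable_space[OF V(1)] by auto
   finally have e0: "(\<Inter>i\<in>I. A (0, i)) = V -` E0 \<inter> space M" .
   have "(\<Inter>i\<in>I. A (1, i)) = (\<Inter>i\<in>I. (\<lambda>\<omega>. g i (W \<omega>)) -` a (1, i) \<inter> space M)" by (rule INF_cong[OF refl A1(1)])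
   also have "... = W -` E1 \<inter> space M" unfolding E1_def using I(2) measurable_space[OF V(2)] by auto
   finally have e1: "(\<Inter>i\<in>I. A (1, i)) = W -` E1 \<inter> space M" .
   have p0: "prob (\<Inter>i\<in>I. A (0, i)) = (\<Prod>i\<in>I. prob (A (0, i)))"
    using ind(1) I A0 unfolding indep_vars_def2 by (intro indep_setsD[where F = "\<lambda>i. {(\<lambda>\<omega>. f i (V \<omega>)) -` A \<inter> space M |A. A \<in> sets N}" and I = I]) auto
   have p1: "prob (\<Inter>i\<in>I. A (1, i)) = (\<Prod>i\<in>I. prob (A (1, i)))"
    using ind(2) I A1 unfolding indep_vars_def2 by (intro indep_setsD[where F = "\<lambda>i. {(\<lambda>\<omega>. g i (W \<omega>)) -` A \<inter> space M |A. A \<in> sets N}" and I = I]) auto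
   have two: "{..<2::nat} = {0, 1}" by auto
   have "(\<Inter>x\<in>?K. A x) = (\<Inter>i\<in>I. A (0, i)) \<inter> (\<Inter>i\<in>I. A (1, i))" unfolding two by auto
   also have "... = (\<lambda>x. (V x, W x)) -` (E0 \<times> E1) \<inter> space M" unfolding e0 e1 by auto
   finally have "prob (\<Inter>x\<in>?K. A x) = prob (V -` E0 \<inter> space M) * prob (W -` E1 \<inter> space M)"
    using indep_varD[OF VW E] by simp
   also have "... = (\<Prod>i\<in>I. prob (A (0, i))) * (\<Prod>i\<in>I. prob (A (1, i)))" using p0 p1 unfolding e0 e1 by simp
   also have "... = (\<Prod>x\<in>?K. prob (A x))"
   proof -
    have "(\<Prod>x\<in>?K. prob (A x)) = (\<Prod>k\<in>{..<2}. \<Prod>i\<in>I. prob (A (k, i)))" by (simp add: prod.cartesian_product case_prod_beta')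
    then show ?thesis unfolding two by simp
   qed
   finally show "prob (\<Inter>x\<in>?K. A x) = (\<Prod>x\<in>?K. prob (A x))" .
  qed
 qed (use I in \<open>auto simp: lessThan_empty_iff\<close>)
 then show ?thesis unfolding indep_vars_def2 using rv by blast
qed

lemma (in prob_space) indep_vars_reindex_inj:
 assumes ind: "indep_vars (\<lambda>_. N) X K" and h: "inj_on h L" "h ` L \<subseteq> K"
 shows "indep_vars (\<lambda>_. N) (\<lambda>x. X (h x)) L"
proof -
 have "indep_vars (\<lambda>x. PiM {h x} (\<lambda>_. N)) (\<lambda>x \<omega>. restrict (\<lambda>y. X y \<omega>) {h x}) L"
  by (rule indep_vars_restrict[OF ind]) (use h in \<open>auto simp: disjoint_family_on_def inj_on_def\<close>)
 from indep_vars_compose2[OF this, of "\<lambda>x f. f (h x)" "\<lambda>_. N"] show ?thesis by simp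
qed

text \<open>Grouping by the second index gives independent blocks, and independence inside each
  block splits its law again. The product of products is the form in which the column model is
  built.\<close>

lemma (in prob_space) indep_vars_blocks:
 assumes ind: "indep_vars (\<lambda>_. N) X (J \<times> L)" and J: "finite J" "J \<noteq> {}" "L \<noteq> {}"
 shows "distr M (PiM L (\<lambda>j. PiM J (\<lambda>_. N))) (\<lambda>\<omega>. \<lambda>j\<in>L. \<lambda>x\<in>J. X (x, j) \<omega>)
  = PiM L (\<lambda>j. PiM J (\<lambda>x. distr M N (X (x, j))))"
proof -
 have rv: "random_variable N (X (x, j))" if "x \<in> J" "j \<in> L" for x j using ind that unfolding indep_vars_def2 by auto
 have "indep_vars (\<lambda>j. PiM (J \<times> {j}) (\<lambda>_. N)) (\<lambda>j \<omega>. restrict (\<lambda>y. X y \<omega>) (J \<times> {j})) L"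
  by (rule indep_vars_restrict[OF ind]) (auto simp: disjoint_family_on_def)
 from indep_vars_compose2[OF this, of "\<lambda>j f. \<lambda>x\<in>J. f (x, j)" "\<lambda>_. PiM J (\<lambda>_. N)"]
 have "indep_vars (\<lambda>_. PiM J (\<lambda>_. N)) (\<lambda>j \<omega>. \<lambda>x\<in>J. restrict (\<lambda>y. X y \<omega>) (J \<times> {j}) (x, j)) L"
  by (auto intro!: measurable_restrict)
 also have "(\<lambda>j \<omega>. \<lambda>x\<in>J. restrict (\<lambda>y. X y \<omega>) (J \<times> {j}) (x, j)) = (\<lambda>j \<omega>. \<lambda>x\<in>J. X (x, j) \<omega>)" by (auto simp: fun_eq_iff)
 finally have B: "indep_vars (\<lambda>_. PiM J (\<lambda>_. N)) (\<lambda>j \<omega>. \<lambda>x\<in>J. X (x, j) \<omega>) L" .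
 have rB: "random_variable (PiM J (\<lambda>_. N)) (\<lambda>\<omega>. \<lambda>x\<in>J. X (x, j) \<omega>)" if "j \<in> L" for j
  by (rule measurable_restrict) (rule rv[OF _ that])
 have "distr M (PiM L (\<lambda>j. PiM J (\<lambda>_. N))) (\<lambda>\<omega>. \<lambda>j\<in>L. \<lambda>x\<in>J. X (x, j) \<omega>)
  = PiM L (\<lambda>j. distr M (PiM J (\<lambda>_. N)) (\<lambda>\<omega>. \<lambda>x\<in>J. X (x, j) \<omega>))"
  using B by (subst (asm) indep_vars_iff_distr_eq_PiM'[OF J(3) rB])
 also have "... = PiM L (\<lambda>j. PiM J (\<lambda>x. distr M N (X (x, j))))"
 proof (rule PiM_cong[OF refl])
  fix j assume j: "j \<in> L"
  have "indep_vars (\<lambda>_. N) (\<lambda>x. X (x, j)) J" by (rule indep_vars_reindex_inj[OF ind]) (use j in \<open>auto simp: inj_on_def\<close>)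
  then show "distr M (PiM J (\<lambda>_. N)) (\<lambda>\<omega>. \<lambda>x\<in>J. X (x, j) \<omega>) = PiM J (\<lambda>x. distr M N (X (x, j)))"
   by (subst (asm) indep_vars_iff_distr_eq_PiM'[OF J(2)]) (use rv j in auto)
 qed
 finally show ?thesis .
qed

text \<open>Fubini for an independent pair: the inner integral runs over an independent copy of Y,
  realised on the same space. This is how \<Sigma> can be frozen while the entries are
  averaged.\<close>

lemma (in prob_space) indep_pair_nn_integral:
 assumes ip: "indep_pair M S X T Y" and F: "F \<in> borel_measurable (S \<Otimes>\<^sub>M T)"
 shows "(\<integral>\<^sup>+\<omega>. F (X \<omega>, Y \<omega>) \<partial>M) = (\<integral>\<^sup>+\<omega>. (\<integral>\<^sup>+\<omega>'. F (X \<omega>, Y \<omega>') \<partial>M) \<partial>M)"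
proof -
 have X[measurable]: "X \<in> M \<rightarrow>\<^sub>M S" and Y[measurable]: "Y \<in> M \<rightarrow>\<^sub>M T"
  and ind: "indep_set {X -` A \<inter> space M | A. A \<in> sets S} {Y -` B \<inter> space M | B. B \<in> sets T}"
  using ip unfolding indep_pair_def by auto
 interpret A: prob_space "distr M S X" by (rule prob_space_distr[OF X])
 interpret B: prob_space "distr M T Y" by (rule prob_space_distr[OF Y])
 have XY: "(\<lambda>\<omega>. (X \<omega>, Y \<omega>)) \<in> M \<rightarrow>\<^sub>M S \<Otimes>\<^sub>M T" by measurable
 have "distr M S X \<Otimes>\<^sub>M distr M T Y = distr M (S \<Otimes>\<^sub>M T) (\<lambda>\<omega>. (X \<omega>, Y \<omega>))"
 proof (rule pair_measure_eqI)
  show "sets (distr M S X \<Otimes>\<^sub>M distr M T Y) = sets (distr M (S \<Otimes>\<^sub>M T) (\<lambda>\<omega>. (X \<omega>, Y \<omega>)))"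
   by (simp cong: sets_pair_measure_cong)
  fix a b assume "a \<in> sets (distr M S X)" "b \<in> sets (distr M T Y)"
  then have ab: "a \<in> sets S" "b \<in> sets T" by auto
  have "emeasure (distr M (S \<Otimes>\<^sub>M T) (\<lambda>\<omega>. (X \<omega>, Y \<omega>))) (a \<times> b) = emeasure M ((X -` a \<inter> space M) \<inter> (Y -` b \<inter> space M))"
   using ab by (subst emeasure_distr[OF XY]) (auto intro!: arg_cong[where f = "emeasure M"])
  also have "... = ennreal (prob (X -` a \<inter> space M) * prob (Y -` b \<inter> space M))"
   unfolding emeasure_eq_measure using indep_setD[OF ind, of "X -` a \<inter> space M" "Y -` b \<inter> space M"] ab by auto
  also have "... = emeasure (distr M S X) a * emeasure (distr M T Y) b"
   using ab by (simp add: emeasure_distr emeasure_eq_measure ennreal_mult)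
  finally show "emeasure (distr M S X) a * emeasure (distr M T Y) b = emeasure (distr M (S \<Otimes>\<^sub>M T) (\<lambda>\<omega>. (X \<omega>, Y \<omega>))) (a \<times> b)" by simp
 qed (unfold_locales)
 note D = this
 have F': "F \<in> borel_measurable (distr M S X \<Otimes>\<^sub>M distr M T Y)" unfolding D using F by simp
 have "(\<integral>\<^sup>+\<omega>. F (X \<omega>, Y \<omega>) \<partial>M) = (\<integral>\<^sup>+q. F q \<partial>(distr M S X \<Otimes>\<^sub>M distr M T Y))"
  unfolding D by (rule nn_integral_distr[OF XY, symmetric]) (use F in simp)
 also have "... = (\<integral>\<^sup>+x. \<integral>\<^sup>+y. F (x, y) \<partial>distr M T Y \<partial>distr M S X)" by (rule B.nn_integral_fst[OF F', symmetric])
 also have "... = (\<integral>\<^sup>+\<omega>. \<integral>\<^sup>+y. F (X \<omega>, y) \<partial>distr M T Y \<partial>M)"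
  by (rule nn_integral_distr[OF X]) (use B.borel_measurable_nn_integral_fst[OF F'] in simp)
 also have "... = (\<integral>\<^sup>+\<omega>. (\<integral>\<^sup>+\<omega>'. F (X \<omega>, Y \<omega>') \<partial>M) \<partial>M)"
 proof (rule nn_integral_cong)
  fix \<omega> assume "\<omega> \<in> space M"
  then have "X \<omega> \<in> space S" using measurable_space[OF X] by auto
  then have "(\<lambda>y. F (X \<omega>, y)) \<in> borel_measurable T" using F by measurable
  then show "(\<integral>\<^sup>+y. F (X \<omega>, y) \<partial>distr M T Y) = (\<integral>\<^sup>+\<omega>'. F (X \<omega>, Y \<omega>') \<partial>M)" by (intro nn_integral_distr[OF Y]) simp
 qed
 finally show ?thesis .
qed

text \<open>By monotone convergence the series of the X k is finite almost everywhere, so its terms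
  tend to 0.\<close>

lemma (in prob_space) AE_tendsto_zero_of_summable:
 fixes X :: "nat => 'a => real"
 assumes X: "\<And>k. X k \<in> borel_measurable M" "\<And>k \<omega>. 0 \<le> X k \<omega>"
  and le: "\<And>k. (\<integral>\<^sup>+\<omega>. ennreal (X k \<omega>) \<partial>M) \<le> ennreal (b k)" and b: "summable b" "\<And>k. 0 \<le> b k"
 shows "AE \<omega> in M. (\<lambda>k. X k \<omega>) \<longlonglongrightarrow> 0"
proof -
 have m: "(\<lambda>\<omega>. ennreal (X k \<omega>)) \<in> borel_measurable M" for k using X(1) by measurable
 have "(\<integral>\<^sup>+\<omega>. (\<Sum>k. ennreal (X k \<omega>)) \<partial>M) = (\<Sum>k. \<integral>\<^sup>+\<omega>. ennreal (X k \<omega>) \<partial>M)" by (rule nn_integral_suminf[OF m])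
 also have "... \<le> (\<Sum>k. ennreal (b k))" by (rule suminf_le[OF le]) auto
 also have "... < \<infinity>" using suminf_ennreal2[OF b(2,1)] by simp
 finally have "(\<integral>\<^sup>+\<omega>. (\<Sum>k. ennreal (X k \<omega>)) \<partial>M) \<noteq> \<infinity>" by simp
 with nn_integral_noteq_infinite[OF borel_measurable_suminf_order[OF m]] have "AE \<omega> in M. (\<Sum>k. ennreal (X k \<omega>)) \<noteq> \<infinity>" by simp
 then show ?thesis
 proof (rule AE_mp, intro AE_I2 impI)
  fix \<omega> assume "(\<Sum>k. ennreal (X k \<omega>)) \<noteq> \<infinity>"
  then have "summable (\<lambda>k. X k \<omega>)" using summable_suminf_not_top[of "\<lambda>k. X k \<omega>"] X(2) by simp
  then show "(\<lambda>k. X k \<omega>) \<longlonglongrightarrow> 0" by (rule summable_LIMSEQ_zero)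
 qed
qed

text \<open>Replacing one column moves tr Q / p by at most \<delta> = 4 / (Im z p), and 16 n^2
  \<delta>^4 contains 16 * 256 = 4096. For p of order n the bound has order n^-2 and is summable;
  the second moment would give only order n^-1.\<close>

lemma (in matrix_model) trace_fourth_moment:
 "(\<integral>\<^sup>+w. ennreal ((cmod (mat_trace (Q w) / of_nat p - mean_trace p n \<mu> B z)) ^ 4) \<partial>P) \<le> ennreal (4096 * (real n)\<^sup>2 / (Im z * real p) ^ 4)"
proof -
 let ?t = "\<lambda>w. mat_trace (Q w) / of_nat p" and ?m = "mean_trace p n \<mu> B z" and ?\<delta> = "4 / (Im z * real p)"
 have Q1: "1\<^sub>m p * Q w = Q w" for w by (rule left_mult_one_mat[OF Qc])
 have i0: "integrable P (\<lambda>w. mat_trace (Q w))" using integrable_trace_resolvent[OF opb_one] unfolding Q1 .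
 then have mt: "?t \<in> borel_measurable P" using borel_measurable_integrable by measurable
 have b: "cmod (?t w) \<le> 1 / Im z" for w using opb_trace[OF Qop, of w] p z by (simp add: norm_divide field_simps)
 have d: "cmod (?t w - ?t (w(j := y))) \<le> ?\<delta>" if "j < n" for w j y
 proof -
  have "cmod (?t w - ?t (w(j := y))) = cmod (mat_trace (1\<^sub>m p * Q w) - mat_trace (1\<^sub>m p * Q (w(j := y)))) / real p"
   unfolding Q1 by (simp add: diff_divide_distrib[symmetric] norm_divide)
  also have "... \<le> (4 * 1 / Im z) / real p"
   unfolding Q_def by (rule divide_right_mono[OF trace_resolvent_update_any[OF Bc that z opb_one]]) simp
  finally show ?thesis by simp
 qed
 note V = cols.complex_bounded_differences_moments[OF mt b d, folded mean_trace_eq]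
 have "16 * ((real n)\<^sup>2 * ?\<delta> ^ 4) = 4096 * (real n)\<^sup>2 / (Im z * real p) ^ 4" by (simp add: power_divide)
 then show ?thesis using V(4) nn_integral_eq_integral[OF V(2)[of 4]] by (simp add: ennreal_leI)
qed

definition ent :: "complex mat \<times> complex mat => nat => nat \<times> nat => complex" where
 "ent y j x = (if fst x = 0 then fst y else snd y) $$ (snd x, j)"

text \<open>Restriction to the index sets turns the array read off by \<open>ent\<close> into an
  extensional function, as elements of the product space are.\<close>

abbreviation columns :: "nat => nat => ('a => complex mat) => ('a => complex mat) => 'a => nat => nat \<times> nat => complex" where
 "columns p n Z1 Z2 \<equiv> \<lambda>\<omega>. \<lambda>j\<in>{..<n}. \<lambda>x\<in>idx p. ent (Z1 \<omega>, Z2 \<omega>) j x"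

lemma Smat_cong:
 assumes "\<And>j x. j < n ==> x \<in> idx p ==> w j x = w' j x" shows "Smat p n B w = Smat p n B w'"
proof -
 have "colv p (w j) k = colv p (w' j) k" if "j < n" "k < 2" for j k
  by (rule eq_vecI) (use assms that in \<open>auto simp: colv_def\<close>)
 then show ?thesis unfolding Smat_def by (intro cong_mat refl) (auto intro!: sum.cong arg_cong2[where f = "(/)"])
qed

lemma mat_borel_space: "space (mat_borel r c) = carrier_mat r c"
 by (simp add: mat_borel_def)

lemma mat_borel_entry_measurable: "i < r ==> j < c ==> (\<lambda>A. A $$ (i, j)) \<in> borel_measurable (mat_borel r c)"
proof -
 assume ij: "i < r" "j < c"
 have "(\<lambda>A. \<lambda>ij\<in>{..<r} \<times> {..<c}. A $$ ij) \<in> mat_borel r c \<rightarrow>\<^sub>M (\<Pi>\<^sub>M ij\<in>{..<r} \<times> {..<c}. (borel :: complex measure))"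
  unfolding mat_borel_def by (rule measurable_vimage_algebra1) (auto simp: space_PiM)
 from measurable_compose[OF this measurable_component_singleton[of "(i, j)"]] ij show ?thesis by simp
qed

text \<open>X contains the square root of \<Sigma> and is not visibly measurable. X' is a measurable
  function that agrees with it on the space, built from W \<Sigma> in place of B W B. Independence
  freezes \<Sigma>, and the moment bound holds uniformly over all frozen psd matrices.\<close>

lemma (in prob_space) trace_deviation:
 fixes p n :: nat and \<Sigma> Z1 Z2 :: "'a => complex mat"
 assumes cm: "column_model p n \<mu> K" and z: "0 < Im z"
  and ip: "indep_pair M (mat_borel p p) \<Sigma> (mat_borel p n \<Otimes>\<^sub>M mat_borel p n) (\<lambda>\<omega>. (Z1 \<omega>, Z2 \<omega>))"
  and psd: "\<And>\<omega>. \<omega> \<in> space M ==> psd p (\<Sigma> \<omega>)"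
  and law: "distr M (column_space p n \<mu>) (columns p n Z1 Z2)
   = column_space p n \<mu>"
 defines "X \<equiv> \<lambda>\<omega>. (cmod (mat_trace (resolvent p (Smat p n (psd_sqrt (\<Sigma> \<omega>)) (ent (Z1 \<omega>, Z2 \<omega>))) z) / of_nat p - mean_trace p n \<mu> (psd_sqrt (\<Sigma> \<omega>)) z)) ^ 4"
 shows "\<exists>X'. X' \<in> borel_measurable M \<and> (\<forall>\<omega>. 0 \<le> X' \<omega>) \<and> (\<forall>\<omega>\<in>space M. X' \<omega> = X \<omega>) \<and> (\<integral>\<^sup>+\<omega>. ennreal (X' \<omega>) \<partial>M) \<le> ennreal (4096 * (real n)\<^sup>2 / (Im z * real p) ^ 4)"
proof -
 let ?J = "{..<2::nat} \<times> {..<p}"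
 let ?P = "PiM {..<n} (\<lambda>j. PiM ?J (\<mu> j))"
 let ?MZ = "mat_borel p n \<Otimes>\<^sub>M mat_borel p n"
 let ?Y = "\<lambda>\<omega>. (Z1 \<omega>, Z2 \<omega>)"
 let ?w = "\<lambda>\<omega>. \<lambda>j\<in>{..<n}. \<lambda>x\<in>?J. ent (?Y \<omega>) j x"
 \<comment> \<open>Forces the dimensions. The measurability lemmas ask for matrices of the right
   size at every argument, also outside the carrier.\<close>
 define nm where "nm A = mat p p (\<lambda>ij. A $$ ij)" for A :: "complex mat"
 have nmc: "nm A \<in> carrier_mat p p" for A by (simp add: nm_def)
 have nm: "nm A = A" if "A \<in> carrier_mat p p" for A using that unfolding nm_def by (intro eq_matI) auto
 define t where "t A y = mat_trace (minv (shift p (Smat p n (1\<^sub>m p) (ent y) * nm A) z)) / of_nat p" for A y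
 have n: "0 < n" and p: "0 < p" using cm by (simp_all add: column_model_def)
 have ent_meas: "(\<lambda>q. ent (f q) j x) \<in> borel_measurable N" if "f \<in> N \<rightarrow>\<^sub>M ?MZ" "j < n" "x \<in> ?J" for f and N :: "'d measure" and j x
 proof -
  have x: "snd x < p" using that(3) by auto
  have "(\<lambda>q. fst (f q) $$ (snd x, j)) \<in> borel_measurable N" "(\<lambda>q. snd (f q) $$ (snd x, j)) \<in> borel_measurable N"
   using measurable_compose[OF measurable_compose[OF that(1) measurable_fst] mat_borel_entry_measurable[OF x that(2)]]
    measurable_compose[OF measurable_compose[OF that(1) measurable_snd] mat_borel_entry_measurable[OF x that(2)]] by auto
  then show ?thesis unfolding ent_def by (cases "fst x = 0") auto
 qed
 have tm: "(\<lambda>(A, y). t A y) \<in> borel_measurable (mat_borel p p \<Otimes>\<^sub>M ?MZ)"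
 proof -
  let ?N = "mat_borel p p \<Otimes>\<^sub>M ?MZ"
  have S: "(\<lambda>q. Smat p n (1\<^sub>m p) (ent (snd q)) $$ (a, b)) \<in> borel_measurable ?N" if "a < p" "b < p" for a b
   by (rule column_model.measurable_Smat_gen[OF cm one_carrier_mat ent_meas[OF measurable_snd] that])
  have A: "(\<lambda>q. nm (fst q) $$ (a, b)) \<in> borel_measurable ?N" if "a < p" "b < p" for a b
   using measurable_compose[OF measurable_fst mat_borel_entry_measurable[OF that]] that by (simp add: nm_def)
  have SA: "(\<lambda>q. (Smat p n (1\<^sub>m p) (ent (snd q)) * nm (fst q)) $$ (a, b)) \<in> borel_measurable ?N" if "a < p" "b < p" for a b
   by (rule measurable_mult_mat[OF Smat_carrier nmc S A that])
  have c: "Smat p n (1\<^sub>m p) (ent (snd q)) * nm (fst q) \<in> carrier_mat p p" for q by (rule mult_carrier_mat[OF Smat_carrier nmc])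
  have c2: "minv (shift p (Smat p n (1\<^sub>m p) (ent (snd q)) * nm (fst q)) z) \<in> carrier_mat p p" for q
   using c[of q] by (simp add: minv_def shift_def adj_mat_def)
  have "(\<lambda>q. t (fst q) (snd q)) \<in> borel_measurable ?N" unfolding t_def
   by (intro borel_measurable_divide borel_measurable_const measurable_mat_trace[OF c2] measurable_minv[OF shift_carrier[OF c]] measurable_shift[OF c SA])
  then show ?thesis by (simp add: case_prod_beta')
 qed
 have \<Sigma>m: "\<Sigma> \<in> M \<rightarrow>\<^sub>M mat_borel p p" and Ym: "?Y \<in> M \<rightarrow>\<^sub>M ?MZ" using ip unfolding indep_pair_def by auto
 define T where "T = distr M ?MZ ?Y"
 interpret T: prob_space T unfolding T_def by (rule prob_space_distr[OF Ym])
 have sT: "sets (mat_borel p p \<Otimes>\<^sub>M T) = sets (mat_borel p p \<Otimes>\<^sub>M ?MZ)" by (simp add: T_def cong: sets_pair_measure_cong)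
 define gg where "gg A = (LINT y|T. t A y)" for A
 have ggm: "gg \<in> borel_measurable (mat_borel p p)" unfolding gg_def
  by (rule T.borel_measurable_lebesgue_integral) (unfold measurable_cong_sets[OF sT refl], rule tm)
 define F where "F = (\<lambda>(A, y). (cmod (t A y - gg A)) ^ 4)"
 have Fm: "F \<in> borel_measurable (mat_borel p p \<Otimes>\<^sub>M ?MZ)"
 proof -
  have "(\<lambda>q. gg (fst q)) \<in> borel_measurable (mat_borel p p \<Otimes>\<^sub>M ?MZ)" by (rule measurable_compose[OF measurable_fst ggm])
  moreover have "(\<lambda>q. t (fst q) (snd q)) \<in> borel_measurable (mat_borel p p \<Otimes>\<^sub>M ?MZ)" using tm by (simp add: case_prod_beta')
  ultimately show ?thesis unfolding F_def case_prod_beta' by measurable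
 qed
 have wm: "?w \<in> M \<rightarrow>\<^sub>M ?P"
 proof (rule measurable_restrict)
  fix j assume j: "j \<in> {..<n}"
  show "(\<lambda>\<omega>. \<lambda>x\<in>?J. ent (?Y \<omega>) j x) \<in> M \<rightarrow>\<^sub>M PiM ?J (\<mu> j)"
  proof (rule measurable_restrict)
   fix x assume x: "x \<in> ?J"
   have "(\<lambda>\<omega>. ent (?Y \<omega>) j x) \<in> borel_measurable M" by (rule ent_meas[OF Ym]) (use j x in auto)
   then show "(\<lambda>\<omega>. ent (?Y \<omega>) j x) \<in> M \<rightarrow>\<^sub>M \<mu> j x"
    using measurable_cong_sets[OF refl entry_space.sets[OF column_model.entries[OF cm]]] by blast
  qed
 qed
 have key: "t A (?Y \<omega>') = mat_trace (resolvent p (Smat p n (psd_sqrt A) (?w \<omega>')) z) / of_nat p"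
  "mat_trace (resolvent p (Smat p n (psd_sqrt A) (ent (?Y \<omega>'))) z) / of_nat p = mat_trace (resolvent p (Smat p n (psd_sqrt A) (?w \<omega>')) z) / of_nat p"
  "gg A = mean_trace p n \<mu> (psd_sqrt A) z"
  "(\<integral>\<^sup>+\<omega>'. ennreal (F (A, ?Y \<omega>')) \<partial>M) \<le> ennreal (4096 * (real n)\<^sup>2 / (Im z * real p) ^ 4)"
  if A: "psd p A" for A \<omega>'
 proof -
  obtain U l where U: "unitary p U" and l: "\<And>i. i < p ==> 0 \<le> l i" and Ae: "A = rspec p U l"
   using psd_spectral[OF A] by blast
  let ?B = "psd_sqrt A"
  have Be: "?B = rspec p U (\<lambda>i. sqrt (l i))" unfolding Ae by (rule psd_sqrt_spec[OF U l])
  note Uc = unitaryD(1)[OF U]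
  have HB: "herm p ?B" unfolding Be by (rule spec_real_herm[OF Uc])
  note Bc = herm.S[OF HB] and Bh = herm.herm[OF HB]
  have "?B * ?B = spec p U (\<lambda>i. complex_of_real (sqrt (l i)) * complex_of_real (sqrt (l i)))" unfolding Be by (rule spec_mult[OF U])
  also have "... = rspec p U l"
   by (rule spec_cong[OF Uc]) (use l in \<open>simp add: of_real_mult[symmetric] del: of_real_mult\<close>)
  finally have BB: "?B * ?B = A" unfolding Ae[symmetric] .
  have Ac: "A \<in> carrier_mat p p" unfolding Ae by (rule spec_carrier[OF Uc])
  have M: "matrix_model p n \<mu> K ?B z (sqrt (\<Sum>i<p. l i)) (real p / real n)" unfolding Be by (rule matrix_model_spec[OF cm U l z])
  let ?G = "\<lambda>w. mat_trace (resolvent p (Smat p n ?B w) z) / of_nat p"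
  have c: "?G (ent (?Y \<omega>')) = ?G (?w \<omega>')" for \<omega>'
   by (rule arg_cong[of _ _ "\<lambda>S. mat_trace (resolvent p S z) / of_nat p"], rule Smat_cong) auto
  show "?G (ent (?Y \<omega>')) = ?G (?w \<omega>')" by (rule c)
  have tG: "t A (?Y \<omega>') = ?G (?w \<omega>')" for \<omega>'
  proof -
   let ?W = "Smat p n (1\<^sub>m p) (ent (?Y \<omega>'))"
   have "herm p (?B * ?W * ?B)" using Smat_herm[of p n ?B "ent (?Y \<omega>')"] unfolding Smat_factor[OF Bc Bh] .
   from trace_resolvent_similar[OF Smat_carrier Bc this, of z] z
   have "mat_trace (resolvent p (Smat p n ?B (ent (?Y \<omega>'))) z) = mat_trace (minv (shift p (?W * A) z))"
    unfolding Smat_factor[OF Bc Bh, of n "ent (?Y \<omega>')"] BB by simp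
   then show ?thesis unfolding c[symmetric] t_def nm[OF Ac] by simp
  qed
  show "t A (?Y \<omega>') = ?G (?w \<omega>')" by (rule tG)
  have P: "?P = PiM {..<n} (column_model.\<nu> p \<mu>)" using column_model.\<nu>_def[OF cm] by presburger
  have "1\<^sub>m p * matrix_model.Q p n ?B z w = resolvent p (Smat p n ?B w) z" for w
   using left_mult_one_mat[OF matrix_model.Qc[OF M]] by (simp add: matrix_model.Q_def[OF M])
  then have iG: "integrable ?P ?G" using matrix_model.integrable_trace_resolvent[OF M opb_one] unfolding P by simp
  then have Gm: "?G \<in> borel_measurable ?P" by (rule borel_measurable_integrable)
  have tmA: "t A \<in> borel_measurable ?MZ"
  proof -
   have "A \<in> space (mat_borel p p)" using Ac by (simp add: mat_borel_space)
   from measurable_compose[OF measurable_Pair1'[OF this] tm] show ?thesis by simp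
  qed
  have "gg A = (LINT \<omega>'|M. t A (?Y \<omega>'))" unfolding gg_def T_def by (rule integral_distr[OF Ym tmA])
  also have "... = (LINT \<omega>'|M. ?G (?w \<omega>'))" by (simp only: tG)
  also have "... = (LINT w|distr M ?P ?w. ?G w)" by (rule integral_distr[OF wm Gm, symmetric])
  also have "... = mean_trace p n \<mu> ?B z" unfolding law mean_trace_def ..
  finally show g: "gg A = mean_trace p n \<mu> ?B z" .
  let ?H = "\<lambda>w. ennreal ((cmod (?G w - mean_trace p n \<mu> ?B z)) ^ 4)"
  have Hm: "?H \<in> borel_measurable ?P" using Gm by measurable
  have "(\<integral>\<^sup>+\<omega>'. ennreal (F (A, ?Y \<omega>')) \<partial>M) = (\<integral>\<^sup>+\<omega>'. ?H (?w \<omega>') \<partial>M)" unfolding F_def by (simp only: prod.case tG g)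
  also have "... = (\<integral>\<^sup>+w. ?H w \<partial>distr M ?P ?w)" by (rule nn_integral_distr[OF wm, symmetric]) (use Hm in simp)
  also have "... \<le> ennreal (4096 * (real n)\<^sup>2 / (Im z * real p) ^ 4)"
   unfolding law using matrix_model.trace_fourth_moment[OF M] unfolding P matrix_model.Q_def[OF M] .
  finally show "(\<integral>\<^sup>+\<omega>'. ennreal (F (A, ?Y \<omega>')) \<partial>M) \<le> ennreal (4096 * (real n)\<^sup>2 / (Im z * real p) ^ 4)" .
 qed
 show ?thesis
 proof (intro exI[of _ "\<lambda>\<omega>. F (\<Sigma> \<omega>, ?Y \<omega>)"] conjI ballI allI)
  show "(\<lambda>\<omega>. F (\<Sigma> \<omega>, ?Y \<omega>)) \<in> borel_measurable M" by (rule measurable_compose[OF measurable_Pair[OF \<Sigma>m Ym] Fm])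
  show "0 \<le> F (\<Sigma> \<omega>, ?Y \<omega>)" for \<omega> by (simp add: F_def)
  show "F (\<Sigma> \<omega>, ?Y \<omega>) = X \<omega>" if "\<omega> \<in> space M" for \<omega>
   unfolding F_def X_def prod.case key(1,3)[OF psd[OF that]] key(2)[OF psd[OF that]] ..
  have "(\<integral>\<^sup>+\<omega>. ennreal (F (\<Sigma> \<omega>, ?Y \<omega>)) \<partial>M) = (\<integral>\<^sup>+\<omega>. (\<integral>\<^sup>+\<omega>'. ennreal (F (\<Sigma> \<omega>, ?Y \<omega>')) \<partial>M) \<partial>M)"
   by (rule indep_pair_nn_integral[OF ip]) (use Fm in measurable)
  also have "... \<le> (\<integral>\<^sup>+\<omega>. ennreal (4096 * (real n)\<^sup>2 / (Im z * real p) ^ 4) \<partial>M)" by (rule nn_integral_mono) (rule key(4)[OF psd])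
  also have "... = ennreal (4096 * (real n)\<^sup>2 / (Im z * real p) ^ 4)" by (simp add: emeasure_space_1)
  finally show "(\<integral>\<^sup>+\<omega>. ennreal (F (\<Sigma> \<omega>, ?Y \<omega>)) \<partial>M) \<le> ennreal (4096 * (real n)\<^sup>2 / (Im z * real p) ^ 4)" .
 qed
qed

lemma power4_le_powr:
 fixes x \<eta> :: real
 assumes "0 \<le> x" "0 < \<eta>" shows "x ^ 4 \<le> 1 + x powr (4 + \<eta>)"
proof (cases "x \<le> 1")
 case True
 then have "x ^ 4 \<le> 1" using assms by (simp add: power_le_one)
 then show ?thesis using powr_ge_zero[of x "4 + \<eta>"] by linarith
next
 case False
 then have "x ^ 4 = x powr 4" by simp
 also have "... \<le> x powr (4 + \<eta>)" using False assms by (intro powr_mono) auto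
 finally show ?thesis by simp
qed

text \<open>The entries of both matrices are jointly independent and are regrouped by columns. A
  fourth moment is at most 1 plus the moment of order 4 + \<eta>, whence 1 + K.\<close>

lemma (in prob_space) independent_columns:
 fixes p n :: nat and Z1 Z2 :: "'a => complex mat"
 assumes pn: "0 < p" "0 < n"
  and VW: "indep_var (mat_borel p n) Z1 (mat_borel p n) Z2"
  and ind: "\<And>Z. Z \<in> {Z1, Z2} ==> indep_vars (\<lambda>_. borel) (\<lambda>ij \<omega>. Z \<omega> $$ ij) ({..<p} \<times> {..<n})"
  and mean: "\<And>Z i j. Z \<in> {Z1, Z2} ==> i < p ==> j < n ==> (LINT \<omega>|M. Z \<omega> $$ (i, j)) = 0"
  and var: "\<And>Z i j. Z \<in> {Z1, Z2} ==> i < p ==> j < n ==> (LINT \<omega>|M. (cmod (Z \<omega> $$ (i, j)))\<^sup>2) = 1"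
  and mom: "0 < \<eta>" "\<And>Z i j. Z \<in> {Z1, Z2} ==> i < p ==> j < n ==>
   integrable M (\<lambda>\<omega>. cmod (Z \<omega> $$ (i, j)) powr (4 + \<eta>)) \<and> (LINT \<omega>|M. cmod (Z \<omega> $$ (i, j)) powr (4 + \<eta>)) \<le> K"
 shows "\<exists>\<mu>. column_model p n \<mu> (1 + K) \<and>
  distr M (column_space p n \<mu>) (columns p n Z1 Z2)
   = column_space p n \<mu>"
proof (intro exI conjI)
 let ?J = "{..<2::nat} \<times> {..<p}"
 let ?Z = "\<lambda>k :: nat. if k = 0 then Z1 else Z2"
 \<comment> \<open>Reducing the indices makes every \<open>\<mu> j x\<close> the law of some entry, also outside the index range.\<close>
 define E where "E j x \<omega> = ?Z (fst x) \<omega> $$ (snd x mod p, j mod n)" for j :: nat and x :: "nat \<times> nat" and \<omega>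
 define \<mu> where "\<mu> j x = distr M borel (E j x)" for j x
 have Zin: "?Z k \<in> {Z1, Z2}" for k by simp
 have ij: "i mod p < p" "j mod n < n" for i j using pn by auto
 have Em: "E j x \<in> borel_measurable M" for j x
  using ind[OF Zin[of "fst x"]] ij unfolding indep_vars_def2 E_def by auto
 have E4: "integrable M (\<lambda>\<omega>. cmod (E j x \<omega>) ^ 4)" "(LINT \<omega>|M. cmod (E j x \<omega>) ^ 4) \<le> 1 + K" for j x
 proof -
  note m = mom(2)[OF Zin[of "fst x"] ij(1)[of "snd x"] ij(2)[of j], folded E_def]
  have le: "cmod (E j x \<omega>) ^ 4 \<le> 1 + cmod (E j x \<omega>) powr (4 + \<eta>)" for \<omega> by (rule power4_le_powr[OF norm_ge_zero mom(1)])
  have i: "integrable M (\<lambda>\<omega>. 1 + cmod (E j x \<omega>) powr (4 + \<eta>))" using m by simp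
  have m4: "(\<lambda>\<omega>. cmod (E j x \<omega>) ^ 4) \<in> borel_measurable M" using Em by measurable
  show i4: "integrable M (\<lambda>\<omega>. cmod (E j x \<omega>) ^ 4)"
   by (rule Bochner_Integration.integrable_bound[OF i m4]) (use le in \<open>auto intro!: AE_I2 order_trans[OF _ abs_ge_self]\<close>)
  have "(LINT \<omega>|M. cmod (E j x \<omega>) ^ 4) \<le> (LINT \<omega>|M. 1 + cmod (E j x \<omega>) powr (4 + \<eta>))" by (rule integral_mono[OF i4 i le])
  also have "... = 1 + (LINT \<omega>|M. cmod (E j x \<omega>) powr (4 + \<eta>))" using m by (simp add: prob_space)
  finally show "(LINT \<omega>|M. cmod (E j x \<omega>) ^ 4) \<le> 1 + K" using m by linarith
 qed
 have b4: "(\<lambda>y :: complex. cmod y ^ 4) \<in> borel_measurable borel" "(\<lambda>y :: complex. (cmod y)\<^sup>2) \<in> borel_measurable borel" by measurable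
 show "column_model p n \<mu> (1 + K)"
 proof (rule column_model.intro[OF pn(2,1)], rule entry_space.intro)
  fix j
  show "finite ?J" by simp
  fix i :: "nat \<times> nat"
  show "prob_space (\<mu> j i)" unfolding \<mu>_def by (rule prob_space_distr[OF Em])
  show "sets (\<mu> j i) = sets borel" by (simp add: \<mu>_def)
  show "integrable (\<mu> j i) (\<lambda>y. cmod y ^ 4)" unfolding \<mu>_def integrable_distr_eq[OF Em b4(1)] by (rule E4(1))
  show "(LINT y|\<mu> j i. cmod y ^ 4) \<le> 1 + K" unfolding \<mu>_def integral_distr[OF Em b4(1)] by (rule E4(2))
  show "(LINT y|\<mu> j i. y) = 0" unfolding \<mu>_def
   using mean[OF Zin[of "fst i"] ij(1)[of "snd i"] ij(2)[of j]] by (subst integral_distr[OF Em]) (simp_all add: E_def[abs_def])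
  show "(LINT y|\<mu> j i. (cmod y)\<^sup>2) = 1" unfolding \<mu>_def integral_distr[OF Em b4(2)]
   using var[OF Zin[of "fst i"] ij(1)[of "snd i"] ij(2)[of j]] by (simp only: E_def)
 qed
 have J: "finite ?J" "?J \<noteq> {}" "{..<n} \<noteq> {}" using pn by (auto simp: lessThan_empty_iff)
 define X where "X y \<omega> = ent (Z1 \<omega>, Z2 \<omega>) (snd y) (fst y)" for y :: "(nat \<times> nat) \<times> nat" and \<omega>
 have "indep_vars (\<lambda>_. borel) (\<lambda>x \<omega>. if fst x = 0 then Z1 \<omega> $$ snd x else Z2 \<omega> $$ snd x) ({..<2::nat} \<times> ({..<p} \<times> {..<n}))"
  by (rule indep_vars_join[OF VW, where f = "\<lambda>ij A. A $$ ij" and g = "\<lambda>ij A. A $$ ij"])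
   (use pn ind in \<open>auto simp: lessThan_empty_iff intro: mat_borel_entry_measurable\<close>)
 from indep_vars_reindex_inj[OF this, of "\<lambda>y. (fst (fst y), (snd (fst y), snd y))" "?J \<times> {..<n}"]
 have IX: "indep_vars (\<lambda>_. borel) X (?J \<times> {..<n})"
  by (auto simp: X_def[abs_def] ent_def inj_on_def image_subset_iff if_distrib[of "\<lambda>A. A $$ _"] cong: if_cong)
 have PE: "PiM {..<n} (\<lambda>j. PiM ?J (\<lambda>x. distr M borel (X (x, j)))) = PiM {..<n} (\<lambda>j. PiM ?J (\<mu> j))"
 proof (intro PiM_cong refl)
  fix j x assume "j \<in> {..<n}" "x \<in> ?J"
  then have "X (x, j) = E j x" by (auto simp: X_def E_def ent_def fun_eq_iff)
  then show "distr M borel (X (x, j)) = \<mu> j x" by (simp add: \<mu>_def)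
 qed
 have sets: "sets (PiM {..<n} (\<lambda>j. PiM ?J (\<mu> j))) = sets (PiM {..<n} (\<lambda>j. PiM ?J (\<lambda>_. borel)))"
  by (intro sets_PiM_cong refl) (simp add: \<mu>_def)
 have "distr M (PiM {..<n} (\<lambda>j. PiM ?J (\<mu> j))) (\<lambda>\<omega>. \<lambda>j\<in>{..<n}. \<lambda>x\<in>?J. ent (Z1 \<omega>, Z2 \<omega>) j x)
  = distr M (PiM {..<n} (\<lambda>j. PiM ?J (\<lambda>_. borel))) (\<lambda>\<omega>. \<lambda>j\<in>{..<n}. \<lambda>x\<in>?J. X (x, j) \<omega>)"
  by (rule distr_cong[OF refl sets]) (simp add: X_def)
 also have "... = PiM {..<n} (\<lambda>j. PiM ?J (\<mu> j))" unfolding indep_vars_blocks[OF IX J] by (rule PE)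
 finally show "distr M (PiM {..<n} (\<lambda>j. PiM ?J (\<mu> j))) (\<lambda>\<omega>. \<lambda>j\<in>{..<n}. \<lambda>x\<in>?J. ent (Z1 \<omega>, Z2 \<omega>) j x) = PiM {..<n} (\<lambda>j. PiM ?J (\<mu> j))" .
qed

theorem theorem6p1:
 fixes M :: "'a measure"
  and p :: "nat \<Rightarrow> nat"
  and c \<eta>\<^sub>0 K C :: real
  and Z1 Z2 \<Sigma> :: "nat \<Rightarrow> 'a \<Rightarrow> complex mat"
  and H :: "real measure"
 assumes prob: "prob_space M"
  and p_pos: "\<And>n. 0 < n \<Longrightarrow> 0 < p n"
  and T1: "0 < c" "(\<lambda>n. real (p n) / real n) \<longlonglongrightarrow> c"
  and T2_indep: "\<And>n. 0 < n \<Longrightarrow>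
    prob_space.indep_var M (mat_borel (p n) n) (Z1 n) (mat_borel (p n) n) (Z2 n)"
  and T2_indep_entries: "\<And>n Z. 0 < n \<Longrightarrow> Z \<in> {Z1, Z2} \<Longrightarrow>
    prob_space.indep_vars M (\<lambda>_. borel) (\<lambda>ij \<omega>. Z n \<omega> $$ ij) ({..<p n} \<times> {..<n})"
  and T2_mean: "\<And>n Z i j. 0 < n \<Longrightarrow> Z \<in> {Z1, Z2} \<Longrightarrow> i < p n \<Longrightarrow> j < n \<Longrightarrow>
    (LINT \<omega>|M. Z n \<omega> $$ (i, j)) = 0"
  and T2_variance: "\<And>n Z i j. 0 < n \<Longrightarrow> Z \<in> {Z1, Z2} \<Longrightarrow> i < p n \<Longrightarrow> j < n \<Longrightarrow>
    (LINT \<omega>|M. (cmod (Z n \<omega> $$ (i, j)))\<^sup>2) = 1"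
  and T2_moments: "0 < \<eta>\<^sub>0"
   "\<And>n Z i j. 0 < n \<Longrightarrow> Z \<in> {Z1, Z2} \<Longrightarrow> i < p n \<Longrightarrow> j < n \<Longrightarrow>
    integrable M (\<lambda>\<omega>. cmod (Z n \<omega> $$ (i, j)) powr (4 + \<eta>\<^sub>0)) \<and>
    (LINT \<omega>|M. cmod (Z n \<omega> $$ (i, j)) powr (4 + \<eta>\<^sub>0)) \<le> K"
  and T3_psd: "\<And>n \<omega>. 0 < n \<Longrightarrow> \<omega> \<in> space M \<Longrightarrow> psd (p n) (\<Sigma> n \<omega>)"
  and T3_indep: "\<And>n. 0 < n \<Longrightarrow>
    indep_pair M (mat_borel (p n) (p n)) (\<Sigma> n)
     (mat_borel (p n) n \<Otimes>\<^sub>M mat_borel (p n) n) (\<lambda>\<omega>. (Z1 n \<omega>, Z2 n \<omega>))"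
  and T3_limit: "nonneg_distr H" "H \<noteq> return borel 0"
   "AE \<omega> in M. weak_conv (\<lambda>n. esd (\<Sigma> n \<omega>)) (cdf H)"
  and T4: "0 < C"
   "AE \<omega> in M. limsup (\<lambda>n. ereal (Re (mat_trace (\<Sigma> n \<omega>)) / real (p n))) < ereal C"
 shows
  "(\<forall>z \<in> upper_half_plane. \<exists>!h. solves_h_eq c H z h) \<and>
   (\<exists>F. real_distribution F \<and>
    (\<forall>z \<in> upper_half_plane.
      stieltjes F z =
       1 / z * (2 / of_real c - 1) +
       1 / (of_real c * z) *
        (1 / (- 1 + of_real c * h_fun c H z) - 1 / (1 + of_real c * h_fun c H z))) \<and>
    (AE \<omega> in M.
      weak_conv
       (\<lambda>n. esd (anticommutator n (psd_sqrt (\<Sigma> n \<omega>) * Z1 n \<omega>) (psd_sqrt (\<Sigma> n \<omega>) * Z2 n \<omega>)))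
       (cdf F))) \<and>
   h_fun c H analytic_on upper_half_plane \<and>
   (\<forall>z \<in> upper_half_plane. \<forall>G. nonneg_distr G \<and> G \<noteq> return borel 0 \<longrightarrow>
    (\<exists>!h. solves_h_eq c G z h) \<and>
    (\<forall>\<epsilon>>0. \<exists>\<delta>>0. \<forall>G'. nonneg_distr G' \<and> G' \<noteq> return borel 0 \<and>
      levy_dist (cdf G) (cdf G') < \<delta> \<longrightarrow>
      cmod (h_fun c G z - h_fun c G' z) < \<epsilon>))"
proof -
 interpret prob_space M by (rule prob)
 \<comment> \<open>The model hypotheses hold for n > 0. With n = k + 1 they hold at every index k,
   and limits do not change.\<close>
 define N where "N k = Suc k" for k
 define q where "q k = p (N k)" for k
 have N: "0 < N k" for k by (simp add: N_def)
 have q: "0 < q k" for k using p_pos[OF N] by (simp add: q_def)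
 have qc: "(\<lambda>k. real (q k) / real (N k)) \<longlonglongrightarrow> c" using LIMSEQ_Suc[OF T1(2)] by (simp add: q_def N_def)
 have Nt: "filterlim N at_top sequentially" unfolding N_def by (rule filterlim_Suc)
 have "\<exists>\<mu>. column_model (q k) (N k) \<mu> (1 + K) \<and>
  distr M (column_space (q k) (N k) \<mu>) (columns (q k) (N k) (Z1 (N k)) (Z2 (N k)))
   = column_space (q k) (N k) \<mu>" for k
 proof (rule independent_columns[OF q N])
  have in_N: "\<exists>Z'. Z' \<in> {Z1, Z2} \<and> Z = Z' (N k)" if "Z \<in> {Z1 (N k), Z2 (N k)}" for Z using that by auto
  show "indep_var (mat_borel (q k) (N k)) (Z1 (N k)) (mat_borel (q k) (N k)) (Z2 (N k))" unfolding q_def by (rule T2_indep[OF N])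
  fix Z assume "Z \<in> {Z1 (N k), Z2 (N k)}"
  then obtain Z' where Z': "Z' \<in> {Z1, Z2}" "Z = Z' (N k)" using in_N by blast
  show "indep_vars (\<lambda>_. borel) (\<lambda>ij \<omega>. Z \<omega> $$ ij) ({..<q k} \<times> {..<N k})" unfolding Z'(2) q_def by (rule T2_indep_entries[OF N Z'(1)])
  fix i j assume "i < q k" "j < N k"
  then have ij: "i < p (N k)" "j < N k" by (simp_all add: q_def)
  show "(LINT \<omega>|M. Z \<omega> $$ (i, j)) = 0" unfolding Z'(2) by (rule T2_mean[OF N Z'(1) ij])
  show "(LINT \<omega>|M. (cmod (Z \<omega> $$ (i, j)))\<^sup>2) = 1" unfolding Z'(2) by (rule T2_variance[OF N Z'(1) ij])
    show "integrable M (\<lambda>\<omega>. cmod (Z \<omega> $$ (i, j)) powr (4 + \<eta>\<^sub>0)) \<and> (LINT \<omega>|M. cmod (Z \<omega> $$ (i, j)) powr (4 + \<eta>\<^sub>0)) \<le> K"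
      unfolding Z'(2) by (rule T2_moments(2)[OF N Z'(1) ij])
  qed (rule T2_moments(1))
  from choice[OF allI[OF this]] obtain \<mu> where \<mu>: "\<forall>k. column_model (q k) (N k) (\<mu> k) (1 + K) \<and>
    distr M (column_space (q k) (N k) (\<mu> k)) (columns (q k) (N k) (Z1 (N k)) (Z2 (N k)))
      = column_space (q k) (N k) (\<mu> k)" ..
  note cm = \<mu>[THEN HOL.spec, THEN conjunct1] and law = \<mu>[THEN HOL.spec, THEN conjunct2]
  have psd: "psd (q k) (\<Sigma> (N k) \<omega>)" if "\<omega> \<in> space M" for k \<omega> unfolding q_def by (rule T3_psd[OF N that])
  define S where "S k \<omega> = Smat (q k) (N k) (psd_sqrt (\<Sigma> (N k) \<omega>)) (ent (Z1 (N k) \<omega>, Z2 (N k) \<omega>))" for k \<omega>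
  define tr where "tr z k \<omega> = mat_trace (resolvent (q k) (S k \<omega>) z) / of_nat (q k)" for z k \<omega>
  define mt where "mt z k \<omega> = mean_trace (q k) (N k) (\<mu> k) (psd_sqrt (\<Sigma> (N k) \<omega>)) z" for z k \<omega>
  have dev: "AE \<omega> in M. (\<lambda>k. tr z k \<omega> - mt z k \<omega>) \<longlonglongrightarrow> 0" if z: "0 < Im z" for z
  proof -
    have "(\<lambda>k. real (N k) / real (q k)) \<longlonglongrightarrow> inverse c" using tendsto_inverse[OF qc] T1(1) by simp
    then have "Bseq (\<lambda>k. real (N k) / real (q k))" by (intro convergent_imp_Bseq) (auto simp: convergent_def)
    then obtain \<Gamma> where "\<forall>k. norm (real (N k) / real (q k)) \<le> \<Gamma>" by (auto simp: Bseq_def)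
    then have \<Gamma>: "real (N k) / real (q k) \<le> \<Gamma>" for k by (simp add: abs_le_iff)
    \<comment> \<open>With \<Gamma> bounding n / p, which converges since c > 0, the bound n^2 / (Im
      z p)^4 is at most (\<Gamma> / Im z)^4 / n^2.\<close>
    define b where "b k = 4096 * (\<Gamma> / Im z) ^ 4 * (1 / real (Suc k) ^ 2)" for k
    have ble: "4096 * (real (N k))\<^sup>2 / (Im z * real (q k)) ^ 4 \<le> b k" for k
    proof -
      have "4096 * (real (N k))\<^sup>2 / (Im z * real (q k)) ^ 4 = 4096 * (real (N k) / real (q k) / Im z) ^ 4 * (1 / real (N k) ^ 2)"
        using N[of k] q[of k] z by (simp add: field_simps eval_nat_numeral)
      also have "... \<le> 4096 * (\<Gamma> / Im z) ^ 4 * (1 / real (N k) ^ 2)"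
        using \<Gamma>[of k] z by (intro mult_right_mono mult_left_mono power_mono divide_right_mono) auto
      finally show ?thesis by (simp add: b_def N_def)
    qed
    have bs: "summable b" unfolding b_def
      by (intro summable_mult) (use summable_Suc_iff[of "\<lambda>k. 1 / real k ^ 2"] inverse_power_summable[of 2, where 'a = real] in \<open>simp add: inverse_eq_divide power_divide\<close>)
    have b0: "0 \<le> b k" for k by (simp add: b_def)
    have "\<exists>X'. X' \<in> borel_measurable M \<and> (\<forall>\<omega>. 0 \<le> X' \<omega>) \<and> (\<forall>\<omega>\<in>space M. X' \<omega> = cmod (tr z k \<omega> - mt z k \<omega>) ^ 4) \<and> (\<integral>\<^sup>+\<omega>. ennreal (X' \<omega>) \<partial>M) \<le> ennreal (b k)" for k
    proof -
      have ip: "indep_pair M (mat_borel (q k) (q k)) (\<Sigma> (N k)) (mat_borel (q k) (N k) \<Otimes>\<^sub>M mat_borel (q k) (N k)) (\<lambda>\<omega>. (Z1 (N k) \<omega>, Z2 (N k) \<omega>))"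
        unfolding q_def by (rule T3_indep[OF N])
      from trace_deviation[OF cm z ip psd law, folded S_def tr_def mt_def]
   show ?thesis using order_trans[OF _ ennreal_leI[OF ble[of k]]] by blast
  qed
  from choice[OF allI[OF this]] obtain X where X': "\<forall>k. X k \<in> borel_measurable M \<and> (\<forall>\<omega>. 0 \<le> X k \<omega>) \<and> (\<forall>\<omega>\<in>space M. X k \<omega> = cmod (tr z k \<omega> - mt z k \<omega>) ^ 4) \<and> (\<integral>\<^sup>+\<omega>. ennreal (X k \<omega>) \<partial>M) \<le> ennreal (b k)" ..
  have X: "X k \<in> borel_measurable M" "0 \<le> X k \<omega>" "\<omega> \<in> space M ==> X k \<omega> = cmod (tr z k \<omega> - mt z k \<omega>) ^ 4"
   "(\<integral>\<^sup>+\<omega>. ennreal (X k \<omega>) \<partial>M) \<le> ennreal (b k)" for k \<omega> using X'[rule_format, of k] by blast+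
  from AE_tendsto_zero_of_summable[OF X(1,2,4) bs b0] show ?thesis
  proof (rule AE_mp, intro AE_I2 impI)
   fix \<omega> assume w: "\<omega> \<in> space M" and "(\<lambda>k. X k \<omega>) \<longlonglongrightarrow> 0"
   from tendsto_real_root[OF this(2), of 4] have "(\<lambda>k. cmod (tr z k \<omega> - mt z k \<omega>)) \<longlonglongrightarrow> 0"
    by (simp add: X(3)[OF w] real_root_power_cancel)
   then show "(\<lambda>k. tr z k \<omega> - mt z k \<omega>) \<longlonglongrightarrow> 0" by (rule tendsto_norm_zero_cancel)
  qed
 qed
 \<comment> \<open>A single null set must serve all z, so only points with rational real and
   imaginary parts are listed. The other points follow from the common Lipschitz bound.\<close>
 define good where "good \<omega> \<longleftrightarrow> \<omega> \<in> space M \<and> weak_conv (\<lambda>n. esd (\<Sigma> n \<omega>)) (cdf H) \<and>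
  (\<forall>q\<in>\<rat> \<times> \<rat>. 0 < snd q \<longrightarrow> (\<lambda>k. tr (Complex (fst q) (snd q)) k \<omega> - mt (Complex (fst q) (snd q)) k \<omega>) \<longlonglongrightarrow> 0)" for \<omega>
 have "AE \<omega> in M. \<forall>q\<in>\<rat> \<times> \<rat>. 0 < snd q \<longrightarrow> (\<lambda>k. tr (Complex (fst q) (snd q)) k \<omega> - mt (Complex (fst q) (snd q)) k \<omega>) \<longlonglongrightarrow> 0"
 proof (subst AE_ball_countable)
  show "countable (\<rat> \<times> \<rat> :: (real \<times> real) set)" by (intro countable_SIGMA countable_rat)
  show "\<forall>q\<in>\<rat> \<times> \<rat>. AE \<omega> in M. 0 < snd q \<longrightarrow> (\<lambda>k. tr (Complex (fst q) (snd q)) k \<omega> - mt (Complex (fst q) (snd q)) k \<omega>) \<longlonglongrightarrow> 0"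
  proof
   fix q :: "real \<times> real" assume "q \<in> \<rat> \<times> \<rat>"
   show "AE \<omega> in M. 0 < snd q \<longrightarrow> (\<lambda>k. tr (Complex (fst q) (snd q)) k \<omega> - mt (Complex (fst q) (snd q)) k \<omega>) \<longlonglongrightarrow> 0"
    using dev[of "Complex (fst q) (snd q)"] by (cases "0 < snd q") auto
  qed
 qed
 with T3_limit(3) AE_space have good: "AE \<omega> in M. good \<omega>" by eventually_elim (simp add: good_def)
 let ?S = "\<lambda>n \<omega>. anticommutator n (psd_sqrt (\<Sigma> n \<omega>) * Z1 n \<omega>) (psd_sqrt (\<Sigma> n \<omega>) * Z2 n \<omega>)"
 have lim: "\<exists>F. real_distribution F \<and> (\<forall>z. 0 < Im z \<longrightarrow> stieltjes F z = s_lim c H z) \<and> weak_conv (\<lambda>n. esd (?S n \<omega>)) (cdf F)"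
  if g: "good \<omega>" for \<omega>
 proof -
  have w: "\<omega> \<in> space M" and wc: "weak_conv (\<lambda>n. esd (\<Sigma> n \<omega>)) (cdf H)"
   and rat: "\<And>a b. a \<in> \<rat> ==> b \<in> \<rat> ==> 0 < b ==> (\<lambda>k. tr (Complex a b) k \<omega> - mt (Complex a b) k \<omega>) \<longlonglongrightarrow> 0"
   using g by (auto simp: good_def)
  have "\<forall>k. \<exists>Ul. unitary (q k) (fst Ul) \<and> (\<forall>i<q k. 0 \<le> snd Ul i) \<and> \<Sigma> (N k) \<omega> = rspec (q k) (fst Ul) (snd Ul)"
   using psd_spectral[OF psd[OF w]] by fastforce
  from choice[OF this] obtain Ul where Ul: "\<And>k. unitary (q k) (fst (Ul k))" "\<And>k i. i < q k ==> 0 \<le> snd (Ul k) i"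
   "\<And>k. \<Sigma> (N k) \<omega> = rspec (q k) (fst (Ul k)) (snd (Ul k))" by blast
  have sq: "psd_sqrt (\<Sigma> (N k) \<omega>) = rspec (q k) (fst (Ul k)) (\<lambda>i. sqrt (snd (Ul k) i))" for k
   unfolding Ul(3) by (rule psd_sqrt_spec[OF Ul(1) Ul(2)])
  have "weak_conv (\<lambda>k. esd (\<Sigma> (N k) \<omega>)) (cdf H)" using wc unfolding weak_conv_def N_def by (auto intro: LIMSEQ_Suc)
  then have wcm: "weak_conv_m (\<lambda>k. empirical (q k) (snd (Ul k))) H"
   unfolding weak_conv_m_def Ul(3) esd_spec[OF Ul(1) q] .
  have mtl: "(\<lambda>k. mt z k \<omega>) \<longlonglongrightarrow> s_lim c H z" if "0 < Im z" for z
   unfolding mt_def sq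
   by (rule spectrum_limit[where U = "\<lambda>k. fst (Ul k)" and l = "\<lambda>k. snd (Ul k)", OF cm Nt qc T1(1) Ul(1,2) T3_limit(1,2) wcm that])
  have trl: "(\<lambda>k. tr (Complex a b) k \<omega>) \<longlonglongrightarrow> s_lim c H (Complex a b)" if "a \<in> \<rat>" "b \<in> \<rat>" "0 < b" for a b
   using tendsto_add[OF rat[OF that] mtl[of "Complex a b"]] that by simp
  have "\<forall>k. \<exists>Vd. unitary (q k) (fst Vd) \<and> S k \<omega> = rspec (q k) (fst Vd) (snd Vd)"
   using spectral_theorem[OF Smat_herm] unfolding S_def by fastforce
  from choice[OF this] obtain Vd where Vd: "\<And>k. unitary (q k) (fst (Vd k))" "\<And>k. S k \<omega> = rspec (q k) (fst (Vd k)) (snd (Vd k))" by blast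
  let ?\<mu> = "\<lambda>k. empirical (q k) (snd (Vd k))"
  have rd: "real_distribution (?\<mu> k)" for k by (rule empirical_real_distribution[OF q])
  have st: "stieltjes (?\<mu> k) z = tr z k \<omega>" if "0 < Im z" for z k
   unfolding tr_def Vd(2) by (rule stieltjes_empirical[OF Vd(1) q that])
  have conv: "(\<lambda>k. stieltjes (?\<mu> k) z) \<longlonglongrightarrow> s_lim c H z" if "0 < Im z" for z
  proof (rule stieltjes_conv_dense[OF rd s_lim_continuous[OF T3_limit(1,2) T1(1)] _ that])
   fix a b :: real assume "a \<in> \<rat>" "b \<in> \<rat>" "0 < b"
   then show "(\<lambda>k. stieltjes (?\<mu> k) (Complex a b)) \<longlonglongrightarrow> s_lim c H (Complex a b)" using trl st[of "Complex a b"] by simp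
  qed
  obtain F where F: "real_distribution F" "\<forall>z. 0 < Im z \<longrightarrow> stieltjes F z = s_lim c H z" "weak_conv_m ?\<mu> F"
   using stieltjes_continuity[OF rd conv s_lim_mass[OF T3_limit(1,2) T1(1)]] by blast
  have "esd (?S (N k) \<omega>) = cdf (?\<mu> k)" for k
  proof -
   have "Z1 (N k) \<in> M \<rightarrow>\<^sub>M mat_borel (q k) (N k)" "Z2 (N k) \<in> M \<rightarrow>\<^sub>M mat_borel (q k) (N k)"
    using T2_indep[OF N[of k]] unfolding indep_var_eq q_def by auto
   from measurable_space[OF this(1) w] measurable_space[OF this(2) w]
   have Zc: "Z1 (N k) \<omega> \<in> carrier_mat (q k) (N k)" "Z2 (N k) \<omega> \<in> carrier_mat (q k) (N k)" by (simp_all add: mat_borel_space)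
   have Z: "Zm (q k) (N k) (ent (Z1 (N k) \<omega>, Z2 (N k) \<omega>)) 0 = Z1 (N k) \<omega>" "Zm (q k) (N k) (ent (Z1 (N k) \<omega>, Z2 (N k) \<omega>)) 1 = Z2 (N k) \<omega>"
    using Zc by (auto intro!: eq_matI simp: Zm_def ent_def)
   have Bc: "psd_sqrt (\<Sigma> (N k) \<omega>) \<in> carrier_mat (q k) (q k)" unfolding sq by (rule spec_carrier[OF unitaryD(1)[OF Ul(1)]])
   have "?S (N k) \<omega> = S k \<omega>" using anticommutator_eq_Smat[OF Bc, of "N k" "ent (Z1 (N k) \<omega>, Z2 (N k) \<omega>)"] unfolding Z S_def .
   then show ?thesis unfolding Vd(2) using esd_spec[OF Vd(1) q] by simp
  qed
  then have "weak_conv (\<lambda>k. esd (?S (Suc k) \<omega>)) (cdf F)" using F(3) unfolding weak_conv_m_def N_def by simp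
  then have "weak_conv (\<lambda>n. esd (?S n \<omega>)) (cdf F)" unfolding weak_conv_def by (auto intro: LIMSEQ_imp_Suc)
  then show ?thesis using F by blast
 qed
 \<comment> \<open>F is taken from one good sample point. Its Stieltjes transform does not depend on
   that point, so by uniqueness F is the limit at every other good point and is not random.\<close>
 obtain \<omega>0 where "good \<omega>0"
 proof (rule ccontr)
  assume "\<not> thesis"
  then have "\<not> good \<omega>" for \<omega> using that by blast
  then have "AE \<omega> in M. False" using good by simp
  then show False by simp
 qed
 from lim[OF this] obtain F where F: "real_distribution F" "\<And>z. 0 < Im z ==> stieltjes F z = s_lim c H z" by blast
 have AEF: "AE \<omega> in M. weak_conv (\<lambda>n. esd (?S n \<omega>)) (cdf F)"
  using good
 proof (rule AE_mp, intro AE_I2 impI)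
  fix \<omega> assume "good \<omega>"
  from lim[OF this] obtain F' where F': "real_distribution F'" "\<And>z. 0 < Im z ==> stieltjes F' z = s_lim c H z" "weak_conv (\<lambda>n. esd (?S n \<omega>)) (cdf F')" by blast
  have "F' = F" by (rule stieltjes_unique[OF F'(1) F(1)]) (simp add: F'(2) F(2))
  then show "weak_conv (\<lambda>n. esd (?S n \<omega>)) (cdf F)" using F'(3) by simp
 qed
 note H = T3_limit(1,2)
 show ?thesis
 proof (intro conjI exI[of _ F] ballI allI impI)
  show "\<exists>!h. solves_h_eq c H z h" if "z \<in> upper_half_plane" for z using solves_h_eq_ex1[OF H T1(1)] that by simp
  show "real_distribution F" by (rule F(1))
  show "stieltjes F z = 1 / z * (2 / of_real c - 1) + 1 / (of_real c * z) * (1 / (- 1 + of_real c * h_fun c H z) - 1 / (1 + of_real c * h_fun c H z))"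
   if "z \<in> upper_half_plane" for z using that F(2)[of z] s_lim_formula[OF H T1(1), of z] by simp
  show "AE \<omega> in M. weak_conv (\<lambda>n. esd (?S n \<omega>)) (cdf F)" by (rule AEF)
  show "h_fun c H analytic_on upper_half_plane" by (rule h_fun_analytic[OF H T1(1)])
  fix z G assume z: "z \<in> upper_half_plane" and G: "nonneg_distr G \<and> G \<noteq> return borel 0"
  show "\<exists>!h. solves_h_eq c G z h" using solves_h_eq_ex1[of G c z] G T1(1) z by simp
  fix \<epsilon> :: real assume "0 < \<epsilon>"
  then show "\<exists>\<delta>>0. \<forall>G'. nonneg_distr G' \<and> G' \<noteq> return borel 0 \<and> levy_dist (cdf G) (cdf G') < \<delta> \<longrightarrow> cmod (h_fun c G z - h_fun c G' z) < \<epsilon>"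
   using h_fun_levy_continuous[of G c z \<epsilon>] G T1(1) z by simp
 qed
qed

end
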